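(* Let $\Sigma$ denote either of the words "short" or "Lipschitz". There is a natural fully faithful functor $\mathrm{CBanhalos}_\Sigma\to \mathrm{Monads}(\mathrm{NSets}_\Sigma)$, $A\mapsto \Lambda_A$, from commutative $\Sigma$ Banach halos to monads on the category $\mathrm{NSets}_\Sigma$ of normed sets, defined by $\Lambda_A(X):=\ell^{p_A}(X,A)$. This functor is compatible with the $\mathbb{R}_+^*$-flow (i.e. with the flows $\sigma_t$, $t\in\mathbb{R}_+^*$, on both sides: $\Lambda_{\sigma_tA}\cong\sigma_t\Lambda_A$).
   Context: A normed set is a set $X$ with a map $|\cdot|_X:X\to[0,\infty)$; a map $f:X\to Y$ is Lipschitz if there is $c\ge0$ with $|f(x)|_Y\le c|x|_X$ for all $x$, and short if one may take $c=1$. $\mathrm{NSets}_{\mathrm{short}}$, $\mathrm{NSets}_{\mathrm{Lipschitz}}$ are the categories of normed sets with short, resp. Lipschitz, maps. A short Banach halo is a triple $(R,|\cdot|_R,p_R)$, $R$ a ring, $|\cdot|_R:R\to[0,\infty)$, $p_R\in]0,\infty]$, such that $|1|_R=1$ unless $R=0$; $|f|_R=0$ iff $f=0$; $|f-g|_R\le\|(|f|_R,|g|_R)\|_{p_R}$ ($\ell^{p_R}$-norm, i.e. $\sqrt[p_R]{|f|^{p_R}+|g|^{p_R}}$, or max if $p_R=\infty$); $|fg|_R\le|f|_R|g|_R$; $R$ is complete. A Lipschitz Banach halo is the same with $p_R=(C_R,D_R)$, $C_R,D_R>0$, $|f-g|_R\le C_R\max(|f|_R,|g|_R)$ and $|fg|_R\le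 D_R|f|_R|g|_R$. Pairs are ordered by $(C_1,D_1)\le(C_2,D_2)$ iff $C_2\le C_1$ and $D_2\le D_1$. A $\Sigma$ morphism $R_1\to R_2$ is a $\Sigma$ ring homomorphism with $p_{R_1}\le p_{R_2}$. $\mathrm{CBanhalos}_\Sigma$ is the category of commutative $\Sigma$ Banach halos. $\ell^{p_A}(X,A)$ is the completion of the free module $A^{(X)}$ on $X$ with respect to the seminorm: in the short case $|\sum a_x\{x\}|=\|(|a_x|_A|x|_X)_{x\in X}\|_{p_A}$; in the Lipschitz case, with $C=C_A$, the infimum of $\|t\|_C$ over finite binary trees $t$ whose leaves are labelled by elements of the form $a\{x\}$ ($a\in A$, $x\in X$) with sum $\sum a_x\{x\}$, where a leaf labelled $a\{x\}$ has $\|\cdot\|_C=|a|_A|x|_X$ and $\|(t_0,t_1)\|_C=C\max(\|t_0\|_C,\|t_1\|_C)$. The completion is the group of Cauchy sequences modulo null sequences, with norm the limit of norms. The monad structure of $\Lambda_A$ is the usual one (unit $x\mapsto 1\{x\}$, multiplication by linear combination), and a morphism $f:A\to B$ induces $\sum a_x\{x\}\mapsto\sum f(a_x)\{x\}$. Flows, for $t\in\mathbb{R}_+^*=]0,\infty[$: on normed sets $\sigma_t(X,|\cdot|_X)=(X,|\cdot|_X^t)$; on short Banach halos $\sigma_t(A)=(A,|\cdot|_A^t,p_A/t)$; on Lipschitz Banach halos $\sigma_t(A)=(A,|\cdot|_A^t,(C_A^t,D_A^t))$; on monads $T$ on normed sets $(\sigma_tT)(X)=\sigma_t(T(\sigm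a_{1/t}X))$.
   Formalization: Full faithfulness at (A,B) is claimed only when D_B ≤ D_A (Lipschitz case) and B ≠ 0 or p_A ≤ p_B, as it can fail otherwise; faithfulness holds for all pairs. In the Lipschitz case the completion norm is the infimum of the limits of norms over representatives; sets are taken in a universe. *)

theory Defs
  imports
    Complex_Main
    "HOL-Library.FuncSet"
    "HOL-Library.Equipollence"
    "HOL-Library.Extended_Nonnegative_Real"
    "HOL-Algebra.Module"
begin

section \<open>Categories, functors, monads\<close>

text \<open>Hom-sets are indexed by their two ends and need not be disjoint, so that an arrow can simply be
  a function; composition receives the three objects involved: \<open>comp C X Y Z g f\<close> is
  \<open>g \<circ> f\<close> for \<open>f : X \<rightarrow> Y\<close> and \<open>g : Y \<rightarrow> Z\<close>.\<close>

record ('o, 'm) cat =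
  obj :: "'o set"
  hom :: "'o \<Rightarrow> 'o \<Rightarrow> 'm set"
  idt :: "'o \<Rightarrow> 'm"
  comp :: "'o \<Rightarrow> 'o \<Rightarrow> 'o \<Rightarrow> 'm \<Rightarrow> 'm \<Rightarrow> 'm"

definition is_category :: "('o, 'm) cat \<Rightarrow> bool" where
  "is_category C \<longleftrightarrow>
    (\<forall>X\<in>obj C. idt C X \<in> hom C X X) \<and>
    (\<forall>X\<in>obj C. \<forall>Y\<in>obj C. \<forall>Z\<in>obj C. \<forall>f\<in>hom C X Y. \<forall>g\<in>hom C Y Z.
      comp C X Y Z g f \<in> hom C X Z) \<and>
    (\<forall>X\<in>obj C. \<forall>Y\<in>obj C. \<forall>f\<in>hom C X Y.
      comp C X X Y f (idt C X) = f \<and> comp C X Y Y (idt C Y) f = f) \<and>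
    (\<forall>W\<in>obj C. \<forall>X\<in>obj C. \<forall>Y\<in>obj C. \<forall>Z\<in>obj C.
      \<forall>f\<in>hom C W X. \<forall>g\<in>hom C X Y. \<forall>h\<in>hom C Y Z.
      comp C W Y Z h (comp C W X Y g f) = comp C W X Z (comp C X Y Z h g) f)"

definition is_iso :: "('o, 'm) cat \<Rightarrow> 'o \<Rightarrow> 'o \<Rightarrow> 'm \<Rightarrow> bool" where
  "is_iso C X Y f \<longleftrightarrow> f \<in> hom C X Y \<and>
    (\<exists>g\<in>hom C Y X. comp C X Y X g f = idt C X \<and> comp C Y X Y f g = idt C Y)"

record ('o1, 'm1, 'o2, 'm2) cat_functor =
  fobj :: "'o1 \<Rightarrow> 'o2"
  fmap :: "'o1 \<Rightarrow> 'o1 \<Rightarrow> 'm1 \<Rightarrow> 'm2"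

definition is_functor ::
  "('o1, 'm1) cat \<Rightarrow> ('o2, 'm2) cat \<Rightarrow> ('o1, 'm1, 'o2, 'm2) cat_functor \<Rightarrow> bool" where
  "is_functor C D F \<longleftrightarrow> is_category C \<and> is_category D \<and>
    (\<forall>X\<in>obj C. fobj F X \<in> obj D) \<and>
    (\<forall>X\<in>obj C. \<forall>Y\<in>obj C. \<forall>f\<in>hom C X Y. fmap F X Y f \<in> hom D (fobj F X) (fobj F Y)) \<and>
    (\<forall>X\<in>obj C. fmap F X X (idt C X) = idt D (fobj F X)) \<and>
    (\<forall>X\<in>obj C. \<forall>Y\<in>obj C. \<forall>Z\<in>obj C. \<forall>f\<in>hom C X Y. \<forall>g\<in>hom C Y Z.
      fmap F X Z (comp C X Y Z g f) =
        comp D (fobj F X) (fobj F Y) (fobj F Z) (fmap F Y Z g) (fmap F X Y f))"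

definition id_functor :: "('o, 'm, 'o, 'm) cat_functor" where
  "id_functor = \<lparr>fobj = (\<lambda>X. X), fmap = (\<lambda>X Y f. f)\<rparr>"

definition comp_functor :: "('o2, 'm2, 'o3, 'm3) cat_functor \<Rightarrow> ('o1, 'm1, 'o2, 'm2) cat_functor \<Rightarrow>
    ('o1, 'm1, 'o3, 'm3) cat_functor" where
  "comp_functor G F =
    \<lparr>fobj = (\<lambda>X. fobj G (fobj F X)),
     fmap = (\<lambda>X Y f. fmap G (fobj F X) (fobj F Y) (fmap F X Y f))\<rparr>"

definition faithful_at ::
  "('o1, 'm1) cat \<Rightarrow> ('o2, 'm2) cat \<Rightarrow> ('o1, 'm1, 'o2, 'm2) cat_functor \<Rightarrow> 'o1 \<Rightarrow> 'o1 \<Rightarrow> bool" where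
  "faithful_at C D F X Y \<longleftrightarrow> inj_on (fmap F X Y) (hom C X Y)"

definition fully_faithful_at ::
  "('o1, 'm1) cat \<Rightarrow> ('o2, 'm2) cat \<Rightarrow> ('o1, 'm1, 'o2, 'm2) cat_functor \<Rightarrow> 'o1 \<Rightarrow> 'o1 \<Rightarrow> bool" where
  "fully_faithful_at C D F X Y \<longleftrightarrow>
    bij_betw (fmap F X Y) (hom C X Y) (hom D (fobj F X) (fobj F Y))"

definition nat_trans :: "('o1, 'm1) cat \<Rightarrow> ('o2, 'm2) cat \<Rightarrow> ('o1, 'm1, 'o2, 'm2) cat_functor \<Rightarrow>
    ('o1, 'm1, 'o2, 'm2) cat_functor \<Rightarrow> ('o1 \<Rightarrow> 'm2) \<Rightarrow> bool" where
  "nat_trans C D F G \<eta> \<longleftrightarrow> is_functor C D F \<and> is_functor C D G \<and>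
    (\<forall>X\<in>obj C. \<eta> X \<in> hom D (fobj F X) (fobj G X)) \<and>
    (\<forall>X\<in>obj C. \<forall>Y\<in>obj C. \<forall>f\<in>hom C X Y.
      comp D (fobj F X) (fobj F Y) (fobj G Y) (\<eta> Y) (fmap F X Y f) =
      comp D (fobj F X) (fobj G X) (fobj G Y) (fmap G X Y f) (\<eta> X))"

definition nat_iso :: "('o1, 'm1) cat \<Rightarrow> ('o2, 'm2) cat \<Rightarrow> ('o1, 'm1, 'o2, 'm2) cat_functor \<Rightarrow>
    ('o1, 'm1, 'o2, 'm2) cat_functor \<Rightarrow> ('o1 \<Rightarrow> 'm2) \<Rightarrow> bool" where
  "nat_iso C D F G \<eta> \<longleftrightarrow> nat_trans C D F G \<eta> \<and>
    (\<forall>X\<in>obj C. is_iso D (fobj F X) (fobj G X) (\<eta> X))"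

record ('o, 'm) monad =
  endo :: "('o, 'm, 'o, 'm) cat_functor"
  eta :: "'o \<Rightarrow> 'm"
  mu :: "'o \<Rightarrow> 'm"

definition is_monad :: "('o, 'm) cat \<Rightarrow> ('o, 'm) monad \<Rightarrow> bool" where
  "is_monad C T \<longleftrightarrow>
    nat_trans C C id_functor (endo T) (eta T) \<and>
    nat_trans C C (comp_functor (endo T) (endo T)) (endo T) (mu T) \<and>
    (\<forall>X\<in>obj C.
      let T1 = fobj (endo T) X; T2 = fobj (endo T) T1; T3 = fobj (endo T) T2 in
      comp C T3 T2 T1 (mu T X) (mu T T1) = comp C T3 T2 T1 (mu T X) (fmap (endo T) T2 T1 (mu T X)) \<and>
      comp C T1 T2 T1 (mu T X) (eta T T1) = idt C T1 \<and>
      comp C T1 T2 T1 (mu T X) (fmap (endo T) X T1 (eta T X)) = idt C T1)"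

definition is_monad_morphism ::
  "('o, 'm) cat \<Rightarrow> ('o, 'm) monad \<Rightarrow> ('o, 'm) monad \<Rightarrow> ('o \<Rightarrow> 'm) \<Rightarrow> bool" where
  "is_monad_morphism C S T \<theta> \<longleftrightarrow>
    nat_trans C C (endo S) (endo T) \<theta> \<and>
    (\<forall>X\<in>obj C.
      let S1 = fobj (endo S) X; S2 = fobj (endo S) S1;
          T1 = fobj (endo T) X; T2 = fobj (endo T) T1; ST = fobj (endo S) T1 in
      comp C X S1 T1 (\<theta> X) (eta S X) = eta T X \<and>
      comp C S2 S1 T1 (\<theta> X) (mu S X) =
      comp C S2 T2 T1 (mu T X) (comp C S2 ST T2 (\<theta> T1) (fmap (endo S) S1 T1 (\<theta> X))))"

definition Monads :: "('o, 'm) cat \<Rightarrow> (('o, 'm) monad, 'o \<Rightarrow> 'm) cat" where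
  "Monads C =
    \<lparr>obj = {T. is_monad C T},
     hom = (\<lambda>S T. {\<theta> \<in> extensional (obj C). is_monad_morphism C S T \<theta>}),
     idt = (\<lambda>T. \<lambda>X\<in>obj C. idt C (fobj (endo T) X)),
     comp = (\<lambda>R S T \<theta> \<zeta>. \<lambda>X\<in>obj C.
       comp C (fobj (endo R) X) (fobj (endo S) X) (fobj (endo T) X) (\<theta> X) (\<zeta> X))\<rparr>"


section \<open>Normed sets\<close>

datatype kind = Short | Lipschitz

fun bounded_map :: "kind \<Rightarrow> 'x set \<Rightarrow> ('x \<Rightarrow> real) \<Rightarrow> ('y \<Rightarrow> real) \<Rightarrow> ('x \<Rightarrow> 'y) \<Rightarrow> bool" where
  "bounded_map Short X NX NY f \<longleftrightarrow> (\<forall>x\<in>X. NY (f x) \<le> NX x)"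
| "bounded_map Lipschitz X NX NY f \<longleftrightarrow> (\<exists>c\<ge>0. \<forall>x\<in>X. NY (f x) \<le> c * NX x)"

text \<open>A collection of small sets. Grothendieck universes satisfy these conditions, and so does the
  collection of all subsets of a type such as \<open>nat \<Rightarrow> bool\<close> (see below). Completions are formed
  from Cauchy sequences, hence the closure under sequences.\<close>

definition universe :: "'u set set \<Rightarrow> bool" where
  "universe \<U> \<longleftrightarrow>
    (\<exists>S\<in>\<U>. infinite S) \<and>
    (\<forall>S\<in>\<U>. \<forall>T :: 'u set. T \<lesssim> S \<longrightarrow> T \<in> \<U>) \<and>
    (\<forall>S\<in>\<U>. \<forall>T\<in>\<U>. \<exists>U\<in>\<U>. S \<times> T \<lesssim> U) \<and>
    (\<forall>S\<in>\<U>. \<exists>U\<in>\<U>. (UNIV :: nat set) \<rightarrow>\<^sub>E S \<lesssim> U)"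

lemma universe_example: "universe (UNIV :: (nat \<Rightarrow> bool) set set)"
proof -
  have seqs: "\<exists>f :: (nat \<Rightarrow> nat \<Rightarrow> bool) \<Rightarrow> nat \<Rightarrow> bool. inj f"
  proof
    show "inj (\<lambda>(f :: nat \<Rightarrow> nat \<Rightarrow> bool) n. case prod_decode n of (i, j) \<Rightarrow> f i j)"
    proof (rule injI, intro ext)
      fix f g :: "nat \<Rightarrow> nat \<Rightarrow> bool" and i j
      assume "(\<lambda>n. case prod_decode n of (i, j) \<Rightarrow> f i j) = (\<lambda>n. case prod_decode n of (i, j) \<Rightarrow> g i j)"
      from fun_cong[OF this, of "prod_encode (i, j)"] show "f i j = g i j" by simp
    qed
  qed
  have "infinite (UNIV :: (nat \<Rightarrow> bool) set)"
    using finite_fun_UNIVD1[where 'a = nat and 'b = bool] by auto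
  moreover have "S \<times> T \<lesssim> (UNIV :: (nat \<Rightarrow> bool) set)" for S T :: "(nat \<Rightarrow> bool) set"
  proof -
    have "inj_on (\<lambda>(x, y) (n :: nat). if n = 0 then x else y) (S \<times> T)"
    proof (rule inj_onI, clarify)
      fix x y x' y' :: "nat \<Rightarrow> bool"
      assume "(\<lambda>n :: nat. if n = 0 then x else y) = (\<lambda>n. if n = 0 then x' else y')"
      from fun_cong[OF this, of 0] fun_cong[OF this, of 1] show "x = x' \<and> y = y'" by simp
    qed
    then have "S \<times> T \<lesssim> (UNIV :: (nat \<Rightarrow> nat \<Rightarrow> bool) set)"
      unfolding lepoll_def by blast
    with seqs show ?thesis unfolding lepoll_def by (metis inj_compose inj_on_subset comp_inj_on subset_UNIV)
  qed
  moreover have "(UNIV :: nat set) \<rightarrow>\<^sub>E S \<lesssim> (UNIV :: (nat \<Rightarrow> bool) set)" for S :: "(nat \<Rightarrow> bool) set"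
    using seqs unfolding lepoll_def by (meson inj_on_subset subset_UNIV)
  ultimately show ?thesis unfolding universe_def by blast
qed

record 'u normed_set =
  pts :: "'u set"
  nrm :: "'u \<Rightarrow> real"

definition normed_sets :: "'u set set \<Rightarrow> 'u normed_set set" where
  "normed_sets \<U> = {X. pts X \<in> \<U> \<and> nrm X \<in> pts X \<rightarrow>\<^sub>E {0..}}"

definition NSets :: "kind \<Rightarrow> 'u set set \<Rightarrow> ('u normed_set, 'u \<Rightarrow> 'u) cat" where
  "NSets \<Sigma> \<U> =
    \<lparr>obj = normed_sets \<U>,
     hom = (\<lambda>X Y. {f \<in> pts X \<rightarrow>\<^sub>E pts Y. bounded_map \<Sigma> (pts X) (nrm X) (nrm Y) f}),
     idt = (\<lambda>X. \<lambda>x\<in>pts X. x),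
     comp = (\<lambda>X Y Z g f. compose (pts X) g f)\<rparr>"


section \<open>Banach halos\<close>

definition lp_norm :: "ennreal \<Rightarrow> 'i set \<Rightarrow> ('i \<Rightarrow> real) \<Rightarrow> real" where
  "lp_norm p I v =
    (if p = \<infinity> then Max (insert 0 (v ` I))
     else (\<Sum>i\<in>I. v i powr enn2real p) powr (1 / enn2real p))"

definition cauchy_seqs :: "('m, 'z) ring_scheme \<Rightarrow> ('m \<Rightarrow> real) \<Rightarrow> (nat \<Rightarrow> 'm) set" where
  "cauchy_seqs G N = {s. (\<forall>n. s n \<in> carrier G) \<and>
    (\<forall>e>0. \<exists>k. \<forall>m\<ge>k. \<forall>n\<ge>k. N (s m \<ominus>\<^bsub>G\<^esub> s n) < e)}"

definition complete_for :: "('m, 'z) ring_scheme \<Rightarrow> ('m \<Rightarrow> real) \<Rightarrow> bool" where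
  "complete_for G N \<longleftrightarrow>
    (\<forall>s\<in>cauchy_seqs G N. \<exists>l\<in>carrier G. (\<lambda>n. N (s n \<ominus>\<^bsub>G\<^esub> l)) \<longlonglongrightarrow> 0)"

datatype modulus = Exponent ennreal | Constants real real

fun modulus_le :: "modulus \<Rightarrow> modulus \<Rightarrow> bool" where
  "modulus_le (Exponent p) (Exponent q) \<longleftrightarrow> p \<le> q"
| "modulus_le (Constants C1 D1) (Constants C2 D2) \<longleftrightarrow> C2 \<le> C1 \<and> D2 \<le> D1"
| "modulus_le _ _ \<longleftrightarrow> False"

text \<open>The constant in the inequality bounding the norm of a product.\<close>

fun mult_const :: "modulus \<Rightarrow> real" where
  "mult_const (Exponent p) = 1"
| "mult_const (Constants C D) = D"

record 'a halo = "'a ring" +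
  hnorm :: "'a \<Rightarrow> real"
  modulus :: modulus

fun is_modulus :: "kind \<Rightarrow> modulus \<Rightarrow> bool" where
  "is_modulus Short (Exponent p) \<longleftrightarrow> 0 < p"
| "is_modulus Lipschitz (Constants C D) \<longleftrightarrow> 0 < C \<and> 0 < D"
| "is_modulus _ _ \<longleftrightarrow> False"

fun modulus_norm :: "modulus \<Rightarrow> real \<Rightarrow> real \<Rightarrow> real" where
  "modulus_norm (Exponent p) r s = lp_norm p UNIV (\<lambda>b. if b then r else s)"
| "modulus_norm (Constants C D) r s = C * max r s"

definition banach_halo :: "kind \<Rightarrow> 'a halo \<Rightarrow> bool" where
  "banach_halo \<Sigma> R \<longleftrightarrow> ring R \<and> is_modulus \<Sigma> (modulus R) \<and>
    (\<forall>f\<in>carrier R. 0 \<le> hnorm R f) \<and>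
    (\<one>\<^bsub>R\<^esub> \<noteq> \<zero>\<^bsub>R\<^esub> \<longrightarrow> hnorm R \<one>\<^bsub>R\<^esub> = 1) \<and>
    (\<forall>f\<in>carrier R. hnorm R f = 0 \<longleftrightarrow> f = \<zero>\<^bsub>R\<^esub>) \<and>
    (\<forall>f\<in>carrier R. \<forall>g\<in>carrier R.
      hnorm R (f \<ominus>\<^bsub>R\<^esub> g) \<le> modulus_norm (modulus R) (hnorm R f) (hnorm R g)) \<and>
    (\<forall>f\<in>carrier R. \<forall>g\<in>carrier R.
      hnorm R (f \<otimes>\<^bsub>R\<^esub> g) \<le> mult_const (modulus R) * hnorm R f * hnorm R g) \<and>
    complete_for R (hnorm R)"

definition sigma_ring_hom :: "kind \<Rightarrow> 'a halo \<Rightarrow> 'b halo \<Rightarrow> ('a \<Rightarrow> 'b) set" where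
  "sigma_ring_hom \<Sigma> R S = {f \<in> ring_hom R S \<inter> extensional (carrier R).
    bounded_map \<Sigma> (carrier R) (hnorm R) (hnorm S) f}"

definition CBanhalos :: "kind \<Rightarrow> 'u set set \<Rightarrow> ('u halo, 'u \<Rightarrow> 'u) cat" where
  "CBanhalos \<Sigma> \<U> =
    \<lparr>obj = {R. banach_halo \<Sigma> R \<and> cring R \<and> carrier R \<in> \<U>},
     hom = (\<lambda>R S. {f \<in> sigma_ring_hom \<Sigma> R S. modulus_le (modulus R) (modulus S)}),
     idt = (\<lambda>R. \<lambda>a\<in>carrier R. a),
     comp = (\<lambda>R S T g f. compose (carrier R) g f)\<rparr>"


section \<open>Free normed modules and their completions\<close>

text \<open>Modules reuse the record of HOL-Algebra, whose fields \<open>mult\<close> and \<open>one\<close> are irrelevant.\<close>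

record ('a, 'm) normed_module = "('a, 'm) module" +
  mnorm :: "'m \<Rightarrow> real"

definition delta :: "'a halo \<Rightarrow> 'x set \<Rightarrow> 'x \<Rightarrow> 'x \<Rightarrow> 'a" where
  "delta A X x = (\<lambda>y\<in>X. if y = x then \<one>\<^bsub>A\<^esub> else \<zero>\<^bsub>A\<^esub>)"

definition support :: "'a halo \<Rightarrow> 'x set \<Rightarrow> ('x \<Rightarrow> 'a) \<Rightarrow> 'x set" where
  "support A X a = {x\<in>X. a x \<noteq> \<zero>\<^bsub>A\<^esub>}"

definition free_module :: "'a halo \<Rightarrow> 'x set \<Rightarrow> ('a, 'x \<Rightarrow> 'a) module" where
  "free_module A X =
    \<lparr>carrier = {a \<in> X \<rightarrow>\<^sub>E carrier A. finite (support A X a)},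
     mult = undefined, one = undefined,
     zero = (\<lambda>x\<in>X. \<zero>\<^bsub>A\<^esub>),
     add = (\<lambda>a b. \<lambda>x\<in>X. a x \<oplus>\<^bsub>A\<^esub> b x),
     smult = (\<lambda>c a. \<lambda>x\<in>X. c \<otimes>\<^bsub>A\<^esub> a x)\<rparr>"

datatype 'l btree = Leaf 'l | Branch "'l btree" "'l btree"

primrec tree_norm :: "real \<Rightarrow> ('l \<Rightarrow> real) \<Rightarrow> 'l btree \<Rightarrow> real" where
  "tree_norm C N (Leaf l) = N l"
| "tree_norm C N (Branch s t) = C * max (tree_norm C N s) (tree_norm C N t)"

primrec tree_sum :: "('m, 'z) ring_scheme \<Rightarrow> ('l \<Rightarrow> 'm) \<Rightarrow> 'l btree \<Rightarrow> 'm" where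
  "tree_sum M v (Leaf l) = v l"
| "tree_sum M v (Branch s t) = tree_sum M v s \<oplus>\<^bsub>M\<^esub> tree_sum M v t"

text \<open>A leaf \<open>(a, x)\<close> stands for \<open>a{x}\<close>. Over the empty set there is no tree, but the zero
  element has to have seminorm 0; over a nonempty set the leaf \<open>0{x}\<close> gives the same value.\<close>

definition free_norm :: "'a halo \<Rightarrow> 'x normed_set \<Rightarrow> ('x \<Rightarrow> 'a) \<Rightarrow> real" where
  "free_norm A X u =
    (case modulus A of
       Exponent p \<Rightarrow> lp_norm p (support A (pts X) u) (\<lambda>x. hnorm A (u x) * nrm X x)
     | Constants C D \<Rightarrow>
         if support A (pts X) u = {} then 0
         else Inf {tree_norm C (\<lambda>(a, x). hnorm A a * nrm X x) t | t.
           set_btree t \<subseteq> carrier A \<times> pts X \<and>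
           tree_sum (free_module A (pts X))
             (\<lambda>(a, x). a \<odot>\<^bsub>free_module A (pts X)\<^esub> delta A (pts X) x) t = u})"

definition free_normed_module ::
  "'a halo \<Rightarrow> 'x normed_set \<Rightarrow> ('a, 'x \<Rightarrow> 'a) normed_module" where
  "free_normed_module A X = module.extend (free_module A (pts X)) (normed_module.fields (free_norm A X))"

definition null_rel :: "('a, 'm) normed_module \<Rightarrow> ((nat \<Rightarrow> 'm) \<times> (nat \<Rightarrow> 'm)) set" where
  "null_rel M = {(s, s'). s \<in> cauchy_seqs M (mnorm M) \<and> s' \<in> cauchy_seqs M (mnorm M) \<and>
    (\<lambda>n. mnorm M (s n \<ominus>\<^bsub>M\<^esub> s' n)) \<longlonglongrightarrow> 0}"

text \<open>The norm of a class is the limit of the norms. For a short halo this limit exists and is the same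
  for all representatives, so that the infimum below is over a singleton. For a Lipschitz halo the norm
  need not be continuous: the limit may fail to exist or depend on the representative, and the infimum
  of the limits that occur fixes a choice within the equivalence class of norms.\<close>

definition completion :: "('a, 'm) normed_module \<Rightarrow> ('a, (nat \<Rightarrow> 'm) set) normed_module" where
  "completion M =
    \<lparr>carrier = cauchy_seqs M (mnorm M) // null_rel M,
     mult = undefined, one = undefined,
     zero = null_rel M `` {\<lambda>n. \<zero>\<^bsub>M\<^esub>},
     add = (\<lambda>c d. \<Union>s\<in>c. \<Union>s'\<in>d. null_rel M `` {\<lambda>n. s n \<oplus>\<^bsub>M\<^esub> s' n}),
     smult = (\<lambda>a c. \<Union>s\<in>c. null_rel M `` {\<lambda>n. a \<odot>\<^bsub>M\<^esub> s n}),
     mnorm = (\<lambda>c. Inf {r. \<exists>s\<in>c. (\<lambda>n. mnorm M (s n)) \<longlonglongrightarrow> r})\<rparr>"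

text \<open>Completions of small modules are transported to small sets along a chosen injection.\<close>

definition encode :: "'u set set \<Rightarrow> 'b set \<Rightarrow> 'b \<Rightarrow> 'u" where
  "encode \<U> S = (SOME e. inj_on e S \<and> e ` S \<in> \<U>)"

definition transport :: "('m \<Rightarrow> 'u) \<Rightarrow> ('a, 'm) normed_module \<Rightarrow> ('a, 'u) normed_module" where
  "transport e M =
    (let d = inv_into (carrier M) e in
     \<lparr>carrier = e ` carrier M,
      mult = undefined, one = undefined,
      zero = e \<zero>\<^bsub>M\<^esub>,
      add = (\<lambda>u v. e (d u \<oplus>\<^bsub>M\<^esub> d v)),
      smult = (\<lambda>a u. e (a \<odot>\<^bsub>M\<^esub> d u)),
      mnorm = (\<lambda>u. mnorm M (d u))\<rparr>)"

definition ell_raw ::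
  "'u halo \<Rightarrow> 'u normed_set \<Rightarrow> ('u, (nat \<Rightarrow> 'u \<Rightarrow> 'u) set) normed_module" where
  "ell_raw A X = completion (free_normed_module A X)"

definition ell_code ::
  "'u set set \<Rightarrow> 'u halo \<Rightarrow> 'u normed_set \<Rightarrow> (nat \<Rightarrow> 'u \<Rightarrow> 'u) set \<Rightarrow> 'u" where
  "ell_code \<U> A X = encode \<U> (carrier (ell_raw A X))"

definition ell :: "'u set set \<Rightarrow> 'u halo \<Rightarrow> 'u normed_set \<Rightarrow> ('u, 'u) normed_module" where
  "ell \<U> A X = transport (ell_code \<U> A X) (ell_raw A X)"

definition ell_reps ::
  "'u set set \<Rightarrow> 'u halo \<Rightarrow> 'u normed_set \<Rightarrow> 'u \<Rightarrow> (nat \<Rightarrow> 'u \<Rightarrow> 'u) set" where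
  "ell_reps \<U> A X = inv_into (carrier (ell_raw A X)) (ell_code \<U> A X)"

definition normed_set_of :: "('a, 'u) normed_module \<Rightarrow> 'u normed_set" where
  "normed_set_of M = \<lparr>pts = carrier M, nrm = restrict (mnorm M) (carrier M)\<rparr>"


section \<open>The monad of a halo\<close>

definition ell_unit :: "'u set set \<Rightarrow> 'u halo \<Rightarrow> 'u normed_set \<Rightarrow> 'u \<Rightarrow> 'u" where
  "ell_unit \<U> A X =
    (\<lambda>x\<in>pts X. ell_code \<U> A X (null_rel (free_normed_module A X) `` {\<lambda>n. delta A (pts X) x}))"

text \<open>The continuous extension of \<open>\<Sum> a\<^sub>x{x} \<mapsto> \<Sum> \<phi>(a\<^sub>x) h(x)\<close>.\<close>

definition lin_ext :: "'u set set \<Rightarrow> ('u \<Rightarrow> 'b) \<Rightarrow> 'u halo \<Rightarrow> 'u normed_set \<Rightarrow>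
    ('b, 'v) normed_module \<Rightarrow> ('u \<Rightarrow> 'v) \<Rightarrow> 'u \<Rightarrow> 'v" where
  "lin_ext \<U> \<phi> A X M h =
    (\<lambda>u\<in>carrier (ell \<U> A X). THE z. z \<in> carrier M \<and>
      (\<forall>s\<in>ell_reps \<U> A X u.
        (\<lambda>n. mnorm M ((\<Oplus>\<^bsub>M\<^esub>x\<in>support A (pts X) (s n). \<phi> (s n x) \<odot>\<^bsub>M\<^esub> h x) \<ominus>\<^bsub>M\<^esub> z))
          \<longlonglongrightarrow> 0))"

definition Lambda_monad :: "'u set set \<Rightarrow> 'u halo \<Rightarrow> ('u normed_set, 'u \<Rightarrow> 'u) monad" where
  "Lambda_monad \<U> A =
    \<lparr>endo =
       \<lparr>fobj = (\<lambda>X. normed_set_of (ell \<U> A X)),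
        fmap = (\<lambda>X Y h. lin_ext \<U> (\<lambda>a. a) A X (ell \<U> A Y) (\<lambda>x. ell_unit \<U> A Y (h x)))\<rparr>,
     eta = ell_unit \<U> A,
     mu = (\<lambda>X. lin_ext \<U> (\<lambda>a. a) A (normed_set_of (ell \<U> A X)) (ell \<U> A X) (\<lambda>y. y))\<rparr>"

definition Lambda :: "'u set set \<Rightarrow>
    ('u halo, 'u \<Rightarrow> 'u, ('u normed_set, 'u \<Rightarrow> 'u) monad, 'u normed_set \<Rightarrow> 'u \<Rightarrow> 'u) cat_functor" where
  "Lambda \<U> =
    \<lparr>fobj = Lambda_monad \<U>,
     fmap = (\<lambda>A B f. \<lambda>X\<in>normed_sets \<U>. lin_ext \<U> f A X (ell \<U> B X) (ell_unit \<U> B X))\<rparr>"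


section \<open>Flows\<close>

definition flow_set :: "real \<Rightarrow> 'u normed_set \<Rightarrow> 'u normed_set" where
  "flow_set t X = \<lparr>pts = pts X, nrm = (\<lambda>x\<in>pts X. nrm X x powr t)\<rparr>"

fun flow_modulus :: "real \<Rightarrow> modulus \<Rightarrow> modulus" where
  "flow_modulus t (Exponent p) = Exponent (p / ennreal t)"
| "flow_modulus t (Constants C D) = Constants (C powr t) (D powr t)"

definition flow_halo :: "real \<Rightarrow> 'a halo \<Rightarrow> 'a halo" where
  "flow_halo t A =
    A\<lparr>hnorm := (\<lambda>a. hnorm A a powr t), modulus := flow_modulus t (modulus A)\<rparr>"

definition flow_monad ::
  "real \<Rightarrow> ('u normed_set, 'u \<Rightarrow> 'u) monad \<Rightarrow> ('u normed_set, 'u \<Rightarrow> 'u) monad" where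
  "flow_monad t T =
    \<lparr>endo =
       \<lparr>fobj = (\<lambda>X. flow_set t (fobj (endo T) (flow_set (1 / t) X))),
        fmap = (\<lambda>X Y. fmap (endo T) (flow_set (1 / t) X) (flow_set (1 / t) Y))\<rparr>,
     eta = (\<lambda>X. eta T (flow_set (1 / t) X)),
     mu = (\<lambda>X. mu T (flow_set (1 / t) X))\<rparr>"

definition halo_flow :: "real \<Rightarrow> ('u halo, 'u \<Rightarrow> 'u, 'u halo, 'u \<Rightarrow> 'u) cat_functor" where
  "halo_flow t = \<lparr>fobj = flow_halo t, fmap = (\<lambda>A B f. f)\<rparr>"

definition monad_flow :: "real \<Rightarrow> 'u set set \<Rightarrow>
    (('u normed_set, 'u \<Rightarrow> 'u) monad, 'u normed_set \<Rightarrow> 'u \<Rightarrow> 'u,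
     ('u normed_set, 'u \<Rightarrow> 'u) monad, 'u normed_set \<Rightarrow> 'u \<Rightarrow> 'u) cat_functor" where
  "monad_flow t \<U> =
    \<lparr>fobj = flow_monad t,
     fmap = (\<lambda>S T \<theta>. \<lambda>X\<in>normed_sets \<U>. \<theta> (flow_set (1 / t) X))\<rparr>"


section \<open>The functor does not see the multiplicative constant\<close>

text \<open>Hence it is not full at pairs of Lipschitz halos differing only by an increase of that
  constant.\<close>

lemma Lambda_monad_mult_const:
  assumes "modulus A = Constants C D"
  shows "Lambda_monad \<U> (A\<lparr>modulus := Constants C D'\<rparr>) = Lambda_monad \<U> A"
proof -
  let ?A = "A\<lparr>modulus := Constants C D'\<rparr>"
  have f: "free_module ?A X = free_module A X" and d: "delta ?A X = delta A X"
    and s: "support ?A X = support A X" for X :: "'x set"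
    by (simp_all add: free_module_def delta_def support_def fun_eq_iff)
  have n: "free_norm ?A X = free_norm A X" for X :: "'x normed_set"
    by (rule ext) (simp add: free_norm_def assms f d s)
  have r: "ell_raw ?A = ell_raw A" "free_normed_module ?A X = free_normed_module A X"
    for X :: "'x normed_set"
    by (simp_all add: ell_raw_def free_normed_module_def f n fun_eq_iff)
  have c: "ell_code \<U> ?A = ell_code \<U> A" "ell_reps \<U> ?A = ell_reps \<U> A" "ell \<U> ?A = ell \<U> A"
    by (simp_all add: ell_code_def ell_reps_def ell_def r fun_eq_iff)
  show ?thesis
    by (simp add: Lambda_monad_def lin_ext_def ell_unit_def r c s d fun_eq_iff)
qed

lemma Lambda_not_full:
  assumes "is_functor (CBanhalos Lipschitz \<U>) (Monads (NSets Lipschitz \<U>)) (Lambda \<U>)"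
    and A: "A \<in> obj (CBanhalos Lipschitz \<U>)" "modulus A = Constants C D" and "D < D'"
  defines "B \<equiv> A\<lparr>modulus := Constants C D'\<rparr>"
  shows "hom (CBanhalos Lipschitz \<U>) A B = {}"
    "idt (Monads (NSets Lipschitz \<U>)) (fobj (Lambda \<U>) A)
      \<in> hom (Monads (NSets Lipschitz \<U>)) (fobj (Lambda \<U>) A) (fobj (Lambda \<U>) B)"
proof -
  show "hom (CBanhalos Lipschitz \<U>) A B = {}"
    using assms by (auto simp: CBanhalos_def)
  have "fobj (Lambda \<U>) B = fobj (Lambda \<U>) A"
    by (simp add: Lambda_def B_def Lambda_monad_mult_const[OF A(2)])
  then show "idt (Monads (NSets Lipschitz \<U>)) (fobj (Lambda \<U>) A)
      \<in> hom (Monads (NSets Lipschitz \<U>)) (fobj (Lambda \<U>) A) (fobj (Lambda \<U>) B)"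
    using assms(1) A(1) by (auto simp: is_functor_def is_category_def)
qed

end

theory Submission
  imports Defs
begin

text \<open>The map \<open>\<Sum> a\<^sub>x{x} \<mapsto> \<Sum> \<phi>(a\<^sub>x) h(x)\<close> is the only additive bounded map with
  \<open>a{x} \<mapsto> \<phi>(a) h(x)\<close> on the completed free module, because the finite sums are dense; it exists
  because the norm of the free module is the largest one that bounds the generators and obeys the modulus
  of the halo on sums. Functoriality, the monad laws and the compatibility of \<open>\<Lambda>\<^sub>f\<close> with units and
  multiplications are comparisons of two such maps on generators.

  Conversely let \<open>\<theta> : \<Lambda>\<^sub>A \<rightarrow> \<Lambda>\<^sub>B\<close> be a morphism of monads. As
  \<open>\<Lambda>\<^sub>A\<close> of a point of norm \<open>1\<close> is \<open>A\<close>, there \<open>\<theta>\<close> is a map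
  \<open>f : A \<rightarrow> B\<close>. The zero element lives over the empty set and addition is the element
  \<open>{p} + {q}\<close> over two points, which \<open>\<theta>\<close> has to preserve since its two coordinates are
  known; so \<open>\<theta>\<close> is additive, \<open>f\<close> is a ring homomorphism and \<open>\<theta> = \<Lambda>\<^sub>f\<close>. The moduli are
  compared on a set of \<open>2\<^sup>k\<close> points of norm \<open>1\<close>: the norm of their sum is \<open>C\<^sup>k\<close> up to a
  constant factor, with \<open>C = 2\<^sup>1\<^sup>/\<^sup>p\<close> in the short case. The upper bound is a balanced tree. For the lower bound
  let a tree have norm \<open>r\<close>: a leaf at depth \<open>d\<close> has norm at most \<open>r C\<^sup>-\<^sup>d\<close> and weight
  \<open>2\<^sup>-\<^sup>d\<close>, the weights add up to \<open>1\<close>, so some point receives weight at most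
  \<open>2\<^sup>-\<^sup>k\<close>, and regrouping its leaves by weight gives \<open>1 \<le> r C\<^sup>1\<^sup>-\<^sup>k\<close> up to a constant.

  Raising norms to the power \<open>t\<close> changes neither Cauchy nor null sequences, so the two sides of the
  compatibility with the flows have the same underlying modules and maps.\<close>

text \<open>The obstacle is the Lipschitz case, where a norm need be neither symmetric nor
  continuous. Estimates on a completion are therefore proved for representatives whose norms
  converge to numbers close to the infimum that defines the norm, and are passed to the limit
  through the continuity of the function \<open>m\<close> that bounds sums. A passage between a
  module and its completion can cost one application of \<open>m\<close> to 0, which is the factor
  \<open>neg_const\<close>. It is 1 for short halos, so a single argument yields short maps there
  and Lipschitz maps otherwise.

  The lost constants are also why \<open>k\<close> stays arbitrary when the moduli are compared: an
  inequality \<open>\<alpha>^k \<le> M * \<beta>^k\<close> for all \<open>k\<close> with a fixed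
  \<open>M\<close> still gives \<open>\<alpha> \<le> \<beta>\<close>. Two things escape this
  comparison. Over the zero ring all norms vanish, so a zero target tells nothing about its modulus;
  and the monad of a Lipschitz halo does not depend on the multiplicative constant. Fullness is
  stated accordingly.\<close>

lemma bounded_real_convergent_subseq:
  fixes f :: "nat \<Rightarrow> real"
  assumes "\<And>n. \<bar>f n\<bar> \<le> B"
  shows "\<exists>r l. strict_mono r \<and> (\<lambda>n. f (r n)) \<longlonglongrightarrow> l"
proof -
  obtain r :: "nat \<Rightarrow> nat" where r: "strict_mono r" "monoseq (\<lambda>n. f (r n))"
    using seq_monosub by blast
  have "Bseq (\<lambda>n. f (r n))"
    using assms by (intro BseqI'[where K = B]) simp
  then have "convergent (\<lambda>n. f (r n))"
    using r(2) by (rule Bseq_monoseq_convergent)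
  then show ?thesis using r(1) by (auto simp: convergent_def)
qed

lemma tendsto_0_squeeze:
  fixes f g :: "nat \<Rightarrow> real"
  assumes "g \<longlonglongrightarrow> 0" "\<And>n. 0 \<le> f n" "\<And>n. f n \<le> g n"
  shows "f \<longlonglongrightarrow> 0"
  by (rule tendsto_sandwich[where f = "\<lambda>_. 0" and h = g]) (use assms in auto)

section \<open>Quasi-normed abelian groups\<close>

text \<open>Two degrees of precision: \<open>m\<close> is the exact bound for sums, from which norms
  of maps are estimated, while the cruder constant \<open>K\<close> is enough for convergence.
  \<open>m_lim\<close> asks for continuity of \<open>m\<close>, since that of \<open>N\<close> may
  fail. Negatives have an axiom of their own because \<open>m\<close> bounds only sums.\<close>

locale qnorm = abelian_group G for G (structure) +
  fixes N :: "'a \<Rightarrow> real" and m :: "real \<Rightarrow> real \<Rightarrow> real" and K :: real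
  assumes N_nonneg [simp]: "x \<in> carrier G \<Longrightarrow> 0 \<le> N x"
    and N_zero [simp]: "N \<zero> = 0"
    and N_add: "x \<in> carrier G \<Longrightarrow> y \<in> carrier G \<Longrightarrow> N (x \<oplus> y) \<le> m (N x) (N y)"
    and N_neg: "x \<in> carrier G \<Longrightarrow> N (\<ominus> x) \<le> K * N x"
    and K_ge_1: "1 \<le> K"
    and m_le: "0 \<le> r \<Longrightarrow> 0 \<le> s \<Longrightarrow> m r s \<le> K * max r s"
    and m_mono: "0 \<le> r \<Longrightarrow> r \<le> r' \<Longrightarrow> 0 \<le> s \<Longrightarrow> s \<le> s' \<Longrightarrow> m r s \<le> m r' s'"
    and m_lim: "(\<And>n. 0 \<le> f n) \<Longrightarrow> (\<And>n. 0 \<le> g n) \<Longrightarrow> f \<longlonglongrightarrow> r \<Longrightarrow> g \<longlonglongrightarrow> s \<Longrightarrow>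
      (\<lambda>n :: nat. m (f n) (g n)) \<longlonglongrightarrow> m r s"
begin

lemma add_minus_cancel [simp]:
  assumes "x \<in> carrier G" "y \<in> carrier G"
  shows "y \<oplus> (x \<ominus> y) = x"
  using assms by (simp add: a_minus_def a_lcomm r_neg)

lemma minus_split:
  assumes "x \<in> carrier G" "y \<in> carrier G" "z \<in> carrier G"
  shows "x \<ominus> z = (x \<ominus> y) \<oplus> (y \<ominus> z)"
proof -
  have "(x \<ominus> y) \<oplus> (y \<ominus> z) = (\<ominus> y \<oplus> y) \<oplus> (x \<oplus> \<ominus> z)"
    using assms by (simp only: a_minus_def a_ac a_inv_closed a_closed)
  then show ?thesis using assms by (simp add: a_minus_def l_neg)
qed

lemma add_minus_add:
  assumes "x \<in> carrier G" "y \<in> carrier G" "z \<in> carrier G" "w \<in> carrier G"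
  shows "(x \<oplus> y) \<ominus> (z \<oplus> w) = (x \<ominus> z) \<oplus> (y \<ominus> w)"
  using assms by (simp add: a_minus_def minus_add a_ac)

lemma neg_minus:
  assumes "x \<in> carrier G" "y \<in> carrier G"
  shows "\<ominus> (x \<ominus> y) = y \<ominus> x"
  using assms by (simp add: a_minus_def minus_add a_comm)

lemma minus_zero [simp]: "x \<in> carrier G \<Longrightarrow> x \<ominus> \<zero> = x"
  using add.inv_one by (simp add: a_minus_def)

lemma minus_self [simp]: "x \<in> carrier G \<Longrightarrow> x \<ominus> x = \<zero>"
  by (simp add: a_minus_def r_neg)

lemma neg_minus_neg:
  assumes "x \<in> carrier G" "y \<in> carrier G"
  shows "\<ominus> x \<ominus> \<ominus> y = \<ominus> (x \<ominus> y)"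
  using assms by (simp add: a_minus_def minus_add)

lemma K_pos: "0 < K" using K_ge_1 by simp

lemma N_add_max:
  "x \<in> carrier G \<Longrightarrow> y \<in> carrier G \<Longrightarrow> N (x \<oplus> y) \<le> K * max (N x) (N y)"
  using N_add m_le by (meson N_nonneg order_trans)

lemma N_add_sum:
  assumes "x \<in> carrier G" "y \<in> carrier G"
  shows "N (x \<oplus> y) \<le> K * (N x + N y)"
proof -
  have "max (N x) (N y) \<le> N x + N y" using assms by simp
  then have "K * max (N x) (N y) \<le> K * (N x + N y)"
    using K_pos by (intro mult_left_mono) auto
  then show ?thesis using N_add_max[OF assms] by linarith
qed

lemma N_minus_commute:
  "x \<in> carrier G \<Longrightarrow> y \<in> carrier G \<Longrightarrow> N (x \<ominus> y) \<le> K * N (y \<ominus> x)"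
  using N_neg[of "y \<ominus> x"] by (simp add: neg_minus)

lemma N_le_minus:
  assumes "x \<in> carrier G" "y \<in> carrier G"
  shows "N x \<le> m (N y) (N (x \<ominus> y))"
  using N_add[of y "x \<ominus> y"] assms by simp

section \<open>Convergence, null sequences and Cauchy sequences\<close>

definition tends :: "(nat \<Rightarrow> 'a) \<Rightarrow> 'a \<Rightarrow> bool" where
  "tends s l \<longleftrightarrow> (\<lambda>n. N (s n \<ominus> l)) \<longlonglongrightarrow> 0"

definition null :: "(nat \<Rightarrow> 'a) \<Rightarrow> bool" where
  "null s \<longleftrightarrow> (\<lambda>n. N (s n)) \<longlonglongrightarrow> 0"

lemma null_zero [simp]: "null (\<lambda>n. \<zero>)"
  by (simp add: null_def)

lemma null_add:
  assumes "\<And>n. s n \<in> carrier G" "\<And>n. t n \<in> carrier G" "null s" "null t"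
  shows "null (\<lambda>n. s n \<oplus> t n)"
  unfolding null_def
proof (rule tendsto_0_squeeze)
  show "(\<lambda>n. K * (N (s n) + N (t n))) \<longlonglongrightarrow> 0"
    using assms(3,4) unfolding null_def by (auto intro!: tendsto_eq_intros)
qed (use assms N_add_sum in auto)

lemma null_neg:
  assumes "\<And>n. s n \<in> carrier G" "null s"
  shows "null (\<lambda>n. \<ominus> s n)"
  unfolding null_def
proof (rule tendsto_0_squeeze)
  show "(\<lambda>n. K * N (s n)) \<longlonglongrightarrow> 0"
    using assms(2) unfolding null_def by (auto intro!: tendsto_eq_intros)
qed (use assms N_neg in auto)

lemma null_commute:
  assumes "\<And>n. s n \<in> carrier G" "\<And>n. t n \<in> carrier G" "null (\<lambda>n. s n \<ominus> t n)"
  shows "null (\<lambda>n. t n \<ominus> s n)"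
  using null_neg[OF _ assms(3)] assms(1,2) by (simp add: neg_minus)

lemma null_trans:
  assumes "\<And>n. s n \<in> carrier G" "\<And>n. t n \<in> carrier G" "\<And>n. u n \<in> carrier G"
    and "null (\<lambda>n. s n \<ominus> t n)" "null (\<lambda>n. t n \<ominus> u n)"
  shows "null (\<lambda>n. s n \<ominus> u n)"
proof -
  have "s n \<ominus> u n = (s n \<ominus> t n) \<oplus> (t n \<ominus> u n)" for n
    using assms minus_split by blast
  then show ?thesis using null_add[OF _ _ assms(4,5)] assms(1-3) by simp
qed

lemma null_const_iff: "x \<in> carrier G \<Longrightarrow> null (\<lambda>n. x) \<longleftrightarrow> N x = 0"
  by (simp add: null_def LIMSEQ_const_iff)

lemma tends_unique:
  assumes "\<And>n. s n \<in> carrier G" "l \<in> carrier G" "l' \<in> carrier G" "tends s l" "tends s l'"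
  shows "N (l \<ominus> l') = 0"
proof -
  have "null (\<lambda>n. l \<ominus> s n)" "null (\<lambda>n. s n \<ominus> l')"
    using assms null_commute[of s "\<lambda>n. l"] by (auto simp: null_def tends_def)
  then have "null (\<lambda>n. l \<ominus> l')"
    using null_trans[of "\<lambda>n. l" s "\<lambda>n. l'"] assms(1-3) by simp
  then show ?thesis using assms(2,3) by (simp add: null_const_iff)
qed

abbreviation "CS \<equiv> cauchy_seqs G N"

lemma CS_closed: "s \<in> CS \<Longrightarrow> s n \<in> carrier G"
  by (simp add: cauchy_seqs_def)

lemma CS_I:
  assumes "\<And>n. s n \<in> carrier G"
    and "\<And>e. e > 0 \<Longrightarrow> \<exists>k. \<forall>p\<ge>k. \<forall>q\<ge>k. N (s p \<ominus> s q) < e"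
  shows "s \<in> CS"
  using assms by (auto simp: cauchy_seqs_def)

lemma CS_D: "s \<in> CS \<Longrightarrow> e > 0 \<Longrightarrow> \<exists>k. \<forall>p\<ge>k. \<forall>q\<ge>k. N (s p \<ominus> s q) < e"
  by (simp add: cauchy_seqs_def)

lemma CS_const [simp]: "x \<in> carrier G \<Longrightarrow> (\<lambda>n. x) \<in> CS"
  by (rule CS_I) auto

text \<open>One criterion serves sums, negatives and scalar multiples: the differences of
  \<open>u\<close> are dominated by those of two Cauchy sequences, each of which is eventually below
  \<open>e / (2 * B)\<close>.\<close>

lemma CS_bound:
  assumes "s \<in> CS" "t \<in> CS" "\<And>n. u n \<in> carrier G" "B > 0"
    and "\<And>p q. N (u p \<ominus> u q) \<le> B * (N (s p \<ominus> s q) + N (t p \<ominus> t q))"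
  shows "u \<in> CS"
proof (rule CS_I)
  fix e :: real assume "e > 0"
  then have e: "e / (2 * B) > 0" using assms(4) by simp
  obtain k1 where k1: "\<forall>p\<ge>k1. \<forall>q\<ge>k1. N (s p \<ominus> s q) < e / (2 * B)"
    using CS_D[OF assms(1) e] by blast
  obtain k2 where k2: "\<forall>p\<ge>k2. \<forall>q\<ge>k2. N (t p \<ominus> t q) < e / (2 * B)"
    using CS_D[OF assms(2) e] by blast
  have "N (u p \<ominus> u q) < e" if "p \<ge> max k1 k2" "q \<ge> max k1 k2" for p q
  proof -
    have "N (s p \<ominus> s q) + N (t p \<ominus> t q) < e / (2 * B) + e / (2 * B)"
      using k1 k2 that by (intro add_strict_mono) auto
    also have "\<dots> = e / B" by simp
    finally have "B * (N (s p \<ominus> s q) + N (t p \<ominus> t q)) < B * (e / B)"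
      using assms(4) by (rule mult_strict_left_mono)
    then show ?thesis using assms(5)[of p q] assms(4) by simp
  qed
  then show "\<exists>k. \<forall>p\<ge>k. \<forall>q\<ge>k. N (u p \<ominus> u q) < e" by blast
qed (use assms in auto)

lemma CS_add:
  assumes "s \<in> CS" "t \<in> CS"
  shows "(\<lambda>n. s n \<oplus> t n) \<in> CS"
  by (rule CS_bound[OF assms _ K_pos])
    (use assms CS_closed in \<open>auto simp: add_minus_add intro!: N_add_sum\<close>)

lemma CS_neg:
  assumes "s \<in> CS"
  shows "(\<lambda>n. \<ominus> s n) \<in> CS"
proof (rule CS_bound[OF assms assms _ K_pos])
  fix p q
  have "N (\<ominus> s p \<ominus> \<ominus> s q) \<le> K * N (s p \<ominus> s q)"
    using N_neg[of "s p \<ominus> s q"] CS_closed[OF assms] by (simp add: neg_minus_neg)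
  also have "\<dots> \<le> K * (N (s p \<ominus> s q) + N (s p \<ominus> s q))"
    using K_pos CS_closed[OF assms] by (intro mult_left_mono) auto
  finally show "N (\<ominus> s p \<ominus> \<ominus> s q) \<le> K * (N (s p \<ominus> s q) + N (s p \<ominus> s q))" .
qed (use CS_closed[OF assms] in auto)

lemma CS_minus: "s \<in> CS \<Longrightarrow> t \<in> CS \<Longrightarrow> (\<lambda>n. s n \<ominus> t n) \<in> CS"
  unfolding a_minus_def by (intro CS_add CS_neg)

text \<open>Since \<open>r p \<ge> p\<close>, the indices \<open>r p\<close>, \<open>r q\<close> and
  \<open>q\<close> all lie beyond the threshold \<open>k\<close>. The second claim means that a
  subsequence represents the same class in the completion.\<close>

lemma CS_subseq:
  assumes "s \<in> CS" "strict_mono r"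
  shows "(\<lambda>n. s (r n)) \<in> CS" "null (\<lambda>n. s (r n) \<ominus> s n)"
proof -
  have sub: "\<exists>k. \<forall>p\<ge>k. \<forall>q\<ge>k. N (s (r p) \<ominus> s (r q)) < e \<and> N (s (r p) \<ominus> s q) < e" if "e > 0" for e
    using CS_D[OF assms(1) that] seq_suble[OF assms(2)] by (meson order_trans)
  show "(\<lambda>n. s (r n)) \<in> CS"
    by (rule CS_I) (use sub CS_closed[OF assms(1)] in blast)+
  show "null (\<lambda>n. s (r n) \<ominus> s n)"
    unfolding null_def LIMSEQ_def dist_real_def
    using sub CS_closed[OF assms(1)] by (metis N_nonneg abs_of_nonneg diff_zero minus_closed)
qed

lemma CS_bounded:
  assumes "s \<in> CS"
  shows "\<exists>B. \<forall>n. N (s n) \<le> B"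
proof -
  obtain k where k: "\<forall>p\<ge>k. \<forall>q\<ge>k. N (s p \<ominus> s q) < 1"
    using CS_D[OF assms, of 1] by auto
  have c: "s n \<in> carrier G" for n using CS_closed[OF assms] .
  have "N (s n) \<le> K * (N (s k) + 1) + (\<Sum>i<k. N (s i))" for n
  proof (cases "n < k")
    case True
    then have "N (s n) \<le> (\<Sum>i<k. N (s i))"
      using c by (intro member_le_sum) auto
    moreover have "0 \<le> K * (N (s k) + 1)" using K_pos c by simp
    ultimately show ?thesis by linarith
  next
    case False
    have "N (s k \<oplus> (s n \<ominus> s k)) \<le> K * (N (s k) + N (s n \<ominus> s k))"
      using c by (intro N_add_sum) auto
    also have "\<dots> \<le> K * (N (s k) + 1)"
      using k False K_pos by (intro mult_left_mono) (auto simp: less_imp_le)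
    finally have "N (s n) \<le> K * (N (s k) + 1)" using c by simp
    moreover have "0 \<le> (\<Sum>i<k. N (s i))" using c by (intro sum_nonneg) auto
    ultimately show ?thesis by linarith
  qed
  then show ?thesis by blast
qed

text \<open>The norms along a Cauchy sequence may oscillate; being bounded, they converge along a
  subsequence, which still represents the same class.\<close>

lemma CS_convergent_subseq:
  assumes "s \<in> CS"
  shows "\<exists>r l. strict_mono r \<and> (\<lambda>n. N (s (r n))) \<longlonglongrightarrow> l"
proof -
  obtain B where "\<forall>n. N (s n) \<le> B" using CS_bounded[OF assms] by blast
  then show ?thesis
    using CS_closed[OF assms] by (intro bounded_real_convergent_subseq[where B = B]) auto
qed

lemma tends_imp_CS:
  assumes "\<And>n. s n \<in> carrier G" "l \<in> carrier G" "tends s l"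
  shows "s \<in> CS"
proof (rule CS_I)
  fix e :: real assume e: "e > 0"
  \<comment> \<open>One factor \<open>K\<close> is lost on splitting the difference at
    \<open>l\<close>, a second one on turning \<open>l \<ominus> s q\<close> around.\<close>
  then have "e / (2 * K * K) > 0" using K_pos by simp
  then obtain k where k: "\<And>n. n \<ge> k \<Longrightarrow> N (s n \<ominus> l) < e / (2 * K * K)"
    using assms(3) assms(1,2) unfolding tends_def LIMSEQ_def dist_real_def by fastforce
  have "N (s p \<ominus> s q) < e" if "p \<ge> k" "q \<ge> k" for p q
  proof -
    have "N (s p \<ominus> s q) \<le> K * (N (s p \<ominus> l) + N (l \<ominus> s q))"
      using minus_split[of "s p" l "s q"] N_add_sum[of "s p \<ominus> l" "l \<ominus> s q"] assms(1,2) by simp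
    also have "\<dots> \<le> K * (K * N (s p \<ominus> l) + K * N (s q \<ominus> l))"
    proof (intro mult_left_mono add_mono)
      have "1 * N (s p \<ominus> l) \<le> K * N (s p \<ominus> l)"
        using K_ge_1 assms(1,2) by (intro mult_right_mono) auto
      then show "N (s p \<ominus> l) \<le> K * N (s p \<ominus> l)" by simp
    qed (use N_minus_commute assms(1,2) K_pos in auto)
    also have "\<dots> = K * K * (N (s p \<ominus> l) + N (s q \<ominus> l))" by (simp add: algebra_simps)
    also have "\<dots> < K * K * (e / (2 * K * K) + e / (2 * K * K))"
      using k that K_pos by (intro mult_strict_left_mono add_strict_mono) auto
    also have "\<dots> = e" using K_pos by (simp add: field_simps)
    finally show ?thesis .
  qed
  then show "\<exists>k. \<forall>p\<ge>k. \<forall>q\<ge>k. N (s p \<ominus> s q) < e" by blast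
qed (use assms in auto)

end

section \<open>Additive maps between abelian groups\<close>

definition additive_map :: "('a, 'x) ring_scheme \<Rightarrow> ('b, 'y) ring_scheme \<Rightarrow> ('a \<Rightarrow> 'b) \<Rightarrow> bool" where
  "additive_map G H F \<longleftrightarrow> (\<forall>x\<in>carrier G. F x \<in> carrier H) \<and>
    (\<forall>x\<in>carrier G. \<forall>y\<in>carrier G. F (x \<oplus>\<^bsub>G\<^esub> y) = F x \<oplus>\<^bsub>H\<^esub> F y)"

lemma additive_closed: "additive_map G H F \<Longrightarrow> x \<in> carrier G \<Longrightarrow> F x \<in> carrier H"
  by (simp add: additive_map_def)

lemma additive_add:
  "additive_map G H F \<Longrightarrow> x \<in> carrier G \<Longrightarrow> y \<in> carrier G \<Longrightarrow> F (x \<oplus>\<^bsub>G\<^esub> y) = F x \<oplus>\<^bsub>H\<^esub> F y"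
  by (simp add: additive_map_def)

lemma additive_zero:
  assumes "abelian_group G" "abelian_group H" "additive_map G H F"
  shows "F \<zero>\<^bsub>G\<^esub> = \<zero>\<^bsub>H\<^esub>"
proof -
  interpret G: abelian_group G by fact
  interpret H: abelian_group H by fact
  have "F \<zero>\<^bsub>G\<^esub> = F \<zero>\<^bsub>G\<^esub> \<oplus>\<^bsub>H\<^esub> F \<zero>\<^bsub>G\<^esub>"
    using additive_add[OF assms(3), of "\<zero>\<^bsub>G\<^esub>" "\<zero>\<^bsub>G\<^esub>"] by simp
  then show ?thesis
    using H.add.l_cancel_one' additive_closed[OF assms(3)] by auto
qed

lemma additive_neg:
  assumes "abelian_group G" "abelian_group H" "additive_map G H F" "x \<in> carrier G"
  shows "F (\<ominus>\<^bsub>G\<^esub> x) = \<ominus>\<^bsub>H\<^esub> F x"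
proof -
  interpret G: abelian_group G by fact
  interpret H: abelian_group H by fact
  have "F (\<ominus>\<^bsub>G\<^esub> x) \<oplus>\<^bsub>H\<^esub> F x = \<zero>\<^bsub>H\<^esub>"
    using additive_add[OF assms(3), of "\<ominus>\<^bsub>G\<^esub> x" x] assms(4) additive_zero[OF assms(1-3)]
    by (simp add: G.l_neg)
  then show ?thesis
    using assms additive_closed[OF assms(3)] H.minus_equality by auto
qed

lemma additive_minus:
  assumes "abelian_group G" "abelian_group H" "additive_map G H F" "x \<in> carrier G" "y \<in> carrier G"
  shows "F (x \<ominus>\<^bsub>G\<^esub> y) = F x \<ominus>\<^bsub>H\<^esub> F y"
proof -
  interpret G: abelian_group G by fact
  show ?thesis
    using assms additive_add[OF assms(3), of x "\<ominus>\<^bsub>G\<^esub> y"] additive_neg[OF assms(1-3)]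
    by (simp add: a_minus_def)
qed

lemma additive_comp:
  "additive_map G H F \<Longrightarrow> additive_map H L F' \<Longrightarrow> additive_map G L (\<lambda>x. F' (F x))"
  by (simp add: additive_map_def)

lemma additive_finsum:
  assumes "abelian_group G" "abelian_group H" "additive_map G H F"
    and "finite I" "\<And>i. i \<in> I \<Longrightarrow> g i \<in> carrier G"
  shows "F (\<Oplus>\<^bsub>G\<^esub>i\<in>I. g i) = (\<Oplus>\<^bsub>H\<^esub>i\<in>I. F (g i))"
proof -
  interpret G: abelian_group G by fact
  interpret H: abelian_group H by fact
  show ?thesis
    using assms(4,5)
  proof (induction I)
    case empty
    then show ?case by (simp add: additive_zero[OF assms(1-3)])
  next
    case (insert i I)
    then have "g \<in> I \<rightarrow> carrier G" "g i \<in> carrier G" by auto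
    with insert additive_closed[OF assms(3)] show ?case
      by (simp add: additive_add[OF assms(3)] Pi_def)
  qed
qed

section \<open>Completion of a quasi-normed group\<close>

text \<open>The axioms determine the completion only up to a bijection of its carrier, so they apply
  to the codes of the classes in a small set; \<open>cls\<close> sends a Cauchy sequence to the code
  of its class, and the choice of the coding injection never enters.\<close>

locale qcompletion = qnorm G N m K
  for G (structure) and N :: "'a \<Rightarrow> real" and m K +
  fixes E :: "('e, 'f) ring_scheme" and cls :: "(nat \<Rightarrow> 'a) \<Rightarrow> 'e" and NE :: "'e \<Rightarrow> real"
  assumes carrier_E: "carrier E = cls ` CS"
    and cls_eq_iff: "s \<in> CS \<Longrightarrow> t \<in> CS \<Longrightarrow> cls s = cls t \<longleftrightarrow> null (\<lambda>n. s n \<ominus> t n)"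
    and cls_add: "s \<in> CS \<Longrightarrow> t \<in> CS \<Longrightarrow> cls s \<oplus>\<^bsub>E\<^esub> cls t = cls (\<lambda>n. s n \<oplus> t n)"
    and cls_zero: "\<zero>\<^bsub>E\<^esub> = cls (\<lambda>n. \<zero>)"
    and NE_cls: "s \<in> CS \<Longrightarrow> NE (cls s) = Inf {r. \<exists>t\<in>CS. cls t = cls s \<and> (\<lambda>n. N (t n)) \<longlonglongrightarrow> r}"
begin

abbreviation cst :: "'a \<Rightarrow> 'e" where "cst x \<equiv> cls (\<lambda>n. x)"

lemma cls_closed [simp]: "s \<in> CS \<Longrightarrow> cls s \<in> carrier E"
  by (simp add: carrier_E)

lemma E_cases: "y \<in> carrier E \<Longrightarrow> (\<And>s. s \<in> CS \<Longrightarrow> y = cls s \<Longrightarrow> thesis) \<Longrightarrow> thesis"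
  by (auto simp: carrier_E)

lemma E_abelian_group: "abelian_group E"
proof (rule abelian_groupI)
  fix x y z assume "x \<in> carrier E" "y \<in> carrier E" "z \<in> carrier E"
  then show "(x \<oplus>\<^bsub>E\<^esub> y) \<oplus>\<^bsub>E\<^esub> z = x \<oplus>\<^bsub>E\<^esub> (y \<oplus>\<^bsub>E\<^esub> z)"
    by (elim E_cases) (simp add: cls_add CS_add a_assoc CS_closed)
next
  fix x y assume "x \<in> carrier E" "y \<in> carrier E"
  then show "x \<oplus>\<^bsub>E\<^esub> y = y \<oplus>\<^bsub>E\<^esub> x" "x \<oplus>\<^bsub>E\<^esub> y \<in> carrier E"
    by (elim E_cases; simp add: cls_add CS_add a_comm CS_closed)+
next
  fix x assume "x \<in> carrier E"
  then obtain s where s: "s \<in> CS" "x = cls s" by (rule E_cases)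
  then show "\<zero>\<^bsub>E\<^esub> \<oplus>\<^bsub>E\<^esub> x = x" by (simp add: cls_add cls_zero CS_closed)
  show "\<exists>y\<in>carrier E. y \<oplus>\<^bsub>E\<^esub> x = \<zero>\<^bsub>E\<^esub>"
    using s by (intro bexI[where x = "cls (\<lambda>n. \<ominus> s n)"])
      (auto simp: cls_add cls_zero CS_neg CS_closed l_neg)
qed (simp add: cls_zero)

sublocale E: abelian_group E by (rule E_abelian_group)

lemma cls_neg: "s \<in> CS \<Longrightarrow> \<ominus>\<^bsub>E\<^esub> cls s = cls (\<lambda>n. \<ominus> s n)"
  by (rule E.minus_equality) (auto simp: cls_add cls_zero CS_neg CS_closed l_neg)

lemma cls_minus: "s \<in> CS \<Longrightarrow> t \<in> CS \<Longrightarrow> cls s \<ominus>\<^bsub>E\<^esub> cls t = cls (\<lambda>n. s n \<ominus> t n)"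
  by (simp add: a_minus_def cls_neg cls_add CS_neg)

lemma cst_additive: "additive_map G E cst"
  by (simp add: additive_map_def cls_add)

lemma NE_lower:
  assumes "s \<in> CS" "t \<in> CS" "cls t = cls s" "(\<lambda>n. N (t n)) \<longlonglongrightarrow> r"
  shows "NE (cls s) \<le> r"
  unfolding NE_cls[OF assms(1)]
proof (rule cInf_lower)
  show "bdd_below {r. \<exists>t\<in>CS. cls t = cls s \<and> (\<lambda>n. N (t n)) \<longlonglongrightarrow> r}"
    by (rule bdd_belowI[where m = 0])
      (auto intro!: LIMSEQ_le_const simp: CS_closed)
qed (use assms in auto)

text \<open>\<open>N (s n)\<close> need not converge, so the bound is taken along a subsequence with
  convergent norms: it has the same class, and its limit is one of the numbers whose infimum is
  \<open>NE\<close>.\<close>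

lemma NE_le:
  assumes "s \<in> CS" "\<And>n. N (s n) \<le> f n" "f \<longlonglongrightarrow> b"
  shows "NE (cls s) \<le> b"
proof -
  obtain r l where r: "strict_mono r" "(\<lambda>n. N (s (r n))) \<longlonglongrightarrow> l"
    using CS_convergent_subseq[OF assms(1)] by blast
  have "(\<lambda>n. f (r n)) \<longlonglongrightarrow> b"
    using LIMSEQ_subseq_LIMSEQ[OF assms(3) r(1)] by (simp add: o_def)
  then have "l \<le> b"
    by (rule LIMSEQ_le[OF r(2)]) (use assms(2) in auto)
  moreover have "NE (cls s) \<le> l"
    using CS_subseq[OF assms(1) r(1)] assms(1) r(2)
    by (intro NE_lower[where t = "\<lambda>n. s (r n)"]) (auto simp: cls_eq_iff)
  ultimately show ?thesis by linarith
qed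

text \<open>Subsequences with convergent norms show that the infimum is over a nonempty set.\<close>

lemma NE_approx:
  assumes "y \<in> carrier E"
  obtains S R where "\<And>k. S k \<in> CS" "\<And>k. cls (S k) = y" "\<And>k. (\<lambda>n. N (S k n)) \<longlonglongrightarrow> R k"
    "\<And>k. 0 \<le> R k" "R \<longlonglongrightarrow> NE y"
proof -
  obtain s where s: "s \<in> CS" "y = cls s" using assms by (rule E_cases)
  let ?A = "{r. \<exists>t\<in>CS. cls t = cls s \<and> (\<lambda>n. N (t n)) \<longlonglongrightarrow> r}"
  obtain r l where r: "strict_mono r" "(\<lambda>n. N (s (r n))) \<longlonglongrightarrow> l"
    using CS_convergent_subseq[OF s(1)] by blast
  have "l \<in> ?A"
    using CS_subseq[OF s(1) r(1)] s(1) r(2) cls_eq_iff by blast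
  then have ne: "?A \<noteq> {}" by blast
  have "\<exists>x\<in>?A. x < NE y + 1 / real (Suc k)" for k
    using cInf_lessD[OF ne, of "NE y + 1 / real (Suc k)"] by (simp add: s NE_cls)
  then have "\<forall>k. \<exists>t x. t \<in> CS \<and> cls t = y \<and> (\<lambda>n. N (t n)) \<longlonglongrightarrow> x \<and> x < NE y + 1 / real (Suc k)"
    using s(2) by blast
  then obtain S R where SR: "\<And>k. S k \<in> CS" "\<And>k. cls (S k) = y"
      "\<And>k. (\<lambda>n. N (S k n)) \<longlonglongrightarrow> R k" "\<And>k. R k < NE y + 1 / real (Suc k)"
    by metis
  have "R \<longlonglongrightarrow> NE y"
  proof (rule tendsto_sandwich[where f = "\<lambda>_. NE y"])
    show "(\<lambda>k. NE y + 1 / real (Suc k)) \<longlonglongrightarrow> NE y"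
      using tendsto_add[OF tendsto_const LIMSEQ_inverse_real_of_nat] by (simp add: inverse_eq_divide)
    show "\<forall>\<^sub>F k in sequentially. NE y \<le> R k"
      using NE_lower[OF s(1) SR(1) _ SR(3)] SR(2) s(2) by auto
  qed (use SR(4) in \<open>auto intro!: always_eventually less_imp_le\<close>)
  moreover have "0 \<le> R k" for k
    using SR(1,3) by (intro LIMSEQ_le_const[OF SR(3)]) (auto simp: CS_closed)
  ultimately show ?thesis using that SR by blast
qed

lemma NE_nonneg:
  assumes "y \<in> carrier E"
  shows "0 \<le> NE y"
proof -
  obtain S R where "\<And>k. 0 \<le> R k" "R \<longlonglongrightarrow> NE y" by (rule NE_approx[OF assms]) blast
  then show ?thesis by (intro LIMSEQ_le_const) auto
qed

lemma NE_cst_le: "x \<in> carrier G \<Longrightarrow> NE (cst x) \<le> N x"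
  by (rule NE_le[where f = "\<lambda>_. N x"]) auto

text \<open>Comparison of \<open>x\<close> with representatives \<open>S k\<close> of its class: in
  \<open>N x \<le> m (N (S k n)) (N (x \<ominus> S k n))\<close> the second argument tends to 0 as
  \<open>n\<close> grows, and then \<open>k\<close> tends to infinity. The norm can drop in the
  completion, but no further than \<open>m _ 0\<close> allows.\<close>

lemma N_le_cst:
  assumes x: "x \<in> carrier G"
  shows "N x \<le> m (NE (cst x)) 0"
proof -
  obtain S R where S: "\<And>k. S k \<in> CS" "\<And>k. cls (S k) = cst x" "\<And>k. (\<lambda>n. N (S k n)) \<longlonglongrightarrow> R k"
    "\<And>k. 0 \<le> R k" "R \<longlonglongrightarrow> NE (cst x)"
    using NE_approx[of "cst x"] x by auto
  have "N x \<le> m (R k) 0" for k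
  proof (rule LIMSEQ_le_const[OF m_lim[OF _ _ S(3)]])
    have c: "S k n \<in> carrier G" for n using CS_closed S(1) .
    show "\<exists>M. \<forall>n\<ge>M. N x \<le> m (N (S k n)) (N (x \<ominus> S k n))"
      using N_le_minus c x by blast
    show "(\<lambda>n. N (x \<ominus> S k n)) \<longlonglongrightarrow> 0"
      using cls_eq_iff[of "\<lambda>n. x" "S k"] S(1,2) x by (simp add: null_def)
  qed (use S CS_closed x in auto)
  then show ?thesis
    by (intro LIMSEQ_le_const[OF m_lim[OF S(4) _ S(5) tendsto_const]]) auto
qed

text \<open>The completion keeps the same \<open>m\<close> and \<open>K\<close>. For fixed
  \<open>k\<close> the sum of two representatives has norm at most \<open>m (R k) (R' k)\<close> in
  the limit, and letting \<open>k\<close> grow uses the continuity of \<open>m\<close> a second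
  time.\<close>

lemma E_qnorm: "qnorm E NE m K"
proof (rule qnorm.intro[OF E_abelian_group], unfold_locales)
  show "0 \<le> NE x" if "x \<in> carrier E" for x using NE_nonneg that .
  show "NE \<zero>\<^bsub>E\<^esub> = 0"
    using NE_cst_le[of \<zero>] NE_nonneg[of "\<zero>\<^bsub>E\<^esub>"] by (simp add: cls_zero)
  show "NE (x \<oplus>\<^bsub>E\<^esub> y) \<le> m (NE x) (NE y)" if "x \<in> carrier E" "y \<in> carrier E" for x y
  proof -
    obtain S R where S: "\<And>k. S k \<in> CS" "\<And>k. cls (S k) = x" "\<And>k. (\<lambda>n. N (S k n)) \<longlonglongrightarrow> R k"
      "\<And>k. 0 \<le> R k" "R \<longlonglongrightarrow> NE x"
      by (rule NE_approx[OF \<open>x \<in> carrier E\<close>]) blast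
    obtain S' R' where S': "\<And>k. S' k \<in> CS" "\<And>k. cls (S' k) = y" "\<And>k. (\<lambda>n. N (S' k n)) \<longlonglongrightarrow> R' k"
      "\<And>k. 0 \<le> R' k" "R' \<longlonglongrightarrow> NE y"
      by (rule NE_approx[OF \<open>y \<in> carrier E\<close>]) blast
    have "NE (x \<oplus>\<^bsub>E\<^esub> y) \<le> m (R k) (R' k)" for k
    proof -
      have "NE (cls (\<lambda>n. S k n \<oplus> S' k n)) \<le> m (R k) (R' k)"
        by (rule NE_le[OF _ N_add m_lim[OF _ _ S(3) S'(3)]])
          (use S(1) S'(1) CS_add CS_closed in auto)
      then show ?thesis using cls_add[OF S(1) S'(1), of k k] by (simp add: S(2) S'(2))
    qed
    then show ?thesis
      by (intro LIMSEQ_le_const[OF m_lim[OF S(4) S'(4) S(5) S'(5)]]) auto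
  qed
  show "NE (\<ominus>\<^bsub>E\<^esub> x) \<le> K * NE x" if "x \<in> carrier E" for x
  proof -
    obtain S R where S: "\<And>k. S k \<in> CS" "\<And>k. cls (S k) = x" "\<And>k. (\<lambda>n. N (S k n)) \<longlonglongrightarrow> R k"
      "\<And>k. 0 \<le> R k" "R \<longlonglongrightarrow> NE x"
      by (rule NE_approx[OF \<open>x \<in> carrier E\<close>]) blast
    have "NE (\<ominus>\<^bsub>E\<^esub> x) \<le> K * R k" for k
    proof -
      have "NE (cls (\<lambda>n. \<ominus> S k n)) \<le> K * R k"
        by (rule NE_le[OF _ N_neg tendsto_mult_left[OF S(3)]])
          (use S(1) CS_neg CS_closed in auto)
      then show ?thesis using cls_neg[OF S(1), of k] by (simp add: S(2))
    qed
    then show ?thesis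
      by (intro LIMSEQ_le_const[OF tendsto_mult_left[OF S(5)]]) auto
  qed
qed (use K_ge_1 m_le m_mono m_lim in auto)

sublocale E: qnorm E NE m K by (rule E_qnorm)

lemma cst_le: "x \<in> carrier G \<Longrightarrow> N x \<le> K * NE (cst x)"
  using N_le_cst m_le[of "NE (cst x)" 0] NE_nonneg[of "cst x"] by fastforce

text \<open>An infimum 0 need not be attained, so no representative is known to be null. Compared
  with \<open>S k\<close>, the given \<open>s\<close> satisfies
  \<open>N (s n) \<le> K * N (S k n) + K * N (s n \<ominus> S k n)\<close>, and the limit
  \<open>K * R k\<close> of the right hand side is small for suitable \<open>k\<close>.\<close>

lemma NE_zero_imp:
  assumes "y \<in> carrier E" "NE y = 0"
  shows "y = \<zero>\<^bsub>E\<^esub>"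
proof -
  obtain s where s: "s \<in> CS" "y = cls s" using assms(1) by (rule E_cases)
  obtain S R where S: "\<And>k. S k \<in> CS" "\<And>k. cls (S k) = y" "\<And>k. (\<lambda>n. N (S k n)) \<longlonglongrightarrow> R k"
    "\<And>k. 0 \<le> R k" "R \<longlonglongrightarrow> NE y"
    by (rule NE_approx[OF \<open>y \<in> carrier E\<close>]) blast
  have "\<exists>n0. \<forall>n\<ge>n0. N (s n) < e" if e: "e > 0" for e
  proof -
    have "(\<lambda>k. K * R k) \<longlonglongrightarrow> 0" using S(5) assms(2) by (auto intro!: tendsto_eq_intros)
    then obtain k where k: "K * R k < e / 2"
      using order_tendstoD(2)[of _ 0 sequentially "e / 2"] e
      by (metis (no_types, lifting) eventually_sequentially half_gt_zero le_refl)
    have "null (\<lambda>n. s n \<ominus> S k n)" using cls_eq_iff[OF s(1) S(1)] S(2) s(2) by simp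
    then have "(\<lambda>n. K * N (S k n) + K * N (s n \<ominus> S k n)) \<longlonglongrightarrow> K * R k + K * 0"
      unfolding null_def by (intro tendsto_intros S)
    then have "\<forall>\<^sub>F n in sequentially. K * N (S k n) + K * N (s n \<ominus> S k n) < e"
      by (rule order_tendstoD(2)) (use k e in auto)
    moreover have "N (s n) \<le> K * N (S k n) + K * N (s n \<ominus> S k n)" for n
      using N_add_sum[of "S k n" "s n \<ominus> S k n"] CS_closed[OF S(1)] CS_closed[OF s(1)]
      by (simp add: distrib_left)
    ultimately have "\<forall>\<^sub>F n in sequentially. N (s n) < e"
      by (elim eventually_mono) (meson le_less_trans)
    then show ?thesis by (simp add: eventually_sequentially)
  qed
  then have "null s"
    unfolding null_def LIMSEQ_def dist_real_def using CS_closed[OF s(1)] by simp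
  then show ?thesis
    using cls_eq_iff[OF s(1), of "\<lambda>n. \<zero>"] CS_closed[OF s(1)] s by (simp add: cls_zero)
qed

lemma cls_tends:
  assumes "s \<in> CS"
  shows "E.tends (\<lambda>n. cst (s n)) (cls s)"
  unfolding E.tends_def LIMSEQ_def dist_real_def
proof (intro allI impI)
  fix e :: real assume "0 < e"
  then obtain k where k: "\<forall>p\<ge>k. \<forall>q\<ge>k. N (s p \<ominus> s q) < e / 2"
    using CS_D[OF assms, of "e / 2"] by auto
  have "\<bar>NE (cst (s n) \<ominus>\<^bsub>E\<^esub> cls s) - 0\<bar> < e" if "n \<ge> k" for n
  proof -
    have c: "s n \<in> carrier G" for n using CS_closed[OF assms] .
    \<comment> \<open>Dropping the first \<open>k\<close> terms keeps the class and makes the bound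
      \<open>e / 2\<close> hold for every term, as \<open>NE_le\<close> requires.\<close>
    have t: "(\<lambda>j. s n \<ominus> s (j + k)) \<in> CS" "cls (\<lambda>j. s n \<ominus> s (j + k)) = cls (\<lambda>j. s n \<ominus> s j)"
    proof -
      have d: "(\<lambda>j. s n \<ominus> s j) \<in> CS" using assms c by (intro CS_minus) auto
      have sm: "strict_mono (\<lambda>j. j + k)" by (simp add: strict_mono_def)
      show "(\<lambda>j. s n \<ominus> s (j + k)) \<in> CS" "cls (\<lambda>j. s n \<ominus> s (j + k)) = cls (\<lambda>j. s n \<ominus> s j)"
        using CS_subseq[OF d sm] d by (simp_all add: cls_eq_iff)
    qed
    have "NE (cls (\<lambda>j. s n \<ominus> s (j + k))) \<le> e / 2"
      by (rule NE_le[OF t(1), where f = "\<lambda>_. e / 2"]) (use k that in \<open>auto simp: less_imp_le\<close>)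
    then have "NE (cst (s n) \<ominus>\<^bsub>E\<^esub> cls s) \<le> e / 2"
      using t(2) assms c by (simp add: cls_minus)
    then show ?thesis using \<open>0 < e\<close> assms c by simp
  qed
  then show "\<exists>no. \<forall>n\<ge>no. \<bar>NE (cst (s n) \<ominus>\<^bsub>E\<^esub> cls s) - 0\<bar> < e" by blast
qed

text \<open>Each \<open>y n\<close> is replaced by a constant class \<open>cst (x n)\<close> at
  distance below \<open>1 / (n + 1)\<close>. As \<open>N\<close> is at most \<open>K\<close> times
  the norm of the constant class, \<open>x\<close> is a Cauchy sequence in \<open>G\<close>, and its
  own class is the limit.\<close>

lemma E_complete: "complete_for E NE"
  unfolding complete_for_def
proof
  fix y assume y: "y \<in> E.CS"
  have yc: "y n \<in> carrier E" for n using E.CS_closed[OF y] .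
  have "\<exists>x\<in>carrier G. NE (cst x \<ominus>\<^bsub>E\<^esub> y n) < 1 / real (Suc n)" for n
  proof -
    obtain s where s: "s \<in> CS" "y n = cls s" using yc by (rule E_cases)
    then have "\<forall>\<^sub>F j in sequentially. NE (cst (s j) \<ominus>\<^bsub>E\<^esub> y n) < 1 / real (Suc n)"
      using order_tendstoD(2)[OF cls_tends[unfolded E.tends_def], of s "1 / real (Suc n)"] by simp
    then obtain j where "NE (cst (s j) \<ominus>\<^bsub>E\<^esub> y n) < 1 / real (Suc n)"
      by (auto simp: eventually_sequentially)
    then show ?thesis using CS_closed[OF s(1)] by blast
  qed
  then obtain x where x: "\<And>n. x n \<in> carrier G" "\<And>n. NE (cst (x n) \<ominus>\<^bsub>E\<^esub> y n) < 1 / real (Suc n)"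
    by metis
  have d: "E.null (\<lambda>n. cst (x n) \<ominus>\<^bsub>E\<^esub> y n)"
    unfolding E.null_def
    by (rule tendsto_0_squeeze[OF LIMSEQ_inverse_real_of_nat])
      (use x yc in \<open>auto simp: inverse_eq_divide intro: less_imp_le\<close>)
  have "E.tends (\<lambda>n. cst (x n) \<ominus>\<^bsub>E\<^esub> y n) \<zero>\<^bsub>E\<^esub>"
    using d x yc by (simp add: E.tends_def E.null_def)
  then have "(\<lambda>n. cst (x n) \<ominus>\<^bsub>E\<^esub> y n) \<in> E.CS"
    using x yc by (intro E.tends_imp_CS) auto
  from E.CS_add[OF y this] have cx: "(\<lambda>n. cst (x n)) \<in> E.CS"
    using x yc by simp
  have "x \<in> CS"
  proof (rule CS_I)
    fix e :: real assume "0 < e"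
    then have "0 < e / K" using K_pos by simp
    then obtain k where k: "\<forall>p\<ge>k. \<forall>q\<ge>k. NE (cst (x p) \<ominus>\<^bsub>E\<^esub> cst (x q)) < e / K"
      using E.CS_D[OF cx] by blast
    have "N (x p \<ominus> x q) < e" if "p \<ge> k" "q \<ge> k" for p q
    proof -
      have "N (x p \<ominus> x q) \<le> K * NE (cst (x p) \<ominus>\<^bsub>E\<^esub> cst (x q))"
        using cst_le[of "x p \<ominus> x q"] x by (simp add: cls_minus)
      also have "\<dots> < K * (e / K)" using k that K_pos by (intro mult_strict_left_mono) auto
      finally show ?thesis using K_pos by simp
    qed
    then show "\<exists>k. \<forall>p\<ge>k. \<forall>q\<ge>k. N (x p \<ominus> x q) < e" by blast
  qed (use x in auto)
  then have "E.null (\<lambda>n. cst (x n) \<ominus>\<^bsub>E\<^esub> cls x)"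
    using cls_tends by (simp add: E.tends_def E.null_def)
  moreover have "E.null (\<lambda>n. y n \<ominus>\<^bsub>E\<^esub> cst (x n))"
    using E.null_commute[OF _ _ d] x yc by auto
  ultimately have "E.null (\<lambda>n. y n \<ominus>\<^bsub>E\<^esub> cls x)"
    using E.null_trans[of y "\<lambda>n. cst (x n)" "\<lambda>n. cls x"] x yc \<open>x \<in> CS\<close> by auto
  then show "\<exists>l\<in>carrier E. (\<lambda>n. NE (y n \<ominus>\<^bsub>E\<^esub> l)) \<longlonglongrightarrow> 0"
    using \<open>x \<in> CS\<close> by (auto simp: E.null_def)
qed

end

section \<open>Complete separated groups and the extension of bounded additive maps\<close>

locale banach_group = qnorm +
  assumes complete: "complete_for G N"
    and separated: "x \<in> carrier G \<Longrightarrow> N x = 0 \<Longrightarrow> x = \<zero>"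
begin

lemma tends_eq:
  assumes "\<And>n. s n \<in> carrier G" "l \<in> carrier G" "l' \<in> carrier G" "tends s l" "tends s l'"
  shows "l = l'"
proof -
  have "l \<ominus> l' = \<zero>" using tends_unique[OF assms] separated assms by simp
  then show ?thesis
    using add_minus_cancel[of l l'] assms(2,3) by simp
qed

lemma CS_tends: "s \<in> CS \<Longrightarrow> \<exists>l\<in>carrier G. tends s l"
  using complete by (auto simp: complete_for_def tends_def)

end

sublocale qcompletion \<subseteq> E: banach_group E NE m K
  by unfold_locales (use E_complete NE_zero_imp in auto)

context qcompletion
begin

lemma bounded_additive_tends:
  assumes "qnorm H N' m' K'" "additive_map E H F" "\<And>y. y \<in> carrier E \<Longrightarrow> N' (F y) \<le> b * NE y" "s \<in> CS"
  shows "(\<lambda>n. N' (F (cst (s n)) \<ominus>\<^bsub>H\<^esub> F (cls s))) \<longlonglongrightarrow> 0"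
proof (rule tendsto_0_squeeze)
  interpret H: qnorm H N' m' K' by fact
  have eq: "F (cst (s n)) \<ominus>\<^bsub>H\<^esub> F (cls s) = F (cst (s n) \<ominus>\<^bsub>E\<^esub> cls s)" for n
    using additive_minus[OF E_abelian_group H.abelian_group_axioms assms(2)] assms(4) CS_closed by simp
  show "(\<lambda>n. b * NE (cst (s n) \<ominus>\<^bsub>E\<^esub> cls s)) \<longlonglongrightarrow> 0"
    using cls_tends[OF assms(4)] unfolding E.tends_def by (auto intro!: tendsto_eq_intros)
  show "N' (F (cst (s n)) \<ominus>\<^bsub>H\<^esub> F (cls s)) \<le> b * NE (cst (s n) \<ominus>\<^bsub>E\<^esub> cls s)" for n
    unfolding eq using assms(3,4) CS_closed by auto
  show "0 \<le> N' (F (cst (s n)) \<ominus>\<^bsub>H\<^esub> F (cls s))" for n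
    unfolding eq using additive_closed[OF assms(2)] assms(4) CS_closed by auto
qed

text \<open>The constant classes are dense and limits in \<open>H\<close> are unique. The bounds
  \<open>b\<close> and \<open>b'\<close> serve only continuity, so they may differ.\<close>

lemma bounded_additive_eqI:
  assumes "banach_group H N' m' K'"
    and "additive_map E H F" "\<And>y. y \<in> carrier E \<Longrightarrow> N' (F y) \<le> b * NE y"
    and "additive_map E H F'" "\<And>y. y \<in> carrier E \<Longrightarrow> N' (F' y) \<le> b' * NE y"
    and "\<And>x. x \<in> carrier G \<Longrightarrow> F (cst x) = F' (cst x)" "y \<in> carrier E"
  shows "F y = F' y"
proof -
  interpret H: banach_group H N' m' K' by fact
  obtain s where s: "s \<in> CS" "y = cls s" using assms(7) by (rule E_cases)
  have "H.tends (\<lambda>n. F (cst (s n))) (F y)" "H.tends (\<lambda>n. F' (cst (s n))) (F' y)"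
    using bounded_additive_tends[OF H.qnorm_axioms assms(2,3) s(1)]
      bounded_additive_tends[OF H.qnorm_axioms assms(4,5) s(1)]
    by (simp_all add: H.tends_def s(2))
  moreover have "F (cst (s n)) = F' (cst (s n))" for n
    using assms(6) CS_closed[OF s(1)] by blast
  ultimately show ?thesis
    using additive_closed[OF assms(2)] additive_closed[OF assms(4)] s CS_closed
    by (intro H.tends_eq[of "\<lambda>n. F (cst (s n))"]) auto
qed

text \<open>\<open>F (cls s)\<close> is the limit of \<open>\<Phi> (s n)\<close>. Since
  \<open>N'\<close> need not be continuous, the bound \<open>b * NE y\<close> does not pass to the
  limit unchanged: \<open>F y\<close> is compared with \<open>\<Phi> (S k n)\<close>, and the
  difference, which tends to 0, leaves \<open>m' (b * NE y) 0\<close>.\<close>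

lemma extension_exists:
  assumes "banach_group H N' m' K'" "additive_map G H \<Phi>" "0 \<le> b"
    and bound: "\<And>x. x \<in> carrier G \<Longrightarrow> N' (\<Phi> x) \<le> b * N x"
  shows "\<exists>F. additive_map E H F \<and> (\<forall>x\<in>carrier G. F (cst x) = \<Phi> x) \<and>
    (\<forall>y\<in>carrier E. N' (F y) \<le> m' (b * NE y) 0)"
proof -
  interpret H: banach_group H N' m' K' by fact
  note Hag = H.abelian_group_axioms
  have Pc: "\<Phi> x \<in> carrier H" if "x \<in> carrier G" for x using additive_closed[OF assms(2) that] .
  have PCS: "(\<lambda>n. \<Phi> (s n)) \<in> H.CS" if s: "s \<in> CS" for s
  proof (rule H.CS_I)
    fix e :: real assume "0 < e"
    \<comment> \<open>\<open>b\<close> may be 0, hence the divisor \<open>b + 1\<close>.\<close>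
    then have "0 < e / (b + 1)" using assms(3) by simp
    then obtain k where k: "\<forall>p\<ge>k. \<forall>q\<ge>k. N (s p \<ominus> s q) < e / (b + 1)"
      using CS_D[OF s] by blast
    have "N' (\<Phi> (s p) \<ominus>\<^bsub>H\<^esub> \<Phi> (s q)) < e" if "p \<ge> k" "q \<ge> k" for p q
    proof -
      have c: "s p \<in> carrier G" "s q \<in> carrier G" using CS_closed[OF s] by auto
      have "N' (\<Phi> (s p) \<ominus>\<^bsub>H\<^esub> \<Phi> (s q)) = N' (\<Phi> (s p \<ominus> s q))"
        using additive_minus[OF abelian_group_axioms Hag assms(2) c] by simp
      also have "\<dots> \<le> b * N (s p \<ominus> s q)" using bound c by simp
      also have "\<dots> \<le> (b + 1) * N (s p \<ominus> s q)" using c by (intro mult_right_mono) auto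
      also have "\<dots> < (b + 1) * (e / (b + 1))"
        using k that assms(3) by (intro mult_strict_left_mono) auto
      finally show ?thesis using assms(3) by simp
    qed
    then show "\<exists>k. \<forall>p\<ge>k. \<forall>q\<ge>k. N' (\<Phi> (s p) \<ominus>\<^bsub>H\<^esub> \<Phi> (s q)) < e" by blast
  qed (use Pc CS_closed[OF s] in auto)
  have "\<exists>z\<in>carrier H. \<forall>s\<in>CS. cls s = y \<longrightarrow> H.tends (\<lambda>n. \<Phi> (s n)) z"
    if y: "y \<in> carrier E" for y
  proof -
    obtain s where s: "s \<in> CS" "y = cls s" using y by (rule E_cases)
    obtain z where z: "z \<in> carrier H" "H.tends (\<lambda>n. \<Phi> (s n)) z"
      using H.CS_tends[OF PCS[OF s(1)]] by blast
    have "H.tends (\<lambda>n. \<Phi> (t n)) z" if t: "t \<in> CS" "cls t = y" for t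
    proof -
      have c: "s n \<in> carrier G" "t n \<in> carrier G" for n using CS_closed s t by auto
      have "null (\<lambda>n. t n \<ominus> s n)" using cls_eq_iff s t by auto
      then have "(\<lambda>n. b * N (t n \<ominus> s n)) \<longlonglongrightarrow> 0"
        unfolding null_def by (auto intro!: tendsto_eq_intros)
      then have "(\<lambda>n. N' (\<Phi> (t n \<ominus> s n))) \<longlonglongrightarrow> 0"
        by (rule tendsto_0_squeeze) (use c Pc bound in auto)
      then have "H.null (\<lambda>n. \<Phi> (t n) \<ominus>\<^bsub>H\<^esub> \<Phi> (s n))"
        using additive_minus[OF abelian_group_axioms Hag assms(2) c(2) c(1)] by (simp add: H.null_def)
      with z(2) have "H.null (\<lambda>n. \<Phi> (t n) \<ominus>\<^bsub>H\<^esub> z)"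
        using H.null_trans[of "\<lambda>n. \<Phi> (t n)" "\<lambda>n. \<Phi> (s n)" "\<lambda>n. z"] c Pc z(1)
        by (simp add: H.tends_def H.null_def)
      then show ?thesis by (simp add: H.tends_def H.null_def)
    qed
    then show ?thesis using z(1) by blast
  qed
  then obtain F where F: "\<And>y. y \<in> carrier E \<Longrightarrow> F y \<in> carrier H"
      "\<And>s. s \<in> CS \<Longrightarrow> H.tends (\<lambda>n. \<Phi> (s n)) (F (cls s))"
    by (metis cls_closed)
  have eqI: "F (cls s) = z" if "s \<in> CS" "z \<in> carrier H" "H.tends (\<lambda>n. \<Phi> (s n)) z" for s z
    using that F Pc CS_closed by (intro H.tends_eq[of "\<lambda>n. \<Phi> (s n)"]) auto
  have "additive_map E H F"
    unfolding additive_map_def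
  proof (intro conjI ballI)
    fix x y assume "x \<in> carrier E" "y \<in> carrier E"
    then obtain s t where st: "s \<in> CS" "x = cls s" "t \<in> CS" "y = cls t" by (metis E_cases)
    have c: "s n \<in> carrier G" "t n \<in> carrier G" for n using CS_closed st by auto
    have "H.tends (\<lambda>n. \<Phi> (s n \<oplus> t n)) (F x \<oplus>\<^bsub>H\<^esub> F y)"
      using H.null_add[OF _ _ F(2)[OF st(1), unfolded H.tends_def, folded H.null_def]
          F(2)[OF st(3), unfolded H.tends_def, folded H.null_def]]
        c st Pc F(1) additive_add[OF assms(2)]
      by (simp add: H.tends_def H.null_def H.add_minus_add)
    then have "F (cls (\<lambda>n. s n \<oplus> t n)) = F x \<oplus>\<^bsub>H\<^esub> F y"
      using st F(1) CS_add by (intro eqI) auto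
    then show "F (x \<oplus>\<^bsub>E\<^esub> y) = F x \<oplus>\<^bsub>H\<^esub> F y" using st by (simp add: cls_add)
  qed (use F in auto)
  moreover have "F (cst x) = \<Phi> x" if "x \<in> carrier G" for x
    using that Pc by (intro eqI) (auto simp: H.tends_def)
  moreover have "N' (F y) \<le> m' (b * NE y) 0" if y: "y \<in> carrier E" for y
  proof -
    obtain S R where S: "\<And>k. S k \<in> CS" "\<And>k. cls (S k) = y" "\<And>k. (\<lambda>n. N (S k n)) \<longlonglongrightarrow> R k"
      "\<And>k. 0 \<le> R k" "R \<longlonglongrightarrow> NE y"
      by (rule NE_approx[OF y]) blast
    have "N' (F y) \<le> m' (b * R k) 0" for k
    proof (rule LIMSEQ_le_const[OF H.m_lim[OF _ _ tendsto_mult_left[OF S(3)]]])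
      have c: "S k n \<in> carrier G" for n using CS_closed S(1) .
      have "N' (F y) \<le> m' (b * N (S k n)) (N' (F y \<ominus>\<^bsub>H\<^esub> \<Phi> (S k n)))" for n
        using H.N_le_minus[of "F y" "\<Phi> (S k n)"] c Pc F(1)[OF y] bound[OF c]
          H.m_mono[of "N' (\<Phi> (S k n))" "b * N (S k n)" "N' (F y \<ominus>\<^bsub>H\<^esub> \<Phi> (S k n))" "N' (F y \<ominus>\<^bsub>H\<^esub> \<Phi> (S k n))"]
        by fastforce
      then show "\<exists>M. \<forall>n\<ge>M. N' (F y) \<le> m' (b * N (S k n)) (N' (F y \<ominus>\<^bsub>H\<^esub> \<Phi> (S k n)))"
        by blast
      show "(\<lambda>n. N' (F y \<ominus>\<^bsub>H\<^esub> \<Phi> (S k n))) \<longlonglongrightarrow> 0"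
        using H.null_commute[of "\<lambda>n. \<Phi> (S k n)" "\<lambda>n. F y"] c Pc F(1)[OF y] F(2)[OF S(1), of k]
        by (simp add: H.tends_def H.null_def S(2))
    qed (use S CS_closed Pc F(1)[OF y] assms(3) in auto)
    then show ?thesis
      using S(4,5) assms(3)
      by (intro LIMSEQ_le_const[OF H.m_lim[OF _ _ tendsto_mult_left[OF S(5)] tendsto_const]]) auto
  qed
  ultimately show ?thesis by blast
qed

end

section \<open>Moduli\<close>

text \<open>The factor in \<open>modulus_norm M r r = growth M * r\<close>: how much a sum of two
  elements of equal norm can grow. A sum of \<open>2^k\<close> generators of norm 1 grows by the
  \<open>k\<close>-th power of it, which is how the monad detects the modulus.\<close>

fun growth :: "modulus \<Rightarrow> real" where
  "growth (Exponent p) = (if p = \<infinity> then 1 else 2 powr (1 / enn2real p))"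
| "growth (Constants C D) = C"

text \<open>Bounds \<open>modulus_norm M r 0\<close> and \<open>modulus_norm M 0 r\<close> by a
  multiple of \<open>r\<close>. The maximum with 1 is there because a Lipschitz constant below 1 can
  occur, over the zero ring.\<close>

fun neg_const :: "modulus \<Rightarrow> real" where
  "neg_const (Exponent p) = 1"
| "neg_const (Constants C D) = max 1 C"

abbreviation quasi_const :: "modulus \<Rightarrow> real" where
  "quasi_const M \<equiv> max 1 (growth M)"

lemma is_modulus_cases:
  assumes "is_modulus \<Sigma> M"
  obtains (infinite) "\<Sigma> = Short" "M = Exponent top_class.top"
  | (finite) p where "\<Sigma> = Short" "M = Exponent (ennreal p)" "0 < p"
  | (constants) C D where "\<Sigma> = Lipschitz" "M = Constants C D" "0 < C" "0 < D"
proof (cases M)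
  case (Exponent p)
  with assms have "\<Sigma> = Short" "0 < p" by (cases \<Sigma>; simp)+
  then show thesis using infinite finite Exponent by (cases p) (auto simp: top_unique)
next
  case (Constants C D)
  with assms constants show thesis by (cases \<Sigma>) auto
qed

lemma lp_norm_infinity_le_iff:
  "finite I \<Longrightarrow> lp_norm top_class.top I v \<le> b \<longleftrightarrow> 0 \<le> b \<and> (\<forall>i\<in>I. v i \<le> b)"
  by (simp add: lp_norm_def)

lemma lp_norm_ennreal:
  "0 < p \<Longrightarrow> lp_norm (ennreal p) I v = (\<Sum>i\<in>I. v i powr p) powr (1 / p)"
  by (simp add: lp_norm_def)

lemma modulus_norm_infinity:
  "0 \<le> r \<Longrightarrow> 0 \<le> s \<Longrightarrow> modulus_norm (Exponent top_class.top) r s = max r s"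
  by (simp add: lp_norm_def UNIV_bool)

lemma modulus_norm_ennreal:
  "0 < p \<Longrightarrow> modulus_norm (Exponent (ennreal p)) r s = (r powr p + s powr p) powr (1 / p)"
  by (simp add: lp_norm_ennreal UNIV_bool add.commute)

lemma modulus_norm_ennreal_powr:
  "0 < p \<Longrightarrow> modulus_norm (Exponent (ennreal p)) r s powr p = r powr p + s powr p"
  by (simp add: modulus_norm_ennreal powr_powr add_nonneg_nonneg del: modulus_norm.simps)

lemma lp_norm_empty [simp]: "lp_norm p {} v = 0"
  by (simp add: lp_norm_def)

lemma lp_norm_nonneg: "finite I \<Longrightarrow> 0 \<le> lp_norm p I v"
  by (simp add: lp_norm_def)

text \<open>Turns an \<open>lp_norm\<close> into iterated norms of two terms, so that the universal
  property of the free norm and the effect of the flow have to be checked for two terms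
  only.\<close>

lemma lp_norm_insert:
  assumes "0 < p" "finite I" "i \<notin> I" "\<And>j. j \<in> insert i I \<Longrightarrow> 0 \<le> v j"
  shows "lp_norm p (insert i I) v = modulus_norm (Exponent p) (v i) (lp_norm p I v)"
proof (cases p)
  case top
  have "modulus_norm (Exponent top_class.top) (v i) (lp_norm top_class.top I v) = max (v i) (lp_norm top_class.top I v)"
    using assms lp_norm_nonneg by (intro modulus_norm_infinity) auto
  also have "\<dots> = lp_norm top_class.top (insert i I) v"
    using assms by (simp add: lp_norm_def insert_commute[of 0])
  finally show ?thesis by (simp add: top)
next
  case (real q)
  then have "0 < q" using assms(1) by auto
  then show ?thesis
    using assms real
    by (simp add: modulus_norm_ennreal lp_norm_ennreal powr_powr sum_nonneg del: modulus_norm.simps)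
qed

lemma modulus_norm_mono:
  assumes "is_modulus \<Sigma> M" "0 \<le> r" "r \<le> r'" "0 \<le> s" "s \<le> s'"
  shows "modulus_norm M r s \<le> modulus_norm M r' s'"
  using assms(1)
proof (cases rule: is_modulus_cases)
  case infinite
  then show ?thesis
    using assms modulus_norm_infinity[of r s] modulus_norm_infinity[of r' s'] by auto
next
  case (finite p)
  then show ?thesis
    using assms by (simp add: modulus_norm_ennreal powr_mono2 add_mono del: modulus_norm.simps)
next
  case (constants C D)
  then show ?thesis using assms by (auto intro!: mult_left_mono)
qed

lemma modulus_norm_diag:
  assumes "is_modulus \<Sigma> M" "0 \<le> r"
  shows "modulus_norm M r r = growth M * r"
  using assms(1)
proof (cases rule: is_modulus_cases)
  case infinite
  then show ?thesis using assms modulus_norm_infinity[of r r] by simp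
next
  case (finite p)
  have "(2 * r powr p) powr (1 / p) = 2 powr (1 / p) * r"
    using finite assms by (simp add: powr_mult powr_powr)
  then show ?thesis using finite by (simp add: modulus_norm_ennreal del: modulus_norm.simps)
qed simp

lemma modulus_norm_le:
  assumes "is_modulus \<Sigma> M" "0 \<le> r" "0 \<le> s"
  shows "modulus_norm M r s \<le> quasi_const M * max r s"
proof -
  have "modulus_norm M r s \<le> modulus_norm M (max r s) (max r s)"
    using assms by (intro modulus_norm_mono) auto
  also have "\<dots> = growth M * max r s" using assms by (intro modulus_norm_diag) auto
  also have "\<dots> \<le> quasi_const M * max r s" using assms by (intro mult_right_mono) auto
  finally show ?thesis .
qed

lemma modulus_norm_zero_right:
  "is_modulus \<Sigma> M \<Longrightarrow> 0 \<le> r \<Longrightarrow> modulus_norm M r 0 \<le> neg_const M * r"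
  by (erule is_modulus_cases)
    (use modulus_norm_infinity[of r 0] in
      \<open>auto simp: modulus_norm_ennreal powr_powr mult_right_mono simp del: modulus_norm.simps(1)\<close>)

lemma modulus_norm_zero_left:
  "is_modulus \<Sigma> M \<Longrightarrow> 0 \<le> r \<Longrightarrow> modulus_norm M 0 r \<le> neg_const M * r"
  by (erule is_modulus_cases)
    (use modulus_norm_infinity[of 0 r] in
      \<open>auto simp: modulus_norm_ennreal powr_powr mult_right_mono simp del: modulus_norm.simps(1)\<close>)

lemma modulus_norm_scale:
  assumes "is_modulus \<Sigma> M" "0 \<le> r" "0 \<le> s" "0 \<le> c"
  shows "modulus_norm M (c * r) (c * s) = c * modulus_norm M r s"
  using assms(1)
proof (cases rule: is_modulus_cases)
  case infinite
  then show ?thesis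
    using assms modulus_norm_infinity[of r s] modulus_norm_infinity[of "c * r" "c * s"]
    by (simp add: max_mult_distrib_left)
next
  case (finite p)
  have "((c * r) powr p + (c * s) powr p) powr (1 / p) = (c powr p * (r powr p + s powr p)) powr (1 / p)"
    using assms by (simp add: powr_mult distrib_left)
  also have "\<dots> = c * (r powr p + s powr p) powr (1 / p)"
    using finite assms by (simp add: powr_mult powr_powr)
  finally show ?thesis using finite by (simp add: modulus_norm_ennreal del: modulus_norm.simps)
next
  case (constants C D)
  then show ?thesis using assms by (simp add: max_mult_distrib_left mult.left_commute)
qed

lemma modulus_norm_tendsto:
  fixes f g :: "nat \<Rightarrow> real"
  assumes M: "is_modulus \<Sigma> M" and pos: "\<And>n. 0 \<le> f n" "\<And>n. 0 \<le> g n"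
    and lim: "f \<longlonglongrightarrow> r" "g \<longlonglongrightarrow> s"
  shows "(\<lambda>n. modulus_norm M (f n) (g n)) \<longlonglongrightarrow> modulus_norm M r s"
proof -
  have rs: "0 \<le> r" "0 \<le> s"
    using LIMSEQ_le_const[OF lim(1), of 0] LIMSEQ_le_const[OF lim(2), of 0] pos by auto
  show ?thesis
    using M
  proof (cases rule: is_modulus_cases)
    case infinite
    have "(\<lambda>n. max (f n) (g n)) \<longlonglongrightarrow> max r s" by (intro tendsto_max lim)
    then show ?thesis
      using infinite pos rs by (simp add: modulus_norm_infinity del: modulus_norm.simps)
  next
    case (finite p)
    have "(\<lambda>n. (f n powr p + g n powr p) powr (1 / p)) \<longlonglongrightarrow> (r powr p + s powr p) powr (1 / p)"
      using finite pos by (intro tendsto_powr' tendsto_add lim tendsto_const) auto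
    then show ?thesis using finite by (simp add: modulus_norm_ennreal del: modulus_norm.simps)
  next
    case (constants C D)
    then show ?thesis by (auto intro!: tendsto_intros lim)
  qed
qed

text \<open>For exponents \<open>p \<le> q\<close> both entries are divided by their
  \<open>p\<close>-norm \<open>?T\<close>: the quotients lie in the unit interval, where
  \<open>x powr q \<le> x powr p\<close>, and their \<open>p\<close>-th powers add up to 1. For
  Lipschitz halos a larger modulus means a smaller constant.\<close>

lemma modulus_norm_antimono:
  assumes "is_modulus \<Sigma> M" "is_modulus \<Sigma> M'" "modulus_le M M'" "0 \<le> r" "0 \<le> s"
  shows "modulus_norm M' r s \<le> modulus_norm M r s"
  using assms(1)
proof (cases rule: is_modulus_cases)
  case infinite
  with assms have "M' = Exponent top_class.top" by (cases M') (auto simp: top_unique)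
  then show ?thesis using infinite by simp
next
  case (finite p)
  let ?T = "(r powr p + s powr p) powr (1 / p)"
  have T: "r \<le> ?T" "s \<le> ?T"
    using powr_mono2[of "1 / p" "r powr p" "r powr p + s powr p"]
      powr_mono2[of "1 / p" "s powr p" "r powr p + s powr p"] finite assms(4,5)
    by (auto simp: powr_powr)
  from assms(2) show ?thesis
  proof (cases rule: is_modulus_cases)
    case infinite
    then show ?thesis
      using modulus_norm_infinity[OF assms(4,5)] modulus_norm_ennreal[OF finite(3), of r s] finite T by simp
  next
    case (finite q)
    note q = this
    have pq: "p \<le> q" using assms(3) \<open>M = Exponent (ennreal p)\<close> q \<open>0 < p\<close> by (simp add: ennreal_le_iff)
    show ?thesis
    proof (cases "?T = 0")
      case True
      then have "r = 0" "s = 0" using T assms(4,5) by auto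
      then show ?thesis
        using q \<open>M = Exponent (ennreal p)\<close> \<open>0 < p\<close> by (simp add: modulus_norm_ennreal del: modulus_norm.simps)
    next
      case False
      then have Tpos: "?T > 0" by (simp add: less_le)
      have le: "(x / ?T) powr q \<le> (x / ?T) powr p" if "0 \<le> x" "x \<le> ?T" for x
      proof (cases "x = 0")
        case False
        then have "0 < x / ?T" "x / ?T \<le> 1" using that Tpos by auto
        then show ?thesis using pq by (intro powr_mono') auto
      qed simp
      have "(r / ?T) powr q + (s / ?T) powr q \<le> (r / ?T) powr p + (s / ?T) powr p"
        using le T assms(4,5) by (intro add_mono) auto
      also have "\<dots> = (r powr p + s powr p) / ?T powr p"
        using assms(4,5) Tpos by (simp add: powr_divide add_divide_distrib)
      also have "\<dots> = 1"
      proof -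
        have "?T powr p = r powr p + s powr p"
          using \<open>0 < p\<close> by (simp add: powr_powr add_nonneg_nonneg)
        moreover have "?T powr p \<noteq> 0" using Tpos by simp
        ultimately show ?thesis by simp
      qed
      finally have "(r powr q + s powr q) / ?T powr q \<le> 1"
        using assms(4,5) Tpos by (simp add: powr_divide add_divide_distrib)
      then have "r powr q + s powr q \<le> ?T powr q"
        using Tpos by (simp add: divide_le_eq)
      then have "(r powr q + s powr q) powr (1 / q) \<le> (?T powr q) powr (1 / q)"
        using q by (intro powr_mono2) auto
      also have "\<dots> = ?T" using q by (simp add: powr_powr)
      finally show ?thesis
        using q \<open>M = Exponent (ennreal p)\<close> \<open>0 < p\<close> by (simp add: modulus_norm_ennreal del: modulus_norm.simps)
    qed
  next
    case (constants C D)
    then show ?thesis using \<open>\<Sigma> = Short\<close> by simp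
  qed
next
  case (constants C D)
  then obtain C' D' where "M' = Constants C' D'" "C' \<le> C" using assms by (cases M') auto
  then show ?thesis using constants assms by (auto intro!: mult_right_mono)
qed

lemma modulus_le_refl: "modulus_le M M"
  by (cases M) auto

lemma modulus_le_trans: "modulus_le M M' \<Longrightarrow> modulus_le M' M'' \<Longrightarrow> modulus_le M M''"
  by (cases M; cases M'; cases M'') auto

lemma growth_pos: "is_modulus \<Sigma> M \<Longrightarrow> 0 < growth M"
  by (erule is_modulus_cases) auto

lemma neg_const_ge_1: "1 \<le> neg_const M"
  by (cases M) auto

lemma neg_const_le_quasi_const: "neg_const M \<le> quasi_const M"
  by (cases M) auto

text \<open>In the short case \<open>growth\<close> is a strictly decreasing function of the
  exponent, with value 1 only at infinity, so it determines the order. In the Lipschitz case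
  \<open>growth\<close> and \<open>mult_const\<close> are the two constants themselves.\<close>

lemma modulus_le_growthI:
  assumes "is_modulus \<Sigma> M" "is_modulus \<Sigma> M'" "growth M' \<le> growth M" "mult_const M' \<le> mult_const M"
  shows "modulus_le M M'"
  using assms(1)
proof (cases rule: is_modulus_cases)
  case infinite
  from assms(2) show ?thesis
  proof (cases rule: is_modulus_cases)
    case (finite q)
    have "2 powr 0 < 2 powr (1 / q)" using finite by (intro powr_less_mono) auto
    then show ?thesis using assms(3) infinite finite by (simp add: not_le[symmetric])
  qed (use infinite in auto)
next
  case (finite p)
  note p = this
  from assms(2) show ?thesis
  proof (cases rule: is_modulus_cases)
    case (finite q)
    then have "1 / q \<le> 1 / p" using assms(3) p by simp
    then show ?thesis using p finite by (simp add: field_simps ennreal_le_iff)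
  qed (use p in auto)
next
  case (constants C D)
  with assms show ?thesis by (cases M') auto
qed

section \<open>Halos\<close>

locale chalo = cring A for A :: "'a halo" (structure) + fixes \<Sigma> :: kind
  assumes halo: "banach_halo \<Sigma> A"
begin

lemma is_modulus: "is_modulus \<Sigma> (modulus A)"
  using halo by (simp add: banach_halo_def)

lemma hnorm_nonneg [simp]: "a \<in> carrier A \<Longrightarrow> 0 \<le> hnorm A a"
  using halo by (simp add: banach_halo_def)

lemma hnorm_eq_0_iff: "a \<in> carrier A \<Longrightarrow> hnorm A a = 0 \<longleftrightarrow> a = \<zero>"
  using halo by (simp add: banach_halo_def)

lemma hnorm_zero [simp]: "hnorm A \<zero> = 0"
  by (simp add: hnorm_eq_0_iff)

lemma hnorm_one: "\<one> \<noteq> \<zero> \<Longrightarrow> hnorm A \<one> = 1"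
  using halo by (simp add: banach_halo_def)

lemma hnorm_one_le: "hnorm A \<one> \<le> 1"
  using hnorm_one by (cases "\<one> = \<zero>") auto

lemma hnorm_minus:
  "a \<in> carrier A \<Longrightarrow> b \<in> carrier A \<Longrightarrow> hnorm A (a \<ominus> b) \<le> modulus_norm (modulus A) (hnorm A a) (hnorm A b)"
  using halo by (simp add: banach_halo_def)

lemma hnorm_mult:
  "a \<in> carrier A \<Longrightarrow> b \<in> carrier A \<Longrightarrow> hnorm A (a \<otimes> b) \<le> mult_const (modulus A) * hnorm A a * hnorm A b"
  using halo by (simp add: banach_halo_def)

lemma mult_const_pos: "0 < mult_const (modulus A)"
  using is_modulus by (rule is_modulus_cases) auto

lemma hnorm_neg:
  assumes "a \<in> carrier A"
  shows "hnorm A (\<ominus> a) \<le> neg_const (modulus A) * hnorm A a"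
proof -
  have "hnorm A (\<ominus> a) \<le> modulus_norm (modulus A) 0 (hnorm A a)"
    using hnorm_minus[of \<zero> a] assms by (simp add: a_minus_def)
  also have "\<dots> \<le> neg_const (modulus A) * hnorm A a"
    using assms is_modulus by (intro modulus_norm_zero_left) auto
  finally show ?thesis .
qed

text \<open>For a Lipschitz halo only this symmetrized norm satisfies the inequality for sums with the
  constant of the halo.\<close>

definition symnorm :: "'a \<Rightarrow> real" where
  "symnorm a = max (hnorm A a) (hnorm A (\<ominus> a))"

lemma hnorm_le_symnorm: "hnorm A a \<le> symnorm a"
  by (simp add: symnorm_def)

lemma symnorm_le:
  assumes "a \<in> carrier A"
  shows "symnorm a \<le> neg_const (modulus A) * hnorm A a"
proof -
  have "1 * hnorm A a \<le> neg_const (modulus A) * hnorm A a"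
    using assms neg_const_ge_1 by (intro mult_right_mono) auto
  then show ?thesis using hnorm_neg[OF assms] by (simp add: symnorm_def)
qed

lemma symnorm_neg: "a \<in> carrier A \<Longrightarrow> symnorm (\<ominus> a) = symnorm a"
  by (simp add: symnorm_def max.commute)

lemma symnorm_nonneg: "a \<in> carrier A \<Longrightarrow> 0 \<le> symnorm a"
  using hnorm_le_symnorm[of a] hnorm_nonneg[of a] by linarith

lemma symnorm_zero: "symnorm \<zero> = 0"
  by (simp add: symnorm_def)

text \<open>Writing \<open>a \<oplus> b\<close> as \<open>a \<ominus> (\<ominus> b)\<close> brings
  in the norm of \<open>\<ominus> b\<close>, which \<open>symnorm b\<close> covers; the same
  inequality for \<open>\<ominus> a\<close> and \<open>\<ominus> b\<close> treats the negative of
  the sum.\<close>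

lemma symnorm_add:
  assumes "a \<in> carrier A" "b \<in> carrier A"
  shows "symnorm (a \<oplus> b) \<le> modulus_norm (modulus A) (symnorm a) (symnorm b)"
proof -
  have "hnorm A (a \<oplus> b) \<le> modulus_norm (modulus A) (symnorm a) (symnorm b)"
    if "a \<in> carrier A" "b \<in> carrier A" for a b
  proof -
    have "hnorm A (a \<oplus> b) \<le> modulus_norm (modulus A) (hnorm A a) (hnorm A (\<ominus> b))"
      using hnorm_minus[of a "\<ominus> b"] that by (simp add: a_minus_def)
    also have "\<dots> \<le> modulus_norm (modulus A) (symnorm a) (symnorm b)"
      using that is_modulus by (intro modulus_norm_mono) (auto simp: symnorm_def)
    finally show ?thesis .
  qed
  from this[of a b] this[of "\<ominus> a" "\<ominus> b"] show ?thesis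
    using assms by (simp add: symnorm_def[of "a \<oplus> b"] minus_add symnorm_neg)
qed

lemma sym_qnorm: "qnorm A symnorm (modulus_norm (modulus A)) (quasi_const (modulus A))"
proof (rule qnorm.intro, unfold_locales)
  fix a assume a: "a \<in> carrier A"
  show "symnorm (\<ominus> a) \<le> quasi_const (modulus A) * symnorm a"
    using a symnorm_neg symnorm_nonneg mult_right_mono[of 1 "quasi_const (modulus A)" "symnorm a"] by simp
qed (use is_modulus in \<open>auto intro: symnorm_nonneg symnorm_zero symnorm_add modulus_norm_le
      modulus_norm_mono modulus_norm_tendsto\<close>)

text \<open>For a Lipschitz halo this is the inequality for \<open>\<one> \<ominus> \<zero>\<close>,
  an element of norm 1.\<close>

lemma growth_ge_1:
  assumes "\<one> \<noteq> \<zero>"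
  shows "1 \<le> growth (modulus A)"
  using is_modulus
proof (cases rule: is_modulus_cases)
  case (finite p)
  then show ?thesis using ge_one_powr_ge_zero[of 2 "1 / p"] by simp
next
  case (constants C D)
  then show ?thesis
    using hnorm_minus[of \<one> \<zero>] hnorm_one[OF assms] by (simp add: a_minus_def)
qed simp

lemma Short_symnorm: "\<Sigma> = Short \<Longrightarrow> a \<in> carrier A \<Longrightarrow> symnorm a = hnorm A a"
  using symnorm_le[of a] hnorm_le_symnorm[of a] is_modulus by (cases "modulus A") auto

end

section \<open>Free normed modules\<close>

lemma free_normed_module_simps [simp]:
  "carrier (free_normed_module A X) = {a \<in> pts X \<rightarrow>\<^sub>E carrier A. finite (support A (pts X) a)}"
  "zero (free_normed_module A X) = (\<lambda>x\<in>pts X. \<zero>\<^bsub>A\<^esub>)"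
  "add (free_normed_module A X) = (\<lambda>a b. \<lambda>x\<in>pts X. a x \<oplus>\<^bsub>A\<^esub> b x)"
  "smult (free_normed_module A X) = (\<lambda>c a. \<lambda>x\<in>pts X. c \<otimes>\<^bsub>A\<^esub> a x)"
  "mnorm (free_normed_module A X) = free_norm A X"
  by (simp_all add: free_normed_module_def module.extend_def normed_module.fields_def free_module_def)

locale free_halo = chalo A \<Sigma> for A :: "'a halo" (structure) and \<Sigma> +
  fixes X :: "'x normed_set"
  assumes nrm_nonneg: "x \<in> pts X \<Longrightarrow> 0 \<le> nrm X x"
begin

abbreviation "P \<equiv> pts X"
abbreviation "F \<equiv> free_normed_module A X"
abbreviation "supp \<equiv> support A P"

definition sgl :: "'a \<Rightarrow> 'x \<Rightarrow> 'x \<Rightarrow> 'a" where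
  "sgl a x = (\<lambda>y\<in>P. if y = x then a else \<zero>)"

lemma delta_sgl: "delta A P x = sgl \<one> x"
  by (simp add: sgl_def delta_def)

lemma F_D:
  assumes "u \<in> carrier F"
  shows "x \<in> P \<Longrightarrow> u x \<in> carrier A" "u \<in> extensional P" "finite (supp u)"
  using assms by (auto simp: PiE_def)

lemma F_I:
  assumes "\<And>x. x \<in> P \<Longrightarrow> u x \<in> carrier A" "u \<in> extensional P"
    and "finite S" "\<And>x. x \<in> P \<Longrightarrow> x \<notin> S \<Longrightarrow> u x = \<zero>"
  shows "u \<in> carrier F"
proof -
  have "supp u \<subseteq> S" using assms(4) by (auto simp: support_def)
  then have "finite (supp u)" using assms(3) finite_subset by blast
  then show ?thesis using assms(1,2) by (auto simp: PiE_def)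
qed

lemma supp_zero: "x \<in> P \<Longrightarrow> x \<notin> supp u \<Longrightarrow> u x = \<zero>"
  by (simp add: support_def)

lemma F_eqI: "u \<in> carrier F \<Longrightarrow> v \<in> carrier F \<Longrightarrow> (\<And>x. x \<in> P \<Longrightarrow> u x = v x) \<Longrightarrow> u = v"
  using F_D(2) by (metis extensionalityI)

lemma sgl_closed [intro]: "a \<in> carrier A \<Longrightarrow> sgl a x \<in> carrier F"
  by (rule F_I[where S = "{x}"]) (auto simp: sgl_def)

lemma F_zero_closed: "\<zero>\<^bsub>F\<^esub> \<in> carrier F"
  by (rule F_I[where S = "{}"]) auto

lemma F_add_closed:
  assumes "u \<in> carrier F" "v \<in> carrier F"
  shows "u \<oplus>\<^bsub>F\<^esub> v \<in> carrier F"
  by (rule F_I[where S = "supp u \<union> supp v"]) (use F_D[OF assms(1)] F_D[OF assms(2)] supp_zero[of _ u] supp_zero[of _ v] in auto)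

lemma F_smult_closed:
  assumes "a \<in> carrier A" "u \<in> carrier F"
  shows "a \<odot>\<^bsub>F\<^esub> u \<in> carrier F"
  by (rule F_I[where S = "supp u"]) (use assms(1) F_D[OF assms(2)] supp_zero[of _ u] in auto)

lemma F_module: "module A F"
proof (rule moduleI[OF is_cring abelian_groupI])
  fix u v w assume "u \<in> carrier F" "v \<in> carrier F" "w \<in> carrier F"
  note D = this[THEN F_D(1)]
  show "(u \<oplus>\<^bsub>F\<^esub> v) \<oplus>\<^bsub>F\<^esub> w = u \<oplus>\<^bsub>F\<^esub> (v \<oplus>\<^bsub>F\<^esub> w)" using D by (auto simp: fun_eq_iff a_assoc)
next
  fix u v assume "u \<in> carrier F" "v \<in> carrier F"
  note D = this[THEN F_D(1)]
  show "u \<oplus>\<^bsub>F\<^esub> v = v \<oplus>\<^bsub>F\<^esub> u" using D by (auto simp: fun_eq_iff a_comm)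
next
  fix u assume u: "u \<in> carrier F"
  note D = F_D[OF this]
  show "\<zero>\<^bsub>F\<^esub> \<oplus>\<^bsub>F\<^esub> u = u" using D by (auto simp: fun_eq_iff extensional_def)
  show "\<one> \<odot>\<^bsub>F\<^esub> u = u" using D by (auto simp: fun_eq_iff extensional_def)
  have "(\<lambda>x\<in>P. \<ominus> u x) \<in> carrier F"
    by (rule F_I[where S = "supp u"]) (use D supp_zero[of _ u] in auto)
  then show "\<exists>v\<in>carrier F. v \<oplus>\<^bsub>F\<^esub> u = \<zero>\<^bsub>F\<^esub>"
    by (rule bexI[rotated]) (use D in \<open>auto simp: fun_eq_iff l_neg\<close>)
next
  fix a b u assume "a \<in> carrier A" "b \<in> carrier A" "u \<in> carrier F"
  note D = this(1,2) F_D(1)[OF this(3)]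
  show "(a \<oplus> b) \<odot>\<^bsub>F\<^esub> u = a \<odot>\<^bsub>F\<^esub> u \<oplus>\<^bsub>F\<^esub> b \<odot>\<^bsub>F\<^esub> u"
    "(a \<otimes> b) \<odot>\<^bsub>F\<^esub> u = a \<odot>\<^bsub>F\<^esub> (b \<odot>\<^bsub>F\<^esub> u)"
    using D by (auto simp: fun_eq_iff l_distr m_assoc)
next
  fix a u v assume "a \<in> carrier A" "u \<in> carrier F" "v \<in> carrier F"
  note D = this(1) this(2,3)[THEN F_D(1)]
  show "a \<odot>\<^bsub>F\<^esub> (u \<oplus>\<^bsub>F\<^esub> v) = a \<odot>\<^bsub>F\<^esub> u \<oplus>\<^bsub>F\<^esub> a \<odot>\<^bsub>F\<^esub> v"
    using D by (auto simp: fun_eq_iff r_distr)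
qed (use F_zero_closed F_add_closed F_smult_closed in \<open>auto simp del: free_normed_module_simps\<close>)

sublocale F: module A F by (rule F_module)

declare free_normed_module_simps(1-4) [simp del]

lemma F_add_app: "x \<in> P \<Longrightarrow> (u \<oplus>\<^bsub>F\<^esub> v) x = u x \<oplus> v x"
  by (simp add: free_normed_module_simps)

lemma F_smult_app: "x \<in> P \<Longrightarrow> (a \<odot>\<^bsub>F\<^esub> u) x = a \<otimes> u x"
  by (simp add: free_normed_module_simps)

lemma F_zero_app: "x \<in> P \<Longrightarrow> \<zero>\<^bsub>F\<^esub> x = \<zero>"
  by (simp add: free_normed_module_simps)

lemma supp_F_zero: "supp \<zero>\<^bsub>F\<^esub> = {}"
  by (auto simp: support_def F_zero_app)

lemma supp_empty_iff: "u \<in> carrier F \<Longrightarrow> supp u = {} \<longleftrightarrow> u = \<zero>\<^bsub>F\<^esub>"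
  using F_eqI[of u "\<zero>\<^bsub>F\<^esub>"] by (auto simp: supp_F_zero support_def F_zero_app)

lemma sgl_app: "y \<in> P \<Longrightarrow> sgl a x y = (if y = x then a else \<zero>)"
  by (simp add: sgl_def)

lemma sgl_zero: "sgl \<zero> x = \<zero>\<^bsub>F\<^esub>"
  by (rule F_eqI) (auto simp: sgl_app F_zero_app)

lemma sgl_add: "a \<in> carrier A \<Longrightarrow> b \<in> carrier A \<Longrightarrow> sgl (a \<oplus> b) x = sgl a x \<oplus>\<^bsub>F\<^esub> sgl b x"
  by (rule F_eqI) (auto simp: sgl_app F_add_app)

lemma smult_sgl: "a \<in> carrier A \<Longrightarrow> b \<in> carrier A \<Longrightarrow> a \<odot>\<^bsub>F\<^esub> sgl b x = sgl (a \<otimes> b) x"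
  by (rule F_eqI) (auto simp: sgl_app F_smult_app)

lemma supp_sgl_add:
  assumes "u \<in> carrier F" "x \<in> P" "x \<notin> supp u" "a \<in> carrier A" "a \<noteq> \<zero>"
  shows "supp (sgl a x \<oplus>\<^bsub>F\<^esub> u) = insert x (supp u)"
  using assms F_D(1)[OF assms(1)] by (auto simp: support_def F_add_app sgl_app split: if_splits)

lemma free_induct [consumes 1, case_names zero add]:
  assumes "u \<in> carrier F" "Q \<zero>\<^bsub>F\<^esub>"
    and add: "\<And>a x u. u \<in> carrier F \<Longrightarrow> x \<in> P \<Longrightarrow> x \<notin> supp u \<Longrightarrow> a \<in> carrier A \<Longrightarrow> a \<noteq> \<zero> \<Longrightarrow>
      Q u \<Longrightarrow> Q (sgl a x \<oplus>\<^bsub>F\<^esub> u)"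
  shows "Q u"
proof -
  have "finite (supp u)" by (rule F_D(3)[OF assms(1)])
  then show ?thesis using assms(1)
  proof (induction "supp u" arbitrary: u)
    case empty
    then show ?case using supp_empty_iff[of u] assms(2) by simp
  next
    case (insert x S)
    note u = F_D[OF insert.prems]
    have x: "x \<in> P" "u x \<noteq> \<zero>" using insert.hyps(4) by (auto simp: support_def)
    let ?v = "u(x := \<zero>)"
    have v: "?v \<in> carrier F"
      by (rule F_I[where S = "supp u"]) (use u x supp_zero[of _ u] in \<open>auto simp: extensional_def\<close>)
    have sv: "S = supp ?v" using insert.hyps(2,4) x by (auto simp: support_def)
    have "u = sgl (u x) x \<oplus>\<^bsub>F\<^esub> ?v"
      by (rule F_eqI) (use insert.prems v u x in \<open>auto simp: F_add_app sgl_app\<close>)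
    moreover have "Q (sgl (u x) x \<oplus>\<^bsub>F\<^esub> ?v)"
      using u x v sv insert.hyps(2) by (intro add insert.hyps(3)) auto
    ultimately show ?case by simp
  qed
qed

lemma additive_free_eqI:
  assumes "abelian_group H" "additive_map F H \<Phi>" "additive_map F H \<Psi>"
    and "\<And>a x. a \<in> carrier A \<Longrightarrow> x \<in> P \<Longrightarrow> \<Phi> (sgl a x) = \<Psi> (sgl a x)" "u \<in> carrier F"
  shows "\<Phi> u = \<Psi> u"
  using assms(5)
proof (induction rule: free_induct)
  case zero
  then show ?case
    using additive_zero[OF F.abelian_group_axioms assms(1) assms(2)]
      additive_zero[OF F.abelian_group_axioms assms(1) assms(3)] by simp
next
  case (add a x u)
  then show ?case
    using additive_add[OF assms(2)] additive_add[OF assms(3)] assms(4) by (simp add: sgl_closed)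
qed

text \<open>The supports of \<open>u\<close>, \<open>v\<close> and their sum differ. Additivity of
  \<open>g\<close> in the coefficient forces \<open>g \<zero> x\<close> to be zero, so all three
  sums may be taken over the union of the supports of \<open>u\<close> and \<open>v\<close>.\<close>

lemma additive_lin:
  assumes "abelian_group H" "\<And>x a. x \<in> P \<Longrightarrow> a \<in> carrier A \<Longrightarrow> g a x \<in> carrier H"
    and "\<And>x a b. x \<in> P \<Longrightarrow> a \<in> carrier A \<Longrightarrow> b \<in> carrier A \<Longrightarrow> g (a \<oplus> b) x = g a x \<oplus>\<^bsub>H\<^esub> g b x"
  shows "additive_map F H (\<lambda>u. \<Oplus>\<^bsub>H\<^esub>x\<in>supp u. g (u x) x)"
    and "a \<in> carrier A \<Longrightarrow> x \<in> P \<Longrightarrow> (\<Oplus>\<^bsub>H\<^esub>y\<in>supp (sgl a x). g (sgl a x y) y) = g a x"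
proof -
  interpret H: abelian_group H by fact
  have g0: "g \<zero> x = \<zero>\<^bsub>H\<^esub>" if "x \<in> P" for x
  proof -
    have "g \<zero> x = g \<zero> x \<oplus>\<^bsub>H\<^esub> g \<zero> x" using assms(3)[of x \<zero> \<zero>] that by simp
    then show ?thesis using H.add.l_cancel_one' assms(2) that by simp
  qed
  have ext: "(\<Oplus>\<^bsub>H\<^esub>x\<in>supp u. g (u x) x) = (\<Oplus>\<^bsub>H\<^esub>x\<in>S. g (u x) x)"
    if "u \<in> carrier F" "finite S" "supp u \<subseteq> S" "S \<subseteq> P" for u S
  proof -
    have c: "(\<lambda>x. g (u x) x) \<in> S \<rightarrow> carrier H" using F_D(1)[OF that(1)] assms(2) that(4) by auto
    show ?thesis
      by (rule H.add.finprod_mono_neutral_cong_left[OF that(2,3) _ _ c])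
        (use g0 supp_zero[of _ u] that(4) in auto)
  qed
  show "additive_map F H (\<lambda>u. \<Oplus>\<^bsub>H\<^esub>x\<in>supp u. g (u x) x)"
    unfolding additive_map_def
  proof (intro conjI ballI)
    fix u assume u: "u \<in> carrier F"
    show "(\<Oplus>\<^bsub>H\<^esub>x\<in>supp u. g (u x) x) \<in> carrier H"
      using F_D(1)[OF u] assms(2) by (intro H.finsum_closed) (auto simp: support_def)
    fix v assume v: "v \<in> carrier F"
    let ?S = "supp u \<union> supp v"
    have S: "finite ?S" "?S \<subseteq> P" using F_D(3) u v by (auto simp: support_def)
    have sub: "supp (u \<oplus>\<^bsub>F\<^esub> v) \<subseteq> ?S" by (auto simp: support_def F_add_app)
    have "(\<Oplus>\<^bsub>H\<^esub>x\<in>supp (u \<oplus>\<^bsub>F\<^esub> v). g ((u \<oplus>\<^bsub>F\<^esub> v) x) x) = (\<Oplus>\<^bsub>H\<^esub>x\<in>?S. g ((u \<oplus>\<^bsub>F\<^esub> v) x) x)"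
      using u v S sub by (intro ext) auto
    also have "\<dots> = (\<Oplus>\<^bsub>H\<^esub>x\<in>?S. g (u x) x \<oplus>\<^bsub>H\<^esub> g (v x) x)"
      using S F_D(1)[OF u] F_D(1)[OF v] assms(2,3)
      by (intro H.finsum_cong') (auto simp: F_add_app subset_iff)
    also have "\<dots> = (\<Oplus>\<^bsub>H\<^esub>x\<in>?S. g (u x) x) \<oplus>\<^bsub>H\<^esub> (\<Oplus>\<^bsub>H\<^esub>x\<in>?S. g (v x) x)"
      using S F_D(1)[OF u] F_D(1)[OF v] assms(2) by (intro H.finsum_addf) (auto simp: subset_iff)
    also have "(\<Oplus>\<^bsub>H\<^esub>x\<in>?S. g (u x) x) = (\<Oplus>\<^bsub>H\<^esub>x\<in>supp u. g (u x) x)"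
      using u S by (intro ext[symmetric]) auto
    also have "(\<Oplus>\<^bsub>H\<^esub>x\<in>?S. g (v x) x) = (\<Oplus>\<^bsub>H\<^esub>x\<in>supp v. g (v x) x)"
      using v S by (intro ext[symmetric]) auto
    finally show "(\<Oplus>\<^bsub>H\<^esub>x\<in>supp (u \<oplus>\<^bsub>F\<^esub> v). g ((u \<oplus>\<^bsub>F\<^esub> v) x) x) =
        (\<Oplus>\<^bsub>H\<^esub>x\<in>supp u. g (u x) x) \<oplus>\<^bsub>H\<^esub> (\<Oplus>\<^bsub>H\<^esub>x\<in>supp v. g (v x) x)" .
  qed
  show "(\<Oplus>\<^bsub>H\<^esub>y\<in>supp (sgl a x). g (sgl a x y) y) = g a x" if "a \<in> carrier A" "x \<in> P"
  proof -
    have "(\<Oplus>\<^bsub>H\<^esub>y\<in>supp (sgl a x). g (sgl a x y) y) = (\<Oplus>\<^bsub>H\<^esub>y\<in>{x}. g (sgl a x y) y)"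
      using that by (intro ext) (auto simp: support_def sgl_app split: if_splits)
    also have "\<dots> = g a x"
      using that assms(2) by (simp add: sgl_app H.finsum_insert[of "{}"])
    finally show ?thesis .
  qed
qed

lemma additive_sgl: "x \<in> P \<Longrightarrow> additive_map A F (\<lambda>a. sgl a x)"
  by (simp add: additive_map_def sgl_add sgl_closed)

lemma additive_smult: "a \<in> carrier A \<Longrightarrow> additive_map F F (\<lambda>u. a \<odot>\<^bsub>F\<^esub> u)"
  by (simp add: additive_map_def F.smult_r_distr)

section \<open>Labelled trees and the norm of the free module\<close>

definition leaf_sum :: "('a \<times> 'x) btree \<Rightarrow> 'x \<Rightarrow> 'a" where
  "leaf_sum t = tree_sum F (\<lambda>(a, x). sgl a x) t"

definition leaf_norm :: "('a \<times> 'x) btree \<Rightarrow> real" where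
  "leaf_norm t = tree_norm (growth (modulus A)) (\<lambda>(a, x). hnorm A a * nrm X x) t"

definition trees :: "('a \<times> 'x) btree set" where
  "trees = {t. set_btree t \<subseteq> carrier A \<times> P}"

lemma leaf_simps [simp]:
  "leaf_sum (Leaf (a, x)) = sgl a x"
  "leaf_sum (Branch s t) = leaf_sum s \<oplus>\<^bsub>F\<^esub> leaf_sum t"
  "leaf_norm (Leaf (a, x)) = hnorm A a * nrm X x"
  "leaf_norm (Branch s t) = growth (modulus A) * max (leaf_norm s) (leaf_norm t)"
  "Leaf (a, x) \<in> trees \<longleftrightarrow> a \<in> carrier A \<and> x \<in> P"
  "Branch s t \<in> trees \<longleftrightarrow> s \<in> trees \<and> t \<in> trees"
  by (auto simp: leaf_sum_def leaf_norm_def trees_def)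

lemma trees_induct [consumes 1, case_names Leaf Branch]:
  assumes "t \<in> trees" "\<And>a x. a \<in> carrier A \<Longrightarrow> x \<in> P \<Longrightarrow> Q (Leaf (a, x))"
    and "\<And>s t. s \<in> trees \<Longrightarrow> t \<in> trees \<Longrightarrow> Q s \<Longrightarrow> Q t \<Longrightarrow> Q (Branch s t)"
  shows "Q t"
  using assms(1)
proof (induction t)
  case (Leaf l)
  then show ?case using assms(2) by (cases l) auto
qed (use assms(3) in auto)

lemma leaf_sum_closed: "t \<in> trees \<Longrightarrow> leaf_sum t \<in> carrier F"
  by (induction rule: trees_induct) auto

lemma growth_gt_0: "0 < growth (modulus A)"
  using growth_pos is_modulus by blast

lemma leaf_norm_nonneg: "t \<in> trees \<Longrightarrow> 0 \<le> leaf_norm t"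
proof (induction rule: trees_induct)
  case (Branch s t)
  then show ?case using growth_gt_0 by (simp add: le_max_iff_disj)
qed (simp add: nrm_nonneg)

lemma trees_exist:
  assumes "u \<in> carrier F" "P \<noteq> {}"
  shows "\<exists>t\<in>trees. leaf_sum t = u"
  using assms(1)
proof (induction rule: free_induct)
  case zero
  obtain x where "x \<in> P" using assms(2) by blast
  then show ?case by (intro bexI[where x = "Leaf (\<zero>, x)"]) (auto simp: sgl_zero)
next
  case (add a x u)
  then obtain t where "t \<in> trees" "leaf_sum t = u" by blast
  then show ?case using add by (intro bexI[where x = "Branch (Leaf (a, x)) t"]) auto
qed

lemma free_norm_Lipschitz:
  assumes "\<Sigma> = Lipschitz"
  shows "free_norm A X u = (if supp u = {} then 0 else Inf (leaf_norm ` {t \<in> trees. leaf_sum t = u}))"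
proof -
  obtain C D where CD: "modulus A = Constants C D"
    using is_modulus assms by (cases "modulus A") auto
  have ts: "tree_sum (free_module A P) (\<lambda>(a, x). a \<odot>\<^bsub>free_module A P\<^esub> delta A P x) t = leaf_sum t"
    if "t \<in> trees" for t
    using that
    by (induction rule: trees_induct)
      (auto simp: sgl_def delta_def free_module_def free_normed_module_simps fun_eq_iff)
  have "{tree_norm C (\<lambda>(a, x). hnorm A a * nrm X x) t | t. set_btree t \<subseteq> carrier A \<times> P \<and>
      tree_sum (free_module A P) (\<lambda>(a, x). a \<odot>\<^bsub>free_module A P\<^esub> delta A P x) t = u}
    = leaf_norm ` {t \<in> trees. leaf_sum t = u}" (is "?L = ?R")
  proof -
    have "r \<in> ?L \<longleftrightarrow> (\<exists>t\<in>trees. r = leaf_norm t \<and> leaf_sum t = u)" for r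
      using ts CD by (auto simp: leaf_norm_def trees_def)
    then show ?thesis by (auto simp: image_iff)
  qed
  then show ?thesis using CD by (simp add: free_norm_def)
qed

lemma free_norm_zero [simp]: "free_norm A X \<zero>\<^bsub>F\<^esub> = 0"
  using is_modulus by (rule is_modulus_cases) (simp_all add: free_norm_def supp_F_zero)

lemma free_norm_nonneg [simp]:
  assumes "u \<in> carrier F"
  shows "0 \<le> free_norm A X u"
proof (cases \<Sigma>)
  case Short
  then show ?thesis
    using is_modulus F_D(3)[OF assms] by (cases "modulus A") (auto simp: free_norm_def lp_norm_nonneg)
next
  case Lipschitz
  have "P \<noteq> {}" if "supp u \<noteq> {}" using that by (auto simp: support_def)
  then show ?thesis
    using trees_exist[OF assms] leaf_norm_nonneg
    by (auto simp: free_norm_Lipschitz[OF Lipschitz] intro!: cInf_greatest)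
qed

lemma free_norm_le_leaf_norm:
  assumes "\<Sigma> = Lipschitz" "t \<in> trees"
  shows "free_norm A X (leaf_sum t) \<le> leaf_norm t"
proof (cases "supp (leaf_sum t) = {}")
  case False
  then show ?thesis
    using assms leaf_norm_nonneg
    by (auto simp: free_norm_Lipschitz intro!: cInf_lower bdd_belowI[where m = 0])
qed (use assms leaf_norm_nonneg in \<open>simp add: free_norm_Lipschitz\<close>)

lemma leaf_norm_approx:
  assumes "\<Sigma> = Lipschitz" "u \<in> carrier F" "P \<noteq> {}" "0 < e"
  shows "\<exists>t\<in>trees. leaf_sum t = u \<and> leaf_norm t < free_norm A X u + e"
proof (cases "supp u = {}")
  case True
  \<comment> \<open>The norm of the zero element is 0 by definition and not as an infimum over
    trees; the leaf \<open>0{x}\<close> realizes that value.\<close>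
  obtain x where "x \<in> P" using assms(3) by blast
  then show ?thesis
    using assms True supp_empty_iff[OF assms(2)]
    by (intro bexI[where x = "Leaf (\<zero>, x)"]) (auto simp: sgl_zero)
next
  case False
  have "leaf_norm ` {t \<in> trees. leaf_sum t = u} \<noteq> {}"
    using trees_exist[OF assms(2,3)] by blast
  from cInf_lessD[OF this, of "free_norm A X u + e"] show ?thesis
    using False assms by (auto simp: free_norm_Lipschitz)
qed

lemma free_norm_Short:
  assumes "\<Sigma> = Short"
  shows "\<exists>p. modulus A = Exponent p \<and> 0 < p \<and>
    free_norm A X u = lp_norm p (supp u) (\<lambda>x. hnorm A (u x) * nrm X x)"
  using is_modulus assms by (cases "modulus A") (auto simp: free_norm_def)

lemma free_norm_sgl_add_Short:
  assumes "\<Sigma> = Short" "u \<in> carrier F" "x \<in> P" "x \<notin> supp u" "a \<in> carrier A" "a \<noteq> \<zero>"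
  shows "free_norm A X (sgl a x \<oplus>\<^bsub>F\<^esub> u) =
    modulus_norm (modulus A) (hnorm A a * nrm X x) (free_norm A X u)"
proof -
  obtain p where p: "modulus A = Exponent p" "0 < p"
    using free_norm_Short[OF assms(1)] by blast
  have n: "free_norm A X u = lp_norm p (supp u) (\<lambda>x. hnorm A (u x) * nrm X x)" for u
    by (simp add: free_norm_def p(1))
  let ?w = "sgl a x \<oplus>\<^bsub>F\<^esub> u"
  have ux: "u x = \<zero>" using assms supp_zero by blast
  have w: "?w x = a" "\<And>y. y \<in> supp u \<Longrightarrow> ?w y = u y"
    using assms ux F_D(1)[OF assms(2)] by (auto simp: F_add_app sgl_app support_def)
  have nn: "0 \<le> hnorm A (?w y) * nrm X y" if "y \<in> insert x (supp u)" for y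
    using that assms w F_D(1)[OF assms(2)] nrm_nonneg by (auto simp: support_def)
  have "free_norm A X ?w = lp_norm p (insert x (supp u)) (\<lambda>y. hnorm A (?w y) * nrm X y)"
    using assms by (simp add: n supp_sgl_add)
  also have "\<dots> = modulus_norm (Exponent p) (hnorm A (?w x) * nrm X x)
      (lp_norm p (supp u) (\<lambda>y. hnorm A (?w y) * nrm X y))"
    using assms p F_D(3) nn by (intro lp_norm_insert) auto
  also have "lp_norm p (supp u) (\<lambda>y. hnorm A (?w y) * nrm X y) = free_norm A X u"
    by (simp add: n lp_norm_def w(2) cong: image_cong sum.cong)
  finally show ?thesis using w(1) by (simp add: p(1))
qed

text \<open>In the short case, splitting off a generator outside the support turns
  \<open>free_norm\<close> into \<open>modulus_norm\<close> of two terms with equality, so the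
  inequality for \<open>N\<close> propagates by induction on the support. In the Lipschitz case it
  propagates from the leaves of a tree to its root, and the infimum over trees is taken afterwards.
  Negation, scalar multiplication, coordinates and linear extensions are all bounded through this
  property.\<close>

lemma free_norm_universal:
  assumes "abelian_group H" "additive_map F H \<Phi>" "0 \<le> c"
    and N: "\<And>y. y \<in> carrier H \<Longrightarrow> 0 \<le> N y" "N \<zero>\<^bsub>H\<^esub> = 0"
      "\<And>y z. y \<in> carrier H \<Longrightarrow> z \<in> carrier H \<Longrightarrow> N (y \<oplus>\<^bsub>H\<^esub> z) \<le> modulus_norm (modulus A) (N y) (N z)"
    and gen: "\<And>a x. a \<in> carrier A \<Longrightarrow> x \<in> P \<Longrightarrow> N (\<Phi> (sgl a x)) \<le> c * (hnorm A a * nrm X x)"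
    and u: "u \<in> carrier F"
  shows "N (\<Phi> u) \<le> c * free_norm A X u"
proof (cases \<Sigma>)
  case Short
  from u show ?thesis
  proof (induction rule: free_induct)
    case zero
    then show ?case using additive_zero[OF F.abelian_group_axioms assms(1,2)] N(2) by simp
  next
    case (add a x u)
    have "N (\<Phi> (sgl a x \<oplus>\<^bsub>F\<^esub> u)) = N (\<Phi> (sgl a x) \<oplus>\<^bsub>H\<^esub> \<Phi> u)"
      using add additive_add[OF assms(2)] by (simp add: sgl_closed)
    also have "\<dots> \<le> modulus_norm (modulus A) (N (\<Phi> (sgl a x))) (N (\<Phi> u))"
      using add additive_closed[OF assms(2)] by (intro N(3)) (auto simp: sgl_closed)
    also have "\<dots> \<le> modulus_norm (modulus A) (c * (hnorm A a * nrm X x)) (c * free_norm A X u)"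
      using add additive_closed[OF assms(2)] gen N(1) is_modulus
      by (intro modulus_norm_mono) (auto simp: sgl_closed)
    also have "\<dots> = c * modulus_norm (modulus A) (hnorm A a * nrm X x) (free_norm A X u)"
      using add is_modulus assms(3) nrm_nonneg by (intro modulus_norm_scale) auto
    also have "\<dots> = c * free_norm A X (sgl a x \<oplus>\<^bsub>F\<^esub> u)"
      using add by (simp add: free_norm_sgl_add_Short[OF Short])
    finally show ?case .
  qed
next
  case Lipschitz
  obtain C D where CD: "modulus A = Constants C D" "0 < C"
    using is_modulus Lipschitz by (cases "modulus A") auto
  have tree: "N (\<Phi> (leaf_sum t)) \<le> c * leaf_norm t" if "t \<in> trees" for t
    using that
  proof (induction rule: trees_induct)
    case (Branch s t)
    have cl: "\<Phi> (leaf_sum s) \<in> carrier H" "\<Phi> (leaf_sum t) \<in> carrier H"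
      using Branch leaf_sum_closed additive_closed[OF assms(2)] by auto
    have "N (\<Phi> (leaf_sum (Branch s t))) = N (\<Phi> (leaf_sum s) \<oplus>\<^bsub>H\<^esub> \<Phi> (leaf_sum t))"
      using Branch leaf_sum_closed additive_add[OF assms(2)] by simp
    also have "\<dots> \<le> C * max (N (\<Phi> (leaf_sum s))) (N (\<Phi> (leaf_sum t)))"
      using N(3)[OF cl] CD by simp
    also have "\<dots> \<le> C * max (c * leaf_norm s) (c * leaf_norm t)"
      using Branch CD by (intro mult_left_mono max.mono) auto
    also have "\<dots> = c * leaf_norm (Branch s t)"
      using assms(3) CD by (simp add: max_mult_distrib_left mult.left_commute)
    finally show ?case .
  qed (use gen in simp)
  show ?thesis
  proof (cases "P = {}")
    case True
    then have "u = \<zero>\<^bsub>F\<^esub>" using u by (intro F_eqI) auto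
    then show ?thesis using additive_zero[OF F.abelian_group_axioms assms(1,2)] N(2) by simp
  next
    case False
    show ?thesis
    proof (rule field_le_epsilon)
      fix e :: real assume "0 < e"
      \<comment> \<open>\<open>c\<close> may be 0, so the tree is chosen within
        \<open>e / (c + 1)\<close> of the infimum.\<close>
      then have e: "0 < e / (c + 1)" using assms(3) by simp
      obtain t where t: "t \<in> trees" "leaf_sum t = u" "leaf_norm t < free_norm A X u + e / (c + 1)"
        using leaf_norm_approx[OF Lipschitz u False e] by blast
      have "N (\<Phi> u) \<le> c * leaf_norm t" using tree[OF t(1)] t(2) by simp
      also have "\<dots> \<le> c * (free_norm A X u + e / (c + 1))"
        using t(3) assms(3) by (intro mult_left_mono) auto
      also have "\<dots> = c * free_norm A X u + c / (c + 1) * e" by (simp add: distrib_left)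
      also have "c / (c + 1) * e \<le> 1 * e" using \<open>0 < e\<close> assms(3) by (intro mult_right_mono) auto
      finally show "N (\<Phi> u) \<le> c * free_norm A X u + e" by simp
    qed
  qed
qed

lemma free_norm_sgl:
  assumes "a \<in> carrier A" "x \<in> P"
  shows "free_norm A X (sgl a x) \<le> hnorm A a * nrm X x"
proof (cases \<Sigma>)
  case Short
  show ?thesis
  proof (cases "a = \<zero>")
    case False
    have "free_norm A X (sgl a x) = modulus_norm (modulus A) (hnorm A a * nrm X x) 0"
      using free_norm_sgl_add_Short[OF Short, of "\<zero>\<^bsub>F\<^esub>" x a] assms False by (simp add: supp_F_zero sgl_closed)
    also have "\<dots> \<le> neg_const (modulus A) * (hnorm A a * nrm X x)"
      using is_modulus assms nrm_nonneg by (intro modulus_norm_zero_right) auto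
    finally show ?thesis using is_modulus Short by (cases "modulus A") auto
  qed (simp add: sgl_zero)
next
  case Lipschitz
  then show ?thesis using free_norm_le_leaf_norm[of "Leaf (a, x)"] assms by simp
qed

text \<open>For exponents the inequality of the halo is applied in each coordinate and then combined
  by the maximum or by the sum of \<open>p\<close>-th powers. For Lipschitz halos two nearly optimal
  trees are joined at a new root.\<close>

lemma free_norm_add:
  assumes u: "u \<in> carrier F" and v: "v \<in> carrier F"
  shows "free_norm A X (u \<oplus>\<^bsub>F\<^esub> v) \<le> modulus_norm (modulus A) (free_norm A X u) (free_norm A X v)"
  using is_modulus
proof (cases rule: is_modulus_cases)
  case infinite
  let ?v = "\<lambda>u x. hnorm A (u x) * nrm X x"
  have n: "free_norm A X w = lp_norm top_class.top (supp w) (?v w)" for w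
    using infinite by (simp add: free_norm_def)
  have le: "?v w x \<le> free_norm A X w" if "w \<in> carrier F" "x \<in> P" for w x
  proof (cases "x \<in> supp w")
    case True
    then show ?thesis
      using lp_norm_infinity_le_iff[of "supp w" "?v w" "free_norm A X w"] F_D(3)[OF that(1)]
      by (simp add: n)
  next
    case False
    then show ?thesis using that supp_zero[of x w] by simp
  qed
  have "?v (u \<oplus>\<^bsub>F\<^esub> v) x \<le> max (free_norm A X u) (free_norm A X v)" if x: "x \<in> P" for x
  proof -
    have c: "u x \<in> carrier A" "v x \<in> carrier A" using x F_D(1) u v by auto
    have "hnorm A (u x \<oplus> v x) \<le> modulus_norm (Exponent top_class.top) (hnorm A (u x)) (hnorm A (v x))"
      using symnorm_add[OF c] c infinite by (simp add: Short_symnorm)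
    also have "\<dots> = max (hnorm A (u x)) (hnorm A (v x))"
      using c by (intro modulus_norm_infinity) auto
    finally have "?v (u \<oplus>\<^bsub>F\<^esub> v) x \<le> max (hnorm A (u x)) (hnorm A (v x)) * nrm X x"
      using x nrm_nonneg by (auto simp: F_add_app intro!: mult_right_mono)
    also have "\<dots> = max (?v u x) (?v v x)"
      using x nrm_nonneg by (simp add: max_mult_distrib_right)
    also have "\<dots> \<le> max (free_norm A X u) (free_norm A X v)"
      using le u v x by (intro max.mono) auto
    finally show ?thesis .
  qed
  then have "free_norm A X (u \<oplus>\<^bsub>F\<^esub> v) \<le> max (free_norm A X u) (free_norm A X v)"
    unfolding n[of "u \<oplus>\<^bsub>F\<^esub> v"]
    using F_D(3)[OF F.add.m_closed[OF u v]] free_norm_nonneg[OF u]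
    by (subst lp_norm_infinity_le_iff) (auto simp: support_def le_max_iff_disj)
  also have "\<dots> = modulus_norm (modulus A) (free_norm A X u) (free_norm A X v)"
    using infinite modulus_norm_infinity u v by simp
  finally show ?thesis .
next
  case (finite p)
  let ?v = "\<lambda>u x. hnorm A (u x) * nrm X x"
  let ?S = "supp u \<union> supp v"
  have S: "finite ?S" "?S \<subseteq> P" using F_D(3) u v by (auto simp: support_def)
  have n: "free_norm A X w = (\<Sum>x\<in>?S. ?v w x powr p) powr (1 / p)"
    if "w \<in> carrier F" "supp w \<subseteq> ?S" for w
  proof -
    have "(\<Sum>x\<in>supp w. ?v w x powr p) = (\<Sum>x\<in>?S. ?v w x powr p)"
      using S that supp_zero[of _ w] finite by (intro sum.mono_neutral_left) (auto simp: subset_iff)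
    then show ?thesis using finite by (simp add: free_norm_def lp_norm_ennreal)
  qed
  have pw: "free_norm A X w powr p = (\<Sum>x\<in>?S. ?v w x powr p)" if "w \<in> carrier F" "supp w \<subseteq> ?S" for w
    using n[OF that] finite by (simp add: powr_powr sum_nonneg)
  have "free_norm A X (u \<oplus>\<^bsub>F\<^esub> v) = (\<Sum>x\<in>?S. ?v (u \<oplus>\<^bsub>F\<^esub> v) x powr p) powr (1 / p)"
    using u v by (intro n) (auto simp: support_def F_add_app)
  also have "\<dots> \<le> (\<Sum>x\<in>?S. ?v u x powr p + ?v v x powr p) powr (1 / p)"
  proof (intro powr_mono2 sum_mono)
    fix x assume "x \<in> ?S"
    then have x: "x \<in> P" using S by blast
    have c: "u x \<in> carrier A" "v x \<in> carrier A" using x F_D(1) u v by auto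
    have "hnorm A (u x \<oplus> v x) powr p
        \<le> modulus_norm (Exponent (ennreal p)) (hnorm A (u x)) (hnorm A (v x)) powr p"
      using symnorm_add[OF c] c finite by (intro powr_mono2) (auto simp: Short_symnorm)
    also have "\<dots> = hnorm A (u x) powr p + hnorm A (v x) powr p"
      using finite by (intro modulus_norm_ennreal_powr) auto
    finally have "hnorm A (u x \<oplus> v x) powr p * nrm X x powr p
        \<le> (hnorm A (u x) powr p + hnorm A (v x) powr p) * nrm X x powr p"
      by (rule mult_right_mono) simp
    then show "?v (u \<oplus>\<^bsub>F\<^esub> v) x powr p \<le> ?v u x powr p + ?v v x powr p"
      using x c nrm_nonneg by (simp add: F_add_app powr_mult distrib_right)
  qed (use finite in \<open>auto intro: sum_nonneg\<close>)
  also have "\<dots> = modulus_norm (modulus A) (free_norm A X u) (free_norm A X v)"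
    using finite u v by (simp add: modulus_norm_ennreal pw sum.distrib del: modulus_norm.simps)
  finally show ?thesis .
next
  case (constants C D)
  note Lip = \<open>\<Sigma> = Lipschitz\<close>
  show ?thesis
  proof (cases "P = {}")
    case True
    then have "u = \<zero>\<^bsub>F\<^esub>" "v = \<zero>\<^bsub>F\<^esub>" using u v by (auto intro: F_eqI)
    then show ?thesis using constants by simp
  next
    case False
    show ?thesis
    proof (rule field_le_epsilon)
      fix e :: real assume "0 < e"
      \<comment> \<open>The new root multiplies the error by \<open>C\<close>.\<close>
      then have e: "0 < e / C" using constants by simp
      obtain s where s: "s \<in> trees" "leaf_sum s = u" "leaf_norm s < free_norm A X u + e / C"
        using leaf_norm_approx[OF Lip u False e] by blast
      obtain t where t: "t \<in> trees" "leaf_sum t = v" "leaf_norm t < free_norm A X v + e / C"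
        using leaf_norm_approx[OF Lip v False e] by blast
      have "free_norm A X (u \<oplus>\<^bsub>F\<^esub> v) \<le> leaf_norm (Branch s t)"
        using free_norm_le_leaf_norm[OF Lip, of "Branch s t"] s t by simp
      also have "\<dots> \<le> C * (max (free_norm A X u) (free_norm A X v) + e / C)"
        using constants s t by (auto intro!: mult_left_mono)
      also have "\<dots> = C * max (free_norm A X u) (free_norm A X v) + e"
        using constants by (simp add: distrib_left)
      finally show "free_norm A X (u \<oplus>\<^bsub>F\<^esub> v)
          \<le> modulus_norm (modulus A) (free_norm A X u) (free_norm A X v) + e"
        using constants by simp
    qed
  qed
qed

lemma additive_neg_F: "additive_map F F (\<lambda>u. \<ominus>\<^bsub>F\<^esub> u)"
  by (simp add: additive_map_def F.minus_add)

lemma neg_sgl: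
  assumes "a \<in> carrier A" "x \<in> P"
  shows "\<ominus>\<^bsub>F\<^esub> sgl a x = sgl (\<ominus> a) x"
  using additive_neg[OF abelian_group_axioms F.abelian_group_axioms additive_sgl] assms by simp

text \<open>The bound for negatives does not follow from the one for sums; it is the universal
  property applied to negation, with \<open>neg_const\<close> measuring its effect on
  generators.\<close>

lemma F_qnorm: "qnorm F (free_norm A X) (modulus_norm (modulus A)) (quasi_const (modulus A))"
proof (rule qnorm.intro[OF F.abelian_group_axioms], unfold_locales)
  fix u assume u: "u \<in> carrier F"
  show "free_norm A X (\<ominus>\<^bsub>F\<^esub> u) \<le> quasi_const (modulus A) * free_norm A X u"
  proof (rule free_norm_universal[OF F.abelian_group_axioms additive_neg_F _ _ _ _ _ u])
    fix a x assume ax: "a \<in> carrier A" "x \<in> P"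
    have "free_norm A X (\<ominus>\<^bsub>F\<^esub> sgl a x) \<le> hnorm A (\<ominus> a) * nrm X x"
      using free_norm_sgl ax by (simp add: neg_sgl)
    also have "\<dots> \<le> (neg_const (modulus A) * hnorm A a) * nrm X x"
      using ax hnorm_neg nrm_nonneg by (intro mult_right_mono) auto
    also have "\<dots> \<le> (quasi_const (modulus A) * hnorm A a) * nrm X x"
      using ax neg_const_le_quasi_const nrm_nonneg by (intro mult_right_mono) auto
    finally show "free_norm A X (\<ominus>\<^bsub>F\<^esub> sgl a x) \<le> quasi_const (modulus A) * (hnorm A a * nrm X x)"
      by simp
  qed (use free_norm_add in auto)
qed (use is_modulus in \<open>auto intro: free_norm_add modulus_norm_le modulus_norm_mono modulus_norm_tendsto\<close>)

lemma free_norm_smult: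
  assumes a: "a \<in> carrier A" and u: "u \<in> carrier F"
  shows "free_norm A X (a \<odot>\<^bsub>F\<^esub> u) \<le> mult_const (modulus A) * hnorm A a * free_norm A X u"
proof (rule free_norm_universal[OF F.abelian_group_axioms additive_smult[OF a] _ _ _ _ _ u])
  fix b x assume bx: "b \<in> carrier A" "x \<in> P"
  have "free_norm A X (a \<odot>\<^bsub>F\<^esub> sgl b x) \<le> hnorm A (a \<otimes> b) * nrm X x"
    using free_norm_sgl a bx by (simp add: smult_sgl)
  also have "\<dots> \<le> (mult_const (modulus A) * hnorm A a * hnorm A b) * nrm X x"
    using a bx nrm_nonneg by (intro mult_right_mono hnorm_mult) auto
  finally show "free_norm A X (a \<odot>\<^bsub>F\<^esub> sgl b x) \<le> mult_const (modulus A) * hnorm A a * (hnorm A b * nrm X x)"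
    by (simp add: mult.assoc)
qed (use free_norm_add a mult_const_pos in auto)

lemma additive_coord: "x \<in> P \<Longrightarrow> additive_map F A (\<lambda>u. u x)"
  by (simp add: additive_map_def F_add_app F_D)

text \<open>The universal property is applied to the coordinate map, with
  \<open>symnorm a * nrm X x\<close> as the norm on \<open>A\<close>; \<open>hnorm\<close> itself
  need not obey the inequality for sums with the constant of the halo. Generators at other points
  have coordinate zero.\<close>

lemma coord_le:
  assumes u: "u \<in> carrier F" and x: "x \<in> P"
  shows "symnorm (u x) * nrm X x \<le> neg_const (modulus A) * free_norm A X u"
proof (rule free_norm_universal[OF abelian_group_axioms additive_coord[OF x] _ _ _ _ _ u,
      where N = "\<lambda>a. symnorm a * nrm X x"])
  have n: "0 \<le> nrm X x" using x nrm_nonneg by blast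
  show "0 \<le> neg_const (modulus A)" using neg_const_ge_1[of "modulus A"] by simp
  fix a assume a: "a \<in> carrier A"
  then show "0 \<le> symnorm a * nrm X x" using n by (simp add: symnorm_nonneg)
  show "symnorm (a \<oplus> b) * nrm X x \<le> modulus_norm (modulus A) (symnorm a * nrm X x) (symnorm b * nrm X x)"
    if b: "b \<in> carrier A" for b
    using mult_right_mono[OF symnorm_add[OF a b] n]
      modulus_norm_scale[OF is_modulus symnorm_nonneg[OF a] symnorm_nonneg[OF b] n]
    by (simp add: mult.commute)
  fix y assume "y \<in> P"
  show "symnorm (sgl a y x) * nrm X x \<le> neg_const (modulus A) * (hnorm A a * nrm X y)"
  proof (cases "x = y")
    case True
    then show ?thesis
      using x mult_right_mono[OF symnorm_le[OF a] n] by (simp add: sgl_app)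
  next
    case False
    then show ?thesis
      using x a \<open>y \<in> P\<close> nrm_nonneg neg_const_ge_1[of "modulus A"] by (simp add: sgl_app symnorm_zero)
  qed
qed (simp add: symnorm_zero)

end

section \<open>Growth of the norms of sums of generators\<close>

context qnorm
begin

text \<open>Binary counters: \<open>a\<close> is a sum of elements \<open>e\<^sub>i\<close> of norm at most
  \<open>r C\<^sup>i\<close>, one for each digit \<open>1\<close> at a place \<open>i \<ge> k\<close> of \<open>2\<^sup>k n\<close>. As two summands of
  the same weight are merged into one of twice the weight, a sum of elements with total weight below
  \<open>2\<^sup>j\<close> has norm at most \<open>r C\<^sup>j\<close>, however the tree that it comes from was
  bracketed.\<close>

inductive counter :: "real \<Rightarrow> real \<Rightarrow> nat \<Rightarrow> nat \<Rightarrow> 'a \<Rightarrow> bool" for r C where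
  zero: "counter r C k 0 \<zero>"
| even: "counter r C (Suc k) n a \<Longrightarrow> 0 < n \<Longrightarrow> counter r C k (2 * n) a"
| odd: "counter r C (Suc k) n a \<Longrightarrow> e \<in> carrier G \<Longrightarrow> N e \<le> r * C ^ k \<Longrightarrow>
    counter r C k (2 * n + 1) (e \<oplus> a)"

lemma counter_closed: "counter r C k n a \<Longrightarrow> a \<in> carrier G"
  by (induction rule: counter.induct) auto

lemma counter_single:
  assumes "e \<in> carrier G" "N e \<le> r * C ^ (k + j)"
  shows "counter r C k (2 ^ j) (e \<oplus> \<zero>)"
  using assms
proof (induction j arbitrary: k)
  case 0
  then show ?case using counter.odd[OF counter.zero, of e r C k] by simp
next
  case (Suc j)
  then show ?case using counter.even[of r C k "2 ^ j" "e \<oplus> \<zero>"] by simp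
qed

text \<open>Binary addition of \<open>2 ^ j\<close>. The carry occurs at an odd counter with
  \<open>j = 0\<close>: the new element and the digit have norm at most \<open>r * C ^ k\<close>
  each, so their sum has norm at most \<open>r * C ^ Suc k\<close> and is inserted one place
  higher.\<close>

lemma counter_insert:
  assumes add: "\<And>x y. x \<in> carrier G \<Longrightarrow> y \<in> carrier G \<Longrightarrow> N (x \<oplus> y) \<le> C * max (N x) (N y)" and "0 < C"
    and "counter r C k n a" "e \<in> carrier G" "N e \<le> r * C ^ (k + j)"
  shows "counter r C k (n + 2 ^ j) (e \<oplus> a)"
  using assms(3-5)
proof (induction arbitrary: e j rule: counter.induct)
  case (zero k)
  then show ?case using counter_single by simp
next
  case (even k n a)
  show ?case
  proof (cases j)
    case 0
    then show ?thesis using counter.odd[OF even.hyps(1), of e] even.prems by simp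
  next
    case (Suc i)
    then have "counter r C (Suc k) (n + 2 ^ i) (e \<oplus> a)" using even.prems by (intro even.IH) auto
    then show ?thesis using counter.even[of r C k "n + 2 ^ i"] Suc by simp
  qed
next
  case (odd k n a e')
  note c = counter_closed[OF odd.hyps(1)] odd.hyps(2) odd.prems(1)
  show ?case
  proof (cases j)
    case 0
    have "N (e \<oplus> e') \<le> C * max (N e) (N e')" using add c by blast
    also have "\<dots> \<le> C * (r * C ^ k)" using odd 0 \<open>0 < C\<close> by (intro mult_left_mono) auto
    finally have "counter r C (Suc k) (n + 2 ^ 0) ((e \<oplus> e') \<oplus> a)"
      using c by (intro odd.IH) (auto simp: mult.left_commute)
    then show ?thesis using counter.even[of r C k "n + 1"] 0 c by (simp add: a_assoc)
  next
    case (Suc i)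
    then have "counter r C (Suc k) (n + 2 ^ i) (e \<oplus> a)" using odd.prems by (intro odd.IH) auto
    then have "counter r C k (2 * (n + 2 ^ i) + 1) (e' \<oplus> (e \<oplus> a))"
      using odd.hyps by (intro counter.odd)
    then show ?thesis using Suc c by (simp add: a_lcomm)
  qed
qed

text \<open>\<open>x\<close> acts as a carry moving upwards. At place \<open>k\<close> its norm is
  at most \<open>r * C ^ k\<close>; merged with a digit there it meets the bound of the next place,
  and without a digit it does so because \<open>1 \<le> C\<close>. After \<open>j\<close> places all
  digits of a number below \<open>2 ^ j\<close> are absorbed.\<close>

lemma counter_bound:
  assumes add: "\<And>x y. x \<in> carrier G \<Longrightarrow> y \<in> carrier G \<Longrightarrow> N (x \<oplus> y) \<le> C * max (N x) (N y)"
    and "1 \<le> C" "0 \<le> r" "counter r C k n a" "x \<in> carrier G" "N x \<le> r * C ^ k" "n < 2 ^ j"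
  shows "N (x \<oplus> a) \<le> r * C ^ (k + j)"
  using assms(4-7)
proof (induction arbitrary: x j rule: counter.induct)
  case (zero k)
  have "r * C ^ k \<le> r * C ^ (k + j)" using assms(2,3) by (intro mult_left_mono power_increasing) auto
  then show ?case using zero by simp
next
  case (even k n a)
  then obtain i where i: "j = Suc i" by (cases j) auto
  have "r * C ^ k \<le> r * C ^ Suc k" using assms(2,3) by (intro mult_left_mono power_increasing) auto
  then have "N (x \<oplus> a) \<le> r * C ^ (Suc k + i)" using even i by (intro even.IH) auto
  then show ?case using i by simp
next
  case (odd k n a e)
  then obtain i where i: "j = Suc i" by (cases j) auto
  note c = counter_closed[OF odd.hyps(1)] odd.hyps(2) odd.prems(1)
  have "N (x \<oplus> e) \<le> C * max (N x) (N e)" using add c by blast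
  also have "\<dots> \<le> C * (r * C ^ k)" using odd assms(2) by (intro mult_left_mono) auto
  finally have "N ((x \<oplus> e) \<oplus> a) \<le> r * C ^ (Suc k + i)"
    using odd.prems i c by (intro odd.IH) (auto simp: mult.left_commute)
  then show ?case using i c by (simp add: a_assoc)
qed

end

section \<open>Weights of the leaves of a tree\<close>

primrec depth :: "'l btree \<Rightarrow> nat" where
  "depth (Leaf l) = 0"
| "depth (Branch s t) = Suc (max (depth s) (depth t))"

text \<open>The weights \<open>2^-d\<close> of the leaves at depth \<open>d\<close>, scaled by
  \<open>2^h\<close> to natural numbers. This reading needs \<open>h\<close> to be at least the
  depth of the tree, since \<open>h - 1\<close> is truncated at 0.\<close>

primrec weight :: "'x \<Rightarrow> nat \<Rightarrow> ('a \<times> 'x) btree \<Rightarrow> nat" where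
  "weight x h (Leaf l) = (if snd l = x then 2 ^ h else 0)"
| "weight x h (Branch s t) = weight x (h - 1) s + weight x (h - 1) t"

text \<open>A leaf counts for one point only, and the two subtrees of a node receive half of
  \<open>2 ^ h\<close> each.\<close>

lemma sum_weight_le:
  assumes "finite I" "depth t \<le> h"
  shows "(\<Sum>x\<in>I. weight x h t) \<le> 2 ^ h"
  using assms(2)
proof (induction t arbitrary: h)
  case (Leaf l)
  then show ?case using assms(1) by (simp add: sum.delta)
next
  case (Branch s t)
  then obtain i where h: "h = Suc i" by (cases h) auto
  have "(\<Sum>x\<in>I. weight x h (Branch s t)) = (\<Sum>x\<in>I. weight x i s) + (\<Sum>x\<in>I. weight x i t)"
    by (simp add: h sum.distrib)
  also have "\<dots> \<le> 2 ^ i + 2 ^ i" using Branch h by (intro add_mono Branch.IH) auto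
  finally show ?case by (simp add: h)
qed

section \<open>Upper and lower bounds for sums of generators of norm 1\<close>

context free_halo
begin

interpretation sym: qnorm A symnorm "modulus_norm (modulus A)" "quasi_const (modulus A)"
  by (rule sym_qnorm)

definition ind :: "'x set \<Rightarrow> 'x \<Rightarrow> 'a" where
  "ind I = (\<lambda>x\<in>P. if x \<in> I then \<one> else \<zero>)"

lemma ind_closed: "finite I \<Longrightarrow> ind I \<in> carrier F"
  by (rule F_I[where S = I]) (auto simp: ind_def)

lemma ind_singleton: "x \<in> P \<Longrightarrow> ind {x} = sgl \<one> x"
  by (simp add: ind_def sgl_def)

lemma ind_Un:
  assumes "finite I" "finite J" "I \<inter> J = {}"
  shows "ind (I \<union> J) = ind I \<oplus>\<^bsub>F\<^esub> ind J"
proof (rule F_eqI)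
  show "ind (I \<union> J) \<in> carrier F" "ind I \<oplus>\<^bsub>F\<^esub> ind J \<in> carrier F"
    using assms by (simp_all add: ind_closed)
qed (use assms in \<open>auto simp: ind_def F_add_app\<close>)

lemma ind_upper:
  assumes "I \<subseteq> P" "\<And>x. x \<in> I \<Longrightarrow> nrm X x = 1" "card I = 2 ^ k"
  shows "free_norm A X (ind I) \<le> growth (modulus A) ^ k"
  using assms
proof (induction k arbitrary: I)
  case 0
  then obtain x where x: "I = {x}" by (metis card_1_singletonE power_0)
  then show ?case
    using free_norm_sgl[of \<one> x] 0 hnorm_one_le by (simp add: ind_singleton)
next
  case (Suc k)
  obtain J where J: "J \<subseteq> I" "card J = 2 ^ k" "finite J"
    using obtain_subset_with_card_n[of "2 ^ k" I] Suc.prems(3) by auto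
  have fin: "finite I" using Suc.prems(3) by (rule_tac card_ge_0_finite) simp
  have J': "card (I - J) = 2 ^ k" using J Suc.prems(3) by (simp add: card_Diff_subset)
  have "ind I = ind (J \<union> (I - J))" using J by (simp add: Un_absorb1)
  also have "\<dots> = ind J \<oplus>\<^bsub>F\<^esub> ind (I - J)" using J fin by (intro ind_Un) auto
  finally have "free_norm A X (ind I) \<le> modulus_norm (modulus A) (free_norm A X (ind J)) (free_norm A X (ind (I - J)))"
    using J fin by (simp add: free_norm_add ind_closed)
  also have "\<dots> \<le> modulus_norm (modulus A) (growth (modulus A) ^ k) (growth (modulus A) ^ k)"
  proof (rule modulus_norm_mono[OF is_modulus])
    show "free_norm A X (ind J) \<le> growth (modulus A) ^ k"
      using Suc.prems J by (intro Suc.IH) auto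
    show "free_norm A X (ind (I - J)) \<le> growth (modulus A) ^ k"
      using Suc.prems J' by (intro Suc.IH) auto
  qed (use J fin in \<open>auto simp: ind_closed\<close>)
  also have "\<dots> = growth (modulus A) * growth (modulus A) ^ k"
    using is_modulus growth_gt_0 by (intro modulus_norm_diag) auto
  finally show ?case by simp
qed

text \<open>The leaves at \<open>x\<close> are inserted into a counter one after another, hence the
  accumulators \<open>n\<close> and \<open>a\<close>. Descending one level divides the bound on the
  norm by \<open>C\<close> and lowers \<open>h\<close> by one, so a leaf arrives with an
  \<open>h\<close> for which \<open>symnorm b \<le> r * C ^ h\<close>, and it is inserted with
  weight \<open>2 ^ h\<close>.\<close>

lemma counter_tree:
  assumes Lip: "modulus A = Constants C D" "0 < C" and x: "x \<in> P" "nrm X x = 1"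
    and "t \<in> trees" "depth t \<le> h" "neg_const (modulus A) * leaf_norm t \<le> r * C ^ h"
    and "sym.counter r C 0 n a"
  shows "sym.counter r C 0 (n + weight x h t) (leaf_sum t x \<oplus> a)"
  using assms(5-8)
proof (induction t arbitrary: h n a rule: trees_induct)
  case (Leaf b y)
  show ?case
  proof (cases "y = x")
    case True
    have "symnorm b \<le> r * C ^ h"
      using Leaf True symnorm_le[of b] x by (simp del: neg_const.simps)
    then have "sym.counter r C 0 (n + 2 ^ h) (b \<oplus> a)"
      using Leaf symnorm_add Lip by (intro sym.counter_insert) auto
    then show ?thesis using True x by (simp add: sgl_app)
  next
    case False
    then show ?thesis using Leaf x sym.counter_closed by (simp add: sgl_app)
  qed
next
  case (Branch s t)
  then obtain i where h: "h = Suc i" by (cases h) auto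
  have bound: "neg_const (modulus A) * leaf_norm u \<le> r * C ^ i"
    if "u \<in> trees" "leaf_norm u \<le> max (leaf_norm s) (leaf_norm t)" for u
  proof -
    have "C * (neg_const (modulus A) * leaf_norm u)
        \<le> C * (neg_const (modulus A) * max (leaf_norm s) (leaf_norm t))"
      using that Lip neg_const_ge_1[of "modulus A"] by (intro mult_left_mono) auto
    also have "\<dots> \<le> C * (r * C ^ i)" using Branch.prems(2) h Lip by (simp add: mult_ac)
    finally show ?thesis using Lip by simp
  qed
  have "sym.counter r C 0 (n + weight x i t) (leaf_sum t x \<oplus> a)"
    using Branch h bound[of t] by (intro Branch.IH(2)) auto
  then have "sym.counter r C 0 ((n + weight x i t) + weight x i s) (leaf_sum s x \<oplus> (leaf_sum t x \<oplus> a))"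
    using Branch h bound[of s] by (intro Branch.IH(1)) auto
  moreover have "leaf_sum s x \<in> carrier A" "leaf_sum t x \<in> carrier A" "a \<in> carrier A"
    using F_D(1)[OF leaf_sum_closed] x Branch sym.counter_closed by auto
  ultimately show ?case using h x by (simp add: F_add_app a_assoc add_ac)
qed

text \<open>For short halos the norm of \<open>ind I\<close> is at least 1 if the exponent is
  infinite and equals \<open>(2 ^ k) powr (1 / p)\<close> otherwise. For Lipschitz halos every tree
  with sum \<open>ind I\<close> obeys the bound: the factor \<open>neg_const\<close> comes from
  passing to \<open>symnorm\<close>, the factor \<open>growth\<close> from rounding a weight up to a
  power of two that exceeds it.\<close>

lemma ind_lower:
  assumes one: "\<one> \<noteq> \<zero>" and I: "I \<subseteq> P" "\<And>x. x \<in> I \<Longrightarrow> nrm X x = 1" "card I = 2 ^ k"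
  shows "growth (modulus A) ^ k \<le> growth (modulus A) * neg_const (modulus A) * free_norm A X (ind I)"
proof -
  have fin: "finite I" using I(3) by (rule_tac card_ge_0_finite) simp
  have "I \<noteq> {}" using I(3) by auto
  have g1: "1 \<le> growth (modulus A)" using growth_ge_1[OF one] .
  have sI: "supp (ind I) = I" using I(1) one by (auto simp: support_def ind_def)
  have v1: "hnorm A (ind I x) * nrm X x = 1" if "x \<in> I" for x
    using that I hnorm_one[OF one] by (auto simp: ind_def)
  from is_modulus show ?thesis
  proof (cases rule: is_modulus_cases)
    case infinite
    obtain x where "x \<in> I" using \<open>I \<noteq> {}\<close> by blast
    moreover have "\<forall>x\<in>I. hnorm A (ind I x) * nrm X x \<le> free_norm A X (ind I)"
      using lp_norm_infinity_le_iff[OF fin, of "\<lambda>x. hnorm A (ind I x) * nrm X x" "free_norm A X (ind I)"]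
        infinite by (simp add: free_norm_def sI)
    ultimately have "1 \<le> free_norm A X (ind I)" using v1 by force
    then show ?thesis using infinite by simp
  next
    case (finite p)
    have "free_norm A X (ind I) = (2 ^ k) powr (1 / p)"
      using finite I(3) v1 by (simp add: free_norm_def sI lp_norm_ennreal)
    also have "\<dots> = growth (modulus A) ^ k"
      using finite by (simp add: powr_power powr_realpow[symmetric] powr_powr mult.commute)
    finally have "free_norm A X (ind I) = growth (modulus A) ^ k" .
    then show ?thesis
      using g1 finite mult_right_mono[OF g1, of "growth (modulus A) ^ k"] by simp
  next
    case (constants C D)
    have C1: "1 \<le> C" using g1 constants by simp
    have tree: "C ^ k \<le> C * neg_const (modulus A) * leaf_norm t"
      if t: "t \<in> trees" "leaf_sum t = ind I" for t
    proof -
      \<comment> \<open>At least the depth, as the weights require, and at least \<open>k\<close>,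
        so that \<open>h - k\<close> is not truncated.\<close>
      define h where "h = max (depth t) k"
      \<comment> \<open>Chosen so that the hypothesis of \<open>counter_tree\<close> on the norm of
        the whole tree is an equality.\<close>
      define r where "r = neg_const (modulus A) * leaf_norm t / C ^ h"
      have r: "0 \<le> r" "neg_const (modulus A) * leaf_norm t = r * C ^ h"
        using leaf_norm_nonneg[OF t(1)] neg_const_ge_1[of "modulus A"] C1 by (auto simp: r_def)
      \<comment> \<open>Pigeonhole: weights above \<open>2 ^ (h - k)\<close> at all
        \<open>2 ^ k\<close> points would add up to more than \<open>2 ^ h\<close>.\<close>
      have "\<exists>x\<in>I. weight x h t \<le> 2 ^ (h - k)"
      proof (rule ccontr)
        assume "\<not> ?thesis"
        then have "(\<Sum>x\<in>I. 2 ^ (h - k)) < (\<Sum>x\<in>I. weight x h t)"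
          using fin \<open>I \<noteq> {}\<close> by (intro sum_strict_mono) auto
        also have "\<dots> \<le> 2 ^ h" using fin by (intro sum_weight_le) (auto simp: h_def)
        also have "\<dots> = (\<Sum>x\<in>I. 2 ^ (h - k))"
          using I(3) by (simp add: h_def power_add[symmetric])
        finally show False by simp
      qed
      then obtain x where x: "x \<in> I" "weight x h t \<le> 2 ^ (h - k)" by blast
      \<comment> \<open>\<open>counter_bound\<close> wants a strict inequality; the added 1 in the
        exponent becomes the extra factor \<open>C\<close>.\<close>
      then have w: "weight x h t < 2 ^ (h - k + 1)"
        by (rule_tac le_less_trans[OF x(2)]) simp
      have "sym.counter r C 0 (0 + weight x h t) (leaf_sum t x \<oplus> \<zero>)"
        using constants I x t r by (intro counter_tree sym.counter.zero) (auto simp: h_def)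
      then have "sym.counter r C 0 (weight x h t) \<one>"
        using t(2) x I by (auto simp: ind_def)
      then have "symnorm (\<zero> \<oplus> \<one>) \<le> r * C ^ (0 + (h - k + 1))"
        using w r C1 symnorm_add constants by (intro sym.counter_bound) auto
      moreover have "1 \<le> symnorm \<one>" using hnorm_le_symnorm[of \<one>] hnorm_one[OF one] by simp
      ultimately have "1 \<le> r * C ^ (h - k + 1)" by simp
      then have "C ^ k * 1 \<le> C ^ k * (r * C ^ (h - k + 1))" using C1 by (intro mult_left_mono) auto
      also have "\<dots> = C * (r * C ^ (k + (h - k)))" by (simp add: power_add)
      also have "\<dots> = C * (neg_const (modulus A) * leaf_norm t)" using r(2) by (simp add: h_def)
      finally show ?thesis by simp
    qed
    have "C ^ k \<le> C * neg_const (modulus A) * (free_norm A X (ind I) + e)" if e: "0 < e" for e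
    proof -
      obtain t where "t \<in> trees" "leaf_sum t = ind I" "leaf_norm t < free_norm A X (ind I) + e"
        using leaf_norm_approx[OF constants(1) ind_closed[OF fin] _ e] I \<open>I \<noteq> {}\<close> by blast
      moreover from this have "C * neg_const (modulus A) * leaf_norm t
          \<le> C * neg_const (modulus A) * (free_norm A X (ind I) + e)"
        using C1 neg_const_ge_1[of "modulus A"] by (intro mult_left_mono) auto
      ultimately show ?thesis using tree by (meson order_trans)
    qed
    then have "C ^ k \<le> C * neg_const (modulus A) * (free_norm A X (ind I) + inverse (real (Suc n)))" for n
      by simp
    moreover have "(\<lambda>n. C * neg_const (modulus A) * (free_norm A X (ind I) + inverse (real (Suc n))))
        \<longlonglongrightarrow> C * neg_const (modulus A) * (free_norm A X (ind I) + 0)"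
      by (intro tendsto_intros LIMSEQ_inverse_real_of_nat)
    ultimately show ?thesis
      using constants by (intro LIMSEQ_le_const[where X = "\<lambda>n. C * neg_const (modulus A) *
          (free_norm A X (ind I) + inverse (real (Suc n)))"]) auto
  qed
qed

end

section \<open>Small sets\<close>

text \<open>Membership in \<open>\<U>\<close> makes sense only for subsets of the type
  \<open>'u\<close>. This extends it, up to injections, to sets of functions, pairs and classes,
  before these are encoded.\<close>

definition small :: "'u set set \<Rightarrow> 'b set \<Rightarrow> bool" where
  "small \<U> S \<longleftrightarrow> (\<exists>V\<in>\<U>. S \<lesssim> V)"

lemma small_mono: "small \<U> S \<Longrightarrow> T \<lesssim> S \<Longrightarrow> small \<U> T"
  unfolding small_def by (blast intro: lepoll_trans)

lemma small_self: "S \<in> \<U> \<Longrightarrow> small \<U> S"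
  unfolding small_def by blast

lemma universe_small:
  assumes "universe \<U>" "small \<U> (S :: 'u set)"
  shows "S \<in> (\<U> :: 'u set set)"
  using assms unfolding small_def universe_def by blast

lemma small_Times:
  assumes "universe \<U>" "small \<U> S" "small \<U> T"
  shows "small \<U> (S \<times> T)"
proof -
  obtain V W where VW: "V \<in> \<U>" "S \<lesssim> V" "W \<in> \<U>" "T \<lesssim> W"
    using assms by (auto simp: small_def)
  have "\<forall>S\<in>\<U>. \<forall>T\<in>\<U>. \<exists>U\<in>\<U>. S \<times> T \<lesssim> U" using assms(1) by (simp add: universe_def)
  then obtain U where "U \<in> \<U>" "V \<times> W \<lesssim> U" using VW by blast
  then show ?thesis
    using lepoll_trans[OF times_lepoll_mono[OF VW(2,4)]] by (auto simp: small_def)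
qed

lemma small_sequences:
  assumes "universe \<U>" "small \<U> S"
  shows "small \<U> ((UNIV :: nat set) \<rightarrow>\<^sub>E S)"
proof -
  obtain V where V: "V \<in> \<U>" "S \<lesssim> V" using assms by (auto simp: small_def)
  have "\<forall>S\<in>\<U>. \<exists>U\<in>\<U>. (UNIV :: nat set) \<rightarrow>\<^sub>E S \<lesssim> U" using assms(1) by (simp add: universe_def)
  then obtain U where "U \<in> \<U>" "(UNIV :: nat set) \<rightarrow>\<^sub>E V \<lesssim> U" using V by blast
  then show ?thesis
    using lepoll_trans[OF lepoll_funcset_right[OF V(2)]] by (auto simp: small_def)
qed

lemma small_countable:
  assumes "universe \<U>" "countable S"
  shows "small \<U> S"
proof -
  obtain V where V: "V \<in> \<U>" "infinite V" using assms(1) by (auto simp: universe_def)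
  have "S \<lesssim> (UNIV :: nat set)" using assms(2) by (auto simp: countable_def lepoll_def)
  also have "(UNIV :: nat set) \<lesssim> V" using V(2) by (simp add: infinite_le_lepoll)
  finally show ?thesis using V(1) by (auto simp: small_def)
qed

lemma small_encode:
  fixes \<U> :: "'u set set"
  assumes "universe \<U>" "small \<U> S"
  shows "inj_on (encode \<U> S) S" "encode \<U> S ` S \<in> \<U>"
proof -
  obtain V e where V: "V \<in> \<U>" "inj_on e S" "e ` S \<subseteq> V"
    using assms(2) by (auto simp: small_def lepoll_def)
  have "e ` S \<in> \<U>"
    by (rule universe_small[OF assms(1) small_mono[OF small_self[OF V(1)] subset_imp_lepoll[OF V(3)]]])
  then have "\<exists>e. inj_on e S \<and> e ` S \<in> \<U>" using V(2) by blast
  then have "inj_on (encode \<U> S) S \<and> encode \<U> S ` S \<in> \<U>" unfolding encode_def by (rule someI_ex)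
  then show "inj_on (encode \<U> S) S" "encode \<U> S ` S \<in> \<U>" by auto
qed

text \<open>A finitely supported function on a nonempty set is determined by a sequence enumerating a
  finite part of its graph that contains the support.\<close>

lemma (in free_halo) small_free:
  assumes U: "universe \<U>" "small \<U> (carrier A)" "small \<U> P"
  shows "small \<U> (carrier F)"
proof (cases "P = {}")
  case True
  have "carrier F \<subseteq> {\<zero>\<^bsub>F\<^esub>}" using True by (auto intro!: F_eqI)
  then have "countable (carrier F)" using countable_subset by blast
  then show ?thesis by (rule small_countable[OF U(1)])
next
  case False
  then obtain x0 where x0: "x0 \<in> P" by blast
  have "\<exists>g \<in> (UNIV :: nat set) \<rightarrow>\<^sub>E P \<times> carrier A. range g = (\<lambda>x. (x, u x)) ` insert x0 (supp u)"
    if "u \<in> carrier F" for u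
  proof -
    have "finite (insert x0 (supp u))" using F_D(3)[OF that] by simp
    then have "countable ((\<lambda>x. (x, u x)) ` insert x0 (supp u))"
      by (intro countable_image countable_finite)
    then have "range (from_nat_into ((\<lambda>x. (x, u x)) ` insert x0 (supp u))) =
        (\<lambda>x. (x, u x)) ` insert x0 (supp u)"
      by (intro range_from_nat_into) auto
    then obtain g :: "nat \<Rightarrow> 'x \<times> 'a" where g: "range g = (\<lambda>x. (x, u x)) ` insert x0 (supp u)"
      by blast
    moreover have "g n \<in> P \<times> carrier A" for n
    proof -
      have "g n \<in> (\<lambda>x. (x, u x)) ` insert x0 (supp u)" using g by blast
      then show ?thesis using F_D(1)[OF that] x0 by (auto simp: support_def)
    qed
    ultimately show ?thesis by (intro bexI[where x = g]) auto
  qed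
  then have "\<forall>u\<in>carrier F. \<exists>g. g \<in> (UNIV :: nat set) \<rightarrow>\<^sub>E P \<times> carrier A \<and>
      range g = (\<lambda>x. (x, u x)) ` insert x0 (supp u)"
    by blast
  from bchoice[OF this] obtain G where G:
      "\<And>u. u \<in> carrier F \<Longrightarrow> G u \<in> (UNIV :: nat set) \<rightarrow>\<^sub>E P \<times> carrier A"
      "\<And>u. u \<in> carrier F \<Longrightarrow> range (G u) = (\<lambda>x. (x, u x)) ` insert x0 (supp u)"
    by blast
  have "inj_on G (carrier F)"
  proof (rule inj_onI)
    fix u v assume uv: "u \<in> carrier F" "v \<in> carrier F" "G u = G v"
    then have eq: "(\<lambda>x. (x, u x)) ` insert x0 (supp u) = (\<lambda>x. (x, v x)) ` insert x0 (supp v)"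
      using G(2)[OF uv(1)] G(2)[OF uv(2)] by (simp only:)
    show "u = v"
    proof (rule F_eqI[OF uv(1,2)])
      fix x assume x: "x \<in> P"
      show "u x = v x"
      proof (cases "x \<in> supp u \<or> x \<in> supp v")
        case True
        then have "(x, u x) \<in> (\<lambda>x. (x, v x)) ` insert x0 (supp v) \<or>
            (x, v x) \<in> (\<lambda>x. (x, u x)) ` insert x0 (supp u)"
          using eq by blast
        then show ?thesis by auto
      next
        case False
        then show ?thesis using x supp_zero[of x u] supp_zero[of x v] by simp
      qed
    qed
  qed
  then have "carrier F \<lesssim> (UNIV :: nat set) \<rightarrow>\<^sub>E P \<times> carrier A"
    unfolding lepoll_def using G(1) by blast
  then show ?thesis by (rule small_mono[OF small_sequences[OF U(1) small_Times[OF U(1,3,2)]]])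
qed

section \<open>The completed free modules\<close>

locale ell_halo = free_halo A \<Sigma> X for A :: "'u halo" (structure) and \<Sigma> and X :: "'u normed_set" +
  fixes \<U> :: "'u set set"
  assumes universe: "universe \<U>" and carrier_small: "carrier A \<in> \<U>" and pts_small: "pts X \<in> \<U>"
begin

abbreviation "E \<equiv> ell \<U> A X"
abbreviation "CF \<equiv> cauchy_seqs F (free_norm A X)"

interpretation Fq: qnorm F "free_norm A X" "modulus_norm (modulus A)" "quasi_const (modulus A)"
  by (rule F_qnorm)

definition cl :: "(nat \<Rightarrow> 'u \<Rightarrow> 'u) \<Rightarrow> 'u" where
  "cl s = ell_code \<U> A X (null_rel F `` {s})"

lemma null_rel_iff: "(s, t) \<in> null_rel F \<longleftrightarrow> s \<in> CF \<and> t \<in> CF \<and> Fq.null (\<lambda>n. s n \<ominus>\<^bsub>F\<^esub> t n)"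
  by (simp add: null_rel_def Fq.null_def)

lemma equiv_null_rel: "equiv CF (null_rel F)"
proof (rule equivI)
  show "refl_on CF (null_rel F)"
    by (auto simp: refl_on_def null_rel_iff Fq.CS_closed)
  show "sym (null_rel F)"
    unfolding sym_def null_rel_iff using Fq.null_commute Fq.CS_closed by meson
  show "trans (null_rel F)"
    unfolding trans_def null_rel_iff using Fq.null_trans Fq.CS_closed by meson
qed (auto simp: null_rel_iff)

lemma carrier_raw: "carrier (ell_raw A X) = CF // null_rel F"
  by (simp add: ell_raw_def completion_def)

text \<open>A class is the image of a sequence in \<open>carrier F\<close>, so the closure of the
  universe under sequences applies.\<close>

lemma small_raw: "small \<U> (carrier (ell_raw A X))"
proof -
  have "small \<U> (carrier F)"
    using small_free[OF universe] carrier_small pts_small small_self by blast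
  then have s: "small \<U> ((UNIV :: nat set) \<rightarrow>\<^sub>E carrier F)" by (rule small_sequences[OF universe])
  have "CF \<subseteq> UNIV \<rightarrow>\<^sub>E carrier F" using Fq.CS_closed by blast
  then have "CF // null_rel F \<subseteq> (\<lambda>s. null_rel F `` {s}) ` (UNIV \<rightarrow>\<^sub>E carrier F)"
    by (auto simp: quotient_def)
  then show ?thesis
    unfolding carrier_raw by (rule small_mono[OF s subset_image_lepoll])
qed

lemma code_inj: "inj_on (ell_code \<U> A X) (carrier (ell_raw A X))"
  and code_small: "ell_code \<U> A X ` carrier (ell_raw A X) \<in> \<U>"
  using small_encode[OF universe small_raw] by (simp_all add: ell_code_def)

lemma ell_simps:
  "carrier E = ell_code \<U> A X ` carrier (ell_raw A X)"
  "\<zero>\<^bsub>E\<^esub> = ell_code \<U> A X \<zero>\<^bsub>ell_raw A X\<^esub>"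
  "u \<oplus>\<^bsub>E\<^esub> v = ell_code \<U> A X (ell_reps \<U> A X u \<oplus>\<^bsub>ell_raw A X\<^esub> ell_reps \<U> A X v)"
  "a \<odot>\<^bsub>E\<^esub> u = ell_code \<U> A X (a \<odot>\<^bsub>ell_raw A X\<^esub> ell_reps \<U> A X u)"
  "mnorm E u = mnorm (ell_raw A X) (ell_reps \<U> A X u)"
  by (simp_all add: ell_def transport_def Let_def ell_reps_def)

lemma carrier_E_small: "carrier E \<in> \<U>"
  using code_small by (simp add: ell_simps)

lemma class_in_raw: "s \<in> CF \<Longrightarrow> null_rel F `` {s} \<in> carrier (ell_raw A X)"
  by (auto simp: carrier_raw quotient_def)

lemma reps_cl_class: "s \<in> CF \<Longrightarrow> ell_reps \<U> A X (cl s) = null_rel F `` {s}"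
  unfolding ell_reps_def cl_def using code_inj class_in_raw by (intro inv_into_f_f)

lemma cl_eq_iff: "s \<in> CF \<Longrightarrow> t \<in> CF \<Longrightarrow> cl s = cl t \<longleftrightarrow> Fq.null (\<lambda>n. s n \<ominus>\<^bsub>F\<^esub> t n)"
  unfolding cl_def using inj_on_eq_iff[OF code_inj class_in_raw class_in_raw, of s t]
    eq_equiv_class_iff[OF equiv_null_rel, of s t] by (simp add: null_rel_iff)

lemma reps_cl:
  assumes "s \<in> CF"
  shows "ell_reps \<U> A X (cl s) = {t \<in> CF. cl t = cl s}"
proof -
  have "(s, t) \<in> null_rel F \<longleftrightarrow> t \<in> CF \<and> cl t = cl s" for t
    using cl_eq_iff[OF assms, of t] assms by (auto simp: null_rel_iff)
  then show ?thesis using assms by (auto simp: reps_cl_class)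
qed

lemma carrier_cl: "carrier E = cl ` CF"
  by (auto simp: ell_simps carrier_raw quotient_def cl_def)

text \<open>The operations of \<open>completion\<close> are unions over representatives; once the
  summand is the same for all of them, the union is that summand.\<close>

lemma Union_class_const:
  assumes "s \<in> CF" "\<And>t. t \<in> CF \<Longrightarrow> Fq.null (\<lambda>n. s n \<ominus>\<^bsub>F\<^esub> t n) \<Longrightarrow> g t = S"
  shows "(\<Union>t\<in>null_rel F `` {s}. g t) = S"
proof -
  have "s \<in> null_rel F `` {s}" using equiv_class_self[OF equiv_null_rel assms(1)] .
  moreover have "g t = S" if "t \<in> null_rel F `` {s}" for t
    using that assms(2) by (simp add: null_rel_iff)
  ultimately show ?thesis by blast
qed

lemma class_eqI:
  "s \<in> CF \<Longrightarrow> t \<in> CF \<Longrightarrow> Fq.null (\<lambda>n. s n \<ominus>\<^bsub>F\<^esub> t n) \<Longrightarrow> null_rel F `` {s} = null_rel F `` {t}"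
  by (rule equiv_class_eq[OF equiv_null_rel]) (simp add: null_rel_iff)

lemma cl_add:
  assumes "s \<in> CF" "t \<in> CF"
  shows "cl s \<oplus>\<^bsub>E\<^esub> cl t = cl (\<lambda>n. s n \<oplus>\<^bsub>F\<^esub> t n)"
proof -
  have "null_rel F `` {\<lambda>n. s' n \<oplus>\<^bsub>F\<^esub> t' n} = null_rel F `` {\<lambda>n. s n \<oplus>\<^bsub>F\<^esub> t n}"
    if "s' \<in> CF" "Fq.null (\<lambda>n. s n \<ominus>\<^bsub>F\<^esub> s' n)" "t' \<in> CF" "Fq.null (\<lambda>n. t n \<ominus>\<^bsub>F\<^esub> t' n)" for s' t'
  proof (rule class_eqI[symmetric])
    have c: "s n \<in> carrier F" "t n \<in> carrier F" "s' n \<in> carrier F" "t' n \<in> carrier F" for n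
      using Fq.CS_closed that assms by auto
    show "Fq.null (\<lambda>n. (s n \<oplus>\<^bsub>F\<^esub> t n) \<ominus>\<^bsub>F\<^esub> (s' n \<oplus>\<^bsub>F\<^esub> t' n))"
      using Fq.null_add[OF _ _ that(2,4)] c by (simp add: Fq.add_minus_add)
  qed (use that assms Fq.CS_add in auto)
  then have "(\<Union>s'\<in>null_rel F `` {s}. \<Union>t'\<in>null_rel F `` {t}. null_rel F `` {\<lambda>n. s' n \<oplus>\<^bsub>F\<^esub> t' n}) =
      null_rel F `` {\<lambda>n. s n \<oplus>\<^bsub>F\<^esub> t n}"
    using assms by (intro Union_class_const) auto
  then show ?thesis
    using assms by (simp add: ell_simps reps_cl_class) (simp add: ell_raw_def completion_def cl_def)
qed

lemma CF_smult:
  assumes a: "a \<in> carrier A" and s: "s \<in> CF"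
  shows "(\<lambda>n. a \<odot>\<^bsub>F\<^esub> s n) \<in> CF"
proof (rule Fq.CS_bound[OF s s])
  \<comment> \<open>The added 1 keeps the factor positive even when \<open>a\<close> is
    zero.\<close>
  let ?B = "mult_const (modulus A) * hnorm A a + 1"
  have nn: "0 \<le> mult_const (modulus A) * hnorm A a" using a mult_const_pos by simp
  show "0 < ?B" using nn by linarith
  fix p q
  have c: "s p \<in> carrier F" "s q \<in> carrier F" using Fq.CS_closed[OF s] by auto
  have "free_norm A X (a \<odot>\<^bsub>F\<^esub> s p \<ominus>\<^bsub>F\<^esub> a \<odot>\<^bsub>F\<^esub> s q) = free_norm A X (a \<odot>\<^bsub>F\<^esub> (s p \<ominus>\<^bsub>F\<^esub> s q))"
    using additive_minus[OF F.abelian_group_axioms F.abelian_group_axioms additive_smult[OF a] c] by simp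
  also have "\<dots> \<le> mult_const (modulus A) * hnorm A a * free_norm A X (s p \<ominus>\<^bsub>F\<^esub> s q)"
    using a c by (intro free_norm_smult) auto
  also have "\<dots> \<le> ?B * (free_norm A X (s p \<ominus>\<^bsub>F\<^esub> s q) + free_norm A X (s p \<ominus>\<^bsub>F\<^esub> s q))"
    using nn c by (intro mult_mono) auto
  finally show "free_norm A X (a \<odot>\<^bsub>F\<^esub> s p \<ominus>\<^bsub>F\<^esub> a \<odot>\<^bsub>F\<^esub> s q)
      \<le> ?B * (free_norm A X (s p \<ominus>\<^bsub>F\<^esub> s q) + free_norm A X (s p \<ominus>\<^bsub>F\<^esub> s q))" .
qed (use a Fq.CS_closed[OF s] in auto)

lemma null_smult:
  assumes a: "a \<in> carrier A" and s: "\<And>n. s n \<in> carrier F" "Fq.null s"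
  shows "Fq.null (\<lambda>n. a \<odot>\<^bsub>F\<^esub> s n)"
  unfolding Fq.null_def
proof (rule tendsto_0_squeeze)
  show "(\<lambda>n. mult_const (modulus A) * hnorm A a * free_norm A X (s n)) \<longlonglongrightarrow> 0"
    using s(2) unfolding Fq.null_def by (auto intro!: tendsto_eq_intros)
qed (use a s free_norm_smult in auto)

lemma cl_smult:
  assumes a: "a \<in> carrier A" and s: "s \<in> CF"
  shows "a \<odot>\<^bsub>E\<^esub> cl s = cl (\<lambda>n. a \<odot>\<^bsub>F\<^esub> s n)"
proof -
  have "null_rel F `` {\<lambda>n. a \<odot>\<^bsub>F\<^esub> t n} = null_rel F `` {\<lambda>n. a \<odot>\<^bsub>F\<^esub> s n}"
    if "t \<in> CF" "Fq.null (\<lambda>n. s n \<ominus>\<^bsub>F\<^esub> t n)" for t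
  proof (rule class_eqI[symmetric])
    have c: "s n \<in> carrier F" "t n \<in> carrier F" for n using Fq.CS_closed that s by auto
    show "Fq.null (\<lambda>n. a \<odot>\<^bsub>F\<^esub> s n \<ominus>\<^bsub>F\<^esub> a \<odot>\<^bsub>F\<^esub> t n)"
      using null_smult[OF a _ that(2)] c
        additive_minus[OF F.abelian_group_axioms F.abelian_group_axioms additive_smult[OF a] c] by simp
  qed (use that s a CF_smult in auto)
  then have "(\<Union>t\<in>null_rel F `` {s}. null_rel F `` {\<lambda>n. a \<odot>\<^bsub>F\<^esub> t n}) = null_rel F `` {\<lambda>n. a \<odot>\<^bsub>F\<^esub> s n}"
    using s by (intro Union_class_const) auto
  then show ?thesis
    using s by (simp add: ell_simps reps_cl_class) (simp add: ell_raw_def completion_def cl_def)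
qed

lemma mnorm_cl:
  assumes "s \<in> CF"
  shows "mnorm E (cl s) = Inf {r. \<exists>t\<in>CF. cl t = cl s \<and> (\<lambda>n. free_norm A X (t n)) \<longlonglongrightarrow> r}"
proof -
  have "mnorm E (cl s) = Inf {r. \<exists>t\<in>ell_reps \<U> A X (cl s). (\<lambda>n. free_norm A X (t n)) \<longlonglongrightarrow> r}"
    by (simp add: ell_simps) (simp add: ell_raw_def completion_def)
  then show ?thesis using assms by (simp add: reps_cl conj_assoc Bex_def)
qed

lemma ell_qcompletion:
  "qcompletion F (free_norm A X) (modulus_norm (modulus A)) (quasi_const (modulus A)) E cl (mnorm E)"
  by (rule qcompletion.intro[OF F_qnorm], unfold_locales)
    (auto simp: carrier_cl cl_eq_iff cl_add mnorm_cl,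
     simp add: ell_simps ell_raw_def completion_def cl_def)

end

sublocale ell_halo \<subseteq> E: qcompletion F "free_norm A X" "modulus_norm (modulus A)"
    "quasi_const (modulus A)" "ell \<U> A X" cl "mnorm (ell \<U> A X)"
  by (rule ell_qcompletion)

section \<open>Generators, scalar multiplication and linear extensions\<close>

context ell_halo
begin

abbreviation "\<eta> \<equiv> ell_unit \<U> A X"

lemma unit_cl: "x \<in> P \<Longrightarrow> \<eta> x = E.cst (sgl \<one> x)"
  by (simp add: ell_unit_def cl_def delta_sgl)

lemma smult_cst: "a \<in> carrier A \<Longrightarrow> u \<in> carrier F \<Longrightarrow> a \<odot>\<^bsub>E\<^esub> E.cst u = E.cst (a \<odot>\<^bsub>F\<^esub> u)"
  by (rule cl_smult) auto

lemma unit_closed: "x \<in> P \<Longrightarrow> \<eta> x \<in> carrier E"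
  by (simp add: unit_cl sgl_closed)

lemma smult_unit: "a \<in> carrier A \<Longrightarrow> x \<in> P \<Longrightarrow> a \<odot>\<^bsub>E\<^esub> \<eta> x = E.cst (sgl a x)"
  by (simp add: unit_cl smult_cst smult_sgl sgl_closed)

lemma E_module: "module A E"
proof (rule moduleI[OF is_cring E.E_abelian_group])
  fix a b u assume ab: "a \<in> carrier A" "b \<in> carrier A" and "u \<in> carrier E"
  then obtain s where s: "s \<in> CF" "u = cl s" by (auto elim: E.E_cases)
  note c = E.CS_closed[OF s(1)]
  show "a \<odot>\<^bsub>E\<^esub> u \<in> carrier E" using ab s by (simp add: cl_smult CF_smult)
  show "(a \<oplus> b) \<odot>\<^bsub>E\<^esub> u = a \<odot>\<^bsub>E\<^esub> u \<oplus>\<^bsub>E\<^esub> b \<odot>\<^bsub>E\<^esub> u"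
    using ab s c by (simp add: cl_smult CF_smult E.cls_add F.smult_l_distr)
  show "(a \<otimes> b) \<odot>\<^bsub>E\<^esub> u = a \<odot>\<^bsub>E\<^esub> (b \<odot>\<^bsub>E\<^esub> u)"
    using ab s c by (simp add: cl_smult CF_smult F.smult_assoc1)
  fix v assume "v \<in> carrier E"
  then obtain t where t: "t \<in> CF" "v = cl t" by (auto elim: E.E_cases)
  show "a \<odot>\<^bsub>E\<^esub> (u \<oplus>\<^bsub>E\<^esub> v) = a \<odot>\<^bsub>E\<^esub> u \<oplus>\<^bsub>E\<^esub> a \<odot>\<^bsub>E\<^esub> v"
    using ab s c t E.CS_closed[OF t(1)] by (simp add: cl_smult CF_smult E.cls_add E.CS_add F.smult_r_distr)
next
  fix u assume "u \<in> carrier E"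
  then obtain s where s: "s \<in> CF" "u = cl s" by (auto elim: E.E_cases)
  then show "\<one> \<odot>\<^bsub>E\<^esub> u = u" using E.CS_closed[OF s(1)] by (simp add: cl_smult)
qed

lemma mnorm_smult:
  assumes a: "a \<in> carrier A" and u: "u \<in> carrier E"
  shows "mnorm E (a \<odot>\<^bsub>E\<^esub> u) \<le> mult_const (modulus A) * hnorm A a * mnorm E u"
proof -
  obtain S R where S: "\<And>k. S k \<in> CF" "\<And>k. cl (S k) = u" "\<And>k. (\<lambda>n. free_norm A X (S k n)) \<longlonglongrightarrow> R k"
    "\<And>k. 0 \<le> R k" "R \<longlonglongrightarrow> mnorm E u"
    by (rule E.NE_approx[OF u]) blast
  have "mnorm E (a \<odot>\<^bsub>E\<^esub> u) \<le> mult_const (modulus A) * hnorm A a * R k" for k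
  proof -
    have "mnorm E (cl (\<lambda>n. a \<odot>\<^bsub>F\<^esub> S k n)) \<le> mult_const (modulus A) * hnorm A a * R k"
      by (rule E.NE_le[OF CF_smult[OF a S(1)] free_norm_smult[OF a E.CS_closed[OF S(1)]]
            tendsto_mult_left[OF S(3)]])
    then show ?thesis using cl_smult[OF a S(1), of k] by (simp add: S(2))
  qed
  then show ?thesis
    by (intro LIMSEQ_le_const[OF tendsto_mult_left[OF S(5)]]) auto
qed

lemma mnorm_smult_unit:
  assumes "a \<in> carrier A" "x \<in> P"
  shows "mnorm E (a \<odot>\<^bsub>E\<^esub> \<eta> x) \<le> hnorm A a * nrm X x"
  using E.NE_cst_le[of "sgl a x"] free_norm_sgl[OF assms] assms by (simp add: smult_unit sgl_closed)

lemma mnorm_unit: "x \<in> P \<Longrightarrow> mnorm E (\<eta> x) \<le> nrm X x"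
  using E.NE_cst_le[of "sgl \<one> x"] free_norm_sgl[of \<one> x] mult_right_mono[OF hnorm_one_le nrm_nonneg[of x]]
  by (simp add: unit_cl sgl_closed)

text \<open>The elements \<open>a{x}\<close> generate the free module additively. Only additivity is
  assumed of the two maps, so that maps that are semilinear over a change of halo are
  covered.\<close>

lemma additive_eqI:
  assumes H: "banach_group H N' m' K'"
    and F1: "additive_map E H f" "\<And>y. y \<in> carrier E \<Longrightarrow> N' (f y) \<le> b * mnorm E y"
    and F2: "additive_map E H f'" "\<And>y. y \<in> carrier E \<Longrightarrow> N' (f' y) \<le> b' * mnorm E y"
    and eq: "\<And>a x. a \<in> carrier A \<Longrightarrow> x \<in> P \<Longrightarrow> f (a \<odot>\<^bsub>E\<^esub> \<eta> x) = f' (a \<odot>\<^bsub>E\<^esub> \<eta> x)"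
    and y: "y \<in> carrier E"
  shows "f y = f' y"
proof (rule E.bounded_additive_eqI[OF H F1 F2 _ y])
  interpret H: banach_group H N' m' K' by fact
  fix u assume u: "u \<in> carrier F"
  show "f (E.cst u) = f' (E.cst u)"
    by (rule additive_free_eqI[OF H.abelian_group_axioms additive_comp[OF E.cst_additive F1(1)]
          additive_comp[OF E.cst_additive F2(1)] _ u])
      (use eq smult_unit in auto)
qed

text \<open>Links the definite description in \<open>lin_ext\<close> with the characterization by
  generators. The value \<open>f y\<close> has the required limit property for every representative
  by continuity of \<open>f\<close>; for uniqueness a single representative suffices, as limits in
  \<open>M\<close> are unique.\<close>

lemma lin_ext_eqI:
  fixes M :: "('b, 'v) normed_module" and \<phi> :: "'u \<Rightarrow> 'b"
  assumes M: "banach_group M (mnorm M) m' K'"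
    and f: "additive_map E M f" "\<And>y. y \<in> carrier E \<Longrightarrow> mnorm M (f y) \<le> b * mnorm E y"
    and gen: "\<And>a x. a \<in> carrier A \<Longrightarrow> x \<in> P \<Longrightarrow> f (a \<odot>\<^bsub>E\<^esub> \<eta> x) = \<phi> a \<odot>\<^bsub>M\<^esub> h x"
    and y: "y \<in> carrier E"
  shows "lin_ext \<U> \<phi> A X M h y = f y"
proof -
  interpret M: banach_group M "mnorm M" m' K' by fact
  have ac: "additive_map F M (\<lambda>u. f (E.cst u))" by (rule additive_comp[OF E.cst_additive f(1)])
  have g: "additive_map F M (\<lambda>u. \<Oplus>\<^bsub>M\<^esub>x\<in>supp u. f (E.cst (sgl (u x) x)))"
    "\<And>a x. a \<in> carrier A \<Longrightarrow> x \<in> P \<Longrightarrow>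
      (\<Oplus>\<^bsub>M\<^esub>y\<in>supp (sgl a x). f (E.cst (sgl (sgl a x y) y))) = f (E.cst (sgl a x))"
    using additive_lin[OF M.abelian_group_axioms, of "\<lambda>a x. f (E.cst (sgl a x))"]
      additive_closed[OF ac] additive_add[OF ac] by (auto simp: sgl_add sgl_closed)
  have sum: "(\<Oplus>\<^bsub>M\<^esub>x\<in>supp u. \<phi> (u x) \<odot>\<^bsub>M\<^esub> h x) = f (E.cst u)" if u: "u \<in> carrier F" for u
  proof -
    have "\<phi> (u x) \<odot>\<^bsub>M\<^esub> h x = f (E.cst (sgl (u x) x))" if "x \<in> supp u" for x
      using gen[of "u x" x] smult_unit[of "u x" x] F_D(1)[OF u] that by (auto simp: support_def)
    then have "(\<Oplus>\<^bsub>M\<^esub>x\<in>supp u. \<phi> (u x) \<odot>\<^bsub>M\<^esub> h x) = (\<Oplus>\<^bsub>M\<^esub>x\<in>supp u. f (E.cst (sgl (u x) x)))"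
      using additive_closed[OF ac] F_D(1)[OF u] by (intro M.finsum_cong') (auto simp: support_def sgl_closed)
    also have "\<dots> = f (E.cst u)"
      by (rule additive_free_eqI[OF M.abelian_group_axioms g(1) ac g(2) u])
    finally show ?thesis .
  qed
  have reps: "s \<in> CF" "u = cl s" if "s \<in> ell_reps \<U> A X u" "u \<in> carrier E" for s u
    using that by (auto simp: reps_cl elim!: E.E_cases)
  obtain s where s: "s \<in> CF" "y = cl s" using y by (rule E.E_cases)
  have "(THE z. z \<in> carrier M \<and> (\<forall>s\<in>ell_reps \<U> A X y.
        (\<lambda>n. mnorm M ((\<Oplus>\<^bsub>M\<^esub>x\<in>supp (s n). \<phi> (s n x) \<odot>\<^bsub>M\<^esub> h x) \<ominus>\<^bsub>M\<^esub> z)) \<longlonglongrightarrow> 0)) = f y"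
  proof (rule the_equality)
    show "f y \<in> carrier M \<and> (\<forall>s\<in>ell_reps \<U> A X y.
        (\<lambda>n. mnorm M ((\<Oplus>\<^bsub>M\<^esub>x\<in>supp (s n). \<phi> (s n x) \<odot>\<^bsub>M\<^esub> h x) \<ominus>\<^bsub>M\<^esub> f y)) \<longlonglongrightarrow> 0)"
    proof (intro conjI ballI)
      show "f y \<in> carrier M" using additive_closed[OF f(1) y] .
      fix t assume "t \<in> ell_reps \<U> A X y"
      then have t: "t \<in> CF" "y = cl t" using reps y by auto
      show "(\<lambda>n. mnorm M ((\<Oplus>\<^bsub>M\<^esub>x\<in>supp (t n). \<phi> (t n x) \<odot>\<^bsub>M\<^esub> h x) \<ominus>\<^bsub>M\<^esub> f y)) \<longlonglongrightarrow> 0"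
        using E.bounded_additive_tends[OF M.qnorm_axioms f t(1)] sum[OF E.CS_closed[OF t(1)]] t(2) by simp
    qed
    fix z assume z: "z \<in> carrier M \<and> (\<forall>s\<in>ell_reps \<U> A X y.
        (\<lambda>n. mnorm M ((\<Oplus>\<^bsub>M\<^esub>x\<in>supp (s n). \<phi> (s n x) \<odot>\<^bsub>M\<^esub> h x) \<ominus>\<^bsub>M\<^esub> z)) \<longlonglongrightarrow> 0)"
    have "s \<in> ell_reps \<U> A X y" using s by (simp add: reps_cl)
    with z have "(\<lambda>n. mnorm M ((\<Oplus>\<^bsub>M\<^esub>x\<in>supp (s n). \<phi> (s n x) \<odot>\<^bsub>M\<^esub> h x) \<ominus>\<^bsub>M\<^esub> z)) \<longlonglongrightarrow> 0"
      by blast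
    then have "M.tends (\<lambda>n. f (E.cst (s n))) z"
      unfolding M.tends_def sum[OF E.CS_closed[OF s(1)]] .
    moreover have "M.tends (\<lambda>n. f (E.cst (s n))) (f y)"
      using E.bounded_additive_tends[OF M.qnorm_axioms f s(1)] s(2) by (simp add: M.tends_def)
    ultimately show "z = f y"
      using z additive_closed[OF f(1)] y E.CS_closed[OF s(1)]
      by (intro M.tends_eq[of "\<lambda>n. f (E.cst (s n))"]) auto
  qed
  then show ?thesis using y by (simp add: lin_ext_def)
qed

text \<open>The norm of the target obeys the modulus \<open>M'\<close>. Through \<open>le\<close> it
  also obeys the modulus of \<open>A\<close>, which is what the universal property of the free norm
  requires; this is where the order of the moduli in a morphism of halos is used.\<close>

lemma extension:
  assumes H: "banach_group H N' (modulus_norm M') K'"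
    and le: "\<And>r s. 0 \<le> r \<Longrightarrow> 0 \<le> s \<Longrightarrow> modulus_norm M' r s \<le> modulus_norm (modulus A) r s"
    and g: "\<And>x a. x \<in> P \<Longrightarrow> a \<in> carrier A \<Longrightarrow> g a x \<in> carrier H"
      "\<And>x a b. x \<in> P \<Longrightarrow> a \<in> carrier A \<Longrightarrow> b \<in> carrier A \<Longrightarrow> g (a \<oplus> b) x = g a x \<oplus>\<^bsub>H\<^esub> g b x"
      "\<And>x a. x \<in> P \<Longrightarrow> a \<in> carrier A \<Longrightarrow> N' (g a x) \<le> c * (hnorm A a * nrm X x)"
    and c: "0 \<le> c"
  shows "\<exists>f. additive_map E H f \<and> (\<forall>a\<in>carrier A. \<forall>x\<in>P. f (a \<odot>\<^bsub>E\<^esub> \<eta> x) = g a x) \<and>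
    (\<forall>y\<in>carrier E. N' (f y) \<le> modulus_norm M' (c * mnorm E y) 0)"
proof -
  interpret H: banach_group H N' "modulus_norm M'" K' by fact
  note lin = additive_lin[OF H.abelian_group_axioms, of g, OF g(1,2)]
  have "N' (\<Oplus>\<^bsub>H\<^esub>x\<in>supp u. g (u x) x) \<le> c * free_norm A X u" if u: "u \<in> carrier F" for u
  proof (rule free_norm_universal[OF H.abelian_group_axioms lin(1) c _ _ _ _ u])
    fix y z assume "y \<in> carrier H" "z \<in> carrier H"
    then show "N' (y \<oplus>\<^bsub>H\<^esub> z) \<le> modulus_norm (modulus A) (N' y) (N' z)"
      using H.N_add[of y z] le[of "N' y" "N' z"] by simp
  qed (use g lin(2) in auto)
  from E.extension_exists[OF H lin(1) c this]
  obtain f where f: "additive_map E H f" "\<forall>u\<in>carrier F. f (E.cst u) = (\<Oplus>\<^bsub>H\<^esub>x\<in>supp u. g (u x) x)"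
      "\<forall>y\<in>carrier E. N' (f y) \<le> modulus_norm M' (c * mnorm E y) 0"
    by auto
  then have "f (a \<odot>\<^bsub>E\<^esub> \<eta> x) = g a x" if "a \<in> carrier A" "x \<in> P" for a x
    using that lin(2)[of a x] by (simp add: smult_unit sgl_closed)
  then show ?thesis using f by blast
qed

lemma E_banach: "banach_group E (mnorm E) (modulus_norm (modulus A)) (quasi_const (modulus A))"
  by (rule E.E.banach_group_axioms)

text \<open>Over a point of norm 1 the coefficient is recovered from the element with two losses:
  \<open>neg_const\<close> for taking a coordinate in the free module, and
  \<open>modulus_norm _ _ 0\<close> for the passage to the completion.\<close>

lemma coefficient_le:
  assumes "a \<in> carrier A" "x \<in> P" "nrm X x = 1"
  shows "symnorm a \<le> neg_const (modulus A) * modulus_norm (modulus A) (mnorm E (a \<odot>\<^bsub>E\<^esub> \<eta> x)) 0"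
proof -
  have "symnorm a \<le> neg_const (modulus A) * free_norm A X (sgl a x)"
    using coord_le[of "sgl a x" x] assms by (simp add: sgl_app sgl_closed)
  also have "\<dots> \<le> neg_const (modulus A) * modulus_norm (modulus A) (mnorm E (E.cst (sgl a x))) 0"
    using neg_const_ge_1[of "modulus A"] assms
    by (intro mult_left_mono E.N_le_cst) (auto simp: sgl_closed)
  finally show ?thesis using assms by (simp add: smult_unit)
qed

lemma smult_unit_inj:
  assumes x: "x \<in> P" "nrm X x = 1" and ab: "a \<in> carrier A" "b \<in> carrier A"
    and eq: "a \<odot>\<^bsub>E\<^esub> \<eta> x = b \<odot>\<^bsub>E\<^esub> \<eta> x"
  shows "a = b"
proof -
  interpret Em: module A E by (rule E_module)
  have m: "additive_map A E (\<lambda>a. a \<odot>\<^bsub>E\<^esub> \<eta> x)"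
    using unit_closed[OF x(1)] by (simp add: additive_map_def Em.smult_l_distr)
  have "(a \<ominus> b) \<odot>\<^bsub>E\<^esub> \<eta> x = \<zero>\<^bsub>E\<^esub>"
    using additive_minus[OF abelian_group_axioms E.E_abelian_group m ab] eq
      unit_closed[OF x(1)] ab by simp
  then have "symnorm (a \<ominus> b) \<le> neg_const (modulus A) * modulus_norm (modulus A) 0 0"
    using coefficient_le[of "a \<ominus> b" x] x ab by simp
  also have "\<dots> \<le> neg_const (modulus A) * (neg_const (modulus A) * 0)"
    using neg_const_ge_1[of "modulus A"] is_modulus
    by (intro mult_left_mono modulus_norm_zero_left) auto
  finally have "symnorm (a \<ominus> b) \<le> 0" by simp
  then have "hnorm A (a \<ominus> b) = 0"
    using hnorm_le_symnorm[of "a \<ominus> b"] hnorm_nonneg[OF minus_closed[OF ab]] by linarith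
  then have "a \<ominus> b = \<zero>" using ab by (simp add: hnorm_eq_0_iff)
  then show ?thesis
    using qnorm.add_minus_cancel[OF sym_qnorm ab] ab by simp
qed

text \<open>A norm at least 1 lets the free norm control the coefficient, so the coefficients of a
  Cauchy sequence form a Cauchy sequence in \<open>A\<close>. Its limit, which exists by
  completeness of \<open>A\<close>, is the coefficient sought.\<close>

lemma singleton_representation:
  assumes X: "P = {x}" "1 \<le> nrm X x" and y: "y \<in> carrier E"
  shows "\<exists>a\<in>carrier A. y = a \<odot>\<^bsub>E\<^esub> \<eta> x"
proof -
  obtain s where s: "s \<in> CF" "y = cl s" using y by (rule E.E_cases)
  have c: "s n \<in> carrier F" for n using E.CS_closed[OF s(1)] .
  have sx: "s n x \<in> carrier A" "s n = sgl (s n x) x" for n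
    using F_D(1)[OF c] X by (auto intro!: F_eqI c simp: sgl_app sgl_closed)
  have coord: "hnorm A (u x) \<le> neg_const (modulus A) * free_norm A X u" if "u \<in> carrier F" for u
  proof -
    have u: "u x \<in> carrier A" using F_D(1)[OF that] X by simp
    then have "symnorm (u x) * 1 \<le> symnorm (u x) * nrm X x"
      using X symnorm_nonneg by (intro mult_left_mono) auto
    then show ?thesis using coord_le[OF that, of x] hnorm_le_symnorm[of "u x"] X by simp
  qed
  have minus: "(u \<ominus>\<^bsub>F\<^esub> v) x = u x \<ominus> v x" if "u \<in> carrier F" "v \<in> carrier F" for u v
    using additive_minus[OF F.abelian_group_axioms abelian_group_axioms additive_coord[of x] that] X by simp
  have "(\<lambda>n. s n x) \<in> cauchy_seqs A (hnorm A)"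
    unfolding cauchy_seqs_def
  proof (intro CollectI conjI allI impI)
    fix e :: real assume "0 < e"
    then have "0 < e / neg_const (modulus A)" using neg_const_ge_1[of "modulus A"] by simp
    then obtain k where k: "\<forall>p\<ge>k. \<forall>q\<ge>k. free_norm A X (s p \<ominus>\<^bsub>F\<^esub> s q) < e / neg_const (modulus A)"
      using E.CS_D[OF s(1)] by blast
    have "hnorm A (s p x \<ominus> s q x) < e" if "p \<ge> k" "q \<ge> k" for p q
    proof -
      have "hnorm A (s p x \<ominus> s q x) \<le> neg_const (modulus A) * free_norm A X (s p \<ominus>\<^bsub>F\<^esub> s q)"
        using coord[of "s p \<ominus>\<^bsub>F\<^esub> s q"] c minus by simp
      also have "\<dots> < neg_const (modulus A) * (e / neg_const (modulus A))"
        using k that neg_const_ge_1[of "modulus A"] by (intro mult_strict_left_mono) auto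
      finally show ?thesis using neg_const_ge_1[of "modulus A"] by simp
    qed
    then show "\<exists>k. \<forall>m\<ge>k. \<forall>n\<ge>k. hnorm A (s m x \<ominus> s n x) < e" by blast
  qed (use sx(1) in auto)
  then have "\<exists>a\<in>carrier A. (\<lambda>n. hnorm A (s n x \<ominus> a)) \<longlonglongrightarrow> 0"
    using halo bspec[of "cauchy_seqs A (hnorm A)" _ "\<lambda>n. s n x"]
    by (simp only: banach_halo_def complete_for_def)
  then obtain a where a: "a \<in> carrier A" "(\<lambda>n. hnorm A (s n x \<ominus> a)) \<longlonglongrightarrow> 0"
    by (elim bexE)
  have xP: "x \<in> P" using X by simp
  have "(\<lambda>n. free_norm A X (s n \<ominus>\<^bsub>F\<^esub> sgl a x)) \<longlonglongrightarrow> 0"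
  proof (rule tendsto_0_squeeze)
    show "(\<lambda>n. hnorm A (s n x \<ominus> a) * nrm X x) \<longlonglongrightarrow> 0" using a(2) by (auto intro!: tendsto_eq_intros)
    fix n
    have "s n \<ominus>\<^bsub>F\<^esub> sgl a x = sgl (s n x \<ominus> a) x"
      using additive_minus[OF abelian_group_axioms F.abelian_group_axioms additive_sgl[OF xP] sx(1) a(1), of n]
        arg_cong[OF sx(2), of "\<lambda>u. u \<ominus>\<^bsub>F\<^esub> sgl a x" n] by simp
    then show "free_norm A X (s n \<ominus>\<^bsub>F\<^esub> sgl a x) \<le> hnorm A (s n x \<ominus> a) * nrm X x"
      using free_norm_sgl[of "s n x \<ominus> a" x] sx(1) a X by simp
  qed (use c a in \<open>auto simp: sgl_closed\<close>)
  then have "y = E.cst (sgl a x)"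
    using cl_eq_iff[OF s(1), of "\<lambda>n. sgl a x"] a s(2) by (simp add: E.null_def sgl_closed)
  then show ?thesis using a xP by (auto simp: smult_unit)
qed

lemma cst_ind:
  assumes "finite I" "I \<subseteq> P"
  shows "(\<Oplus>\<^bsub>E\<^esub>x\<in>I. \<eta> x) = E.cst (ind I)"
  using assms
proof (induction I)
  case empty
  have "ind {} = \<zero>\<^bsub>F\<^esub>"
    by (rule F_eqI[OF ind_closed F.zero_closed]) (auto simp: ind_def F_zero_app)
  then show ?case by (simp add: E.cls_zero)
next
  case (insert x I)
  have "ind (insert x I) = ind {x} \<oplus>\<^bsub>F\<^esub> ind I"
    using insert ind_Un[of "{x}" I] by simp
  moreover have "(\<Oplus>\<^bsub>E\<^esub>x\<in>insert x I. \<eta> x) = \<eta> x \<oplus>\<^bsub>E\<^esub> (\<Oplus>\<^bsub>E\<^esub>x\<in>I. \<eta> x)"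
    using insert unit_closed by (intro E.E.finsum_insert) auto
  ultimately show ?case
    using insert additive_add[OF E.cst_additive, of "sgl \<one> x" "ind I"]
    by (simp add: ind_singleton unit_cl sgl_closed ind_closed)
qed

lemma unit_sum_upper:
  assumes I: "I \<subseteq> P" "\<And>x. x \<in> I \<Longrightarrow> nrm X x = 1" "card I = 2 ^ k"
  shows "mnorm E (\<Oplus>\<^bsub>E\<^esub>x\<in>I. \<eta> x) \<le> growth (modulus A) ^ k"
proof -
  have "finite I" using I(3) by (rule_tac card_ge_0_finite) simp
  then show ?thesis
    using ind_upper[OF I] E.NE_cst_le[OF ind_closed, of I] I(1) by (simp add: cst_ind)
qed

text \<open>The factor \<open>quasi_const\<close> is the price of passing from the free module to
  its completion.\<close>

lemma unit_sum_lower: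
  assumes "\<one> \<noteq> \<zero>" and I: "I \<subseteq> P" "\<And>x. x \<in> I \<Longrightarrow> nrm X x = 1" "card I = 2 ^ k"
  shows "growth (modulus A) ^ k \<le>
    growth (modulus A) * neg_const (modulus A) * quasi_const (modulus A) * mnorm E (\<Oplus>\<^bsub>E\<^esub>x\<in>I. \<eta> x)"
proof -
  have fin: "finite I" using I(3) by (rule_tac card_ge_0_finite) simp
  have "growth (modulus A) ^ k \<le> growth (modulus A) * neg_const (modulus A) * free_norm A X (ind I)"
    by (rule ind_lower[OF assms])
  also have "\<dots> \<le> growth (modulus A) * neg_const (modulus A) * (quasi_const (modulus A) * mnorm E (E.cst (ind I)))"
    using growth_gt_0 neg_const_ge_1[of "modulus A"] by (intro mult_left_mono E.cst_le ind_closed fin) auto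
  finally show ?thesis using fin I(1) by (simp add: cst_ind mult.assoc)
qed

lemma empty_carrier: "P = {} \<Longrightarrow> carrier E = {\<zero>\<^bsub>E\<^esub>}"
proof -
  assume "P = {}"
  then have z: "u = \<zero>\<^bsub>F\<^esub>" if "u \<in> carrier F" for u using that by (intro F_eqI) auto
  have "y = \<zero>\<^bsub>E\<^esub>" if y: "y \<in> carrier E" for y
  proof -
    obtain s where s: "s \<in> CF" "y = cl s" using y by (rule E.E_cases)
    have "s = (\<lambda>n. \<zero>\<^bsub>F\<^esub>)" using z[OF E.CS_closed[OF s(1)]] by (simp add: fun_eq_iff)
    then show ?thesis using s(2) E.cls_zero by simp
  qed
  then show ?thesis by auto
qed

end

section \<open>Functors and monads on normed sets\<close>

lemma is_functor_id: "is_category C \<Longrightarrow> is_functor C C id_functor"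
  by (auto simp: is_functor_def id_functor_def)

lemma is_functor_comp:
  assumes F: "is_functor C D F" and G: "is_functor D E G"
  shows "is_functor C E (comp_functor G F)"
  using F G by (simp add: is_functor_def comp_functor_def)

lemma compose_eq_iff:
  "compose S g f = compose S g' f' \<longleftrightarrow> (\<forall>x\<in>S. g (f x) = g' (f' x))"
  by (auto simp: compose_def fun_eq_iff restrict_def)

lemma compose_eq_restrict_iff:
  "compose S g f = restrict k S \<longleftrightarrow> (\<forall>x\<in>S. g (f x) = k x)"
  by (auto simp: compose_def fun_eq_iff restrict_def)

lemma compose_eq_extensional_iff:
  "k \<in> extensional S \<Longrightarrow> compose S g f = k \<longleftrightarrow> (\<forall>x\<in>S. g (f x) = k x)"
  by (auto simp: compose_def fun_eq_iff restrict_def extensional_def)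

lemma bounded_map_cong:
  "(\<And>x. x \<in> X \<Longrightarrow> NX x = NX' x) \<Longrightarrow> (\<And>x. x \<in> X \<Longrightarrow> NY (f x) = NY' (f' x)) \<Longrightarrow>
    bounded_map \<Sigma> X NX NY f = bounded_map \<Sigma> X NX' NY' f'"
  by (cases \<Sigma>) auto

lemma bounded_map_Short: "(\<And>x. x \<in> X \<Longrightarrow> NY (f x) \<le> NX x) \<Longrightarrow> bounded_map \<Sigma> X NX NY f"
  by (cases \<Sigma>) (auto intro!: exI[where x = 1])

lemma bounded_map_D: "bounded_map \<Sigma> X NX NY f \<Longrightarrow> \<exists>c\<ge>0. \<forall>x\<in>X. NY (f x) \<le> c * NX x"
  by (cases \<Sigma>) (auto intro!: exI[where x = 1])

lemma bounded_map_comp: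
  assumes "bounded_map \<Sigma> X NX NY f" "bounded_map \<Sigma> Y NY NZ g" "f \<in> X \<rightarrow> Y"
  shows "bounded_map \<Sigma> X NX NZ (\<lambda>x. g (f x))"
proof (cases \<Sigma>)
  case Short
  have "NZ (g (f x)) \<le> NX x" if "x \<in> X" for x
  proof -
    have "NZ (g (f x)) \<le> NY (f x)" using assms Short that by auto
    also have "\<dots> \<le> NX x" using assms Short that by auto
    finally show ?thesis .
  qed
  then show ?thesis using Short by simp
next
  case Lipschitz
  obtain c where c: "0 \<le> c" "\<And>x. x \<in> X \<Longrightarrow> NY (f x) \<le> c * NX x" using assms(1) Lipschitz by auto
  obtain d where d: "0 \<le> d" "\<And>x. x \<in> Y \<Longrightarrow> NZ (g x) \<le> d * NY x" using assms(2) Lipschitz by auto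
  have "NZ (g (f x)) \<le> (d * c) * NX x" if "x \<in> X" for x
  proof -
    have "NZ (g (f x)) \<le> d * NY (f x)" using d assms(3) that by auto
    also have "\<dots> \<le> d * (c * NX x)" using c d that by (intro mult_left_mono) auto
    finally show ?thesis by (simp add: mult.assoc)
  qed
  then show ?thesis using c(1) d(1) Lipschitz by (auto intro!: exI[where x = "d * c"])
qed

lemma normed_sets_D:
  assumes "X \<in> normed_sets \<U>"
  shows "pts X \<in> \<U>" "x \<in> pts X \<Longrightarrow> 0 \<le> nrm X x" "nrm X \<in> extensional (pts X)"
  using assms by (auto simp: normed_sets_def PiE_def)

section \<open>The category of normed sets\<close>

locale nsets =
  fixes \<Sigma> :: kind and \<U> :: "'u set set"
begin

abbreviation "\<C> \<equiv> NSets \<Sigma> \<U>"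

lemma C_simps:
  "obj \<C> = normed_sets \<U>"
  "idt \<C> X = (\<lambda>x\<in>pts X. x)"
  "comp \<C> X Y Z g f = compose (pts X) g f"
  "hom \<C> X Y = {f \<in> pts X \<rightarrow>\<^sub>E pts Y. bounded_map \<Sigma> (pts X) (nrm X) (nrm Y) f}"
  by (simp_all add: NSets_def)

lemma hom_app: "f \<in> hom \<C> X Y \<Longrightarrow> x \<in> pts X \<Longrightarrow> f x \<in> pts Y"
  by (auto simp: C_simps)

lemma hom_ext: "f \<in> hom \<C> X Y \<Longrightarrow> f \<in> extensional (pts X)"
  by (auto simp: C_simps PiE_def)

lemma hom_eqI: "f \<in> hom \<C> X Y \<Longrightarrow> g \<in> hom \<C> X Y' \<Longrightarrow> (\<And>x. x \<in> pts X \<Longrightarrow> f x = g x) \<Longrightarrow> f = g"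
  by (rule extensionalityI[of _ "pts X"]) (auto simp: hom_ext)

lemma hom_comp:
  assumes "f \<in> hom \<C> X Y" "g \<in> hom \<C> Y Z"
  shows "compose (pts X) g f \<in> hom \<C> X Z"
proof -
  have "bounded_map \<Sigma> (pts X) (nrm X) (nrm Z) (compose (pts X) g f)
      = bounded_map \<Sigma> (pts X) (nrm X) (nrm Z) (\<lambda>x. g (f x))"
    by (rule bounded_map_cong) (auto simp: compose_def)
  moreover have "bounded_map \<Sigma> (pts X) (nrm X) (nrm Z) (\<lambda>x. g (f x))"
    by (rule bounded_map_comp[where Y = "pts Y" and NY = "nrm Y"]) (use assms in \<open>auto simp: C_simps\<close>)
  ultimately show ?thesis using assms by (auto simp: C_simps compose_def)
qed

lemma hom_idt: "idt \<C> X \<in> hom \<C> X X"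
  by (auto simp: C_simps intro!: bounded_map_Short)

lemma C_category: "is_category \<C>"
  unfolding is_category_def
proof (intro conjI ballI)
  fix W X Y Z f g h assume "f \<in> hom \<C> W X" "g \<in> hom \<C> X Y" "h \<in> hom \<C> Y Z"
  then show "comp \<C> W Y Z h (comp \<C> W X Y g f) = comp \<C> W X Z (comp \<C> X Y Z h g) f"
    by (auto simp: C_simps compose_def fun_eq_iff)
next
  fix X Y f assume "f \<in> hom \<C> X Y"
  then show "comp \<C> X X Y f (idt \<C> X) = f" "comp \<C> X Y Y (idt \<C> Y) f = f"
    by (auto simp: C_simps compose_eq_extensional_iff PiE_def)
qed (use hom_idt hom_comp in \<open>auto simp: C_simps(3)\<close>)

text \<open>\<open>is_functor\<close> spelled out on points: equations between extensional maps
  become equations between values, which is the form in which they are proved and used.\<close>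

definition functor_laws :: "('u normed_set, 'u \<Rightarrow> 'u, 'u normed_set, 'u \<Rightarrow> 'u) cat_functor \<Rightarrow> bool" where
  "functor_laws F \<longleftrightarrow>
    (\<forall>X\<in>normed_sets \<U>. fobj F X \<in> normed_sets \<U>) \<and>
    (\<forall>X\<in>normed_sets \<U>. \<forall>Y\<in>normed_sets \<U>. \<forall>f\<in>hom \<C> X Y. fmap F X Y f \<in> hom \<C> (fobj F X) (fobj F Y)) \<and>
    (\<forall>X\<in>normed_sets \<U>. \<forall>u\<in>pts (fobj F X). fmap F X X (idt \<C> X) u = u) \<and>
    (\<forall>X\<in>normed_sets \<U>. \<forall>Y\<in>normed_sets \<U>. \<forall>Z\<in>normed_sets \<U>. \<forall>f\<in>hom \<C> X Y. \<forall>g\<in>hom \<C> Y Z.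
      \<forall>u\<in>pts (fobj F X). fmap F X Z (compose (pts X) g f) u = fmap F Y Z g (fmap F X Y f u))"

lemma is_functor_iff: "is_functor \<C> \<C> F \<longleftrightarrow> functor_laws F"
proof
  assume "is_functor \<C> \<C> F"
  then have F: "\<And>X. X \<in> normed_sets \<U> \<Longrightarrow> fobj F X \<in> normed_sets \<U>"
    "\<And>X Y f. X \<in> normed_sets \<U> \<Longrightarrow> Y \<in> normed_sets \<U> \<Longrightarrow> f \<in> hom \<C> X Y \<Longrightarrow>
      fmap F X Y f \<in> hom \<C> (fobj F X) (fobj F Y)"
    "\<And>X. X \<in> normed_sets \<U> \<Longrightarrow> fmap F X X (idt \<C> X) = idt \<C> (fobj F X)"
    "\<And>X Y Z f g. X \<in> normed_sets \<U> \<Longrightarrow> Y \<in> normed_sets \<U> \<Longrightarrow> Z \<in> normed_sets \<U> \<Longrightarrow>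
      f \<in> hom \<C> X Y \<Longrightarrow> g \<in> hom \<C> Y Z \<Longrightarrow>
      fmap F X Z (compose (pts X) g f) = compose (pts (fobj F X)) (fmap F Y Z g) (fmap F X Y f)"
    unfolding is_functor_def C_simps(1,3) by blast+
  show "functor_laws F"
    unfolding functor_laws_def
  proof (intro conjI ballI F(1,2))
    fix X u assume X: "X \<in> normed_sets \<U>" and u: "u \<in> pts (fobj F X)"
    show "fmap F X X (idt \<C> X) u = u" unfolding F(3)[OF X] using u by (simp add: C_simps(2))
    fix Y Z f g
    assume "Y \<in> normed_sets \<U>" "Z \<in> normed_sets \<U>" "f \<in> hom \<C> X Y" "g \<in> hom \<C> Y Z"
    from F(4)[OF X this] show "fmap F X Z (compose (pts X) g f) u = fmap F Y Z g (fmap F X Y f u)"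
      using u by (simp add: compose_eq)
  qed
next
  assume F: "functor_laws F"
  have h: "fmap F X Y f \<in> hom \<C> (fobj F X) (fobj F Y)"
    if "X \<in> normed_sets \<U>" "Y \<in> normed_sets \<U>" "f \<in> hom \<C> X Y" for X Y f
    using F that by (simp add: functor_laws_def)
  show "is_functor \<C> \<C> F"
    unfolding is_functor_def C_simps(1)
  proof (intro conjI ballI C_category h)
    fix X assume X: "X \<in> normed_sets \<U>"
    show "fobj F X \<in> normed_sets \<U>" using F X by (simp add: functor_laws_def)
    show "fmap F X X (idt \<C> X) = idt \<C> (fobj F X)"
      by (rule hom_eqI[OF h[OF X X hom_idt] hom_idt]) (use F X in \<open>simp add: functor_laws_def C_simps(2)\<close>)
    fix Y Z f g
    assume YZ: "Y \<in> normed_sets \<U>" "Z \<in> normed_sets \<U>" and fg: "f \<in> hom \<C> X Y" "g \<in> hom \<C> Y Z"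
    show "fmap F X Z (comp \<C> X Y Z g f) =
        comp \<C> (fobj F X) (fobj F Y) (fobj F Z) (fmap F Y Z g) (fmap F X Y f)"
      unfolding C_simps(3)
      by (rule hom_eqI[OF h[OF X YZ(2) hom_comp[OF fg]] hom_comp[OF h[OF X YZ(1) fg(1)] h[OF YZ fg(2)]]])
        (use F X YZ fg in \<open>simp add: functor_laws_def compose_def\<close>)
  qed auto
qed

lemma functor_laws_D:
  assumes "functor_laws F"
  shows "X \<in> normed_sets \<U> \<Longrightarrow> fobj F X \<in> normed_sets \<U>"
    "X \<in> normed_sets \<U> \<Longrightarrow> Y \<in> normed_sets \<U> \<Longrightarrow> f \<in> hom \<C> X Y \<Longrightarrow>
      fmap F X Y f \<in> hom \<C> (fobj F X) (fobj F Y)"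
    "X \<in> normed_sets \<U> \<Longrightarrow> u \<in> pts (fobj F X) \<Longrightarrow> fmap F X X (idt \<C> X) u = u"
    "X \<in> normed_sets \<U> \<Longrightarrow> Y \<in> normed_sets \<U> \<Longrightarrow> Z \<in> normed_sets \<U> \<Longrightarrow> f \<in> hom \<C> X Y \<Longrightarrow>
      g \<in> hom \<C> Y Z \<Longrightarrow> u \<in> pts (fobj F X) \<Longrightarrow>
      fmap F X Z (compose (pts X) g f) u = fmap F Y Z g (fmap F X Y f u)"
  using assms by (simp_all add: functor_laws_def)

lemma nat_trans_iff:
  "nat_trans \<C> \<C> F G \<theta> \<longleftrightarrow> functor_laws F \<and> functor_laws G \<and>
    (\<forall>X\<in>normed_sets \<U>. \<theta> X \<in> hom \<C> (fobj F X) (fobj G X)) \<and>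
    (\<forall>X\<in>normed_sets \<U>. \<forall>Y\<in>normed_sets \<U>. \<forall>f\<in>hom \<C> X Y. \<forall>u\<in>pts (fobj F X).
      \<theta> Y (fmap F X Y f u) = fmap G X Y f (\<theta> X u))"
  unfolding nat_trans_def is_functor_iff C_simps(1,3) compose_eq_iff by blast

definition monad_laws :: "('u normed_set, 'u \<Rightarrow> 'u) monad \<Rightarrow> bool" where
  "monad_laws T \<longleftrightarrow> functor_laws (endo T) \<and>
    (\<forall>X\<in>normed_sets \<U>. eta T X \<in> hom \<C> X (fobj (endo T) X)) \<and>
    (\<forall>X\<in>normed_sets \<U>. \<forall>Y\<in>normed_sets \<U>. \<forall>f\<in>hom \<C> X Y. \<forall>x\<in>pts X.
      eta T Y (f x) = fmap (endo T) X Y f (eta T X x)) \<and>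
    (\<forall>X\<in>normed_sets \<U>. mu T X \<in> hom \<C> (fobj (endo T) (fobj (endo T) X)) (fobj (endo T) X)) \<and>
    (\<forall>X\<in>normed_sets \<U>. \<forall>Y\<in>normed_sets \<U>. \<forall>f\<in>hom \<C> X Y. \<forall>v\<in>pts (fobj (endo T) (fobj (endo T) X)).
      mu T Y (fmap (endo T) (fobj (endo T) X) (fobj (endo T) Y) (fmap (endo T) X Y f) v) =
      fmap (endo T) X Y f (mu T X v)) \<and>
    (\<forall>X\<in>normed_sets \<U>. \<forall>w\<in>pts (fobj (endo T) (fobj (endo T) (fobj (endo T) X))).
      mu T X (mu T (fobj (endo T) X) w) =
      mu T X (fmap (endo T) (fobj (endo T) (fobj (endo T) X)) (fobj (endo T) X) (mu T X) w)) \<and>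
    (\<forall>X\<in>normed_sets \<U>. \<forall>u\<in>pts (fobj (endo T) X).
      mu T X (eta T (fobj (endo T) X) u) = u \<and>
      mu T X (fmap (endo T) X (fobj (endo T) X) (eta T X) u) = u)"

lemma functor_laws_comp:
  assumes "functor_laws F"
  shows "functor_laws (comp_functor F F)"
  using is_functor_comp assms unfolding is_functor_iff[symmetric] by blast

lemma functor_laws_id: "functor_laws id_functor"
  using is_functor_id[OF C_category] unfolding is_functor_iff .

lemma is_monad_iff: "is_monad \<C> T \<longleftrightarrow> monad_laws T"
  unfolding is_monad_def nat_trans_iff monad_laws_def Let_def C_simps(1-3) compose_eq_iff
    compose_eq_restrict_iff
  using functor_laws_id functor_laws_comp[of "endo T"]
  by (auto simp: id_functor_def comp_functor_def)

definition monad_morphism_laws ::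
  "('u normed_set, 'u \<Rightarrow> 'u) monad \<Rightarrow> ('u normed_set, 'u \<Rightarrow> 'u) monad \<Rightarrow> ('u normed_set \<Rightarrow> 'u \<Rightarrow> 'u) \<Rightarrow> bool"
where
  "monad_morphism_laws S T \<theta> \<longleftrightarrow>
    (\<forall>X\<in>normed_sets \<U>. \<theta> X \<in> hom \<C> (fobj (endo S) X) (fobj (endo T) X)) \<and>
    (\<forall>X\<in>normed_sets \<U>. \<forall>Y\<in>normed_sets \<U>. \<forall>f\<in>hom \<C> X Y. \<forall>u\<in>pts (fobj (endo S) X).
      \<theta> Y (fmap (endo S) X Y f u) = fmap (endo T) X Y f (\<theta> X u)) \<and>
    (\<forall>X\<in>normed_sets \<U>. \<forall>x\<in>pts X. \<theta> X (eta S X x) = eta T X x) \<and>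
    (\<forall>X\<in>normed_sets \<U>. \<forall>v\<in>pts (fobj (endo S) (fobj (endo S) X)).
      \<theta> X (mu S X v) = mu T X (\<theta> (fobj (endo T) X)
        (fmap (endo S) (fobj (endo S) X) (fobj (endo T) X) (\<theta> X) v)))"

lemma is_monad_morphism_iff:
  assumes S: "monad_laws S" and T: "monad_laws T"
  shows "is_monad_morphism \<C> S T \<theta> \<longleftrightarrow> monad_morphism_laws S T \<theta>"
proof -
  have ext: "eta T X \<in> extensional (pts X)" if "X \<in> normed_sets \<U>" for X
    using T that hom_ext by (auto simp: monad_laws_def)
  have cc: "compose Q m (compose Q g f) = compose Q m (\<lambda>x. g (f x))" for Q and m g f :: "'u \<Rightarrow> 'u"
    by (auto simp: compose_def fun_eq_iff)
  have u: "compose (pts X) (\<theta> X) (eta S X) = eta T X \<longleftrightarrow> (\<forall>x\<in>pts X. \<theta> X (eta S X x) = eta T X x)"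
    if "X \<in> normed_sets \<U>" for X
    by (rule compose_eq_extensional_iff[OF ext[OF that]])
  have SD: "functor_laws (endo S)" and TD: "functor_laws (endo T)"
    using S T by (simp_all add: monad_laws_def)
  show ?thesis
    unfolding is_monad_morphism_def nat_trans_iff monad_morphism_laws_def Let_def C_simps(1,3) cc
      compose_eq_iff
    using SD TD u by auto
qed

section \<open>The category of monads\<close>

lemma Monads_simps:
  "obj (Monads \<C>) = {T. monad_laws T}"
  "idt (Monads \<C>) T = (\<lambda>X\<in>normed_sets \<U>. \<lambda>u\<in>pts (fobj (endo T) X). u)"
  "comp (Monads \<C>) R S T \<theta> \<zeta> = (\<lambda>X\<in>normed_sets \<U>. compose (pts (fobj (endo R) X)) (\<theta> X) (\<zeta> X))"
  by (simp_all add: Monads_def is_monad_iff C_simps(1-3))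

lemma Monads_hom:
  "monad_laws S \<Longrightarrow> monad_laws T \<Longrightarrow>
    hom (Monads \<C>) S T = {\<theta> \<in> extensional (normed_sets \<U>). monad_morphism_laws S T \<theta>}"
  by (simp add: Monads_def C_simps(1) is_monad_morphism_iff)

lemma monad_morphism_comp:
  assumes R: "monad_laws R" and S: "monad_laws S" and T: "monad_laws T"
    and \<zeta>: "monad_morphism_laws R S \<zeta>" and \<theta>: "monad_morphism_laws S T \<theta>"
  shows "monad_morphism_laws R T (\<lambda>X\<in>normed_sets \<U>. compose (pts (fobj (endo R) X)) (\<theta> X) (\<zeta> X))"
proof -
  let ?N = "normed_sets \<U>"
  have fR: "functor_laws (endo R)" and fS: "functor_laws (endo S)" and fT: "functor_laws (endo T)"
    using R S T by (simp_all add: monad_laws_def)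
  have etaR: "eta R X \<in> hom \<C> X (fobj (endo R) X)" and muR: "mu R X \<in> hom \<C> (fobj (endo R) (fobj (endo R) X)) (fobj (endo R) X)"
    if "X \<in> ?N" for X using R that by (simp_all add: monad_laws_def)
  have zh: "\<zeta> X \<in> hom \<C> (fobj (endo R) X) (fobj (endo S) X)"
    and th: "\<theta> X \<in> hom \<C> (fobj (endo S) X) (fobj (endo T) X)" if "X \<in> ?N" for X
    using \<zeta> \<theta> that by (simp_all add: monad_morphism_laws_def)
  have zn: "\<zeta> Y (fmap (endo R) X Y f u) = fmap (endo S) X Y f (\<zeta> X u)"
    if "X \<in> ?N" "Y \<in> ?N" "f \<in> hom \<C> X Y" "u \<in> pts (fobj (endo R) X)" for X Y f u
    using \<zeta> that by (simp add: monad_morphism_laws_def)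
  have tn: "\<theta> Y (fmap (endo S) X Y f u) = fmap (endo T) X Y f (\<theta> X u)"
    if "X \<in> ?N" "Y \<in> ?N" "f \<in> hom \<C> X Y" "u \<in> pts (fobj (endo S) X)" for X Y f u
    using \<theta> that by (simp add: monad_morphism_laws_def)
  have hc: "compose (pts (fobj (endo R) X)) (\<theta> X) (\<zeta> X) \<in> hom \<C> (fobj (endo R) X) (fobj (endo T) X)"
    if "X \<in> ?N" for X using hom_comp[OF zh th] that by blast
  show ?thesis
    unfolding monad_morphism_laws_def
  proof (intro conjI ballI)
    fix X assume X: "X \<in> ?N"
    then show "(\<lambda>X\<in>?N. compose (pts (fobj (endo R) X)) (\<theta> X) (\<zeta> X)) X
        \<in> hom \<C> (fobj (endo R) X) (fobj (endo T) X)" using hc by simp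
    fix x assume "x \<in> pts X"
    then show "(\<lambda>X\<in>?N. compose (pts (fobj (endo R) X)) (\<theta> X) (\<zeta> X)) X (eta R X x) = eta T X x"
      using X hom_app[OF etaR[OF X]] \<zeta> \<theta> by (simp add: compose_def monad_morphism_laws_def)
  next
    fix X Y f u
    assume X: "X \<in> ?N" and Y: "Y \<in> ?N" and f: "f \<in> hom \<C> X Y" and u: "u \<in> pts (fobj (endo R) X)"
    have "\<zeta> X u \<in> pts (fobj (endo S) X)" "fmap (endo R) X Y f u \<in> pts (fobj (endo R) Y)"
      using hom_app[OF zh[OF X] u] hom_app[OF functor_laws_D(2)[OF fR X Y f] u] .
    then show "(\<lambda>X\<in>?N. compose (pts (fobj (endo R) X)) (\<theta> X) (\<zeta> X)) Y (fmap (endo R) X Y f u) =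
        fmap (endo T) X Y f ((\<lambda>X\<in>?N. compose (pts (fobj (endo R) X)) (\<theta> X) (\<zeta> X)) X u)"
      using X Y u by (simp add: compose_def zn[OF X Y f u] tn[OF X Y f])
  next
    fix X v assume X: "X \<in> ?N" and v: "v \<in> pts (fobj (endo R) (fobj (endo R) X))"
    let ?RX = "fobj (endo R) X" and ?SX = "fobj (endo S) X" and ?TX = "fobj (endo T) X"
    note N = functor_laws_D(1)[OF fR X] functor_laws_D(1)[OF fS X] functor_laws_D(1)[OF fT X]
    let ?Rz = "fmap (endo R) ?RX ?SX (\<zeta> X) v"
    have Rz: "?Rz \<in> pts (fobj (endo R) ?SX)"
      by (rule hom_app[OF functor_laws_D(2)[OF fR N(1,2) zh[OF X]] v])
    have Rc: "fmap (endo R) ?RX ?TX (compose (pts ?RX) (\<theta> X) (\<zeta> X)) v = fmap (endo R) ?SX ?TX (\<theta> X) ?Rz"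
      by (rule functor_laws_D(4)[OF fR N(1,2,3) zh[OF X] th[OF X] v])
    have Rt: "fmap (endo R) ?SX ?TX (\<theta> X) ?Rz \<in> pts (fobj (endo R) ?TX)"
      by (rule hom_app[OF functor_laws_D(2)[OF fR N(2,3) th[OF X]] Rz])
    have "\<theta> X (\<zeta> X (mu R X v)) = \<theta> X (mu S X (\<zeta> ?SX ?Rz))"
      using \<zeta> X v by (simp add: monad_morphism_laws_def)
    also have "\<dots> = mu T X (\<theta> ?TX (fmap (endo S) ?SX ?TX (\<theta> X) (\<zeta> ?SX ?Rz)))"
      using \<theta> X hom_app[OF zh[OF N(2)] Rz] by (simp add: monad_morphism_laws_def)
    \<comment> \<open>Naturality of \<open>\<zeta>\<close> at the map \<open>\<theta> X\<close> lets
      the two transformations change places.\<close>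
    also have "fmap (endo S) ?SX ?TX (\<theta> X) (\<zeta> ?SX ?Rz) = \<zeta> ?TX (fmap (endo R) ?SX ?TX (\<theta> X) ?Rz)"
      by (rule zn[OF N(2,3) th[OF X] Rz, symmetric])
    finally show "(\<lambda>X\<in>?N. compose (pts (fobj (endo R) X)) (\<theta> X) (\<zeta> X)) X (mu R X v) =
        mu T X ((\<lambda>X\<in>?N. compose (pts (fobj (endo R) X)) (\<theta> X) (\<zeta> X)) ?TX
          (fmap (endo R) ?RX ?TX ((\<lambda>X\<in>?N. compose (pts (fobj (endo R) X)) (\<theta> X) (\<zeta> X)) X) v))"
      using X N Rt hom_app[OF muR[OF X] v] by (simp add: Rc compose_eq)
  qed
qed

text \<open>Equality of the records would be too much to ask: they may differ at junk arguments outside the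
  category.\<close>

definition monad_agree ::
  "('u normed_set, 'u \<Rightarrow> 'u) monad \<Rightarrow> ('u normed_set, 'u \<Rightarrow> 'u) monad \<Rightarrow> bool" where
  "monad_agree S T \<longleftrightarrow>
    (\<forall>X\<in>normed_sets \<U>. fobj (endo S) X = fobj (endo T) X) \<and>
    (\<forall>X\<in>normed_sets \<U>. \<forall>Y\<in>normed_sets \<U>. \<forall>f\<in>hom \<C> X Y. fmap (endo S) X Y f = fmap (endo T) X Y f) \<and>
    (\<forall>X\<in>normed_sets \<U>. eta S X = eta T X \<and> mu S X = mu T X)"

lemma monad_agree_morphism:
  assumes S: "monad_laws S" and ST: "monad_agree S T"
  shows "monad_morphism_laws S T (idt (Monads \<C>) S)"
proof -
  have fS: "functor_laws (endo S)" using S by (simp add: monad_laws_def)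
  have etaS: "eta S X \<in> hom \<C> X (fobj (endo S) X)"
    and muS: "mu S X \<in> hom \<C> (fobj (endo S) (fobj (endo S) X)) (fobj (endo S) X)"
    if "X \<in> normed_sets \<U>" for X using S that by (simp_all add: monad_laws_def)
  have eq: "fobj (endo T) X = fobj (endo S) X" "eta T X = eta S X" "mu T X = mu S X" if "X \<in> normed_sets \<U>" for X
    using ST that by (auto simp: monad_agree_def)
  have eqm: "fmap (endo T) X Y f = fmap (endo S) X Y f"
    if "X \<in> normed_sets \<U>" "Y \<in> normed_sets \<U>" "f \<in> hom \<C> X Y" for X Y f
    using ST that by (simp add: monad_agree_def)
  show ?thesis
    unfolding monad_morphism_laws_def Monads_simps
  proof (intro conjI ballI)
    fix X assume X: "X \<in> normed_sets \<U>"
    have "(\<lambda>u\<in>pts (fobj (endo S) X). u) \<in> hom \<C> (fobj (endo S) X) (fobj (endo S) X)"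
      using hom_idt[of "fobj (endo S) X"] by (simp add: C_simps(2))
    then show "(\<lambda>X\<in>normed_sets \<U>. \<lambda>u\<in>pts (fobj (endo S) X). u) X \<in> hom \<C> (fobj (endo S) X) (fobj (endo T) X)"
      using X by (simp add: eq)
    fix x assume "x \<in> pts X"
    then show "(\<lambda>X\<in>normed_sets \<U>. \<lambda>u\<in>pts (fobj (endo S) X). u) X (eta S X x) = eta T X x"
      using X hom_app[OF etaS[OF X]] by (simp add: eq)
  next
    fix X Y f u
    assume X: "X \<in> normed_sets \<U>" "Y \<in> normed_sets \<U>" "f \<in> hom \<C> X Y" and u: "u \<in> pts (fobj (endo S) X)"
    then show "(\<lambda>X\<in>normed_sets \<U>. \<lambda>u\<in>pts (fobj (endo S) X). u) Y (fmap (endo S) X Y f u) =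
        fmap (endo T) X Y f ((\<lambda>X\<in>normed_sets \<U>. \<lambda>u\<in>pts (fobj (endo S) X). u) X u)"
      using hom_app[OF functor_laws_D(2)[OF fS X] u] by (simp add: eqm)
  next
    fix X v assume X: "X \<in> normed_sets \<U>" and v: "v \<in> pts (fobj (endo S) (fobj (endo S) X))"
    let ?SX = "fobj (endo S) X"
    have N: "?SX \<in> normed_sets \<U>" by (rule functor_laws_D(1)[OF fS X])
    have "fmap (endo S) ?SX ?SX (idt \<C> ?SX) v = v" by (rule functor_laws_D(3)[OF fS N v])
    then show "(\<lambda>X\<in>normed_sets \<U>. \<lambda>u\<in>pts (fobj (endo S) X). u) X (mu S X v) =
        mu T X ((\<lambda>X\<in>normed_sets \<U>. \<lambda>u\<in>pts (fobj (endo S) X). u) (fobj (endo T) X)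
          (fmap (endo S) ?SX (fobj (endo T) X) ((\<lambda>X\<in>normed_sets \<U>. \<lambda>u\<in>pts (fobj (endo S) X). u) X) v))"
      using X N v hom_app[OF muS[OF X] v] by (simp add: eq C_simps(2))
  qed
qed

lemma monad_agree_refl: "monad_agree T T"
  by (simp add: monad_agree_def)

lemma Monads_category: "is_category (Monads \<C>)"
  unfolding is_category_def Monads_simps(1)
proof (intro conjI ballI; unfold mem_Collect_eq)
  fix T assume "monad_laws T"
  then show "idt (Monads \<C>) T \<in> hom (Monads \<C>) T T"
    using monad_agree_morphism[OF _ monad_agree_refl] by (simp add: Monads_hom) (simp add: Monads_simps)
next
  fix R S T \<zeta> \<theta>
  assume "monad_laws R" "monad_laws S" "monad_laws T" "\<zeta> \<in> hom (Monads \<C>) R S" "\<theta> \<in> hom (Monads \<C>) S T"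
  then show "comp (Monads \<C>) R S T \<theta> \<zeta> \<in> hom (Monads \<C>) R T"
    using monad_morphism_comp[of R S T \<zeta> \<theta>] by (simp add: Monads_hom Monads_simps(3))
next
  fix S T \<theta> assume "monad_laws S" "monad_laws T" "\<theta> \<in> hom (Monads \<C>) S T"
  then have \<theta>: "\<theta> \<in> extensional (normed_sets \<U>)"
    "\<And>X. X \<in> normed_sets \<U> \<Longrightarrow> \<theta> X \<in> hom \<C> (fobj (endo S) X) (fobj (endo T) X)"
    by (auto simp: Monads_hom monad_morphism_laws_def)
  have "compose (pts (fobj (endo S) X)) (\<theta> X) (\<lambda>u\<in>pts (fobj (endo S) X). u) = \<theta> X"
    "compose (pts (fobj (endo S) X)) (\<lambda>u\<in>pts (fobj (endo T) X). u) (\<theta> X) = \<theta> X"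
    if "X \<in> normed_sets \<U>" for X
    using hom_ext[OF \<theta>(2)[OF that]] hom_app[OF \<theta>(2)[OF that]] by (simp_all add: compose_eq_extensional_iff)
  then show "comp (Monads \<C>) S S T \<theta> (idt (Monads \<C>) S) = \<theta>" "comp (Monads \<C>) S T T (idt (Monads \<C>) T) \<theta> = \<theta>"
    using \<theta>(1) by (auto simp: Monads_simps(2,3) intro!: extensionalityI[of _ "normed_sets \<U>"])
next
  fix Q R S T \<xi> \<zeta> \<theta>
  assume "monad_laws Q" "monad_laws R" "\<xi> \<in> hom (Monads \<C>) Q R"
  then have "\<And>X. X \<in> normed_sets \<U> \<Longrightarrow> \<xi> X \<in> hom \<C> (fobj (endo Q) X) (fobj (endo R) X)"
    by (auto simp: Monads_hom monad_morphism_laws_def)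
  from hom_app[OF this]
  show "comp (Monads \<C>) Q S T \<theta> (comp (Monads \<C>) Q R S \<zeta> \<xi>) =
      comp (Monads \<C>) Q R T (comp (Monads \<C>) R S T \<theta> \<zeta>) \<xi>"
    by (auto simp: Monads_simps(3) compose_def fun_eq_iff)
qed

text \<open>Agreeing monads have literally the same objects, arrows, units and multiplications
  inside the category, so the family of identities is a morphism in both directions and its own
  inverse.\<close>

lemma monad_agree_iso:
  assumes S: "monad_laws S" and T: "monad_laws T" and ST: "monad_agree S T"
  shows "is_iso (Monads \<C>) S T (idt (Monads \<C>) S)"
proof -
  have TS: "monad_agree T S" using ST by (simp add: monad_agree_def)
  have eq: "idt (Monads \<C>) T = idt (Monads \<C>) S"
    using ST by (auto simp: Monads_simps monad_agree_def fun_eq_iff)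
  have "idt (Monads \<C>) S \<in> hom (Monads \<C>) S T" "idt (Monads \<C>) S \<in> hom (Monads \<C>) T S"
    using monad_agree_morphism[OF S ST] monad_agree_morphism[OF T TS] S T
    unfolding eq by (simp_all add: Monads_hom) (simp_all add: Monads_simps)
  moreover have "comp (Monads \<C>) S T S (idt (Monads \<C>) S) (idt (Monads \<C>) S) = idt (Monads \<C>) S"
    "comp (Monads \<C>) T S T (idt (Monads \<C>) S) (idt (Monads \<C>) S) = idt (Monads \<C>) T"
    using ST by (auto simp: Monads_simps compose_def fun_eq_iff monad_agree_def)
  ultimately show ?thesis unfolding is_iso_def by blast
qed

end

section \<open>The functor from halos to monads\<close>

text \<open>The bound \<open>b\<close> is left free because it serves only continuity. The sharper
  statement that short data extend to short maps is kept apart, in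
  \<open>lin_ext_bounded\<close>.\<close>

definition semilin ::
  "'a halo \<Rightarrow> ('a, 'm) normed_module \<Rightarrow> ('a \<Rightarrow> 'b) \<Rightarrow> ('b, 'n) normed_module \<Rightarrow> ('m \<Rightarrow> 'n) \<Rightarrow> bool" where
  "semilin A M \<phi> H f \<longleftrightarrow> additive_map M H f \<and>
    (\<exists>b\<ge>0. \<forall>y\<in>carrier M. mnorm H (f y) \<le> b * mnorm M y) \<and>
    (\<forall>a\<in>carrier A. \<forall>y\<in>carrier M. f (a \<odot>\<^bsub>M\<^esub> y) = \<phi> a \<odot>\<^bsub>H\<^esub> f y)"

lemma semilin_additive: "semilin A M \<phi> H f \<Longrightarrow> additive_map M H f"
  by (simp add: semilin_def)

lemma semilin_closed: "semilin A M \<phi> H f \<Longrightarrow> y \<in> carrier M \<Longrightarrow> f y \<in> carrier H"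
  using semilin_additive additive_closed by metis

lemma semilin_smult:
  "semilin A M \<phi> H f \<Longrightarrow> a \<in> carrier A \<Longrightarrow> y \<in> carrier M \<Longrightarrow> f (a \<odot>\<^bsub>M\<^esub> y) = \<phi> a \<odot>\<^bsub>H\<^esub> f y"
  by (simp add: semilin_def)

lemma semilin_bound: "semilin A M \<phi> H f \<Longrightarrow> \<exists>b\<ge>0. \<forall>y\<in>carrier M. mnorm H (f y) \<le> b * mnorm M y"
  by (simp add: semilin_def)

lemma semilin_id: "(\<And>a. a \<in> carrier A \<Longrightarrow> \<phi> a = a) \<Longrightarrow> semilin A M \<phi> M (\<lambda>u. u)"
  by (auto simp: semilin_def additive_map_def intro!: exI[where x = 1])

lemma semilin_comp:
  assumes f: "semilin A M \<phi> H f" and g: "semilin B H \<psi> G g" and \<phi>: "\<And>a. a \<in> carrier A \<Longrightarrow> \<phi> a \<in> carrier B"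
    and \<chi>: "\<And>a. a \<in> carrier A \<Longrightarrow> \<chi> a = \<psi> (\<phi> a)"
  shows "semilin A M \<chi> G (\<lambda>u. g (f u))"
  unfolding semilin_def
proof (intro conjI ballI)
  show "additive_map M G (\<lambda>u. g (f u))"
    by (rule additive_comp[OF semilin_additive[OF f] semilin_additive[OF g]])
  obtain b where b: "0 \<le> b" "\<And>y. y \<in> carrier M \<Longrightarrow> mnorm H (f y) \<le> b * mnorm M y"
    using semilin_bound[OF f] by blast
  obtain c where c: "0 \<le> c" "\<And>y. y \<in> carrier H \<Longrightarrow> mnorm G (g y) \<le> c * mnorm H y"
    using semilin_bound[OF g] by blast
  have "mnorm G (g (f y)) \<le> (c * b) * mnorm M y" if "y \<in> carrier M" for y
  proof -
    have "mnorm G (g (f y)) \<le> c * mnorm H (f y)" using c semilin_closed[OF f that] by blast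
    also have "\<dots> \<le> c * (b * mnorm M y)" using b that c by (intro mult_left_mono) auto
    finally show ?thesis by (simp add: mult.assoc)
  qed
  then show "\<exists>b\<ge>0. \<forall>y\<in>carrier M. mnorm G (g (f y)) \<le> b * mnorm M y"
    using b(1) c(1) by (intro exI[where x = "c * b"]) auto
  fix a y assume "a \<in> carrier A" "y \<in> carrier M"
  then show "g (f (a \<odot>\<^bsub>M\<^esub> y)) = \<chi> a \<odot>\<^bsub>G\<^esub> g (f y)"
    using f g \<phi> \<chi> semilin_closed[OF f] by (simp add: semilin_smult[OF f] semilin_smult[OF g])
qed

section \<open>Semilinear extension of maps from the generators\<close>

locale lambda_ctx = nsets \<Sigma> \<U> for \<Sigma> and \<U> :: "'u set set" +
  assumes universe: "universe \<U>"
begin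

abbreviation "\<H> \<equiv> obj (CBanhalos \<Sigma> \<U>)"
abbreviation "\<N> \<equiv> normed_sets \<U>"
abbreviation "L A X \<equiv> normed_set_of (ell \<U> A X)"
abbreviation "\<delta> A X \<equiv> ell_unit \<U> A X"

lemma halo_D:
  assumes "A \<in> \<H>"
  shows "chalo A \<Sigma>" "carrier A \<in> \<U>"
  using assms by (auto simp: CBanhalos_def intro: chalo.intro chalo_axioms.intro)

lemma ell_haloI: "A \<in> \<H> \<Longrightarrow> X \<in> \<N> \<Longrightarrow> ell_halo A \<Sigma> X \<U>"
  using halo_D[of A] normed_sets_D[of X \<U>] universe
  by (intro ell_halo.intro free_halo.intro free_halo_axioms.intro ell_halo_axioms.intro) auto

lemma pts_L [simp]: "pts (L A X) = carrier (ell \<U> A X)"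
  by (simp add: normed_set_of_def)

lemma nrm_L: "u \<in> carrier (ell \<U> A X) \<Longrightarrow> nrm (L A X) u = mnorm (ell \<U> A X) u"
  by (simp add: normed_set_of_def)

lemma L_N: assumes "A \<in> \<H>" "X \<in> \<N>" shows "L A X \<in> \<N>"
proof -
  interpret ell_halo A \<Sigma> X \<U> by (rule ell_haloI[OF assms])
  show ?thesis
    using carrier_E_small E.NE_nonneg by (auto simp: normed_sets_def normed_set_of_def)
qed

lemma ell_banach:
  assumes "A \<in> \<H>" "X \<in> \<N>"
  shows "banach_group (ell \<U> A X) (mnorm (ell \<U> A X)) (modulus_norm (modulus A)) (quasi_const (modulus A))"
  using ell_halo.E_banach[OF ell_haloI[OF assms]] .

lemma ell_module: "A \<in> \<H> \<Longrightarrow> X \<in> \<N> \<Longrightarrow> module A (ell \<U> A X)"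
  by (rule ell_halo.E_module[OF ell_haloI])

lemma unit_in: "A \<in> \<H> \<Longrightarrow> X \<in> \<N> \<Longrightarrow> x \<in> pts X \<Longrightarrow> \<delta> A X x \<in> carrier (ell \<U> A X)"
  by (rule ell_halo.unit_closed[OF ell_haloI])

lemma unit_hom:
  assumes "A \<in> \<H>" "X \<in> \<N>"
  shows "\<delta> A X \<in> hom \<C> X (L A X)"
proof -
  interpret ell_halo A \<Sigma> X \<U> by (rule ell_haloI[OF assms])
  have "\<delta> A X \<in> extensional (pts X)" by (simp add: ell_unit_def)
  then show ?thesis
    using unit_closed mnorm_unit
    by (auto simp: C_simps nrm_L PiE_def intro!: bounded_map_Short)
qed

lemma semilin_eqI:
  assumes A: "A \<in> \<H>" "X \<in> \<N>" and H: "banach_group H (mnorm H) m K"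
    and f: "semilin A (ell \<U> A X) \<phi> H f" and g: "semilin A (ell \<U> A X) \<phi> H g"
    and eq: "\<And>x. x \<in> pts X \<Longrightarrow> f (\<delta> A X x) = g (\<delta> A X x)" and u: "u \<in> carrier (ell \<U> A X)"
  shows "f u = g u"
proof -
  interpret ell_halo A \<Sigma> X \<U> by (rule ell_haloI[OF A])
  obtain b where b: "\<And>y. y \<in> carrier E \<Longrightarrow> mnorm H (f y) \<le> b * mnorm E y"
    using semilin_bound[OF f] by blast
  obtain c where c: "\<And>y. y \<in> carrier E \<Longrightarrow> mnorm H (g y) \<le> c * mnorm E y"
    using semilin_bound[OF g] by blast
  show ?thesis
    by (rule additive_eqI[OF H semilin_additive[OF f] b semilin_additive[OF g] c _ u])
      (use semilin_smult[OF f] semilin_smult[OF g] eq unit_closed in auto)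
qed

lemma lin_ext_semilin_eq:
  assumes A: "A \<in> \<H>" "X \<in> \<N>" and H: "banach_group H (mnorm H) m K"
    and f: "semilin A (ell \<U> A X) \<phi> H f" and h: "\<And>x. x \<in> pts X \<Longrightarrow> f (\<delta> A X x) = h x"
    and u: "u \<in> carrier (ell \<U> A X)"
  shows "lin_ext \<U> \<phi> A X H h u = f u"
proof -
  interpret ell_halo A \<Sigma> X \<U> by (rule ell_haloI[OF A])
  obtain b where b: "\<And>y. y \<in> carrier E \<Longrightarrow> mnorm H (f y) \<le> b * mnorm E y"
    using semilin_bound[OF f] by blast
  show ?thesis
    by (rule lin_ext_eqI[OF H semilin_additive[OF f] b _ u]) (use semilin_smult[OF f] h unit_closed in auto)
qed

definition halo_hom :: "('u \<Rightarrow> 'u) \<Rightarrow> 'u halo \<Rightarrow> 'u halo \<Rightarrow> bool" where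
  "halo_hom \<phi> A B \<longleftrightarrow> \<phi> \<in> ring_hom A B \<and> bounded_map \<Sigma> (carrier A) (hnorm A) (hnorm B) \<phi> \<and>
    modulus_le (modulus A) (modulus B)"

lemma halo_hom_id: "halo_hom (\<lambda>a. a) A A"
  by (auto simp: halo_hom_def ring_hom_def modulus_le_refl intro!: bounded_map_Short)

lemma hom_CBanhalos:
  "hom (CBanhalos \<Sigma> \<U>) A B = {f \<in> extensional (carrier A). halo_hom f A B}"
  by (auto simp: CBanhalos_def sigma_ring_hom_def halo_hom_def)

text \<open>The bound of the extension is the product of the constants of \<open>\<phi>\<close> and
  \<open>h\<close>, of the multiplicative constant of \<open>B\<close> and of one
  \<open>neg_const\<close> from the completion. All four are 1 in the short case, so short data
  extend to short maps. Semilinearity is derived after the additive extension exists.\<close>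

lemma lin_ext_main:
  assumes A: "A \<in> \<H>" "X \<in> \<N>" and B: "B \<in> \<H>" "Y \<in> \<N>"
    and \<phi>: "halo_hom \<phi> A B" and h: "h \<in> pts X \<rightarrow> carrier (ell \<U> B Y)"
      "bounded_map \<Sigma> (pts X) (nrm X) (mnorm (ell \<U> B Y)) h"
  shows lin_ext_semilin: "semilin A (ell \<U> A X) \<phi> (ell \<U> B Y) (lin_ext \<U> \<phi> A X (ell \<U> B Y) h)"
    and lin_ext_bounded: "bounded_map \<Sigma> (carrier (ell \<U> A X)) (mnorm (ell \<U> A X)) (mnorm (ell \<U> B Y))
      (lin_ext \<U> \<phi> A X (ell \<U> B Y) h)"
    and lin_ext_unit: "x \<in> pts X \<Longrightarrow> lin_ext \<U> \<phi> A X (ell \<U> B Y) h (\<delta> A X x) = h x"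
proof -
  interpret A: ell_halo A \<Sigma> X \<U> by (rule ell_haloI[OF A])
  interpret B: ell_halo B \<Sigma> Y \<U> by (rule ell_haloI[OF B])
  interpret Bm: module B "ell \<U> B Y" by (rule ell_module[OF B])
  interpret Am: module A "ell \<U> A X" by (rule ell_module[OF A])
  have \<phi>r: "\<phi> \<in> ring_hom A B" using \<phi> by (simp add: halo_hom_def)
  note \<phi>c = ring_hom_closed[OF \<phi>r] and \<phi>add = ring_hom_add[OF \<phi>r] and \<phi>one = ring_hom_one[OF \<phi>r]
  \<comment> \<open>For the short kind the constant has to be 1; a mere existential bound would lose
    this.\<close>
  obtain p where p: "0 \<le> p" "\<And>a. a \<in> carrier A \<Longrightarrow> hnorm B (\<phi> a) \<le> p * hnorm A a" "\<Sigma> = Short \<Longrightarrow> p = 1"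
    using \<phi> bounded_map_D[of \<Sigma> "carrier A" "hnorm A" "hnorm B" \<phi>] unfolding halo_hom_def
    by (cases \<Sigma>) auto
  obtain q where q: "0 \<le> q" "\<And>x. x \<in> pts X \<Longrightarrow> mnorm (ell \<U> B Y) (h x) \<le> q * nrm X x" "\<Sigma> = Short \<Longrightarrow> q = 1"
    using h(2) bounded_map_D[OF h(2)] by (cases \<Sigma>) auto
  let ?D = "mult_const (modulus B)"
  have hc: "h x \<in> carrier (ell \<U> B Y)" if "x \<in> pts X" for x using h(1) that by auto
  have D: "0 < ?D" by (rule B.mult_const_pos)
  have g: "mnorm (ell \<U> B Y) (\<phi> a \<odot>\<^bsub>ell \<U> B Y\<^esub> h x) \<le> (?D * p * q) * (hnorm A a * nrm X x)"
    if "x \<in> pts X" "a \<in> carrier A" for x a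
  proof -
    have "mnorm (ell \<U> B Y) (\<phi> a \<odot>\<^bsub>ell \<U> B Y\<^esub> h x) \<le> ?D * hnorm B (\<phi> a) * mnorm (ell \<U> B Y) (h x)"
      using that hc \<phi>c by (intro B.mnorm_smult) auto
    also have "\<dots> \<le> ?D * (p * hnorm A a) * (q * nrm X x)"
      using that p q D hc \<phi>c B.E.NE_nonneg by (intro mult_mono) auto
    finally show ?thesis by (simp add: mult_ac)
  qed
  have "\<exists>f. additive_map (ell \<U> A X) (ell \<U> B Y) f \<and>
      (\<forall>a\<in>carrier A. \<forall>x\<in>pts X. f (a \<odot>\<^bsub>ell \<U> A X\<^esub> \<delta> A X x) = \<phi> a \<odot>\<^bsub>ell \<U> B Y\<^esub> h x) \<and>
      (\<forall>y\<in>carrier (ell \<U> A X). mnorm (ell \<U> B Y) (f y)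
        \<le> modulus_norm (modulus B) ((?D * p * q) * mnorm (ell \<U> A X) y) 0)"
  proof (rule A.extension[OF ell_banach[OF B] _ _ _ g])
    show "modulus_norm (modulus B) r s \<le> modulus_norm (modulus A) r s" if "0 \<le> r" "0 \<le> s" for r s
      using \<phi> that by (intro modulus_norm_antimono[OF A.is_modulus B.is_modulus]) (simp_all add: halo_hom_def)
    show "0 \<le> ?D * p * q" using D p q by simp
  qed (use hc \<phi>c \<phi>add Bm.smult_l_distr in auto)
  then obtain f where f: "additive_map (ell \<U> A X) (ell \<U> B Y) f"
      "\<And>a x. a \<in> carrier A \<Longrightarrow> x \<in> pts X \<Longrightarrow> f (a \<odot>\<^bsub>ell \<U> A X\<^esub> \<delta> A X x) = \<phi> a \<odot>\<^bsub>ell \<U> B Y\<^esub> h x"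
      "\<And>y. y \<in> carrier (ell \<U> A X) \<Longrightarrow> mnorm (ell \<U> B Y) (f y)
        \<le> modulus_norm (modulus B) ((?D * p * q) * mnorm (ell \<U> A X) y) 0"
    by blast
  define b where "b = neg_const (modulus B) * (?D * p * q)"
  have b0: "0 \<le> b" using D p q neg_const_ge_1[of "modulus B"] by (simp add: b_def)
  have fb: "mnorm (ell \<U> B Y) (f y) \<le> b * mnorm (ell \<U> A X) y" if "y \<in> carrier (ell \<U> A X)" for y
  proof -
    have "modulus_norm (modulus B) ((?D * p * q) * mnorm (ell \<U> A X) y) 0
        \<le> neg_const (modulus B) * ((?D * p * q) * mnorm (ell \<U> A X) y)"
      using D p q A.E.NE_nonneg[OF that] by (intro modulus_norm_zero_right[OF B.is_modulus]) auto
    then show ?thesis using f(3)[OF that] by (simp add: b_def mult.assoc)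
  qed
  have b1: "b = 1" if "\<Sigma> = Short"
    using p(3) q(3) that B.is_modulus by (cases "modulus B") (auto simp: b_def)
  \<comment> \<open>Both sides are bounded additive maps of \<open>u\<close>, so it suffices to
    compare them on the elements \<open>c{x}\<close>, where the claim is multiplicativity of
    \<open>\<phi>\<close>.\<close>
  have fs: "f (a \<odot>\<^bsub>ell \<U> A X\<^esub> u) = \<phi> a \<odot>\<^bsub>ell \<U> B Y\<^esub> f u" if a: "a \<in> carrier A" and u: "u \<in> carrier (ell \<U> A X)" for a u
  proof (rule A.additive_eqI[OF ell_banach[OF B] _ _ _ _ _ u])
    show "additive_map (ell \<U> A X) (ell \<U> B Y) (\<lambda>u. f (a \<odot>\<^bsub>ell \<U> A X\<^esub> u))"
      using a additive_closed[OF f(1)] additive_add[OF f(1)] by (simp add: additive_map_def Am.smult_r_distr)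
    show "additive_map (ell \<U> A X) (ell \<U> B Y) (\<lambda>u. \<phi> a \<odot>\<^bsub>ell \<U> B Y\<^esub> f u)"
      using a \<phi>c additive_closed[OF f(1)] additive_add[OF f(1)] by (simp add: additive_map_def Bm.smult_r_distr)
    fix y assume y: "y \<in> carrier (ell \<U> A X)"
    have "mnorm (ell \<U> B Y) (f (a \<odot>\<^bsub>ell \<U> A X\<^esub> y)) \<le> b * mnorm (ell \<U> A X) (a \<odot>\<^bsub>ell \<U> A X\<^esub> y)"
      using a y by (intro fb) auto
    also have "\<dots> \<le> b * (mult_const (modulus A) * hnorm A a * mnorm (ell \<U> A X) y)"
      using a y b0 by (intro mult_left_mono A.mnorm_smult) auto
    finally show "mnorm (ell \<U> B Y) (f (a \<odot>\<^bsub>ell \<U> A X\<^esub> y))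
        \<le> (b * mult_const (modulus A) * hnorm A a) * mnorm (ell \<U> A X) y" by (simp add: mult.assoc)
    have "mnorm (ell \<U> B Y) (\<phi> a \<odot>\<^bsub>ell \<U> B Y\<^esub> f y) \<le> ?D * hnorm B (\<phi> a) * mnorm (ell \<U> B Y) (f y)"
      using a y \<phi>c additive_closed[OF f(1)] by (intro B.mnorm_smult) auto
    also have "\<dots> \<le> ?D * hnorm B (\<phi> a) * (b * mnorm (ell \<U> A X) y)"
      using fb[OF y] D \<phi>c[OF a] by (intro mult_left_mono) auto
    finally show "mnorm (ell \<U> B Y) (\<phi> a \<odot>\<^bsub>ell \<U> B Y\<^esub> f y)
        \<le> (?D * hnorm B (\<phi> a) * b) * mnorm (ell \<U> A X) y" by (simp add: mult.assoc)
  next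
    fix c x assume cx: "c \<in> carrier A" "x \<in> pts X"
    have "a \<odot>\<^bsub>ell \<U> A X\<^esub> (c \<odot>\<^bsub>ell \<U> A X\<^esub> \<delta> A X x) = (a \<otimes>\<^bsub>A\<^esub> c) \<odot>\<^bsub>ell \<U> A X\<^esub> \<delta> A X x"
      using a cx A.unit_closed by (simp add: Am.smult_assoc1)
    then show "f (a \<odot>\<^bsub>ell \<U> A X\<^esub> (c \<odot>\<^bsub>ell \<U> A X\<^esub> \<delta> A X x)) = \<phi> a \<odot>\<^bsub>ell \<U> B Y\<^esub> f (c \<odot>\<^bsub>ell \<U> A X\<^esub> \<delta> A X x)"
      using a cx \<phi>c hc ring_hom_mult[OF \<phi>r] by (simp add: f(2) Bm.smult_assoc1)
  qed
  have sl: "semilin A (ell \<U> A X) \<phi> (ell \<U> B Y) f"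
    using f(1) fb b0 fs by (auto simp: semilin_def)
  have fu: "f (\<delta> A X x) = h x" if "x \<in> pts X" for x
    using f(2)[of "\<one>\<^bsub>A\<^esub>" x] that A.unit_closed \<phi>one hc by simp
  have eq: "lin_ext \<U> \<phi> A X (ell \<U> B Y) h u = f u" if "u \<in> carrier (ell \<U> A X)" for u
    using lin_ext_semilin_eq[OF A ell_banach[OF B] sl fu that] .
  show "semilin A (ell \<U> A X) \<phi> (ell \<U> B Y) (lin_ext \<U> \<phi> A X (ell \<U> B Y) h)"
    using sl by (auto simp: semilin_def additive_map_def eq)
  show "bounded_map \<Sigma> (carrier (ell \<U> A X)) (mnorm (ell \<U> A X)) (mnorm (ell \<U> B Y))
      (lin_ext \<U> \<phi> A X (ell \<U> B Y) h)"
    using fb b0 b1 by (cases \<Sigma>) (auto simp: eq)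
  show "lin_ext \<U> \<phi> A X (ell \<U> B Y) h (\<delta> A X x) = h x" if "x \<in> pts X"
    using eq fu A.unit_closed that by simp
qed

lemma hom_L_D:
  assumes "h \<in> hom \<C> X (L B Y)"
  shows "h \<in> pts X \<rightarrow> carrier (ell \<U> B Y)" "bounded_map \<Sigma> (pts X) (nrm X) (mnorm (ell \<U> B Y)) h"
proof -
  show 1: "h \<in> pts X \<rightarrow> carrier (ell \<U> B Y)" using assms by (auto simp: C_simps)
  have "bounded_map \<Sigma> (pts X) (nrm X) (nrm (L B Y)) h = bounded_map \<Sigma> (pts X) (nrm X) (mnorm (ell \<U> B Y)) h"
    using 1 by (intro bounded_map_cong) (auto intro!: nrm_L)
  then show "bounded_map \<Sigma> (pts X) (nrm X) (mnorm (ell \<U> B Y)) h" using assms by (simp add: C_simps)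
qed

lemma lin_ext_hom:
  assumes A: "A \<in> \<H>" "X \<in> \<N>" and B: "B \<in> \<H>" "Y \<in> \<N>" and \<phi>: "halo_hom \<phi> A B"
    and h: "h \<in> pts X \<rightarrow> carrier (ell \<U> B Y)" "bounded_map \<Sigma> (pts X) (nrm X) (mnorm (ell \<U> B Y)) h"
  shows "lin_ext \<U> \<phi> A X (ell \<U> B Y) h \<in> hom \<C> (L A X) (L B Y)"
proof -
  let ?f = "lin_ext \<U> \<phi> A X (ell \<U> B Y) h"
  have c: "?f u \<in> carrier (ell \<U> B Y)" if "u \<in> carrier (ell \<U> A X)" for u
    using semilin_closed[OF lin_ext_semilin[OF A B \<phi> h] that] .
  have "bounded_map \<Sigma> (carrier (ell \<U> A X)) (nrm (L A X)) (nrm (L B Y)) ?f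
      = bounded_map \<Sigma> (carrier (ell \<U> A X)) (mnorm (ell \<U> A X)) (mnorm (ell \<U> B Y)) ?f"
    using c by (intro bounded_map_cong) (auto simp: nrm_L)
  moreover have "?f \<in> extensional (carrier (ell \<U> A X))" by (simp add: lin_ext_def)
  ultimately show ?thesis
    using c lin_ext_bounded[OF A B \<phi> h] by (auto simp: C_simps PiE_def)
qed

section \<open>The monad of a halo\<close>

abbreviation "Tmap A X Y h \<equiv> lin_ext \<U> (\<lambda>a. a) A X (ell \<U> A Y) (\<lambda>x. \<delta> A Y (h x))"
abbreviation "Tmu A X \<equiv> lin_ext \<U> (\<lambda>a. a) A (L A X) (ell \<U> A X) (\<lambda>y. y)"

lemma Lambda_monad_simps:
  "fobj (endo (Lambda_monad \<U> A)) X = L A X"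
  "fmap (endo (Lambda_monad \<U> A)) X Y h = Tmap A X Y h"
  "eta (Lambda_monad \<U> A) X = \<delta> A X"
  "mu (Lambda_monad \<U> A) X = Tmu A X"
  by (simp_all add: Lambda_monad_def)

lemma unit_comp_hom:
  assumes "A \<in> \<H>" "Y \<in> \<N>" "h \<in> hom \<C> X Y"
  shows "(\<lambda>x. \<delta> A Y (h x)) \<in> pts X \<rightarrow> carrier (ell \<U> A Y)"
    "bounded_map \<Sigma> (pts X) (nrm X) (mnorm (ell \<U> A Y)) (\<lambda>x. \<delta> A Y (h x))"
proof -
  show "(\<lambda>x. \<delta> A Y (h x)) \<in> pts X \<rightarrow> carrier (ell \<U> A Y)"
    using unit_in[OF assms(1,2)] hom_app[OF assms(3)] by auto
  show "bounded_map \<Sigma> (pts X) (nrm X) (mnorm (ell \<U> A Y)) (\<lambda>x. \<delta> A Y (h x))"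
    by (rule bounded_map_comp[where Y = "pts Y" and NY = "nrm Y"])
      (use assms(3) hom_L_D(2)[OF unit_hom[OF assms(1,2)]] in \<open>auto simp: C_simps\<close>)
qed

lemma Tmap:
  assumes A: "A \<in> \<H>" "X \<in> \<N>" "Y \<in> \<N>" "h \<in> hom \<C> X Y"
  shows Tmap_semilin: "semilin A (ell \<U> A X) (\<lambda>a. a) (ell \<U> A Y) (Tmap A X Y h)"
    and Tmap_hom: "Tmap A X Y h \<in> hom \<C> (L A X) (L A Y)"
    and Tmap_unit: "x \<in> pts X \<Longrightarrow> Tmap A X Y h (\<delta> A X x) = \<delta> A Y (h x)"
  using lin_ext_semilin[OF A(1,2) A(1,3) halo_hom_id unit_comp_hom[OF A(1,3,4)]]
    lin_ext_hom[OF A(1,2) A(1,3) halo_hom_id unit_comp_hom[OF A(1,3,4)]]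
    lin_ext_unit[OF A(1,2) A(1,3) halo_hom_id unit_comp_hom[OF A(1,3,4)]] by auto

lemma id_bounded:
  "(\<lambda>y. y) \<in> pts (L A X) \<rightarrow> carrier (ell \<U> A X)"
  "bounded_map \<Sigma> (pts (L A X)) (nrm (L A X)) (mnorm (ell \<U> A X)) (\<lambda>y. y)"
  by (auto simp: nrm_L intro!: bounded_map_Short)

lemma Tmu:
  assumes A: "A \<in> \<H>" "X \<in> \<N>"
  shows Tmu_semilin: "semilin A (ell \<U> A (L A X)) (\<lambda>a. a) (ell \<U> A X) (Tmu A X)"
    and Tmu_hom: "Tmu A X \<in> hom \<C> (L A (L A X)) (L A X)"
    and Tmu_unit: "y \<in> carrier (ell \<U> A X) \<Longrightarrow> Tmu A X (\<delta> A (L A X) y) = y"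
  using lin_ext_semilin[OF A(1) L_N[OF A] A halo_hom_id id_bounded]
    lin_ext_hom[OF A(1) L_N[OF A] A halo_hom_id id_bounded]
    lin_ext_unit[OF A(1) L_N[OF A] A halo_hom_id id_bounded] by auto

lemma linear_eqI:
  assumes "A \<in> \<H>" "X \<in> \<N>" "Y \<in> \<N>"
    and "semilin A (ell \<U> A X) (\<lambda>a. a) (ell \<U> A Y) f" "semilin A (ell \<U> A X) (\<lambda>a. a) (ell \<U> A Y) g"
    and "u \<in> carrier (ell \<U> A X)" "\<And>x. x \<in> pts X \<Longrightarrow> f (\<delta> A X x) = g (\<delta> A X x)"
  shows "f u = g u"
  by (rule semilin_eqI[OF assms(1,2) ell_banach[OF assms(1,3)] assms(4,5,7,6)])

lemma linear_comp:
  "semilin A M (\<lambda>a. a) H f \<Longrightarrow> semilin A H (\<lambda>a. a) G g \<Longrightarrow> semilin A M (\<lambda>a. a) G (\<lambda>u. g (f u))"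
  by (rule semilin_comp) auto

lemma monad_laws_Lambda:
  assumes A: "A \<in> \<H>"
  shows "monad_laws (Lambda_monad \<U> A)"
  unfolding monad_laws_def functor_laws_def Lambda_monad_simps pts_L
proof (intro conjI ballI)
  fix X assume X: "X \<in> \<N>"
  note LX = L_N[OF A X]
  note LLX = L_N[OF A LX]
  show "L A X \<in> \<N>" by (rule LX)
  show "\<delta> A X \<in> hom \<C> X (L A X)" by (rule unit_hom[OF A X])
  show "Tmu A X \<in> hom \<C> (L A (L A X)) (L A X)" by (rule Tmu_hom[OF A X])
  show "Tmap A X X (idt \<C> X) u = u" if "u \<in> carrier (ell \<U> A X)" for u
    by (rule linear_eqI[OF A X X Tmap_semilin[OF A X X hom_idt] semilin_id[OF refl] that])
      (simp only: Tmap_unit[OF A X X hom_idt], simp add: C_simps(2))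
  show "Tmu A X (Tmu A (L A X) w) = Tmu A X (Tmap A (L A (L A X)) (L A X) (Tmu A X) w)"
    if "w \<in> carrier (ell \<U> A (L A (L A X)))" for w
    by (rule linear_eqI[OF A LLX X linear_comp[OF Tmu_semilin[OF A LX] Tmu_semilin[OF A X]]
          linear_comp[OF Tmap_semilin[OF A LLX LX Tmu_hom[OF A X]] Tmu_semilin[OF A X]] that])
      (simp add: Tmu_unit[OF A LX] Tmap_unit[OF A LLX LX Tmu_hom[OF A X]] Tmu_unit[OF A X]
        semilin_closed[OF Tmu_semilin[OF A X]])
  show "Tmu A X (\<delta> A (L A X) u) = u" if "u \<in> carrier (ell \<U> A X)" for u
    by (rule Tmu_unit[OF A X that])
  show "Tmu A X (Tmap A X (L A X) (\<delta> A X) u) = u" if "u \<in> carrier (ell \<U> A X)" for u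
    by (rule linear_eqI[OF A X X linear_comp[OF Tmap_semilin[OF A X LX unit_hom[OF A X]] Tmu_semilin[OF A X]]
          semilin_id[OF refl] that])
      (simp add: Tmap_unit[OF A X LX unit_hom[OF A X]] Tmu_unit[OF A X] unit_in[OF A X])
  fix Y h assume Y: "Y \<in> \<N>" and h: "h \<in> hom \<C> X Y"
  note LY = L_N[OF A Y]
  show "Tmap A X Y h \<in> hom \<C> (L A X) (L A Y)" by (rule Tmap_hom[OF A X Y h])
  show "\<delta> A Y (h x) = Tmap A X Y h (\<delta> A X x)" if "x \<in> pts X" for x
    by (rule Tmap_unit[OF A X Y h that, symmetric])
  show "Tmu A Y (Tmap A (L A X) (L A Y) (Tmap A X Y h) v) = Tmap A X Y h (Tmu A X v)"
    if "v \<in> carrier (ell \<U> A (L A X))" for v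
    by (rule linear_eqI[OF A LX Y
          linear_comp[OF Tmap_semilin[OF A LX LY Tmap_hom[OF A X Y h]] Tmu_semilin[OF A Y]]
          linear_comp[OF Tmu_semilin[OF A X] Tmap_semilin[OF A X Y h]] that])
      (simp add: Tmap_unit[OF A LX LY Tmap_hom[OF A X Y h]] Tmu_unit[OF A X] Tmu_unit[OF A Y]
        semilin_closed[OF Tmap_semilin[OF A X Y h]])
  fix Z g assume Z: "Z \<in> \<N>" and g: "g \<in> hom \<C> Y Z"
  show "Tmap A X Z (compose (pts X) g h) u = Tmap A Y Z g (Tmap A X Y h u)" if "u \<in> carrier (ell \<U> A X)" for u
    by (rule linear_eqI[OF A X Z Tmap_semilin[OF A X Z hom_comp[OF h g]]
          linear_comp[OF Tmap_semilin[OF A X Y h] Tmap_semilin[OF A Y Z g]] that])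
      (simp add: Tmap_unit[OF A X Z hom_comp[OF h g]] Tmap_unit[OF A X Y h] Tmap_unit[OF A Y Z g]
        hom_app[OF h] compose_eq)
qed

section \<open>The morphism of monads induced by a morphism of halos\<close>

abbreviation "\<Theta> f A B X \<equiv> lin_ext \<U> f A X (ell \<U> B X) (\<delta> B X)"

lemma Theta:
  assumes A: "A \<in> \<H>" and B: "B \<in> \<H>" and f: "halo_hom f A B" and X: "X \<in> \<N>"
  shows Theta_semilin: "semilin A (ell \<U> A X) f (ell \<U> B X) (\<Theta> f A B X)"
    and Theta_hom: "\<Theta> f A B X \<in> hom \<C> (L A X) (L B X)"
    and Theta_unit: "x \<in> pts X \<Longrightarrow> \<Theta> f A B X (\<delta> A X x) = \<delta> B X x"
  using lin_ext_semilin[OF A X B X f hom_L_D[OF unit_hom[OF B X]]]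
    lin_ext_hom[OF A X B X f hom_L_D[OF unit_hom[OF B X]]]
    lin_ext_unit[OF A X B X f hom_L_D[OF unit_hom[OF B X]]] by auto

lemma halo_hom_closed: "halo_hom f A B \<Longrightarrow> a \<in> carrier A \<Longrightarrow> f a \<in> carrier B"
  by (auto simp: halo_hom_def intro: ring_hom_closed)

lemma Theta_monad_morphism:
  assumes A: "A \<in> \<H>" and B: "B \<in> \<H>" and f: "halo_hom f A B"
    and \<theta>: "\<And>X. X \<in> \<N> \<Longrightarrow> \<theta> X = \<Theta> f A B X"
  shows "monad_morphism_laws (Lambda_monad \<U> A) (Lambda_monad \<U> B) \<theta>"
  unfolding monad_morphism_laws_def Lambda_monad_simps pts_L
proof (intro conjI ballI)
  note T = Theta[OF A B f]
  note fc = halo_hom_closed[OF f]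
  fix X assume X: "X \<in> \<N>"
  note LA = L_N[OF A X] and LB = L_N[OF B X]
  show "\<theta> X \<in> hom \<C> (L A X) (L B X)" using T(2) X \<theta> by simp
  show "\<theta> X (\<delta> A X x) = \<delta> B X x" if "x \<in> pts X" for x using T(3) X \<theta> that by simp
  show "\<theta> X (Tmu A X v) = Tmu B X (\<theta> (L B X) (Tmap A (L A X) (L B X) (\<theta> X) v))"
    if "v \<in> carrier (ell \<U> A (L A X))" for v
    unfolding \<theta>[OF X] \<theta>[OF LB]
    by (rule semilin_eqI[OF A LA ell_banach[OF B X]
          semilin_comp[OF Tmu_semilin[OF A X] T(1)[OF X]]
          semilin_comp[OF semilin_comp[OF Tmap_semilin[OF A LA LB T(2)[OF X]] T(1)[OF LB], where \<chi> = f]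
            Tmu_semilin[OF B X]] _ that])
      (auto simp: fc Tmu_unit[OF A X] Tmap_unit[OF A LA LB T(2)[OF X]] T(3)[OF LB] Tmu_unit[OF B X]
        semilin_closed[OF T(1)[OF X]])
  fix Y h u assume Y: "Y \<in> \<N>" and h: "h \<in> hom \<C> X Y" and u: "u \<in> carrier (ell \<U> A X)"
  show "\<theta> Y (Tmap A X Y h u) = Tmap B X Y h (\<theta> X u)"
    unfolding \<theta>[OF X] \<theta>[OF Y]
    by (rule semilin_eqI[OF A X ell_banach[OF B Y]
          semilin_comp[OF Tmap_semilin[OF A X Y h] T(1)[OF Y]]
          semilin_comp[OF T(1)[OF X] Tmap_semilin[OF B X Y h]] _ u])
      (auto simp: fc Tmap_unit[OF A X Y h] T(3)[OF X] T(3)[OF Y] Tmap_unit[OF B X Y h] hom_app[OF h])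
qed

lemma CBanhalos_simps:
  "idt (CBanhalos \<Sigma> \<U>) A = (\<lambda>a\<in>carrier A. a)"
  "comp (CBanhalos \<Sigma> \<U>) A B D g f = compose (carrier A) g f"
  by (simp_all add: CBanhalos_def)

lemma halo_hom_compose:
  assumes f: "halo_hom f A B" and g: "halo_hom g B D"
    and k: "\<And>a. a \<in> carrier A \<Longrightarrow> k a = g (f a)" and A: "A \<in> \<H>"
  shows "halo_hom k A D"
proof -
  interpret chalo A \<Sigma> by (rule halo_D(1)[OF A])
  have fr: "f \<in> ring_hom A B" and gr: "g \<in> ring_hom B D" using f g by (simp_all add: halo_hom_def)
  have "k \<in> ring_hom A D"
    using ring_hom_closed[OF fr] ring_hom_closed[OF gr] ring_hom_mult[OF fr] ring_hom_mult[OF gr]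
      ring_hom_add[OF fr] ring_hom_add[OF gr] ring_hom_one[OF fr] ring_hom_one[OF gr]
    by (intro ring_hom_memI) (simp_all add: k)
  moreover have "bounded_map \<Sigma> (carrier A) (hnorm A) (hnorm D) (\<lambda>a. g (f a))"
    by (rule bounded_map_comp[where Y = "carrier B" and NY = "hnorm B"])
      (use f g ring_hom_closed[OF fr] in \<open>auto simp: halo_hom_def\<close>)
  moreover have "bounded_map \<Sigma> (carrier A) (hnorm A) (hnorm D) k
      = bounded_map \<Sigma> (carrier A) (hnorm A) (hnorm D) (\<lambda>a. g (f a))"
    by (rule bounded_map_cong) (simp_all add: k)
  ultimately show ?thesis using f g modulus_le_trans by (auto simp: halo_hom_def)
qed

lemma CBanhalos_category: "is_category (CBanhalos \<Sigma> \<U>)"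
  unfolding is_category_def CBanhalos_simps hom_CBanhalos mem_Collect_eq
proof (intro conjI ballI; (elim CollectE conjE)?)
  fix A assume "A \<in> \<H>"
  show "(\<lambda>a\<in>carrier A. a) \<in> extensional (carrier A)" by simp
  show "halo_hom (\<lambda>a\<in>carrier A. a) A A"
    by (rule halo_hom_compose[OF halo_hom_id halo_hom_id _ \<open>A \<in> \<H>\<close>]) simp
next
  fix A B D f g
  assume A: "A \<in> \<H>" and f: "halo_hom f A B" and g: "halo_hom g B D"
  show "halo_hom (compose (carrier A) g f) A D"
    by (rule halo_hom_compose[OF f g _ A]) (simp add: compose_eq)
  show "compose (carrier A) g f \<in> extensional (carrier A)" by (simp add: compose_def)
next
  fix A B f assume "f \<in> extensional (carrier A)" "halo_hom f A B"
  then show "compose (carrier A) f (\<lambda>a\<in>carrier A. a) = f" "compose (carrier A) (\<lambda>a\<in>carrier B. a) f = f"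
    by (auto simp: compose_eq_extensional_iff halo_hom_closed)
next
  fix W A B D f g h assume "halo_hom f W A"
  then show "compose (carrier W) h (compose (carrier W) g f) = compose (carrier W) (compose (carrier A) h g) f"
    by (auto simp: compose_def fun_eq_iff halo_hom_closed)
qed

lemma Lambda_simps:
  "fobj (Lambda \<U>) A = Lambda_monad \<U> A"
  "fmap (Lambda \<U>) A B f = (\<lambda>X\<in>\<N>. \<Theta> f A B X)"
  by (simp_all add: Lambda_def)

lemma Lambda_functor: "is_functor (CBanhalos \<Sigma> \<U>) (Monads \<C>) (Lambda \<U>)"
  unfolding is_functor_def
proof (intro conjI ballI CBanhalos_category Monads_category)
  fix A assume A: "A \<in> \<H>"
  note mA = monad_laws_Lambda[OF A]
  show "fobj (Lambda \<U>) A \<in> obj (Monads \<C>)" using mA by (simp add: Lambda_simps Monads_simps)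
  have "\<Theta> (\<lambda>a\<in>carrier A. a) A A X = (\<lambda>u\<in>carrier (ell \<U> A X). u)" if X: "X \<in> \<N>" for X
  proof (rule extensionalityI[of _ "carrier (ell \<U> A X)"])
    show "\<Theta> (\<lambda>a\<in>carrier A. a) A A X u = (\<lambda>u\<in>carrier (ell \<U> A X). u) u" if u: "u \<in> carrier (ell \<U> A X)" for u
      using lin_ext_semilin_eq[OF A X ell_banach[OF A X] semilin_id refl u, of "\<lambda>a\<in>carrier A. a"] u by simp
  qed (simp_all add: lin_ext_def)
  then show "fmap (Lambda \<U>) A A (idt (CBanhalos \<Sigma> \<U>) A) = idt (Monads \<C>) (fobj (Lambda \<U>) A)"
    by (auto simp: Lambda_simps CBanhalos_simps Monads_simps Lambda_monad_simps fun_eq_iff)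
  fix B f assume B: "B \<in> \<H>" and "f \<in> hom (CBanhalos \<Sigma> \<U>) A B"
  then have f: "halo_hom f A B" by (simp add: hom_CBanhalos)
  note mB = monad_laws_Lambda[OF B]
  show "fmap (Lambda \<U>) A B f \<in> hom (Monads \<C>) (fobj (Lambda \<U>) A) (fobj (Lambda \<U>) B)"
    using Theta_monad_morphism[OF A B f, of "\<lambda>X\<in>\<N>. \<Theta> f A B X"]
    by (simp add: Lambda_simps Monads_hom[OF mA mB])
  fix D g assume D: "D \<in> \<H>" and "g \<in> hom (CBanhalos \<Sigma> \<U>) B D"
  then have g: "halo_hom g B D" by (simp add: hom_CBanhalos)
  let ?k = "compose (carrier A) g f"
  have k: "halo_hom ?k A D" by (rule halo_hom_compose[OF f g _ A]) (simp add: compose_eq)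
  have "\<Theta> ?k A D X = compose (carrier (ell \<U> A X)) (\<Theta> g B D X) (\<Theta> f A B X)" if X: "X \<in> \<N>" for X
  proof (rule extensionalityI[of _ "carrier (ell \<U> A X)"])
    fix u assume u: "u \<in> carrier (ell \<U> A X)"
    have "\<Theta> ?k A D X u = \<Theta> g B D X (\<Theta> f A B X u)"
      by (rule lin_ext_semilin_eq[OF A X ell_banach[OF D X]
            semilin_comp[OF Theta_semilin[OF A B f X] Theta_semilin[OF B D g X]] _ u])
        (auto simp: halo_hom_closed[OF f] compose_eq Theta_unit[OF A B f X] Theta_unit[OF B D g X])
    then show "\<Theta> ?k A D X u = compose (carrier (ell \<U> A X)) (\<Theta> g B D X) (\<Theta> f A B X) u"
      using u by (simp add: compose_eq)
  qed (simp_all add: lin_ext_def)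
  then show "fmap (Lambda \<U>) A D (comp (CBanhalos \<Sigma> \<U>) A B D g f) =
      comp (Monads \<C>) (fobj (Lambda \<U>) A) (fobj (Lambda \<U>) B) (fobj (Lambda \<U>) D)
        (fmap (Lambda \<U>) B D g) (fmap (Lambda \<U>) A B f)"
    by (auto simp: Lambda_simps CBanhalos_simps Monads_simps Lambda_monad_simps fun_eq_iff)
qed

end

section \<open>Morphisms between the monads of halos\<close>

text \<open>Used to decompose the identity over a set of two points into its two
  coordinates.\<close>

lemma semilin_add:
  assumes H: "qnorm H (mnorm H) m K" "module B H"
    and f: "semilin A M \<phi> H f" and g: "semilin A M \<phi> H g" and \<phi>: "\<And>a. a \<in> carrier A \<Longrightarrow> \<phi> a \<in> carrier B"
  shows "semilin A M \<phi> H (\<lambda>u. f u \<oplus>\<^bsub>H\<^esub> g u)"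
proof -
  interpret H: qnorm H "mnorm H" m K by fact
  interpret Hm: module B H by fact
  note c = semilin_closed[OF f] semilin_closed[OF g]
  obtain b where b: "0 \<le> b" "\<And>y. y \<in> carrier M \<Longrightarrow> mnorm H (f y) \<le> b * mnorm M y"
    using semilin_bound[OF f] by blast
  obtain d where d: "0 \<le> d" "\<And>y. y \<in> carrier M \<Longrightarrow> mnorm H (g y) \<le> d * mnorm M y"
    using semilin_bound[OF g] by blast
  have "mnorm H (f y \<oplus>\<^bsub>H\<^esub> g y) \<le> (K * (b + d)) * mnorm M y" if "y \<in> carrier M" for y
  proof -
    have "mnorm H (f y \<oplus>\<^bsub>H\<^esub> g y) \<le> K * (mnorm H (f y) + mnorm H (g y))"
      using c that by (intro H.N_add_sum) auto
    also have "\<dots> \<le> K * (b * mnorm M y + d * mnorm M y)"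
      using b d that H.K_pos by (intro mult_left_mono add_mono) auto
    finally show ?thesis by (simp add: algebra_simps)
  qed
  then have "\<exists>b\<ge>0. \<forall>y\<in>carrier M. mnorm H (f y \<oplus>\<^bsub>H\<^esub> g y) \<le> b * mnorm M y"
    using b(1) d(1) H.K_pos by (intro exI[where x = "K * (b + d)"]) auto
  moreover have "additive_map M H (\<lambda>u. f u \<oplus>\<^bsub>H\<^esub> g u)"
    using c additive_add[OF semilin_additive[OF f]] additive_add[OF semilin_additive[OF g]]
    by (simp add: additive_map_def H.a_ac)
  moreover have "f (a \<odot>\<^bsub>M\<^esub> y) \<oplus>\<^bsub>H\<^esub> g (a \<odot>\<^bsub>M\<^esub> y) = \<phi> a \<odot>\<^bsub>H\<^esub> (f y \<oplus>\<^bsub>H\<^esub> g y)"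
    if "a \<in> carrier A" "y \<in> carrier M" for a y
    using that c \<phi> by (simp add: semilin_smult[OF f] semilin_smult[OF g] Hm.smult_r_distr)
  ultimately show ?thesis by (simp add: semilin_def)
qed

section \<open>Test objects and faithfulness\<close>

definition const_set :: "'u set \<Rightarrow> real \<Rightarrow> 'u normed_set" where
  "const_set S r = \<lparr>pts = S, nrm = (\<lambda>x\<in>S. r)\<rparr>"

lemma pts_const_set [simp]: "pts (const_set S r) = S"
  and nrm_const_set: "x \<in> S \<Longrightarrow> nrm (const_set S r) x = r"
  by (simp_all add: const_set_def)

lemma const_set_normed: "S \<in> \<U> \<Longrightarrow> 0 \<le> r \<Longrightarrow> const_set S r \<in> normed_sets \<U>"
  by (simp add: normed_sets_def const_set_def)

context lambda_ctx
begin

lemma countable_universe: "countable S \<Longrightarrow> S \<in> \<U>"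
  using universe_small[OF universe small_countable[OF universe]] by blast

text \<open>Any element of the type serves as the single point of the test objects.\<close>

abbreviation "pt \<equiv> undefined :: 'u"
abbreviation "Pt r \<equiv> const_set {pt} r"

lemma Pt_N: "0 \<le> r \<Longrightarrow> Pt r \<in> \<N>"
  by (rule const_set_normed) (simp_all add: countable_universe)

lemma pt_in: "pt \<in> pts (Pt r)" by simp

text \<open>All auxiliary maps between test objects are chosen short, which makes them morphisms for
  both kinds at once.\<close>

lemma hom_shortI:
  "f \<in> pts X \<rightarrow>\<^sub>E pts Y \<Longrightarrow> (\<And>x. x \<in> pts X \<Longrightarrow> nrm Y (f x) \<le> nrm X x) \<Longrightarrow> f \<in> hom \<C> X Y"
  by (auto simp: C_simps intro: bounded_map_Short)

lemma to_L_shortI: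
  assumes "\<And>x. x \<in> pts X \<Longrightarrow> h x \<in> carrier (ell \<U> A Y)"
    "\<And>x. x \<in> pts X \<Longrightarrow> mnorm (ell \<U> A Y) (h x) \<le> nrm X x"
  shows "restrict h (pts X) \<in> hom \<C> X (L A Y)"
  using assms by (intro hom_shortI) (auto simp: nrm_L)

abbreviation "LE A X Y h \<equiv> lin_ext \<U> (\<lambda>a. a) A X (ell \<U> A Y) h"

lemma LE:
  assumes A: "A \<in> \<H>" "X \<in> \<N>" "Y \<in> \<N>" "h \<in> hom \<C> X (L A Y)"
  shows LE_semilin: "semilin A (ell \<U> A X) (\<lambda>a. a) (ell \<U> A Y) (LE A X Y h)"
    and LE_unit: "x \<in> pts X \<Longrightarrow> LE A X Y h (\<delta> A X x) = h x"
  using lin_ext_semilin[OF A(1,2) A(1,3) halo_hom_id hom_L_D[OF A(4)]]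
    lin_ext_unit[OF A(1,2) A(1,3) halo_hom_id hom_L_D[OF A(4)]] by auto

text \<open>A linear extension is the Kleisli extension of the monad. Hence it is expressed by monad
  operations alone, and every morphism of monads has to respect it.\<close>

lemma LE_eq_Tmu_Tmap:
  assumes A: "A \<in> \<H>" "X \<in> \<N>" "Y \<in> \<N>" "h \<in> hom \<C> X (L A Y)" "u \<in> carrier (ell \<U> A X)"
  shows "LE A X Y h u = Tmu A Y (Tmap A X (L A Y) h u)"
proof (rule linear_eqI[OF A(1-3) LE_semilin[OF A(1-4)] _ A(5)])
  note LY = L_N[OF A(1,3)]
  show "semilin A (ell \<U> A X) (\<lambda>a. a) (ell \<U> A Y) (\<lambda>u. Tmu A Y (Tmap A X (L A Y) h u))"
    by (rule linear_comp[OF Tmap_semilin[OF A(1,2) LY A(4)] Tmu_semilin[OF A(1,3)]])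
  fix x assume x: "x \<in> pts X"
  then have "h x \<in> carrier (ell \<U> A Y)" using hom_app[OF A(4)] by simp
  then show "LE A X Y h (\<delta> A X x) = Tmu A Y (Tmap A X (L A Y) h (\<delta> A X x))"
    by (simp only: LE_unit[OF A(1-4) x] Tmap_unit[OF A(1,2) LY A(4) x] Tmu_unit[OF A(1,3)])
qed

lemma ell_smult_unit_inj:
  "A \<in> \<H> \<Longrightarrow> a \<in> carrier A \<Longrightarrow> b \<in> carrier A \<Longrightarrow>
    a \<odot>\<^bsub>ell \<U> A (Pt 1)\<^esub> \<delta> A (Pt 1) pt = b \<odot>\<^bsub>ell \<U> A (Pt 1)\<^esub> \<delta> A (Pt 1) pt \<Longrightarrow> a = b"
  using ell_halo.smult_unit_inj[OF ell_haloI[OF _ Pt_N[of 1]], of A pt a b] by (simp add: nrm_const_set)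

text \<open>At the point of norm 1 the map \<open>\<Theta> f A B\<close> sends the element with
  coefficient \<open>a\<close> to the one with coefficient \<open>f a\<close>, and coefficients
  there are unique.\<close>

lemma Lambda_faithful:
  assumes A: "A \<in> \<H>" and B: "B \<in> \<H>"
  shows "faithful_at (CBanhalos \<Sigma> \<U>) (Monads \<C>) (Lambda \<U>) A B"
  unfolding faithful_at_def
proof (rule inj_onI)
  fix f g
  assume fg: "f \<in> hom (CBanhalos \<Sigma> \<U>) A B" "g \<in> hom (CBanhalos \<Sigma> \<U>) A B"
    and eq: "fmap (Lambda \<U>) A B f = fmap (Lambda \<U>) A B g"
  have f: "f \<in> extensional (carrier A)" "halo_hom f A B" and g: "g \<in> extensional (carrier A)" "halo_hom g A B"
    using fg by (simp_all add: hom_CBanhalos)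
  have N: "Pt 1 \<in> \<N>" by (rule Pt_N) simp
  have th: "\<Theta> f A B (Pt 1) = \<Theta> g A B (Pt 1)"
    using fun_cong[OF eq, of "Pt 1"] N by (simp add: Lambda_simps)
  have val: "\<Theta> k A B (Pt 1) (a \<odot>\<^bsub>ell \<U> A (Pt 1)\<^esub> \<delta> A (Pt 1) pt) = k a \<odot>\<^bsub>ell \<U> B (Pt 1)\<^esub> \<delta> B (Pt 1) pt"
    if "halo_hom k A B" "a \<in> carrier A" for k a
    using semilin_smult[OF Theta_semilin[OF A B that(1) N] that(2) unit_in[OF A N pt_in]]
      Theta_unit[OF A B that(1) N pt_in] by simp
  show "f = g"
  proof (rule extensionalityI[OF f(1) g(1)])
    fix a assume a: "a \<in> carrier A"
    show "f a = g a"
      by (rule ell_smult_unit_inj[OF B])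
        (use val[OF f(2) a] val[OF g(2) a] th halo_hom_closed[OF f(2) a] halo_hom_closed[OF g(2) a] in auto)
  qed
qed

end

section \<open>Reconstruction of the ring homomorphism from a morphism of monads\<close>

locale monad_morphism = lambda_ctx +
  fixes A B :: "'a halo" and \<theta> :: "'a normed_set \<Rightarrow> 'a \<Rightarrow> 'a"
  assumes A: "A \<in> \<H>" and B: "B \<in> \<H>"
    and laws: "monad_morphism_laws (Lambda_monad \<U> A) (Lambda_monad \<U> B) \<theta>"
begin

lemma theta_hom: "X \<in> \<N> \<Longrightarrow> \<theta> X \<in> hom \<C> (L A X) (L B X)"
  using laws by (simp add: monad_morphism_laws_def Lambda_monad_simps)

lemma theta_in: "X \<in> \<N> \<Longrightarrow> u \<in> carrier (ell \<U> A X) \<Longrightarrow> \<theta> X u \<in> carrier (ell \<U> B X)"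
  using hom_app[OF theta_hom] by simp

lemma theta_nat:
  "X \<in> \<N> \<Longrightarrow> Y \<in> \<N> \<Longrightarrow> h \<in> hom \<C> X Y \<Longrightarrow> u \<in> carrier (ell \<U> A X) \<Longrightarrow>
    \<theta> Y (Tmap A X Y h u) = Tmap B X Y h (\<theta> X u)"
  using laws by (simp add: monad_morphism_laws_def Lambda_monad_simps)

lemma theta_unit: "X \<in> \<N> \<Longrightarrow> x \<in> pts X \<Longrightarrow> \<theta> X (\<delta> A X x) = \<delta> B X x"
  using laws by (simp add: monad_morphism_laws_def Lambda_monad_simps)

lemma theta_mu:
  "X \<in> \<N> \<Longrightarrow> v \<in> carrier (ell \<U> A (L A X)) \<Longrightarrow>
    \<theta> X (Tmu A X v) = Tmu B X (\<theta> (L B X) (Tmap A (L A X) (L B X) (\<theta> X) v))"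
  using laws by (simp add: monad_morphism_laws_def Lambda_monad_simps)

text \<open>Substituting elements for generators is built from \<open>Tmap\<close> and
  \<open>Tmu\<close>, so naturality and the multiplication law of \<open>\<theta>\<close> suffice.
  This reduces questions about arbitrary elements to universal ones over small test objects.\<close>

lemma theta_LE:
  assumes X: "X \<in> \<N>" and Y: "Y \<in> \<N>" and h: "h \<in> hom \<C> X (L A Y)" and u: "u \<in> carrier (ell \<U> A X)"
    and k: "k \<in> hom \<C> X (L B Y)" "\<And>x. x \<in> pts X \<Longrightarrow> k x = \<theta> Y (h x)"
  shows "\<theta> Y (LE A X Y h u) = LE B X Y k (\<theta> X u)"
proof -
  note LA = L_N[OF A Y] and LB = L_N[OF B Y]
  have keq: "k = compose (pts X) (\<theta> Y) h"
    by (rule hom_eqI[OF k(1) hom_comp[OF h theta_hom[OF Y]]]) (simp add: k(2) compose_eq)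
  have Th: "Tmap A X (L A Y) h u \<in> carrier (ell \<U> A (L A Y))"
    by (rule semilin_closed[OF Tmap_semilin[OF A X LA h] u])
  have "\<theta> Y (LE A X Y h u) = Tmu B Y (\<theta> (L B Y) (Tmap A (L A Y) (L B Y) (\<theta> Y) (Tmap A X (L A Y) h u)))"
    unfolding LE_eq_Tmu_Tmap[OF A X Y h u] by (rule theta_mu[OF Y Th])
  also have "Tmap A (L A Y) (L B Y) (\<theta> Y) (Tmap A X (L A Y) h u) = Tmap A X (L B Y) k u"
    by (rule linear_eqI[OF A X LB linear_comp[OF Tmap_semilin[OF A X LA h] Tmap_semilin[OF A LA LB theta_hom[OF Y]]]
          Tmap_semilin[OF A X LB k(1)] u])
      (use hom_app[OF h] in \<open>simp add: Tmap_unit[OF A X LA h] Tmap_unit[OF A LA LB theta_hom[OF Y]]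
        Tmap_unit[OF A X LB k(1)] k(2)\<close>)
  also have "\<theta> (L B Y) \<dots> = Tmap B X (L B Y) k (\<theta> X u)"
    by (rule theta_nat[OF X LB k(1) u])
  also have "Tmu B Y \<dots> = LE B X Y k (\<theta> X u)"
    by (rule LE_eq_Tmu_Tmap[OF B X Y k(1) theta_in[OF X u], symmetric])
  finally show ?thesis .
qed

lemma theta_LE':
  assumes X: "X \<in> \<N>" and Y: "Y \<in> \<N>" and h: "h \<in> hom \<C> X (L A Y)" and u: "u \<in> carrier (ell \<U> A X)"
  shows "\<theta> Y (LE A X Y h u) = LE B X Y (compose (pts X) (\<theta> Y) h) (\<theta> X u)"
  by (rule theta_LE[OF X Y h u hom_comp[OF h theta_hom[OF Y]]]) (simp add: compose_eq)

lemma ell_abelian_group: "X \<in> \<N> \<Longrightarrow> abelian_group (ell \<U> A X)" "X \<in> \<N> \<Longrightarrow> abelian_group (ell \<U> B X)"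
  using ell_module A B module.axioms(2) by blast+

lemma LE_zero:
  assumes "D \<in> \<H>" "X \<in> \<N>" "Y \<in> \<N>" "h \<in> hom \<C> X (L D Y)"
  shows "LE D X Y h \<zero>\<^bsub>ell \<U> D X\<^esub> = \<zero>\<^bsub>ell \<U> D Y\<^esub>"
  by (rule additive_zero[OF _ _ semilin_additive[OF LE_semilin[OF assms]]])
    (use ell_module assms module.axioms(2) in blast)+

text \<open>The zero element comes from the empty set.\<close>

lemma theta_zero:
  assumes X: "X \<in> \<N>"
  shows "\<theta> X \<zero>\<^bsub>ell \<U> A X\<^esub> = \<zero>\<^bsub>ell \<U> B X\<^esub>"
proof -
  let ?O = "const_set {} 0 :: 'a normed_set"
  have N: "?O \<in> \<N>" by (rule const_set_normed) (simp_all add: countable_universe)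
  have h: "restrict undefined (pts ?O) \<in> hom \<C> ?O (L D X)" for D by (rule hom_shortI) auto
  have z: "\<zero>\<^bsub>ell \<U> A ?O\<^esub> \<in> carrier (ell \<U> A ?O)"
    using ell_abelian_group(1)[OF N] by (simp add: abelian_group.axioms(1) abelian_monoid.zero_closed)
  have c: "carrier (ell \<U> B ?O) = {\<zero>\<^bsub>ell \<U> B ?O\<^esub>}"
    by (rule ell_halo.empty_carrier[OF ell_haloI[OF B N]]) simp
  have "\<theta> X \<zero>\<^bsub>ell \<U> A X\<^esub> = \<theta> X (LE A ?O X (restrict undefined (pts ?O)) \<zero>\<^bsub>ell \<U> A ?O\<^esub>)"
    by (simp only: LE_zero[OF A N X h])
  also have "\<dots> = LE B ?O X (restrict undefined (pts ?O)) (\<theta> ?O \<zero>\<^bsub>ell \<U> A ?O\<^esub>)"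
    by (rule theta_LE[OF N X h z h]) simp
  also have "\<theta> ?O \<zero>\<^bsub>ell \<U> A ?O\<^esub> = \<zero>\<^bsub>ell \<U> B ?O\<^esub>"
    using theta_in[OF N z] c by simp
  finally show ?thesis by (simp only: LE_zero[OF B N X h])
qed

lemma mnorm_nonneg:
  "D \<in> \<H> \<Longrightarrow> X \<in> \<N> \<Longrightarrow> u \<in> carrier (ell \<U> D X) \<Longrightarrow> 0 \<le> mnorm (ell \<U> D X) u"
  using qnorm.N_nonneg[OF banach_group.axioms(1)[OF ell_banach]] by blast

lemma mnorm_unit_le:
  "D \<in> \<H> \<Longrightarrow> X \<in> \<N> \<Longrightarrow> x \<in> pts X \<Longrightarrow> mnorm (ell \<U> D X) (\<delta> D X x) \<le> nrm X x"
  by (rule ell_halo.mnorm_unit[OF ell_haloI])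

text \<open>The two coordinates of an element over a set with two points determine it, so that the sum of
  the two generators is preserved; every sum is the image of this one.\<close>

lemma theta_add:
  assumes X: "X \<in> \<N>" and u: "u \<in> carrier (ell \<U> A X)" and v: "v \<in> carrier (ell \<U> A X)"
  shows "\<theta> X (u \<oplus>\<^bsub>ell \<U> A X\<^esub> v) = \<theta> X u \<oplus>\<^bsub>ell \<U> B X\<^esub> \<theta> X v"
proof -
  \<comment> \<open>Two points of this norm can be sent to \<open>u\<close> and \<open>v\<close> by
    a short map.\<close>
  define r where "r = max (mnorm (ell \<U> A X) u) (mnorm (ell \<U> A X) v)"
  have r: "0 \<le> r" using mnorm_nonneg[OF A X u] by (simp add: r_def le_max_iff_disj)
  obtain S where "S \<in> \<U>" "infinite S" using universe by (auto simp: universe_def)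
  then obtain p q where pq: "p \<in> S" "q \<in> S" "p \<noteq> q"
    by (metis finite.emptyI finite_insert insertI1 subsetI finite_subset singletonI)
  let ?Q = "const_set {p, q} r" and ?S = "Pt r"
  have N: "?Q \<in> \<N>" by (rule const_set_normed) (simp_all add: countable_universe r)
  have NS: "?S \<in> \<N>" by (rule Pt_N[OF r])
  have pqin: "p \<in> pts ?Q" "q \<in> pts ?Q" by simp_all
  \<comment> \<open>The projection to the coordinate \<open>i\<close>, written as a substitution:
    \<open>i\<close> goes to the point and the other generator to zero. As \<open>\<theta>\<close>
    preserves units and zero, it carries the projection over \<open>A\<close> to the one over
    \<open>B\<close>.\<close>
  define \<pi> where "\<pi> D i = (\<lambda>y\<in>pts ?Q. if y = i then \<delta> D ?S pt else \<zero>\<^bsub>ell \<U> D ?S\<^esub>)" for D i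
  have zin: "\<zero>\<^bsub>ell \<U> D Y\<^esub> \<in> carrier (ell \<U> D Y)" if "D \<in> \<H>" "Y \<in> \<N>" for D Y
    using module.axioms(2)[OF ell_module[OF that]] by (simp add: abelian_group.axioms(1) abelian_monoid.zero_closed)
  have \<pi>h: "\<pi> D i \<in> hom \<C> ?Q (L D ?S)" if D: "D \<in> \<H>" for D i
    unfolding \<pi>_def
  proof (rule to_L_shortI)
    fix y assume y: "y \<in> pts ?Q"
    show "(if y = i then \<delta> D ?S pt else \<zero>\<^bsub>ell \<U> D ?S\<^esub>) \<in> carrier (ell \<U> D ?S)"
      using unit_in[OF D NS pt_in] zin[OF D NS] by simp
    have "mnorm (ell \<U> D ?S) \<zero>\<^bsub>ell \<U> D ?S\<^esub> = 0"
      using qnorm.N_zero[OF banach_group.axioms(1)[OF ell_banach[OF D NS]]] .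
    then show "mnorm (ell \<U> D ?S) (if y = i then \<delta> D ?S pt else \<zero>\<^bsub>ell \<U> D ?S\<^esub>) \<le> nrm ?Q y"
      using mnorm_unit_le[OF D NS pt_in] r y by (auto simp: nrm_const_set)
  qed
  let ?sum = "\<lambda>D. \<delta> D ?Q p \<oplus>\<^bsub>ell \<U> D ?Q\<^esub> \<delta> D ?Q q"
  have sumin: "?sum D \<in> carrier (ell \<U> D ?Q)" if D: "D \<in> \<H>" for D
    using module.axioms(2)[OF ell_module[OF D N]] unit_in[OF D N pqin(1)] unit_in[OF D N pqin(2)]
    by (simp add: abelian_group.axioms(1) abelian_monoid.a_closed)
  have LEsum: "LE D ?Q Y h (?sum D) = h p \<oplus>\<^bsub>ell \<U> D Y\<^esub> h q"
    if D: "D \<in> \<H>" and Y: "Y \<in> \<N>" and h: "h \<in> hom \<C> ?Q (L D Y)" for D Y h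
    using additive_add[OF semilin_additive[OF LE_semilin[OF D N Y h]] unit_in[OF D N pqin(1)] unit_in[OF D N pqin(2)]]
      LE_unit[OF D N Y h pqin(1)] LE_unit[OF D N Y h pqin(2)] by simp
  have \<pi>sum: "LE D ?Q ?S (\<pi> D i) (?sum D) = \<delta> D ?S pt" if D: "D \<in> \<H>" and i: "i = p \<or> i = q" for D i
  proof -
    interpret S: module D "ell \<U> D ?S" by (rule ell_module[OF D NS])
    have "\<delta> D ?S pt \<in> carrier (ell \<U> D ?S)" by (rule unit_in[OF D NS pt_in])
    then show ?thesis
      unfolding LEsum[OF D NS \<pi>h[OF D]] using i pq by (auto simp: \<pi>_def)
  qed
  define w where "w = \<theta> ?Q (?sum A)"
  have w: "w \<in> carrier (ell \<U> B ?Q)" unfolding w_def by (rule theta_in[OF N sumin[OF A]])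
  have \<pi>w: "LE B ?Q ?S (\<pi> B i) w = \<delta> B ?S pt" if i: "i = p \<or> i = q" for i
  proof -
    have "\<theta> ?S (LE A ?Q ?S (\<pi> A i) (?sum A)) = LE B ?Q ?S (\<pi> B i) w"
      unfolding w_def
      by (rule theta_LE[OF N NS \<pi>h[OF A] sumin[OF A] \<pi>h[OF B]])
        (simp add: \<pi>_def theta_unit[OF NS pt_in] theta_zero[OF NS])
    then show ?thesis by (simp only: \<pi>sum[OF A i] theta_unit[OF NS pt_in])
  qed
  define \<iota> where "\<iota> i = (\<lambda>y\<in>pts ?S. \<delta> B ?Q i)" for i
  have \<iota>h: "\<iota> i \<in> hom \<C> ?S (L B ?Q)" if "i \<in> pts ?Q" for i
    unfolding \<iota>_def
    by (rule to_L_shortI) (use that unit_in[OF B N that] mnorm_unit_le[OF B N that] in \<open>auto simp: nrm_const_set\<close>)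
  \<comment> \<open>An element over two points is the sum of its coordinates put back in place. Both
    sides are linear in \<open>y\<close>, so the two generators decide.\<close>
  have dec: "LE B ?S ?Q (\<iota> p) (LE B ?Q ?S (\<pi> B p) y) \<oplus>\<^bsub>ell \<U> B ?Q\<^esub> LE B ?S ?Q (\<iota> q) (LE B ?Q ?S (\<pi> B q) y) = y"
    if y: "y \<in> carrier (ell \<U> B ?Q)" for y
  proof (rule linear_eqI[OF B N N _ semilin_id[OF refl] y])
    have sl: "semilin B (ell \<U> B ?Q) (\<lambda>a. a) (ell \<U> B ?Q) (\<lambda>y. LE B ?S ?Q (\<iota> i) (LE B ?Q ?S (\<pi> B i) y))"
      if "i \<in> pts ?Q" for i
      by (rule linear_comp[OF LE_semilin[OF B N NS \<pi>h[OF B]] LE_semilin[OF B NS N \<iota>h[OF that]]])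
    show "semilin B (ell \<U> B ?Q) (\<lambda>a. a) (ell \<U> B ?Q) (\<lambda>y.
        LE B ?S ?Q (\<iota> p) (LE B ?Q ?S (\<pi> B p) y) \<oplus>\<^bsub>ell \<U> B ?Q\<^esub> LE B ?S ?Q (\<iota> q) (LE B ?Q ?S (\<pi> B q) y))"
      by (rule semilin_add[OF banach_group.axioms(1)[OF ell_banach[OF B N]] ell_module[OF B N] sl sl]) simp_all
    fix x assume x: "x \<in> pts ?Q"
    interpret Q: module B "ell \<U> B ?Q" by (rule ell_module[OF B N])
    have d: "\<delta> B ?Q p \<in> carrier (ell \<U> B ?Q)" "\<delta> B ?Q q \<in> carrier (ell \<U> B ?Q)"
      by (rule unit_in[OF B N pqin(1)], rule unit_in[OF B N pqin(2)])
    have LEi: "LE B ?S ?Q (\<iota> i) (LE B ?Q ?S (\<pi> B i) (\<delta> B ?Q x)) = (if x = i then \<delta> B ?Q i else \<zero>\<^bsub>ell \<U> B ?Q\<^esub>)"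
      if i: "i \<in> pts ?Q" for i
      using x LE_unit[OF B N NS \<pi>h[OF B] x, of i] LE_unit[OF B NS N \<iota>h[OF i] pt_in]
        LE_zero[OF B NS N \<iota>h[OF i]] by (simp add: \<pi>_def \<iota>_def)
    show "LE B ?S ?Q (\<iota> p) (LE B ?Q ?S (\<pi> B p) (\<delta> B ?Q x)) \<oplus>\<^bsub>ell \<U> B ?Q\<^esub>
        LE B ?S ?Q (\<iota> q) (LE B ?Q ?S (\<pi> B q) (\<delta> B ?Q x)) = \<delta> B ?Q x"
      unfolding LEi[OF pqin(1)] LEi[OF pqin(2)] using x pq d by auto
  qed
  have "w = ?sum B"
    using dec[OF w] dec[OF sumin[OF B]] \<pi>w[of p] \<pi>w[of q] \<pi>sum[OF B, of p] \<pi>sum[OF B, of q] by simp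
  \<comment> \<open>Substituting \<open>u\<close> and \<open>v\<close> for the two points turns the
    sum of the generators into the sum of \<open>u\<close> and \<open>v\<close>.\<close>
  define h where "h = (\<lambda>y\<in>pts ?Q. if y = p then u else v)"
  have h: "h \<in> hom \<C> ?Q (L A X)"
    unfolding h_def by (rule to_L_shortI) (use u v in \<open>auto simp: nrm_const_set r_def\<close>)
  have "LE A ?Q X h (?sum A) = u \<oplus>\<^bsub>ell \<U> A X\<^esub> v"
    unfolding LEsum[OF A X h] using pq by (auto simp: h_def)
  moreover have "\<theta> X (LE A ?Q X h (?sum A)) = LE B ?Q X (compose (pts ?Q) (\<theta> X) h) w"
    unfolding w_def by (rule theta_LE'[OF N X h sumin[OF A]])
  moreover have "LE B ?Q X (compose (pts ?Q) (\<theta> X) h) (?sum B) = \<theta> X u \<oplus>\<^bsub>ell \<U> B X\<^esub> \<theta> X v"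
    unfolding LEsum[OF B X hom_comp[OF h theta_hom[OF X]]] using pq by (auto simp: h_def compose_eq)
  ultimately show ?thesis using \<open>w = ?sum B\<close> by simp
qed

lemma theta_additive: "X \<in> \<N> \<Longrightarrow> additive_map (ell \<U> A X) (ell \<U> B X) (\<theta> X)"
  by (simp add: additive_map_def theta_in theta_add)

text \<open>The coefficient exists by \<open>theta_Pt\<close> and is unique by
  \<open>ell_smult_unit_inj\<close>, so the choice is no choice. The restriction to the carrier is
  there because arrows between halos are extensional.\<close>

definition scalar :: "'a \<Rightarrow> 'a" where
  "scalar = (\<lambda>a\<in>carrier A. SOME b. b \<in> carrier B \<and>
    \<theta> (Pt 1) (a \<odot>\<^bsub>ell \<U> A (Pt 1)\<^esub> \<delta> A (Pt 1) pt) = b \<odot>\<^bsub>ell \<U> B (Pt 1)\<^esub> \<delta> B (Pt 1) pt)"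

lemma smult_in: "D \<in> \<H> \<Longrightarrow> X \<in> \<N> \<Longrightarrow> a \<in> carrier D \<Longrightarrow> x \<in> pts X \<Longrightarrow>
    a \<odot>\<^bsub>ell \<U> D X\<^esub> \<delta> D X x \<in> carrier (ell \<U> D X)"
  using module.smult_closed[OF ell_module] unit_in by blast

lemma theta_Pt:
  assumes "1 \<le> r" "a \<in> carrier A"
  shows "\<exists>b\<in>carrier B. \<theta> (Pt r) (a \<odot>\<^bsub>ell \<U> A (Pt r)\<^esub> \<delta> A (Pt r) pt) = b \<odot>\<^bsub>ell \<U> B (Pt r)\<^esub> \<delta> B (Pt r) pt"
proof -
  have N: "Pt r \<in> \<N>" using assms by (intro Pt_N) auto
  show ?thesis
    by (rule ell_halo.singleton_representation[OF ell_haloI[OF B N] _ _ theta_in[OF N smult_in[OF A N assms(2) pt_in]]])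
      (use assms in \<open>simp_all add: nrm_const_set\<close>)
qed

lemma scalar:
  assumes "a \<in> carrier A"
  shows "scalar a \<in> carrier B"
    "\<theta> (Pt 1) (a \<odot>\<^bsub>ell \<U> A (Pt 1)\<^esub> \<delta> A (Pt 1) pt) = scalar a \<odot>\<^bsub>ell \<U> B (Pt 1)\<^esub> \<delta> B (Pt 1) pt"
proof -
  have "\<exists>b. b \<in> carrier B \<and>
      \<theta> (Pt 1) (a \<odot>\<^bsub>ell \<U> A (Pt 1)\<^esub> \<delta> A (Pt 1) pt) = b \<odot>\<^bsub>ell \<U> B (Pt 1)\<^esub> \<delta> B (Pt 1) pt"
    using theta_Pt[OF order_refl assms] by blast
  from someI_ex[OF this] assms
  show "scalar a \<in> carrier B"
    "\<theta> (Pt 1) (a \<odot>\<^bsub>ell \<U> A (Pt 1)\<^esub> \<delta> A (Pt 1) pt) = scalar a \<odot>\<^bsub>ell \<U> B (Pt 1)\<^esub> \<delta> B (Pt 1) pt"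
    by (simp_all add: scalar_def)
qed

lemma Tmap_smult_unit:
  assumes "D \<in> \<H>" "X \<in> \<N>" "Y \<in> \<N>" "h \<in> hom \<C> X Y" "a \<in> carrier D" "x \<in> pts X"
  shows "Tmap D X Y h (a \<odot>\<^bsub>ell \<U> D X\<^esub> \<delta> D X x) = a \<odot>\<^bsub>ell \<U> D Y\<^esub> \<delta> D Y (h x)"
  using semilin_smult[OF Tmap_semilin[OF assms(1-4)] assms(5) unit_in[OF assms(1,2,6)]]
    Tmap_unit[OF assms(1-4,6)] by simp

text \<open>Short maps do not increase the norm, so a point of norm at least \<open>1\<close> is needed that maps both
  to the given point and to the point of norm \<open>1\<close>.\<close>

lemma theta_smult_unit:
  assumes X: "X \<in> \<N>" and x: "x \<in> pts X" and a: "a \<in> carrier A"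
  shows "\<theta> X (a \<odot>\<^bsub>ell \<U> A X\<^esub> \<delta> A X x) = scalar a \<odot>\<^bsub>ell \<U> B X\<^esub> \<delta> B X x"
proof -
  define r where "r = max 1 (nrm X x)"
  have r: "1 \<le> r" "nrm X x \<le> r" by (simp_all add: r_def)
  have N: "Pt r \<in> \<N>" and N1: "Pt 1 \<in> \<N>" using r by (auto intro!: Pt_N)
  define k where "k = (\<lambda>y\<in>pts (Pt r). pt)"
  define j where "j = (\<lambda>y\<in>pts (Pt r). x)"
  have k: "k \<in> hom \<C> (Pt r) (Pt 1)" unfolding k_def using r by (intro hom_shortI) (auto simp: nrm_const_set)
  have j: "j \<in> hom \<C> (Pt r) X" unfolding j_def using r x by (intro hom_shortI) (auto simp: nrm_const_set)
  obtain b where b: "b \<in> carrier B"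
      "\<theta> (Pt r) (a \<odot>\<^bsub>ell \<U> A (Pt r)\<^esub> \<delta> A (Pt r) pt) = b \<odot>\<^bsub>ell \<U> B (Pt r)\<^esub> \<delta> B (Pt r) pt"
    using theta_Pt[OF r(1) a] by blast
  note ar = smult_in[OF A N a pt_in]
  have "\<theta> (Pt 1) (a \<odot>\<^bsub>ell \<U> A (Pt 1)\<^esub> \<delta> A (Pt 1) pt) = b \<odot>\<^bsub>ell \<U> B (Pt 1)\<^esub> \<delta> B (Pt 1) pt"
    using theta_nat[OF N N1 k ar] Tmap_smult_unit[OF A N N1 k a pt_in] Tmap_smult_unit[OF B N N1 k b(1) pt_in]
    by (simp add: b(2) k_def)
  then have "b = scalar a"
    by (intro ell_smult_unit_inj[OF B b(1) scalar(1)[OF a]]) (simp only: scalar(2)[OF a])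
  then show ?thesis
    using theta_nat[OF N X j ar] Tmap_smult_unit[OF A N X j a pt_in] Tmap_smult_unit[OF B N X j b(1) pt_in]
    by (simp add: b(2) j_def)
qed

text \<open>The element \<open>a \<odot> u\<close> arises from \<open>a{pt}\<close> by substituting
  \<open>u\<close> for a point of norm equal to that of \<open>u\<close>, which is a short map;
  \<open>\<theta>\<close> respects the substitution and is known on \<open>a{pt}\<close>.\<close>

lemma theta_smult:
  assumes X: "X \<in> \<N>" and u: "u \<in> carrier (ell \<U> A X)" and a: "a \<in> carrier A"
  shows "\<theta> X (a \<odot>\<^bsub>ell \<U> A X\<^esub> u) = scalar a \<odot>\<^bsub>ell \<U> B X\<^esub> \<theta> X u"
proof -
  define r where "r = mnorm (ell \<U> A X) u"
  have N: "Pt r \<in> \<N>" using mnorm_nonneg[OF A X u] by (intro Pt_N) (simp add: r_def)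
  define h where "h = (\<lambda>y\<in>pts (Pt r). u)"
  have h: "h \<in> hom \<C> (Pt r) (L A X)"
    unfolding h_def by (rule to_L_shortI) (use u in \<open>auto simp: nrm_const_set r_def\<close>)
  let ?k = "compose (pts (Pt r)) (\<theta> X) h"
  have k: "?k \<in> hom \<C> (Pt r) (L B X)" by (rule hom_comp[OF h theta_hom[OF X]])
  have "LE A (Pt r) X h (a \<odot>\<^bsub>ell \<U> A (Pt r)\<^esub> \<delta> A (Pt r) pt) = a \<odot>\<^bsub>ell \<U> A X\<^esub> u"
    using semilin_smult[OF LE_semilin[OF A N X h] a unit_in[OF A N pt_in]] LE_unit[OF A N X h pt_in]
    by (simp add: h_def)
  moreover have "\<theta> X (LE A (Pt r) X h (a \<odot>\<^bsub>ell \<U> A (Pt r)\<^esub> \<delta> A (Pt r) pt))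
      = LE B (Pt r) X ?k (scalar a \<odot>\<^bsub>ell \<U> B (Pt r)\<^esub> \<delta> B (Pt r) pt)"
    unfolding theta_LE'[OF N X h smult_in[OF A N a pt_in]] theta_smult_unit[OF N pt_in a] ..
  moreover have "LE B (Pt r) X ?k (scalar a \<odot>\<^bsub>ell \<U> B (Pt r)\<^esub> \<delta> B (Pt r) pt) = scalar a \<odot>\<^bsub>ell \<U> B X\<^esub> \<theta> X u"
    using semilin_smult[OF LE_semilin[OF B N X k] scalar(1)[OF a] unit_in[OF B N pt_in]] LE_unit[OF B N X k pt_in]
    by (simp add: h_def compose_eq)
  ultimately show ?thesis by simp
qed

lemma theta_bound:
  assumes X: "X \<in> \<N>"
  shows "\<exists>b\<ge>0. (\<forall>u\<in>carrier (ell \<U> A X). mnorm (ell \<U> B X) (\<theta> X u) \<le> b * mnorm (ell \<U> A X) u) \<and>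
    (\<Sigma> = Short \<longrightarrow> b = 1)"
proof -
  have b: "bounded_map \<Sigma> (carrier (ell \<U> A X)) (nrm (L A X)) (nrm (L B X)) (\<theta> X)"
    using theta_hom[OF X] by (simp add: C_simps)
  have "\<exists>b\<ge>0. (\<forall>u\<in>carrier (ell \<U> A X). nrm (L B X) (\<theta> X u) \<le> b * nrm (L A X) u) \<and> (\<Sigma> = Short \<longrightarrow> b = 1)"
    using b bounded_map_D[OF b] by (cases \<Sigma>) auto
  then show ?thesis using theta_in[OF X] by (simp add: nrm_L)
qed

lemma theta_semilin: "X \<in> \<N> \<Longrightarrow> semilin A (ell \<U> A X) scalar (ell \<U> B X) (\<theta> X)"
  using theta_additive theta_bound theta_smult unfolding semilin_def by blast

lemma theta_eq: "X \<in> \<N> \<Longrightarrow> \<theta> X = \<Theta> scalar A B X"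
proof (rule extensionalityI[of _ "carrier (ell \<U> A X)"])
  assume X: "X \<in> \<N>"
  show "\<theta> X \<in> extensional (carrier (ell \<U> A X))" using hom_ext[OF theta_hom[OF X]] by simp
  show "\<Theta> scalar A B X \<in> extensional (carrier (ell \<U> A X))" by (simp add: lin_ext_def)
  fix u assume u: "u \<in> carrier (ell \<U> A X)"
  show "\<theta> X u = \<Theta> scalar A B X u"
    by (rule lin_ext_semilin_eq[OF A X ell_banach[OF B X] theta_semilin[OF X] _ u, symmetric])
      (rule theta_unit[OF X])
qed

text \<open>Each law compares two coefficients over the point of norm 1, where they are unique.
  Multiplicativity is semilinearity of \<open>\<theta>\<close> at the element with coefficient
  \<open>b\<close>.\<close>

lemma scalar_ring_hom: "scalar \<in> ring_hom A B"
proof -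
  have N: "Pt 1 \<in> \<N>" by (rule Pt_N) simp
  let ?\<theta> = "\<theta> (Pt 1)" and ?d = "\<delta> A (Pt 1) pt" and ?e = "\<delta> B (Pt 1) pt"
  interpret A: module A "ell \<U> A (Pt 1)" by (rule ell_module[OF A N])
  interpret B: module B "ell \<U> B (Pt 1)" by (rule ell_module[OF B N])
  have d: "?d \<in> carrier (ell \<U> A (Pt 1))" and e: "?e \<in> carrier (ell \<U> B (Pt 1))"
    by (rule unit_in[OF A N pt_in], rule unit_in[OF B N pt_in])
  note sc = scalar(1) and se = scalar(2)[symmetric]
  show ?thesis
  proof (rule ring_hom_memI)
    fix a b assume ab: "a \<in> carrier A" "b \<in> carrier A"
    show "scalar (a \<otimes>\<^bsub>A\<^esub> b) = scalar a \<otimes>\<^bsub>B\<^esub> scalar b"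
    proof (rule ell_smult_unit_inj[OF B])
      have "?\<theta> ((a \<otimes>\<^bsub>A\<^esub> b) \<odot>\<^bsub>ell \<U> A (Pt 1)\<^esub> ?d) = ?\<theta> (a \<odot>\<^bsub>ell \<U> A (Pt 1)\<^esub> (b \<odot>\<^bsub>ell \<U> A (Pt 1)\<^esub> ?d))"
        using ab d by (simp add: A.smult_assoc1)
      also have "\<dots> = scalar a \<odot>\<^bsub>ell \<U> B (Pt 1)\<^esub> (scalar b \<odot>\<^bsub>ell \<U> B (Pt 1)\<^esub> ?e)"
        using ab d by (simp add: theta_smult[OF N] theta_unit[OF N pt_in])
      finally show "scalar (a \<otimes>\<^bsub>A\<^esub> b) \<odot>\<^bsub>ell \<U> B (Pt 1)\<^esub> ?e = (scalar a \<otimes>\<^bsub>B\<^esub> scalar b) \<odot>\<^bsub>ell \<U> B (Pt 1)\<^esub> ?e"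
        using ab e sc by (simp add: se B.smult_assoc1)
    qed (use ab sc in auto)
    show "scalar (a \<oplus>\<^bsub>A\<^esub> b) = scalar a \<oplus>\<^bsub>B\<^esub> scalar b"
    proof (rule ell_smult_unit_inj[OF B])
      have "?\<theta> ((a \<oplus>\<^bsub>A\<^esub> b) \<odot>\<^bsub>ell \<U> A (Pt 1)\<^esub> ?d) =
          ?\<theta> (a \<odot>\<^bsub>ell \<U> A (Pt 1)\<^esub> ?d \<oplus>\<^bsub>ell \<U> A (Pt 1)\<^esub> b \<odot>\<^bsub>ell \<U> A (Pt 1)\<^esub> ?d)"
        using ab d by (simp add: A.smult_l_distr)
      also have "\<dots> = scalar a \<odot>\<^bsub>ell \<U> B (Pt 1)\<^esub> ?e \<oplus>\<^bsub>ell \<U> B (Pt 1)\<^esub> scalar b \<odot>\<^bsub>ell \<U> B (Pt 1)\<^esub> ?e"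
        using ab d by (simp add: theta_add[OF N] scalar(2))
      finally show "scalar (a \<oplus>\<^bsub>A\<^esub> b) \<odot>\<^bsub>ell \<U> B (Pt 1)\<^esub> ?e = (scalar a \<oplus>\<^bsub>B\<^esub> scalar b) \<odot>\<^bsub>ell \<U> B (Pt 1)\<^esub> ?e"
        using ab e sc by (simp add: se B.smult_l_distr)
    qed (use ab sc in auto)
  next
    show "scalar \<one>\<^bsub>A\<^esub> = \<one>\<^bsub>B\<^esub>"
    proof (rule ell_smult_unit_inj[OF B])
      show "scalar \<one>\<^bsub>A\<^esub> \<odot>\<^bsub>ell \<U> B (Pt 1)\<^esub> ?e = \<one>\<^bsub>B\<^esub> \<odot>\<^bsub>ell \<U> B (Pt 1)\<^esub> ?e"
        using d e by (simp add: se theta_unit[OF N pt_in])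
    qed (use sc in auto)
  qed (use sc in auto)
qed

text \<open>Reading a coefficient of \<open>B\<close> back from its element costs
  \<open>neg_const\<close> twice, once for the coordinate and once for the completion; the bound of
  \<open>\<theta>\<close> is the third factor. All three are 1 in the short case.\<close>

lemma scalar_bounded: "bounded_map \<Sigma> (carrier A) (hnorm A) (hnorm B) scalar"
proof -
  have N: "Pt 1 \<in> \<N>" by (rule Pt_N) simp
  interpret A: ell_halo A \<Sigma> "Pt 1" \<U> by (rule ell_haloI[OF A N])
  interpret B: ell_halo B \<Sigma> "Pt 1" \<U> by (rule ell_haloI[OF B N])
  let ?c = "neg_const (modulus B)"
  obtain b where b: "0 \<le> b" "\<And>u. u \<in> carrier (ell \<U> A (Pt 1)) \<Longrightarrow>
      mnorm (ell \<U> B (Pt 1)) (\<theta> (Pt 1) u) \<le> b * mnorm (ell \<U> A (Pt 1)) u" "\<Sigma> = Short \<longrightarrow> b = 1"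
    using theta_bound[OF N] by blast
  have c: "0 \<le> ?c" using neg_const_ge_1[of "modulus B"] by simp
  have "hnorm B (scalar a) \<le> (?c * ?c * b) * hnorm A a" if a: "a \<in> carrier A" for a
  proof -
    let ?v = "scalar a \<odot>\<^bsub>ell \<U> B (Pt 1)\<^esub> \<delta> B (Pt 1) pt"
    have v: "?v \<in> carrier (ell \<U> B (Pt 1))" by (rule smult_in[OF B N scalar(1)[OF a] pt_in])
    have "hnorm B (scalar a) \<le> ?c * modulus_norm (modulus B) (mnorm (ell \<U> B (Pt 1)) ?v) 0"
      using B.coefficient_le[OF scalar(1)[OF a] pt_in] B.hnorm_le_symnorm[of "scalar a"]
      by (simp add: nrm_const_set)
    also have "\<dots> \<le> ?c * (?c * mnorm (ell \<U> B (Pt 1)) ?v)"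
      using c v mnorm_nonneg[OF B N] by (intro mult_left_mono modulus_norm_zero_right[OF B.is_modulus]) auto
    also have "\<dots> \<le> ?c * (?c * (b * mnorm (ell \<U> A (Pt 1)) (a \<odot>\<^bsub>ell \<U> A (Pt 1)\<^esub> \<delta> A (Pt 1) pt)))"
      using c b(2)[OF smult_in[OF A N a pt_in]] by (intro mult_left_mono) (simp_all add: scalar(2)[OF a])
    also have "\<dots> \<le> ?c * (?c * (b * hnorm A a))"
      using c b(1) A.mnorm_smult_unit[OF a pt_in] by (intro mult_left_mono) (simp_all add: nrm_const_set)
    finally show ?thesis by (simp add: mult.assoc)
  qed
  then have "\<exists>d\<ge>0. (\<forall>a\<in>carrier A. hnorm B (scalar a) \<le> d * hnorm A a) \<and> (\<Sigma> = Short \<longrightarrow> d = 1)"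
    using c b(1,3) B.is_modulus by (intro exI[where x = "?c * ?c * b"]) (cases "modulus B"; auto)
  then show ?thesis by (cases \<Sigma>) auto
qed

text \<open>\<open>\<theta>\<close> sends a sum of generators to the sum of the same generators. The
  bounds for \<open>2 ^ k\<close> of them differ by a factor \<open>M\<close> that does not depend
  on \<open>k\<close>, and the powers of a quotient above 1 would eventually exceed it.\<close>

lemma growth_le:
  assumes oneB: "\<one>\<^bsub>B\<^esub> \<noteq> \<zero>\<^bsub>B\<^esub>"
  shows "growth (modulus B) \<le> growth (modulus A)"
proof -
  \<comment> \<open>One infinite set contains \<open>2 ^ k\<close> points for every
    \<open>k\<close>, so the bound \<open>b\<close> of \<open>\<theta>\<close>, which may depend on
    the normed set, is the same for all \<open>k\<close>.\<close>
  obtain S where S: "S \<in> \<U>" "infinite S" using universe by (auto simp: universe_def)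
  let ?X = "const_set S 1"
  have N: "?X \<in> \<N>" by (rule const_set_normed) (simp_all add: S)
  interpret A: ell_halo A \<Sigma> ?X \<U> by (rule ell_haloI[OF A N])
  interpret B: ell_halo B \<Sigma> ?X \<U> by (rule ell_haloI[OF B N])
  obtain b where b: "0 \<le> b" "\<And>u. u \<in> carrier (ell \<U> A ?X) \<Longrightarrow>
      mnorm (ell \<U> B ?X) (\<theta> ?X u) \<le> b * mnorm (ell \<U> A ?X) u"
    using theta_bound[OF N] by blast
  let ?gA = "growth (modulus A)" and ?gB = "growth (modulus B)"
  define M where "M = ?gB * neg_const (modulus B) * quasi_const (modulus B) * b"
  have pos: "0 < ?gA" "0 < ?gB" using A.growth_gt_0 B.growth_gt_0 by auto
  have le: "?gB ^ k \<le> M * ?gA ^ k" for k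
  proof -
    obtain I where I: "I \<subseteq> S" "finite I" "card I = 2 ^ k"
      using infinite_arbitrarily_large[OF S(2)] by blast
    have Ip: "I \<subseteq> pts ?X" "\<And>x. x \<in> I \<Longrightarrow> nrm ?X x = 1" using I by (auto simp: nrm_const_set)
    have in_A: "\<delta> A ?X x \<in> carrier (ell \<U> A ?X)" and th: "\<theta> ?X (\<delta> A ?X x) = \<delta> B ?X x"
      and in_B: "\<delta> B ?X x \<in> carrier (ell \<U> B ?X)" if "x \<in> I" for x
      using that Ip(1) unit_in[OF A N] unit_in[OF B N] theta_unit[OF N] by blast+
    have "\<theta> ?X (\<Oplus>\<^bsub>ell \<U> A ?X\<^esub>x\<in>I. \<delta> A ?X x) = (\<Oplus>\<^bsub>ell \<U> B ?X\<^esub>x\<in>I. \<theta> ?X (\<delta> A ?X x))"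
      by (rule additive_finsum[OF ell_abelian_group(1)[OF N] ell_abelian_group(2)[OF N] theta_additive[OF N] I(2) in_A])
    also have "\<dots> = (\<Oplus>\<^bsub>ell \<U> B ?X\<^esub>x\<in>I. \<delta> B ?X x)"
      using th in_B by (intro B.E.E.finsum_cong') auto
    finally have th_sum: "\<theta> ?X (\<Oplus>\<^bsub>ell \<U> A ?X\<^esub>x\<in>I. \<delta> A ?X x) = (\<Oplus>\<^bsub>ell \<U> B ?X\<^esub>x\<in>I. \<delta> B ?X x)" .
    have sum_in: "(\<Oplus>\<^bsub>ell \<U> A ?X\<^esub>x\<in>I. \<delta> A ?X x) \<in> carrier (ell \<U> A ?X)"
      using in_A by (intro A.E.E.finsum_closed) auto
    have "mnorm (ell \<U> B ?X) (\<Oplus>\<^bsub>ell \<U> B ?X\<^esub>x\<in>I. \<delta> B ?X x) \<le> b * mnorm (ell \<U> A ?X) (\<Oplus>\<^bsub>ell \<U> A ?X\<^esub>x\<in>I. \<delta> A ?X x)"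
      using b(2)[OF sum_in] by (simp add: th_sum)
    also have "\<dots> \<le> b * ?gA ^ k"
      using b(1) by (intro mult_left_mono A.unit_sum_upper Ip I(3)) auto
    finally have "?gB * neg_const (modulus B) * quasi_const (modulus B) *
        mnorm (ell \<U> B ?X) (\<Oplus>\<^bsub>ell \<U> B ?X\<^esub>x\<in>I. \<delta> B ?X x)
        \<le> ?gB * neg_const (modulus B) * quasi_const (modulus B) * (b * ?gA ^ k)"
      using pos neg_const_ge_1[of "modulus B"] by (intro mult_left_mono) auto
    moreover have "?gB ^ k \<le> ?gB * neg_const (modulus B) * quasi_const (modulus B) *
        mnorm (ell \<U> B ?X) (\<Oplus>\<^bsub>ell \<U> B ?X\<^esub>x\<in>I. \<delta> B ?X x)"
      by (rule B.unit_sum_lower[OF oneB Ip I(3)])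
    ultimately show ?thesis by (simp add: M_def mult.assoc)
  qed
  show ?thesis
  proof (rule ccontr)
    assume "\<not> ?gB \<le> ?gA"
    then have "1 < ?gB / ?gA" using pos by simp
    then obtain k where "M < (?gB / ?gA) ^ k" using real_arch_pow by blast
    then have "M * ?gA ^ k < ?gB ^ k" using pos by (simp add: power_divide field_simps)
    then show False using le[of k] by simp
  qed
qed

end

section \<open>Fullness\<close>

context lambda_ctx
begin

lemma Lambda_full:
  assumes A: "A \<in> \<H>" and B: "B \<in> \<H>" and \<theta>: "\<theta> \<in> hom (Monads \<C>) (fobj (Lambda \<U>) A) (fobj (Lambda \<U>) B)"
  shows "\<exists>f\<in>sigma_ring_hom \<Sigma> A B. \<theta> = fmap (Lambda \<U>) A B f"
    and "\<one>\<^bsub>B\<^esub> \<noteq> \<zero>\<^bsub>B\<^esub> \<Longrightarrow> growth (modulus B) \<le> growth (modulus A)"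
proof -
  have t: "\<theta> \<in> extensional \<N>" "monad_morphism_laws (Lambda_monad \<U> A) (Lambda_monad \<U> B) \<theta>"
    using \<theta> by (simp_all add: Lambda_simps Monads_hom monad_laws_Lambda A B)
  interpret monad_morphism \<Sigma> \<U> A B \<theta>
    by unfold_locales (use A B t in auto)
  have "scalar \<in> sigma_ring_hom \<Sigma> A B"
    using scalar_ring_hom scalar_bounded by (auto simp: sigma_ring_hom_def scalar_def)
  moreover have "\<theta> = fmap (Lambda \<U>) A B scalar"
    unfolding Lambda_simps by (rule extensionalityI[OF t(1)]) (auto simp: theta_eq)
  ultimately show "\<exists>f\<in>sigma_ring_hom \<Sigma> A B. \<theta> = fmap (Lambda \<U>) A B f" by blast
  show "\<one>\<^bsub>B\<^esub> \<noteq> \<zero>\<^bsub>B\<^esub> \<Longrightarrow> growth (modulus B) \<le> growth (modulus A)" by (rule growth_le)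
qed

text \<open>Between the ring homomorphism found for \<open>\<theta>\<close> and an arrow of halos
  only the order of the moduli is missing: it is read off from the growth rates when
  \<open>B\<close> is nonzero and assumed otherwise.\<close>

lemma Lambda_fully_faithful:
  assumes A: "A \<in> \<H>" and B: "B \<in> \<H>"
    and "\<one>\<^bsub>B\<^esub> \<noteq> \<zero>\<^bsub>B\<^esub> \<or> modulus_le (modulus A) (modulus B)" "mult_const (modulus B) \<le> mult_const (modulus A)"
  shows "fully_faithful_at (CBanhalos \<Sigma> \<U>) (Monads \<C>) (Lambda \<U>) A B"
  unfolding fully_faithful_at_def bij_betw_def
proof (intro conjI equalityI subsetI)
  show "inj_on (fmap (Lambda \<U>) A B) (hom (CBanhalos \<Sigma> \<U>) A B)"
    using Lambda_faithful[OF A B] by (simp add: faithful_at_def)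
  show "\<theta> \<in> hom (Monads \<C>) (fobj (Lambda \<U>) A) (fobj (Lambda \<U>) B)"
    if "\<theta> \<in> fmap (Lambda \<U>) A B ` hom (CBanhalos \<Sigma> \<U>) A B" for \<theta>
    using that Lambda_functor A B unfolding is_functor_def by blast
  fix \<theta> assume \<theta>: "\<theta> \<in> hom (Monads \<C>) (fobj (Lambda \<U>) A) (fobj (Lambda \<U>) B)"
  obtain f where f: "f \<in> sigma_ring_hom \<Sigma> A B" "\<theta> = fmap (Lambda \<U>) A B f"
    using Lambda_full(1)[OF A B \<theta>] by blast
  have "modulus_le (modulus A) (modulus B)"
    using assms(3)
  proof
    assume "\<one>\<^bsub>B\<^esub> \<noteq> \<zero>\<^bsub>B\<^esub>"
    from Lambda_full(2)[OF A B \<theta> this] show ?thesis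
      by (intro modulus_le_growthI[OF chalo.is_modulus[OF halo_D(1)[OF A]] chalo.is_modulus[OF halo_D(1)[OF B]]]
          assms(4))
  qed
  then have "f \<in> hom (CBanhalos \<Sigma> \<U>) A B" using f(1) by (simp add: CBanhalos_def)
  then show "\<theta> \<in> fmap (Lambda \<U>) A B ` hom (CBanhalos \<Sigma> \<U>) A B" using f(2) by blast
qed

end

section \<open>Flows\<close>

lemma powr_inverse_cancel [simp]:
  fixes x t :: real
  assumes "0 < t" "0 \<le> x"
  shows "(x powr t) powr (1 / t) = x" "(x powr (1 / t)) powr t = x"
  using assms by (simp_all add: powr_powr)

lemma flow_modulus_ennreal: "0 < t \<Longrightarrow> 0 < p \<Longrightarrow> flow_modulus t (Exponent (ennreal p)) = Exponent (ennreal (p / t))"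
  by (simp add: divide_ennreal)

lemma flow_modulus_top: "0 < t \<Longrightarrow> flow_modulus t (Exponent top_class.top) = Exponent top_class.top"
  by (simp add: ennreal_top_divide)

lemma max_powr: "0 < t \<Longrightarrow> 0 \<le> r \<Longrightarrow> 0 \<le> s \<Longrightarrow> max (r powr t) (s powr t) = max r s powr (t :: real)"
  using powr_mono2[of t r s] powr_mono2[of t s r] by (auto simp: max_def)

lemma flow_is_modulus:
  assumes "0 < t" "is_modulus \<Sigma> M"
  shows "is_modulus \<Sigma> (flow_modulus t M)"
  using assms(2)
  by (rule is_modulus_cases) (use assms(1) flow_modulus_ennreal flow_modulus_top in \<open>auto simp del: flow_modulus.simps(1) simp: flow_modulus.simps(2)\<close>)

lemma modulus_norm_flow:
  assumes "0 < t" "is_modulus \<Sigma> M" "0 \<le> r" "0 \<le> s"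
  shows "modulus_norm (flow_modulus t M) (r powr t) (s powr t) = modulus_norm M r s powr t"
  using assms(2)
proof (cases rule: is_modulus_cases)
  case infinite
  have "modulus_norm (Exponent top_class.top) (r powr t) (s powr t) = max (r powr t) (s powr t)"
    by (rule modulus_norm_infinity) auto
  also have "\<dots> = modulus_norm (Exponent top_class.top) r s powr t"
    using assms max_powr modulus_norm_infinity[of r s] by simp
  finally show ?thesis using infinite assms(1) by (simp only: flow_modulus_top)
next
  case (finite p)
  have "modulus_norm (Exponent (ennreal (p / t))) (r powr t) (s powr t)
      = ((r powr t) powr (p / t) + (s powr t) powr (p / t)) powr (1 / (p / t))"
    using finite assms(1) by (intro modulus_norm_ennreal) simp
  also have "\<dots> = modulus_norm (Exponent (ennreal p)) r s powr t"
    using finite assms by (simp add: modulus_norm_ennreal powr_powr del: modulus_norm.simps)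
  finally show ?thesis using finite assms(1) by (simp only: flow_modulus_ennreal)
next
  case (constants C D)
  then show ?thesis using assms max_powr[OF assms(1,3,4)] by (simp add: powr_mult)
qed

text \<open>The exponent \<open>p / t\<close> undoes the power \<open>t\<close> applied to the
  entries; adding one entry at a time reduces this to two terms.\<close>

lemma lp_norm_flow:
  assumes "0 < t" "0 < p" "finite I" "\<And>i. i \<in> I \<Longrightarrow> 0 \<le> v i"
  shows "lp_norm (p / ennreal t) I (\<lambda>i. v i powr t) = lp_norm p I v powr t"
  using assms(3,4)
proof (induction I)
  case (insert i I)
  have M: "is_modulus Short (Exponent p)" using assms(2) by simp
  have "0 < p / ennreal t" using flow_is_modulus[OF assms(1) M] by simp
  then have "lp_norm (p / ennreal t) (insert i I) (\<lambda>i. v i powr t)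
      = modulus_norm (flow_modulus t (Exponent p)) (v i powr t) (lp_norm (p / ennreal t) I (\<lambda>i. v i powr t))"
    using insert by (subst lp_norm_insert) auto
  also have "\<dots> = modulus_norm (flow_modulus t (Exponent p)) (v i powr t) (lp_norm p I v powr t)"
    using insert by simp
  also have "\<dots> = modulus_norm (Exponent p) (v i) (lp_norm p I v) powr t"
    using insert lp_norm_nonneg by (intro modulus_norm_flow[OF assms(1) M]) auto
  also have "\<dots> = lp_norm p (insert i I) v powr t"
    using insert assms(2) by (subst lp_norm_insert) auto
  finally show ?case .
qed simp

lemma flow_modulus_le:
  assumes "0 < t" "is_modulus \<Sigma> M" "is_modulus \<Sigma> M'" "modulus_le M M'"
  shows "modulus_le (flow_modulus t M) (flow_modulus t M')"
proof (cases M)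
  case (Exponent p)
  then obtain q where "M' = Exponent q" "p \<le> q" using assms(4) by (cases M') auto
  then show ?thesis using Exponent by (simp add: divide_right_mono_ennreal)
next
  case (Constants C D)
  then obtain C' D' where "M' = Constants C' D'" "C' \<le> C" "D' \<le> D" using assms(4) by (cases M') auto
  moreover from this have "0 < C'" "0 < D'" using assms(3) by (cases \<Sigma>; simp)+
  ultimately show ?thesis using Constants assms(1) by (simp add: powr_mono2)
qed

lemma mult_const_flow: "mult_const (flow_modulus t M) = mult_const M powr t"
  by (cases M) auto

lemma tendsto_powr_iff:
  fixes f :: "nat \<Rightarrow> real"
  assumes "0 < t" "\<And>n. 0 \<le> f n" "0 \<le> r"
  shows "(\<lambda>n. f n powr t) \<longlonglongrightarrow> r powr t \<longleftrightarrow> f \<longlonglongrightarrow> r"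
proof
  assume "(\<lambda>n. f n powr t) \<longlonglongrightarrow> r powr t"
  from tendsto_powr'[OF this tendsto_const, of "1 / t"]
  have "(\<lambda>n. (f n powr t) powr (1 / t)) \<longlonglongrightarrow> (r powr t) powr (1 / t)"
    using assms(1) by simp
  then show "f \<longlonglongrightarrow> r" using assms by simp
next
  assume "f \<longlonglongrightarrow> r"
  from tendsto_powr'[OF this tendsto_const, of t] show "(\<lambda>n. f n powr t) \<longlonglongrightarrow> r powr t"
    using assms by simp
qed

text \<open>On nonnegative reals the power \<open>t\<close> is increasing with increasing inverse
  \<open>1 / t\<close>, so it commutes with infima.\<close>

lemma Inf_powr:
  fixes S :: "real set"
  assumes "0 < t" "S \<noteq> {}" "\<And>x. x \<in> S \<Longrightarrow> 0 \<le> x"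
  shows "Inf ((\<lambda>x. x powr t) ` S) = Inf S powr t"
proof (rule antisym)
  have b: "bdd_below S" "bdd_below ((\<lambda>x. x powr t) ` S)"
    using assms(3) by (auto intro!: bdd_belowI[where m = 0])
  have nn: "0 \<le> Inf ((\<lambda>x. x powr t) ` S)" "0 \<le> Inf S"
    using assms(2,3) by (auto intro!: cInf_greatest)
  have "Inf ((\<lambda>x. x powr t) ` S) powr (1 / t) \<le> x" if "x \<in> S" for x
  proof -
    have "Inf ((\<lambda>x. x powr t) ` S) \<le> x powr t" using b(2) that by (intro cInf_lower) auto
    then have "Inf ((\<lambda>x. x powr t) ` S) powr (1 / t) \<le> (x powr t) powr (1 / t)"
      using nn assms(1) by (intro powr_mono2) auto
    then show ?thesis using assms that by simp
  qed
  then have "Inf ((\<lambda>x. x powr t) ` S) powr (1 / t) \<le> Inf S"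
    using assms(2) by (intro cInf_greatest) auto
  then have "(Inf ((\<lambda>x. x powr t) ` S) powr (1 / t)) powr t \<le> Inf S powr t"
    using assms(1) by (intro powr_mono2) auto
  then show "Inf ((\<lambda>x. x powr t) ` S) \<le> Inf S powr t" using nn assms(1) by simp
  show "Inf S powr t \<le> Inf ((\<lambda>x. x powr t) ` S)"
    using assms nn cInf_lower[OF _ b(1)] by (intro cInf_greatest) (auto intro!: powr_mono2)
qed

section \<open>The flow on halos and on normed sets\<close>

lemma flow_halo_simps [simp]:
  "carrier (flow_halo t A) = carrier A" "add (flow_halo t A) = add A" "zero (flow_halo t A) = zero A"
  "mult (flow_halo t A) = mult A" "one (flow_halo t A) = one A"
  "hnorm (flow_halo t A) = (\<lambda>a. hnorm A a powr t)" "modulus (flow_halo t A) = flow_modulus t (modulus A)"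
  by (simp_all add: flow_halo_def)

lemma a_minus_cong:
  "carrier R = carrier S \<Longrightarrow> add R = add S \<Longrightarrow> zero R = zero S \<Longrightarrow> a_minus R = a_minus S"
  by (simp add: a_minus_def a_inv_def m_inv_def fun_eq_iff)

lemma cring_cong:
  "carrier R = carrier S \<Longrightarrow> add R = add S \<Longrightarrow> zero R = zero S \<Longrightarrow> mult R = mult S \<Longrightarrow> one R = one S \<Longrightarrow>
    cring R = cring S"
  unfolding cring_def ring_def ring_axioms_def abelian_group_def abelian_monoid_def abelian_group_axioms_def
    comm_monoid_def comm_monoid_axioms_def monoid_def comm_group_def group_def group_axioms_def Units_def
  by simp

text \<open>\<open>x < e\<close> is equivalent to \<open>x powr t < e powr t\<close>, and
  \<open>e powr t\<close> runs through all positive numbers together with \<open>e\<close>.\<close>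

lemma cauchy_seqs_powr:
  assumes "0 < t" "carrier G' = carrier G" "a_minus G' = a_minus G"
    and "\<And>x. x \<in> carrier G \<Longrightarrow> 0 \<le> N x" "\<And>x. x \<in> carrier G \<Longrightarrow> N' x = N x powr t"
    and "\<And>x y. x \<in> carrier G \<Longrightarrow> y \<in> carrier G \<Longrightarrow> x \<ominus>\<^bsub>G\<^esub> y \<in> carrier G"
  shows "cauchy_seqs G' N' = cauchy_seqs G N"
proof -
  have lt: "x powr t < e powr t \<longleftrightarrow> x < e" if "0 \<le> x" "0 < e" for x e
    using that assms(1) powr_less_mono2[of t x e] powr_mono2[of t e x] by (meson less_imp_le not_less)
  have "(\<forall>e>0. \<exists>k. \<forall>m\<ge>k. \<forall>n\<ge>k. N' (s m \<ominus>\<^bsub>G\<^esub> s n) < e) \<longleftrightarrow> (\<forall>e>0. \<exists>k. \<forall>m\<ge>k. \<forall>n\<ge>k. N (s m \<ominus>\<^bsub>G\<^esub> s n) < e)"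
    if s: "\<forall>n. s n \<in> carrier G" for s
  proof -
    have eq: "N' (s m \<ominus>\<^bsub>G\<^esub> s n) < e powr t \<longleftrightarrow> N (s m \<ominus>\<^bsub>G\<^esub> s n) < e" if "0 < e" for m n e
      using that assms(4-6) s by (simp add: lt)
    show ?thesis
    proof (intro iffI allI impI)
      fix e :: real assume 1: "\<forall>e>0. \<exists>k. \<forall>m\<ge>k. \<forall>n\<ge>k. N' (s m \<ominus>\<^bsub>G\<^esub> s n) < e" and e: "0 < e"
      have "0 < e powr t" using e by simp
      from 1[rule_format, OF this] show "\<exists>k. \<forall>m\<ge>k. \<forall>n\<ge>k. N (s m \<ominus>\<^bsub>G\<^esub> s n) < e"
        by (simp only: eq[OF e])
    next
      fix e :: real assume 1: "\<forall>e>0. \<exists>k. \<forall>m\<ge>k. \<forall>n\<ge>k. N (s m \<ominus>\<^bsub>G\<^esub> s n) < e" and e: "0 < e"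
      have e': "0 < e powr (1 / t)" using e by simp
      have "(e powr (1 / t)) powr t = e" using e assms(1) by simp
      with 1[rule_format, OF e'] show "\<exists>k. \<forall>m\<ge>k. \<forall>n\<ge>k. N' (s m \<ominus>\<^bsub>G\<^esub> s n) < e"
        by (simp only: eq[OF e', symmetric])
    qed
  qed
  then show ?thesis unfolding cauchy_seqs_def assms(2,3) by blast
qed

lemma (in chalo) flow_chalo:
  assumes t: "0 < t"
  shows "chalo (flow_halo t A) \<Sigma>"
proof (intro chalo.intro chalo_axioms.intro)
  let ?A = "flow_halo t A"
  have cr: "cring ?A = cring A" by (rule cring_cong) simp_all
  then show c: "cring ?A" using is_cring by simp
  have minus: "a_minus ?A = a_minus A" by (rule a_minus_cong) simp_all
  have CS: "cauchy_seqs ?A (hnorm ?A) = cauchy_seqs A (hnorm A)"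
    by (rule cauchy_seqs_powr[OF t _ minus]) auto
  show "banach_halo \<Sigma> ?A"
    unfolding banach_halo_def
  proof (intro conjI ballI impI)
    show "ring ?A" using c by (rule cring.axioms(1))
    show "is_modulus \<Sigma> (modulus ?A)" using flow_is_modulus[OF t is_modulus] by simp
    show "hnorm ?A \<one>\<^bsub>?A\<^esub> = 1" if "\<one>\<^bsub>?A\<^esub> \<noteq> \<zero>\<^bsub>?A\<^esub>" using that hnorm_one by simp
    show "complete_for ?A (hnorm ?A)"
      unfolding complete_for_def CS
    proof
      fix s assume s: "s \<in> cauchy_seqs A (hnorm A)"
      have "complete_for A (hnorm A)" using halo by (simp add: banach_halo_def)
      then have "\<exists>l\<in>carrier A. (\<lambda>n. hnorm A (s n \<ominus> l)) \<longlonglongrightarrow> 0" using s by (simp add: complete_for_def)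
      then obtain l where l: "l \<in> carrier A" "(\<lambda>n. hnorm A (s n \<ominus> l)) \<longlonglongrightarrow> 0" by (elim bexE)
      have "s n \<in> carrier A" for n using s by (simp add: cauchy_seqs_def)
      then have "(\<lambda>n. hnorm A (s n \<ominus> l) powr t) \<longlonglongrightarrow> 0 powr t"
        using l t by (subst tendsto_powr_iff) auto
      then show "\<exists>l\<in>carrier ?A. (\<lambda>n. hnorm ?A (s n \<ominus>\<^bsub>?A\<^esub> l)) \<longlonglongrightarrow> 0"
        using l(1) t by (auto simp: minus)
    qed
  next
    fix a assume a: "a \<in> carrier ?A"
    then show "0 \<le> hnorm ?A a" "hnorm ?A a = 0 \<longleftrightarrow> a = \<zero>\<^bsub>?A\<^esub>" by (simp_all add: hnorm_eq_0_iff)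
    fix b assume b: "b \<in> carrier ?A"
    have "hnorm A (a \<ominus> b) powr t \<le> modulus_norm (modulus A) (hnorm A a) (hnorm A b) powr t"
      using a b t hnorm_minus by (intro powr_mono2) auto
    then show "hnorm ?A (a \<ominus>\<^bsub>?A\<^esub> b) \<le> modulus_norm (modulus ?A) (hnorm ?A a) (hnorm ?A b)"
      using a b modulus_norm_flow[OF t is_modulus] by (simp add: minus)
    have "hnorm A (a \<otimes> b) powr t \<le> (mult_const (modulus A) * hnorm A a * hnorm A b) powr t"
      using a b t hnorm_mult by (intro powr_mono2) auto
    then show "hnorm ?A (a \<otimes>\<^bsub>?A\<^esub> b) \<le> mult_const (modulus ?A) * hnorm ?A a * hnorm ?A b"
      using a b mult_const_pos by (simp add: mult_const_flow powr_mult)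
  qed
qed

lemma pts_flow_set [simp]: "pts (flow_set t X) = pts X"
  by (simp add: flow_set_def)

lemma nrm_flow_set: "x \<in> pts X \<Longrightarrow> nrm (flow_set t X) x = nrm X x powr t"
  by (simp add: flow_set_def)

lemma flow_set_normed: "X \<in> normed_sets \<U> \<Longrightarrow> flow_set t X \<in> normed_sets \<U>"
  by (auto simp: normed_sets_def flow_set_def)

lemma flow_set_inverse:
  assumes "0 < t" "X \<in> normed_sets \<U>"
  shows "flow_set t (flow_set (1 / t) X) = X" "flow_set (1 / t) (flow_set t X) = X"
proof -
  have "(\<lambda>x\<in>pts X. (nrm X x powr (1 / t)) powr t) = nrm X" "(\<lambda>x\<in>pts X. (nrm X x powr t) powr (1 / t)) = nrm X"
    using normed_sets_D[OF assms(2)] assms(1) by (auto simp: fun_eq_iff extensional_def)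
  then show "flow_set t (flow_set (1 / t) X) = X" "flow_set (1 / t) (flow_set t X) = X"
    by (simp_all add: flow_set_def cong: restrict_cong)
qed

lemma bounded_map_powr:
  assumes "0 < t" "bounded_map \<Sigma> X NX NY f" "\<And>x. x \<in> X \<Longrightarrow> 0 \<le> NX x" "\<And>x. x \<in> X \<Longrightarrow> 0 \<le> NY (f x)"
  shows "bounded_map \<Sigma> X (\<lambda>x. NX x powr t) (\<lambda>y. NY y powr t) f"
proof (cases \<Sigma>)
  case Short
  then show ?thesis using assms by (auto intro!: powr_mono2)
next
  case Lipschitz
  then obtain c where c: "0 \<le> c" "\<And>x. x \<in> X \<Longrightarrow> NY (f x) \<le> c * NX x" using assms(2) by auto
  have "NY (f x) powr t \<le> c powr t * NX x powr t" if "x \<in> X" for x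
    using powr_mono2[OF _ assms(4)[OF that] c(2)[OF that], of t] assms(1) c(1) assms(3)[OF that]
    by (simp add: powr_mult)
  then show ?thesis using Lipschitz by (auto intro!: exI[where x = "c powr t"])
qed

section \<open>The flow on monads\<close>

context nsets
begin

lemma flow_hom_mono:
  assumes t: "0 < t" and X: "X \<in> normed_sets \<U>" and Y: "Y \<in> normed_sets \<U>" and f: "f \<in> hom \<C> X Y"
  shows "f \<in> hom \<C> (flow_set t X) (flow_set t Y)"
proof -
  have fp: "f x \<in> pts Y" if "x \<in> pts X" for x using hom_app[OF f that] .
  have "bounded_map \<Sigma> (pts X) (\<lambda>x. nrm X x powr t) (\<lambda>y. nrm Y y powr t) f"
    by (rule bounded_map_powr[OF t]) (use f fp normed_sets_D[OF X] normed_sets_D[OF Y] in \<open>auto simp: C_simps\<close>)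
  moreover have "bounded_map \<Sigma> (pts X) (nrm (flow_set t X)) (nrm (flow_set t Y)) f
      = bounded_map \<Sigma> (pts X) (\<lambda>x. nrm X x powr t) (\<lambda>y. nrm Y y powr t) f"
    using fp by (intro bounded_map_cong) (simp_all add: nrm_flow_set)
  ultimately show ?thesis using f by (simp add: C_simps)
qed

lemma flow_hom:
  assumes t: "0 < t" and X: "X \<in> normed_sets \<U>" and Y: "Y \<in> normed_sets \<U>"
  shows "hom \<C> (flow_set t X) (flow_set t Y) = hom \<C> X Y"
proof
  show "hom \<C> X Y \<subseteq> hom \<C> (flow_set t X) (flow_set t Y)" using flow_hom_mono[OF t X Y] by blast
  show "hom \<C> (flow_set t X) (flow_set t Y) \<subseteq> hom \<C> X Y"
    using flow_hom_mono[of "1 / t" "flow_set t X" "flow_set t Y"] t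
      flow_set_normed[OF X, of t] flow_set_normed[OF Y, of t]
    by (auto simp: flow_set_inverse[OF t X] flow_set_inverse[OF t Y])
qed

lemma idt_flow: "idt \<C> (flow_set t X) = idt \<C> X"
  by (simp add: C_simps(2))

lemma flow_monad_simps:
  "fobj (endo (flow_monad t T)) X = flow_set t (fobj (endo T) (flow_set (1 / t) X))"
  "fmap (endo (flow_monad t T)) X Y = fmap (endo T) (flow_set (1 / t) X) (flow_set (1 / t) Y)"
  "eta (flow_monad t T) X = eta T (flow_set (1 / t) X)"
  "mu (flow_monad t T) X = mu T (flow_set (1 / t) X)"
  by (simp_all add: flow_monad_def)

text \<open>Flowing both ends by \<open>1 / t\<close> moves the flow from the target to the source.
  This is needed for the unit of a flowed monad, whose source carries no flow.\<close>

lemma flow_hom_adjoint: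
  assumes t: "0 < t" and X: "X \<in> normed_sets \<U>" and Y: "Y \<in> normed_sets \<U>"
  shows "hom \<C> X (flow_set t Y) = hom \<C> (flow_set (1 / t) X) Y"
  using flow_hom[OF t flow_set_normed[OF X] Y, of "1 / t"] by (simp add: flow_set_inverse[OF t X])

lemma flow_hom_inverse:
  "0 < t \<Longrightarrow> X \<in> normed_sets \<U> \<Longrightarrow> Y \<in> normed_sets \<U> \<Longrightarrow>
    hom \<C> (flow_set (1 / t) X) (flow_set (1 / t) Y) = hom \<C> X Y"
  by (rule flow_hom) simp_all

text \<open>The flowed monad is a conjugate of \<open>T\<close> by flows. Inner flows by
  \<open>t\<close> and \<open>1 / t\<close> cancel on the nose, so its laws at \<open>X\<close> are
  the laws of \<open>T\<close> at \<open>flow_set (1 / t) X\<close>.\<close>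

lemma flow_monad_laws:
  assumes t: "0 < t" and T: "monad_laws T"
  shows "monad_laws (flow_monad t T)"
proof -
  have fT: "functor_laws (endo T)" using T by (simp add: monad_laws_def)
  let ?\<sigma> = "flow_set (1 / t)" and ?T = "fobj (endo T)"
  have s: "?\<sigma> X \<in> normed_sets \<U>" if "X \<in> normed_sets \<U>" for X using flow_set_normed[OF that] .
  have TN: "?T X \<in> normed_sets \<U>" if "X \<in> normed_sets \<U>" for X using functor_laws_D(1)[OF fT that] .
  have inv: "?\<sigma> (flow_set t X) = X" if "X \<in> normed_sets \<U>" for X using flow_set_inverse(2)[OF t that] .
  note hom_inv = flow_hom_inverse[OF t]
  have Tlaws:
    "\<And>X. X \<in> normed_sets \<U> \<Longrightarrow> eta T X \<in> hom \<C> X (?T X)"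
    "\<And>X Y f x. X \<in> normed_sets \<U> \<Longrightarrow> Y \<in> normed_sets \<U> \<Longrightarrow> f \<in> hom \<C> X Y \<Longrightarrow> x \<in> pts X \<Longrightarrow>
      eta T Y (f x) = fmap (endo T) X Y f (eta T X x)"
    "\<And>X. X \<in> normed_sets \<U> \<Longrightarrow> mu T X \<in> hom \<C> (?T (?T X)) (?T X)"
    "\<And>X Y f v. X \<in> normed_sets \<U> \<Longrightarrow> Y \<in> normed_sets \<U> \<Longrightarrow> f \<in> hom \<C> X Y \<Longrightarrow> v \<in> pts (?T (?T X)) \<Longrightarrow>
      mu T Y (fmap (endo T) (?T X) (?T Y) (fmap (endo T) X Y f) v) = fmap (endo T) X Y f (mu T X v)"
    "\<And>X w. X \<in> normed_sets \<U> \<Longrightarrow> w \<in> pts (?T (?T (?T X))) \<Longrightarrow>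
      mu T X (mu T (?T X) w) = mu T X (fmap (endo T) (?T (?T X)) (?T X) (mu T X) w)"
    "\<And>X u. X \<in> normed_sets \<U> \<Longrightarrow> u \<in> pts (?T X) \<Longrightarrow> mu T X (eta T (?T X) u) = u"
    "\<And>X u. X \<in> normed_sets \<U> \<Longrightarrow> u \<in> pts (?T X) \<Longrightarrow> mu T X (fmap (endo T) X (?T X) (eta T X) u) = u"
    using T unfolding monad_laws_def by blast+
  show ?thesis
    unfolding monad_laws_def functor_laws_def flow_monad_simps pts_flow_set
  proof (intro conjI ballI)
    fix X assume X: "X \<in> normed_sets \<U>"
    note sX = s[OF X] and TX = TN[OF s[OF X]] and TTX = TN[OF TN[OF s[OF X]]]
    show "flow_set t (?T (?\<sigma> X)) \<in> normed_sets \<U>" by (rule flow_set_normed[OF TX])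
    show "eta T (?\<sigma> X) \<in> hom \<C> X (flow_set t (?T (?\<sigma> X)))"
      unfolding flow_hom_adjoint[OF t X TX] by (rule Tlaws(1)[OF sX])
    show "mu T (?\<sigma> X) \<in> hom \<C> (flow_set t (?T (?\<sigma> (flow_set t (?T (?\<sigma> X)))))) (flow_set t (?T (?\<sigma> X)))"
      unfolding inv[OF TX] flow_hom[OF t TTX TX] by (rule Tlaws(3)[OF sX])
    show "fmap (endo T) (?\<sigma> X) (?\<sigma> X) (idt \<C> X) u = u" if "u \<in> pts (?T (?\<sigma> X))" for u
      using functor_laws_D(3)[OF fT sX that] by (simp only: idt_flow)
    show "mu T (?\<sigma> X) (mu T (?\<sigma> (flow_set t (?T (?\<sigma> X)))) w) =
        mu T (?\<sigma> X) (fmap (endo T) (?\<sigma> (flow_set t (?T (?\<sigma> (flow_set t (?T (?\<sigma> X)))))))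
          (?\<sigma> (flow_set t (?T (?\<sigma> X)))) (mu T (?\<sigma> X)) w)"
      if "w \<in> pts (?T (?\<sigma> (flow_set t (?T (?\<sigma> (flow_set t (?T (?\<sigma> X))))))))" for w
      using that unfolding inv[OF TX] inv[OF TTX] by (rule Tlaws(5)[OF sX])
    show "mu T (?\<sigma> X) (eta T (?\<sigma> (flow_set t (?T (?\<sigma> X)))) u) = u"
      "mu T (?\<sigma> X) (fmap (endo T) (?\<sigma> X) (?\<sigma> (flow_set t (?T (?\<sigma> X)))) (eta T (?\<sigma> X)) u) = u"
      if "u \<in> pts (?T (?\<sigma> X))" for u
      unfolding inv[OF TX] by (rule Tlaws(6)[OF sX that], rule Tlaws(7)[OF sX that])
    fix Y f assume Y: "Y \<in> normed_sets \<U>" and f: "f \<in> hom \<C> X Y"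
    note sY = s[OF Y] and TY = TN[OF s[OF Y]]
    have f': "f \<in> hom \<C> (?\<sigma> X) (?\<sigma> Y)" using f by (simp only: hom_inv[OF X Y])
    show "fmap (endo T) (?\<sigma> X) (?\<sigma> Y) f \<in> hom \<C> (flow_set t (?T (?\<sigma> X))) (flow_set t (?T (?\<sigma> Y)))"
      unfolding flow_hom[OF t TX TY] by (rule functor_laws_D(2)[OF fT sX sY f'])
    show "eta T (?\<sigma> Y) (f x) = fmap (endo T) (?\<sigma> X) (?\<sigma> Y) f (eta T (?\<sigma> X) x)" if "x \<in> pts X" for x
      using that by (intro Tlaws(2)[OF sX sY f']) simp
    show "mu T (?\<sigma> Y) (fmap (endo T) (?\<sigma> (flow_set t (?T (?\<sigma> X)))) (?\<sigma> (flow_set t (?T (?\<sigma> Y))))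
        (fmap (endo T) (?\<sigma> X) (?\<sigma> Y) f) v) = fmap (endo T) (?\<sigma> X) (?\<sigma> Y) f (mu T (?\<sigma> X) v)"
      if "v \<in> pts (?T (?\<sigma> (flow_set t (?T (?\<sigma> X)))))" for v
      using that unfolding inv[OF TX] inv[OF TY] by (rule Tlaws(4)[OF sX sY f'])
    fix Z g assume Z: "Z \<in> normed_sets \<U>" and g: "g \<in> hom \<C> Y Z"
    have g': "g \<in> hom \<C> (?\<sigma> Y) (?\<sigma> Z)" using g by (simp only: hom_inv[OF Y Z])
    show "fmap (endo T) (?\<sigma> X) (?\<sigma> Z) (compose (pts X) g f) u =
        fmap (endo T) (?\<sigma> Y) (?\<sigma> Z) g (fmap (endo T) (?\<sigma> X) (?\<sigma> Y) f u)"
      if "u \<in> pts (?T (?\<sigma> X))" for u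
      using functor_laws_D(4)[OF fT sX sY s[OF Z] f' g' that] by simp
  qed
qed

lemma flow_monad_morphism_laws:
  assumes t: "0 < t" and S: "monad_laws S" and T: "monad_laws T" and \<theta>: "monad_morphism_laws S T \<theta>"
  shows "monad_morphism_laws (flow_monad t S) (flow_monad t T) (\<lambda>X\<in>normed_sets \<U>. \<theta> (flow_set (1 / t) X))"
proof -
  have fS: "functor_laws (endo S)" and fT: "functor_laws (endo T)" using S T by (simp_all add: monad_laws_def)
  let ?\<sigma> = "flow_set (1 / t)" and ?S = "fobj (endo S)" and ?T = "fobj (endo T)"
  have s: "?\<sigma> X \<in> normed_sets \<U>" if "X \<in> normed_sets \<U>" for X using flow_set_normed[OF that] .
  have inv: "?\<sigma> (flow_set t X) = X" if "X \<in> normed_sets \<U>" for X using flow_set_inverse(2)[OF t that] .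
  have th: "\<And>X. X \<in> normed_sets \<U> \<Longrightarrow> \<theta> X \<in> hom \<C> (?S X) (?T X)"
    "\<And>X Y f u. X \<in> normed_sets \<U> \<Longrightarrow> Y \<in> normed_sets \<U> \<Longrightarrow> f \<in> hom \<C> X Y \<Longrightarrow> u \<in> pts (?S X) \<Longrightarrow>
      \<theta> Y (fmap (endo S) X Y f u) = fmap (endo T) X Y f (\<theta> X u)"
    "\<And>X x. X \<in> normed_sets \<U> \<Longrightarrow> x \<in> pts X \<Longrightarrow> \<theta> X (eta S X x) = eta T X x"
    "\<And>X v. X \<in> normed_sets \<U> \<Longrightarrow> v \<in> pts (?S (?S X)) \<Longrightarrow>
      \<theta> X (mu S X v) = mu T X (\<theta> (?T X) (fmap (endo S) (?S X) (?T X) (\<theta> X) v))"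
    using \<theta> unfolding monad_morphism_laws_def by blast+
  show ?thesis
    unfolding monad_morphism_laws_def flow_monad_simps pts_flow_set
  proof (intro conjI ballI)
    fix X assume X: "X \<in> normed_sets \<U>"
    note SX = functor_laws_D(1)[OF fS s[OF X]] and TX = functor_laws_D(1)[OF fT s[OF X]]
    show "(\<lambda>X\<in>normed_sets \<U>. \<theta> (?\<sigma> X)) X \<in> hom \<C> (flow_set t (?S (?\<sigma> X))) (flow_set t (?T (?\<sigma> X)))"
      using X th(1)[OF s[OF X]] by (simp add: flow_hom[OF t SX TX])
    show "(\<lambda>X\<in>normed_sets \<U>. \<theta> (?\<sigma> X)) X (eta S (?\<sigma> X) x) = eta T (?\<sigma> X) x" if "x \<in> pts X" for x
      using X th(3)[OF s[OF X]] that by simp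
    show "(\<lambda>X\<in>normed_sets \<U>. \<theta> (?\<sigma> X)) X (mu S (?\<sigma> X) v) = mu T (?\<sigma> X)
        ((\<lambda>X\<in>normed_sets \<U>. \<theta> (?\<sigma> X)) (flow_set t (?T (?\<sigma> X)))
          (fmap (endo S) (?\<sigma> (flow_set t (?S (?\<sigma> X)))) (?\<sigma> (flow_set t (?T (?\<sigma> X))))
            ((\<lambda>X\<in>normed_sets \<U>. \<theta> (?\<sigma> X)) X) v))"
      if "v \<in> pts (?S (?\<sigma> (flow_set t (?S (?\<sigma> X)))))" for v
      using that X TX th(4)[OF s[OF X]] flow_set_normed[OF TX, of t] by (simp add: inv[OF SX] inv[OF TX])
    fix Y f u assume Y: "Y \<in> normed_sets \<U>" and f: "f \<in> hom \<C> X Y" and u: "u \<in> pts (?S (?\<sigma> X))"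
    have "f \<in> hom \<C> (?\<sigma> X) (?\<sigma> Y)" using f by (simp only: flow_hom_inverse[OF t X Y])
    from th(2)[OF s[OF X] s[OF Y] this u]
    show "(\<lambda>X\<in>normed_sets \<U>. \<theta> (?\<sigma> X)) Y (fmap (endo S) (?\<sigma> X) (?\<sigma> Y) f u) =
        fmap (endo T) (?\<sigma> X) (?\<sigma> Y) f ((\<lambda>X\<in>normed_sets \<U>. \<theta> (?\<sigma> X)) X u)"
      using X Y by simp
  qed
qed

lemma monad_flow_functor:
  assumes t: "0 < t"
  shows "is_functor (Monads \<C>) (Monads \<C>) (monad_flow t \<U>)"
  unfolding is_functor_def
proof (intro conjI ballI Monads_category)
  fix R assume "R \<in> obj (Monads \<C>)"
  then have R: "monad_laws R" by (simp add: Monads_simps)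
  show "fobj (monad_flow t \<U>) R \<in> obj (Monads \<C>)"
    using flow_monad_laws[OF t R] by (simp add: Monads_simps monad_flow_def)
  show "fmap (monad_flow t \<U>) R R (idt (Monads \<C>) R) = idt (Monads \<C>) (fobj (monad_flow t \<U>) R)"
    using flow_set_normed by (auto simp: Monads_simps monad_flow_def flow_monad_simps fun_eq_iff)
  fix S \<zeta> assume "S \<in> obj (Monads \<C>)" and \<zeta>: "\<zeta> \<in> hom (Monads \<C>) R S"
  then have S: "monad_laws S" by (simp add: Monads_simps)
  show "fmap (monad_flow t \<U>) R S \<zeta> \<in> hom (Monads \<C>) (fobj (monad_flow t \<U>) R) (fobj (monad_flow t \<U>) S)"
    using \<zeta> flow_monad_morphism_laws[OF t R S, of \<zeta>] flow_monad_laws[OF t R] flow_monad_laws[OF t S]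
    by (simp add: Monads_hom R S monad_flow_def)
  fix T \<theta>
  show "fmap (monad_flow t \<U>) R T (comp (Monads \<C>) R S T \<theta> \<zeta>) =
      comp (Monads \<C>) (fobj (monad_flow t \<U>) R) (fobj (monad_flow t \<U>) S) (fobj (monad_flow t \<U>) T)
        (fmap (monad_flow t \<U>) S T \<theta>) (fmap (monad_flow t \<U>) R S \<zeta>)"
    using flow_set_normed by (auto simp: Monads_simps monad_flow_def flow_monad_simps fun_eq_iff)
qed

end

section \<open>The flow on free modules and their completions\<close>

context free_halo
begin

lemma flow_free_halo:
  assumes "0 < t"
  shows "free_halo (flow_halo t A) \<Sigma> (flow_set t X)"
  using flow_chalo[OF assms] by (intro free_halo.intro free_halo_axioms.intro) (simp_all add: nrm_flow_set)

lemma support_flow: "support (flow_halo t A) P = supp"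
  by (simp add: support_def fun_eq_iff)

lemma free_flow:
  "carrier (free_normed_module (flow_halo t A) (flow_set t X)) = carrier F"
  "add (free_normed_module (flow_halo t A) (flow_set t X)) = add F"
  "zero (free_normed_module (flow_halo t A) (flow_set t X)) = zero F"
  "smult (free_normed_module (flow_halo t A) (flow_set t X)) = smult F"
  by (simp_all add: free_normed_module_simps support_flow)

text \<open>For short halos the \<open>lp_norm\<close> commutes with the power. For Lipschitz halos
  the trees and their sums stay the same, each tree norm is raised to the power \<open>t\<close>,
  and the power commutes with the infimum.\<close>

lemma free_norm_flow:
  assumes t: "0 < t" and u: "u \<in> carrier F"
  shows "free_norm (flow_halo t A) (flow_set t X) u = free_norm A X u powr t"
proof (cases \<Sigma>)
  case Short
  then obtain p where p: "modulus A = Exponent p" "0 < p" using free_norm_Short by blast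
  have "hnorm A (u x) powr t * nrm (flow_set t X) x = (hnorm A (u x) * nrm X x) powr t" if "x \<in> supp u" for x
    using that F_D(1)[OF u] nrm_nonneg by (simp add: support_def nrm_flow_set powr_mult)
  then have "free_norm (flow_halo t A) (flow_set t X) u
      = lp_norm (p / ennreal t) (supp u) (\<lambda>x. (hnorm A (u x) * nrm X x) powr t)"
    by (simp add: free_norm_def p(1) support_flow lp_norm_def cong: image_cong sum.cong)
  also have "\<dots> = lp_norm p (supp u) (\<lambda>x. hnorm A (u x) * nrm X x) powr t"
    using F_D[OF u] nrm_nonneg by (intro lp_norm_flow t p) (auto simp: support_def)
  finally show ?thesis by (simp add: free_norm_def p(1))
next
  case Lipschitz
  interpret fl: free_halo "flow_halo t A" \<Sigma> "flow_set t X" by (rule flow_free_halo[OF t])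
  obtain C D where CD: "modulus A = Constants C D" "0 < C"
    using is_modulus Lipschitz by (cases "modulus A") auto
  have trees: "fl.trees = trees" by (simp add: fl.trees_def trees_def)
  have "fl.sgl = sgl" by (simp add: fl.sgl_def sgl_def fun_eq_iff)
  then have sum: "fl.leaf_sum s = leaf_sum s" for s
    by (induction s) (auto simp: fl.leaf_sum_def leaf_sum_def free_flow split: prod.splits)
  have norm: "fl.leaf_norm s = leaf_norm s powr t" if "s \<in> trees" for s
    using that
  proof (induction rule: trees_induct)
    case (Leaf a x)
    then show ?case using nrm_nonneg by (simp add: nrm_flow_set powr_mult)
  next
    case (Branch r s)
    then show ?case
      using CD t leaf_norm_nonneg max_powr[of t "leaf_norm r" "leaf_norm s"]
      by (simp add: powr_mult le_max_iff_disj)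
  qed
  show ?thesis
  proof (cases "supp u = {}")
    case True
    then show ?thesis using fl.free_norm_Lipschitz[OF Lipschitz] t
      by (simp add: free_norm_Lipschitz[OF Lipschitz] support_flow)
  next
    case False
    have "P \<noteq> {}" using False by (auto simp: support_def)
    have "fl.leaf_norm ` {s \<in> trees. leaf_sum s = u} = (\<lambda>r. r powr t) ` (leaf_norm ` {s \<in> trees. leaf_sum s = u})"
      unfolding image_image using norm by (intro image_cong) auto
    moreover have "Inf ((\<lambda>r. r powr t) ` (leaf_norm ` {s \<in> trees. leaf_sum s = u}))
        = Inf (leaf_norm ` {s \<in> trees. leaf_sum s = u}) powr t"
      using trees_exist[OF u \<open>P \<noteq> {}\<close>] leaf_norm_nonneg by (intro Inf_powr[OF t]) auto
    ultimately show ?thesis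
      using False fl.free_norm_Lipschitz[OF Lipschitz, of u]
      by (simp add: free_norm_Lipschitz[OF Lipschitz] support_flow trees sum)
  qed
qed

end

context ell_halo
begin

lemma flow_cauchy:
  assumes t: "0 < t"
  shows "cauchy_seqs (free_normed_module (flow_halo t A) (flow_set t X))
      (free_norm (flow_halo t A) (flow_set t X)) = CF"
  by (rule cauchy_seqs_powr[OF t free_flow(1) a_minus_cong]) (simp_all add: free_flow free_norm_flow[OF t])

lemma flow_null_rel:
  assumes t: "0 < t"
  shows "null_rel (free_normed_module (flow_halo t A) (flow_set t X)) = null_rel F"
proof -
  have minus: "a_minus (free_normed_module (flow_halo t A) (flow_set t X)) = a_minus F"
    by (rule a_minus_cong) (simp_all add: free_flow)
  have "(\<lambda>n. free_norm (flow_halo t A) (flow_set t X) (r n \<ominus>\<^bsub>F\<^esub> s n)) \<longlonglongrightarrow> 0 \<longleftrightarrow>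
      (\<lambda>n. free_norm A X (r n \<ominus>\<^bsub>F\<^esub> s n)) \<longlonglongrightarrow> 0" if "r \<in> CF" "s \<in> CF" for r s
    using tendsto_powr_iff[OF t, of "\<lambda>n. free_norm A X (r n \<ominus>\<^bsub>F\<^esub> s n)" 0]
      E.CS_closed[OF that(1)] E.CS_closed[OF that(2)] t by (simp add: free_norm_flow[OF t])
  then show ?thesis
    unfolding null_rel_def by (simp add: flow_cauchy[OF t] minus cong: conj_cong)
qed

lemma flow_raw:
  assumes t: "0 < t"
  shows "carrier (ell_raw (flow_halo t A) (flow_set t X)) = carrier (ell_raw A X)"
    "add (ell_raw (flow_halo t A) (flow_set t X)) = add (ell_raw A X)"
    "zero (ell_raw (flow_halo t A) (flow_set t X)) = zero (ell_raw A X)"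
    "smult (ell_raw (flow_halo t A) (flow_set t X)) = smult (ell_raw A X)"
  by (simp_all add: ell_raw_def completion_def flow_null_rel[OF t] flow_cauchy[OF t] free_flow)

text \<open>The coding injection is chosen from the carrier of the completion alone, and the flow
  leaves the set of classes unchanged. Hence the coded elements are literally equal on both
  sides.\<close>

lemma flow_code:
  assumes t: "0 < t"
  shows "ell_code \<U> (flow_halo t A) (flow_set t X) = ell_code \<U> A X"
    "ell_reps \<U> (flow_halo t A) (flow_set t X) = ell_reps \<U> A X"
  by (simp_all add: ell_reps_def ell_code_def flow_raw[OF t])

lemma flow_ell:
  assumes t: "0 < t"
  shows "carrier (ell \<U> (flow_halo t A) (flow_set t X)) = carrier E"
    "add (ell \<U> (flow_halo t A) (flow_set t X)) = add E"
    "zero (ell \<U> (flow_halo t A) (flow_set t X)) = zero E"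
    "smult (ell \<U> (flow_halo t A) (flow_set t X)) = smult E"
    "ell_unit \<U> (flow_halo t A) (flow_set t X) = \<eta>"
proof -
  have "delta (flow_halo t A) P = delta A P" by (simp add: delta_def fun_eq_iff)
  then show "ell_unit \<U> (flow_halo t A) (flow_set t X) = \<eta>"
    by (simp add: ell_unit_def flow_code[OF t] flow_null_rel[OF t])
qed (simp_all add: ell_def transport_def Let_def flow_code[OF t] flow_raw[OF t])

text \<open>The limits that occur for the flowed norm are the \<open>t\<close>-th powers of those
  for the original norm, and some limit does occur, so the power commutes with the infimum.\<close>

lemma flow_mnorm:
  assumes t: "0 < t" and y: "y \<in> carrier E"
  shows "mnorm (ell \<U> (flow_halo t A) (flow_set t X)) y = mnorm E y powr t"
proof -
  obtain s where s: "s \<in> CF" "y = cl s" using y by (rule E.E_cases)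
  let ?R = "{r. \<exists>q\<in>CF. cl q = cl s \<and> (\<lambda>n. free_norm A X (q n)) \<longlonglongrightarrow> r}"
  let ?R' = "{r. \<exists>q\<in>CF. cl q = cl s \<and> (\<lambda>n. free_norm (flow_halo t A) (flow_set t X) (q n)) \<longlonglongrightarrow> r}"
  have nn: "0 \<le> r" if "q \<in> CF" "(\<lambda>n. free_norm A X (q n)) \<longlonglongrightarrow> r" for q r
    using LIMSEQ_le_const[OF that(2), of 0] E.CS_closed[OF that(1)] by auto
  have iff: "(\<lambda>n. free_norm (flow_halo t A) (flow_set t X) (q n)) \<longlonglongrightarrow> r powr t \<longleftrightarrow>
      (\<lambda>n. free_norm A X (q n)) \<longlonglongrightarrow> r" if "q \<in> CF" "0 \<le> r" for q r
    using tendsto_powr_iff[OF t _ that(2), of "\<lambda>n. free_norm A X (q n)"] E.CS_closed[OF that(1)]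
    by (simp add: free_norm_flow[OF t])
  have "?R' = (\<lambda>r. r powr t) ` ?R"
  proof (intro equalityI subsetI)
    fix r assume "r \<in> ?R'"
    then obtain q where q: "q \<in> CF" "cl q = cl s" "(\<lambda>n. free_norm (flow_halo t A) (flow_set t X) (q n)) \<longlonglongrightarrow> r"
      by blast
    have "0 \<le> r"
      using LIMSEQ_le_const[OF q(3), of 0] E.CS_closed[OF q(1)] by (auto simp: free_norm_flow[OF t])
    \<comment> \<open>A limit of flowed norms is nonnegative and therefore a \<open>t\<close>-th
      power.\<close>
    then have r: "r = (r powr (1 / t)) powr t" using t by simp
    have "(\<lambda>n. free_norm A X (q n)) \<longlonglongrightarrow> r powr (1 / t)"
      using q(3) iff[OF q(1), of "r powr (1 / t)"] r by simp
    then show "r \<in> (\<lambda>r. r powr t) ` ?R" using q r by blast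
  next
    fix r' assume "r' \<in> (\<lambda>r. r powr t) ` ?R"
    then obtain r q where "r' = r powr t" "q \<in> CF" "cl q = cl s" "(\<lambda>n. free_norm A X (q n)) \<longlonglongrightarrow> r" by blast
    then show "r' \<in> ?R'" using iff[of q r] nn[of q r] by blast
  qed
  moreover have "?R \<noteq> {}"
  proof -
    obtain S R where "\<And>k. S k \<in> CF" "\<And>k. cl (S k) = y" "\<And>k. (\<lambda>n. free_norm A X (S k n)) \<longlonglongrightarrow> R k"
      by (rule E.NE_approx[OF y]) blast
    then show ?thesis using s(2) by blast
  qed
  ultimately have "Inf ?R' = Inf ?R powr t" using nn by (auto intro!: Inf_powr[OF t])
  moreover have "mnorm (ell \<U> (flow_halo t A) (flow_set t X)) y
      = Inf {r. \<exists>q\<in>ell_reps \<U> A X y. (\<lambda>n. free_norm (flow_halo t A) (flow_set t X) (q n)) \<longlonglongrightarrow> r}"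
    by (simp add: ell_def transport_def Let_def flow_code[OF t, unfolded ell_reps_def] ell_reps_def flow_raw[OF t])
      (simp add: ell_raw_def completion_def)
  moreover have "\<dots> = Inf ?R'" using s by (simp add: reps_cl conj_assoc Bex_def)
  ultimately show ?thesis using mnorm_cl[OF s(1)] s(2) by simp
qed

end

section \<open>Compatibility of the functor with the flows\<close>

context lambda_ctx
begin

lemma flow_halo_in: "0 < t \<Longrightarrow> A \<in> \<H> \<Longrightarrow> flow_halo t A \<in> \<H>"
  using chalo.flow_chalo[OF halo_D(1), of A t] halo_D(2)[of A] chalo.halo chalo.axioms(1)
  by (fastforce simp: CBanhalos_def)

lemma flow_halo_hom:
  assumes t: "0 < t" and A: "A \<in> \<H>" and B: "B \<in> \<H>" and f: "halo_hom f A B"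
  shows "halo_hom f (flow_halo t A) (flow_halo t B)"
proof -
  interpret A: chalo A \<Sigma> by (rule halo_D(1)[OF A])
  interpret B: chalo B \<Sigma> by (rule halo_D(1)[OF B])
  have "bounded_map \<Sigma> (carrier A) (\<lambda>a. hnorm A a powr t) (\<lambda>b. hnorm B b powr t) f"
    by (rule bounded_map_powr[OF t]) (use f halo_hom_closed[OF f] in \<open>auto simp: halo_hom_def\<close>)
  moreover have "modulus_le (flow_modulus t (modulus A)) (flow_modulus t (modulus B))"
    using f by (intro flow_modulus_le[OF t A.is_modulus B.is_modulus]) (simp add: halo_hom_def)
  moreover have "f \<in> ring_hom (flow_halo t A) (flow_halo t B)"
    using f by (simp add: halo_hom_def ring_hom_def)
  ultimately show ?thesis by (simp add: halo_hom_def)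
qed

lemma halo_flow_functor:
  assumes t: "0 < t"
  shows "is_functor (CBanhalos \<Sigma> \<U>) (CBanhalos \<Sigma> \<U>) (halo_flow t)"
  unfolding is_functor_def
  using CBanhalos_category flow_halo_in[OF t] flow_halo_hom[OF t]
  by (auto simp: halo_flow_def hom_CBanhalos CBanhalos_simps)

lemma flow_L:
  assumes t: "0 < t" and A: "A \<in> \<H>" and X: "X \<in> \<N>"
  shows "L (flow_halo t A) (flow_set t X) = flow_set t (L A X)"
proof -
  interpret ell_halo A \<Sigma> X \<U> by (rule ell_haloI[OF A X])
  show ?thesis
    by (simp add: normed_set_of_def flow_set_def[of t "\<lparr>pts = carrier E, nrm = restrict (mnorm E) (carrier E)\<rparr>"]
        flow_ell(1)[OF t] flow_mnorm[OF t] cong: restrict_cong)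
qed

lemma flow_semilin:
  assumes t: "0 < t" and A: "A \<in> \<H>" "X \<in> \<N>" and B: "B \<in> \<H>" "Y \<in> \<N>"
    and f: "semilin A (ell \<U> A X) \<phi> (ell \<U> B Y) f"
  shows "semilin (flow_halo t A) (ell \<U> (flow_halo t A) (flow_set t X)) \<phi>
    (ell \<U> (flow_halo t B) (flow_set t Y)) f"
proof -
  interpret A: ell_halo A \<Sigma> X \<U> by (rule ell_haloI[OF A])
  interpret B: ell_halo B \<Sigma> Y \<U> by (rule ell_haloI[OF B])
  obtain b where b: "0 \<le> b" "\<And>y. y \<in> carrier (ell \<U> A X) \<Longrightarrow> mnorm (ell \<U> B Y) (f y) \<le> b * mnorm (ell \<U> A X) y"
    using semilin_bound[OF f] by blast
  have "mnorm (ell \<U> B Y) (f y) powr t \<le> b powr t * mnorm (ell \<U> A X) y powr t" if y: "y \<in> carrier (ell \<U> A X)" for y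
  proof -
    have "mnorm (ell \<U> B Y) (f y) powr t \<le> (b * mnorm (ell \<U> A X) y) powr t"
      using b(2)[OF y] t B.E.NE_nonneg[OF semilin_closed[OF f y]] by (intro powr_mono2) auto
    then show ?thesis using b(1) A.E.NE_nonneg[OF y] by (simp add: powr_mult)
  qed
  then have "\<exists>b\<ge>0. \<forall>y\<in>carrier (ell \<U> A X). mnorm (ell \<U> B Y) (f y) powr t \<le> b * mnorm (ell \<U> A X) y powr t"
    by (intro exI[where x = "b powr t"]) auto
  then show ?thesis
    using semilin_additive[OF f] semilin_smult[OF f] semilin_closed[OF f]
    by (simp add: semilin_def additive_map_def A.flow_ell[OF t] B.flow_ell[OF t] A.flow_mnorm[OF t] B.flow_mnorm[OF t])
qed

text \<open>The extension built before the flow remains semilinear over \<open>\<phi>\<close> and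
  bounded, now by \<open>b powr t\<close>, and has the same values on generators; uniqueness
  identifies it with the extension built after the flow.\<close>

lemma lin_ext_flow:
  assumes t: "0 < t" and A: "A \<in> \<H>" "X \<in> \<N>" and B: "B \<in> \<H>" "Y \<in> \<N>"
    and \<phi>: "halo_hom \<phi> A B" and h: "h \<in> pts X \<rightarrow> carrier (ell \<U> B Y)"
      "bounded_map \<Sigma> (pts X) (nrm X) (mnorm (ell \<U> B Y)) h"
  shows "lin_ext \<U> \<phi> (flow_halo t A) (flow_set t X) (ell \<U> (flow_halo t B) (flow_set t Y)) h =
    lin_ext \<U> \<phi> A X (ell \<U> B Y) h"
proof (rule extensionalityI[of _ "carrier (ell \<U> A X)"])
  interpret A: ell_halo A \<Sigma> X \<U> by (rule ell_haloI[OF A])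
  show "lin_ext \<U> \<phi> (flow_halo t A) (flow_set t X) (ell \<U> (flow_halo t B) (flow_set t Y)) h
      \<in> extensional (carrier (ell \<U> A X))" by (simp add: lin_ext_def A.flow_ell[OF t])
  show "lin_ext \<U> \<phi> A X (ell \<U> B Y) h \<in> extensional (carrier (ell \<U> A X))" by (simp add: lin_ext_def)
  fix u assume u: "u \<in> carrier (ell \<U> A X)"
  note At = flow_halo_in[OF t A(1)] flow_set_normed[OF A(2), of t]
  note Bt = flow_halo_in[OF t B(1)] flow_set_normed[OF B(2), of t]
  show "lin_ext \<U> \<phi> (flow_halo t A) (flow_set t X) (ell \<U> (flow_halo t B) (flow_set t Y)) h u =
      lin_ext \<U> \<phi> A X (ell \<U> B Y) h u"
    by (rule lin_ext_semilin_eq[OF At ell_banach[OF Bt] flow_semilin[OF t A B lin_ext_semilin[OF A B \<phi> h]]])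
      (use u lin_ext_unit[OF A B \<phi> h] in \<open>simp_all add: A.flow_ell[OF t]\<close>)
qed

lemma unit_flow:
  assumes "0 < t" "A \<in> \<H>" "X \<in> \<N>"
  shows "\<delta> (flow_halo t A) (flow_set t X) = \<delta> A X"
  using ell_halo.flow_ell(5)[OF ell_haloI[OF assms(2,3)] assms(1)] .

lemma Lambda_flow_agree:
  assumes t: "0 < t" and A: "A \<in> \<H>"
  shows "monad_agree (Lambda_monad \<U> (flow_halo t A)) (flow_monad t (Lambda_monad \<U> A))"
  unfolding monad_agree_def flow_monad_simps Lambda_monad_simps
proof (intro conjI ballI)
  fix X assume X: "X \<in> \<N>"
  let ?X = "flow_set (1 / t) X"
  have X': "?X \<in> \<N>" by (rule flow_set_normed[OF X])
  have XX: "flow_set t ?X = X" by (rule flow_set_inverse(1)[OF t X])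
  note L = flow_L[OF t A X', unfolded XX]
  show "L (flow_halo t A) X = flow_set t (L A ?X)" by (rule L)
  show "\<delta> (flow_halo t A) X = \<delta> A ?X" using unit_flow[OF t A X'] by (simp only: XX)
  show "Tmu (flow_halo t A) X = Tmu A ?X"
    using lin_ext_flow[OF t A L_N[OF A X'] A X' halo_hom_id id_bounded] unfolding XX L .
  fix Y h assume Y: "Y \<in> \<N>" and h: "h \<in> hom \<C> X Y"
  let ?Y = "flow_set (1 / t) Y"
  have Y': "?Y \<in> \<N>" by (rule flow_set_normed[OF Y])
  have YY: "flow_set t ?Y = Y" by (rule flow_set_inverse(1)[OF t Y])
  have h': "h \<in> hom \<C> ?X ?Y" using h by (simp only: flow_hom_inverse[OF t X Y])
  have "\<delta> (flow_halo t A) Y = \<delta> A ?Y" using unit_flow[OF t A Y'] by (simp only: YY)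
  then show "Tmap (flow_halo t A) X Y h = Tmap A ?X ?Y h"
    using lin_ext_flow[OF t A X' A Y' halo_hom_id unit_comp_hom[OF A Y' h']] unfolding XX YY by simp
qed

text \<open>The components are identities, since the two monads at each halo agree. Naturality then
  says that \<open>\<Theta> f\<close> is the same map before and after the flow.\<close>

lemma Lambda_flow:
  assumes t: "0 < t"
  shows "nat_iso (CBanhalos \<Sigma> \<U>) (Monads \<C>) (comp_functor (Lambda \<U>) (halo_flow t))
    (comp_functor (monad_flow t \<U>) (Lambda \<U>)) (\<lambda>A. idt (Monads \<C>) (Lambda_monad \<U> (flow_halo t A)))"
proof -
  have ob: "fobj (comp_functor (Lambda \<U>) (halo_flow t)) A = Lambda_monad \<U> (flow_halo t A)"
    "fobj (comp_functor (monad_flow t \<U>) (Lambda \<U>)) A = flow_monad t (Lambda_monad \<U> A)" for A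
    by (simp_all add: comp_functor_def Lambda_simps halo_flow_def monad_flow_def)
  have mor: "fmap (comp_functor (Lambda \<U>) (halo_flow t)) A B f = (\<lambda>X\<in>\<N>. \<Theta> f (flow_halo t A) (flow_halo t B) X)"
    "fmap (comp_functor (monad_flow t \<U>) (Lambda \<U>)) A B f = (\<lambda>X\<in>\<N>. \<Theta> f A B (flow_set (1 / t) X))" for A B f
    using flow_set_normed by (auto simp: comp_functor_def Lambda_simps halo_flow_def monad_flow_def fun_eq_iff)
  have iso: "is_iso (Monads \<C>) (Lambda_monad \<U> (flow_halo t A)) (flow_monad t (Lambda_monad \<U> A))
      (idt (Monads \<C>) (Lambda_monad \<U> (flow_halo t A)))" if A: "A \<in> \<H>" for A
    by (rule monad_agree_iso[OF monad_laws_Lambda[OF flow_halo_in[OF t A]] flow_monad_laws[OF t monad_laws_Lambda[OF A]]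
          Lambda_flow_agree[OF t A]])
  show ?thesis
    unfolding nat_iso_def nat_trans_def ob mor
  proof (intro conjI ballI)
    show "is_functor (CBanhalos \<Sigma> \<U>) (Monads \<C>) (comp_functor (Lambda \<U>) (halo_flow t))"
      by (rule is_functor_comp[OF halo_flow_functor[OF t] Lambda_functor])
    show "is_functor (CBanhalos \<Sigma> \<U>) (Monads \<C>) (comp_functor (monad_flow t \<U>) (Lambda \<U>))"
      by (rule is_functor_comp[OF Lambda_functor monad_flow_functor[OF t]])
    fix A assume A: "A \<in> \<H>"
    show "is_iso (Monads \<C>) (Lambda_monad \<U> (flow_halo t A)) (flow_monad t (Lambda_monad \<U> A))
        (idt (Monads \<C>) (Lambda_monad \<U> (flow_halo t A)))" by (rule iso[OF A])
    then show "idt (Monads \<C>) (Lambda_monad \<U> (flow_halo t A))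
        \<in> hom (Monads \<C>) (Lambda_monad \<U> (flow_halo t A)) (flow_monad t (Lambda_monad \<U> A))"
      by (simp add: is_iso_def)
    fix B f assume B: "B \<in> \<H>" and "f \<in> hom (CBanhalos \<Sigma> \<U>) A B"
    then have f: "halo_hom f A B" by (simp add: hom_CBanhalos)
    have eq: "\<Theta> f (flow_halo t A) (flow_halo t B) X = \<Theta> f A B (flow_set (1 / t) X)"
      and car: "carrier (ell \<U> (flow_halo t A) X) = carrier (ell \<U> A (flow_set (1 / t) X))"
        "carrier (ell \<U> (flow_halo t B) X) = carrier (ell \<U> B (flow_set (1 / t) X))"
      if X: "X \<in> \<N>" for X
    proof -
      let ?X = "flow_set (1 / t) X"
      have X': "?X \<in> \<N>" by (rule flow_set_normed[OF X])
      have XX: "flow_set t ?X = X" by (rule flow_set_inverse(1)[OF t X])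
      show "carrier (ell \<U> (flow_halo t A) X) = carrier (ell \<U> A ?X)"
        using ell_halo.flow_ell(1)[OF ell_haloI[OF A X'] t] unfolding XX .
      show "carrier (ell \<U> (flow_halo t B) X) = carrier (ell \<U> B ?X)"
        using ell_halo.flow_ell(1)[OF ell_haloI[OF B X'] t] unfolding XX .
      show "\<Theta> f (flow_halo t A) (flow_halo t B) X = \<Theta> f A B ?X"
        using lin_ext_flow[OF t A X' B X' f hom_L_D[OF unit_hom[OF B X']]] unit_flow[OF t B X']
        unfolding XX by simp
    qed
    have "\<Theta> f A B (flow_set (1 / t) X) u \<in> carrier (ell \<U> B (flow_set (1 / t) X))"
      if "X \<in> \<N>" "u \<in> carrier (ell \<U> A (flow_set (1 / t) X))" for X u
      by (rule semilin_closed[OF Theta_semilin[OF A B f flow_set_normed[OF that(1)]] that(2)])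
    then show "comp (Monads \<C>) (Lambda_monad \<U> (flow_halo t A)) (Lambda_monad \<U> (flow_halo t B))
          (flow_monad t (Lambda_monad \<U> B)) (idt (Monads \<C>) (Lambda_monad \<U> (flow_halo t B)))
          (\<lambda>X\<in>\<N>. \<Theta> f (flow_halo t A) (flow_halo t B) X) =
        comp (Monads \<C>) (Lambda_monad \<U> (flow_halo t A)) (flow_monad t (Lambda_monad \<U> A))
          (flow_monad t (Lambda_monad \<U> B)) (\<lambda>X\<in>\<N>. \<Theta> f A B (flow_set (1 / t) X))
          (idt (Monads \<C>) (Lambda_monad \<U> (flow_halo t A)))"
      by (auto simp: Monads_simps Lambda_monad_simps eq car compose_def fun_eq_iff)
  qed
qed

end

text \<open>Fullness at all pairs of Lipschitz halos is excluded by \<open>Lambda_not_full\<close>,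
  and a zero target has only a trivial monad, whatever its modulus. So faithfulness is stated for
  all pairs, every morphism of monads is shown to come from a bounded ring homomorphism, and
  bijectivity on arrows is claimed where the order of the moduli is known or can be recovered. For
  short halos both multiplicative constants are 1.\<close>

theorem corollary1:
  fixes \<Sigma> :: kind and \<U> :: "'u set set"
  assumes "universe \<U>"
  shows "is_functor (CBanhalos \<Sigma> \<U>) (Monads (NSets \<Sigma> \<U>)) (Lambda \<U>) \<and>
    (\<forall>A\<in>obj (CBanhalos \<Sigma> \<U>). \<forall>B\<in>obj (CBanhalos \<Sigma> \<U>).
      faithful_at (CBanhalos \<Sigma> \<U>) (Monads (NSets \<Sigma> \<U>)) (Lambda \<U>) A B \<and>
      hom (Monads (NSets \<Sigma> \<U>)) (fobj (Lambda \<U>) A) (fobj (Lambda \<U>) B)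
        \<subseteq> fmap (Lambda \<U>) A B ` sigma_ring_hom \<Sigma> A B \<and>
      ((\<one>\<^bsub>B\<^esub> \<noteq> \<zero>\<^bsub>B\<^esub> \<or> modulus_le (modulus A) (modulus B)) \<and>
         mult_const (modulus B) \<le> mult_const (modulus A) \<longrightarrow>
       fully_faithful_at (CBanhalos \<Sigma> \<U>) (Monads (NSets \<Sigma> \<U>)) (Lambda \<U>) A B)) \<and>
    (\<forall>t>0. \<exists>\<tau>.
      nat_iso (CBanhalos \<Sigma> \<U>) (Monads (NSets \<Sigma> \<U>))
        (comp_functor (Lambda \<U>) (halo_flow t))
        (comp_functor (monad_flow t \<U>) (Lambda \<U>)) \<tau>)"
proof -
  interpret lambda_ctx \<Sigma> \<U> by unfold_locales (rule assms)
  show ?thesis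
  proof (intro conjI ballI allI impI subsetI)
    show "is_functor (CBanhalos \<Sigma> \<U>) (Monads \<C>) (Lambda \<U>)" by (rule Lambda_functor)
    fix A B assume A: "A \<in> \<H>" and B: "B \<in> \<H>"
    show "faithful_at (CBanhalos \<Sigma> \<U>) (Monads \<C>) (Lambda \<U>) A B" by (rule Lambda_faithful[OF A B])
    show "\<theta> \<in> fmap (Lambda \<U>) A B ` sigma_ring_hom \<Sigma> A B"
      if "\<theta> \<in> hom (Monads \<C>) (fobj (Lambda \<U>) A) (fobj (Lambda \<U>) B)" for \<theta>
      using Lambda_full(1)[OF A B that] by blast
    show "fully_faithful_at (CBanhalos \<Sigma> \<U>) (Monads \<C>) (Lambda \<U>) A B"
      if "(\<one>\<^bsub>B\<^esub> \<noteq> \<zero>\<^bsub>B\<^esub> \<or> modulus_le (modulus A) (modulus B)) \<and> mult_const (modulus B) \<le> mult_const (modulus A)"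
      using that by (intro Lambda_fully_faithful[OF A B]) auto
  next
    fix t :: real assume "0 < t"
    then show "\<exists>\<tau>. nat_iso (CBanhalos \<Sigma> \<U>) (Monads \<C>) (comp_functor (Lambda \<U>) (halo_flow t))
        (comp_functor (monad_flow t \<U>) (Lambda \<U>)) \<tau>"
      using Lambda_flow by blast
  qed
qed

end
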